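(* Let $(M,\omega)$ be a symplectic 6-manifold and $\varphi$ a smooth primitive 3-form on $M$ which belongs pointwise to the orbit $\mathcal{O}_0^+$ and satisfies $d\varphi=0$ and $dF(\varphi)=0$. Then $K=K(\varphi)$ is a smooth section of $\mathrm{End}\,TM$ such that $K^2=0$, and $\mathcal{L}:=\ker K=\mathrm{Im}\,K$ defines a Lagrangian foliation on $(M,\omega)$. In addition, the Nijenhuis tensor $N_K$ of $K$ vanishes, namely $$N_K(X,Y)=K[KX,Y]+K[X,KY]-[KX,KY]=0$$ for any vector fields $X$ and $Y$. The symmetric bilinear form $g(\cdot,\cdot)=\omega(\cdot,K\cdot)$ induces a Riemannian metric on the vector bundle $TM/\mathcal{L}$. The bundle $TM/\mathcal{L}$ is canonically oriented so that the volume form of this Riemannian metric is exactly $\frac{1}{\sqrt{2}}F(\varphi)$. Through the bundle isomorphism $K:TM/\mathcal{L}\cong\mathcal{L}$ one also gets a natural Riemannian metric $g_{\mathcal{L}}$ with orientation on $\mathcal{L}$, such that $$g_{\mathcal{L}}(X,Y)=\omega(K^{-1}X,Y)$$ for any vector fields $X,Y$ tangent to $\mathcal{L}$, and this is independent of the choice of preimage $K^{-1}X$ of $X$ under $K$.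
   Context: A 3-form $\varphi$ on a symplectic 6-manifold $(M,\omega)$ is primitive if $\omega\wedge\varphi=0$. For a primitive 3-form $\varphi$, the endomorphism $K=K(\varphi)$ of $TM$ is defined by $\iota_{KX}\frac{\omega^3}{3!}=-\iota_X\varphi\wedge\varphi$, and the 3-form $F(\varphi)$ is defined by $F(\varphi)(X,Y,Z)=-2\varphi(KX,Y,Z)$. The form $\varphi$ lies in $\mathcal{O}_0^+$ at a point $p$ if there is a basis $e^1,\dots,e^6$ of $T_p^*M$ with $\omega=e^{12}+e^{34}+e^{56}$ and $\varphi=e^{146}+e^{236}+e^{245}$, where $e^{ij}=e^i\wedge e^j$ and $e^{ijk}=e^i\wedge e^j\wedge e^k$. The Nijenhuis tensor of $K$ is $N_K(X,Y)=-K^2[X,Y]+K([KX,Y]+[X,KY])-[KX,KY]$. Pointwise, $\ker F(\varphi)=\{v:\iota_vF(\varphi)=0\}$ equals $\ker K$, so $F(\varphi)$ descends to a 3-form on $TM/\mathcal{L}$. *)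

theory Defs
  imports "HOL-Analysis.Analysis" "HOL-Library.Function_Algebras"
begin

text \<open>Pointwise real vector space structure on functions; it is only used for families of
  coordinate vectors indexed by charts, i.e. for tangent vectors.\<close>

instantiation "fun" :: (type, real_vector) real_vector
begin

definition scaleR_fun_def: "r *\<^sub>R f = (\<lambda>x. r *\<^sub>R f x)"

instance
  by standard (simp_all add: scaleR_fun_def fun_eq_iff scaleR_add_right scaleR_add_left)

end


section \<open>Smooth maps and smooth manifolds\<close>

text \<open>Both notions below are meant for open sets.\<close>

primrec Ck_on :: "nat \<Rightarrow> 'a::euclidean_space set \<Rightarrow> ('a \<Rightarrow> 'b::real_normed_vector) \<Rightarrow> bool" where
  "Ck_on 0 S f \<longleftrightarrow> continuous_on S f"
| "Ck_on (Suc k) S f \<longleftrightarrow> (\<forall>x\<in>S. f differentiable (at x)) \<and>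
     (\<forall>v. Ck_on k S (\<lambda>x. frechet_derivative f (at x) v))"

definition smooth_on :: "'a::euclidean_space set \<Rightarrow> ('a \<Rightarrow> 'b::real_normed_vector) \<Rightarrow> bool" where
  "smooth_on S f \<longleftrightarrow> (\<forall>k. Ck_on k S f)"

text \<open>A chart is a pair of its domain and its coordinate map; the values of the coordinate map
  outside the domain are irrelevant.\<close>

type_synonym ('a, 'n) chart = "'a set \<times> ('a \<Rightarrow> real ^ 'n)"

definition chart_inv :: "('a, 'n) chart \<Rightarrow> real ^ 'n \<Rightarrow> 'a" where
  "chart_inv c = inv_into (fst c) (snd c)"

definition is_chart :: "('a::topological_space, 'n::finite) chart \<Rightarrow> bool" where
  "is_chart c \<longleftrightarrow> open (fst c) \<and> open (snd c ` fst c) \<and>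
     homeomorphism (fst c) (snd c ` fst c) (snd c) (chart_inv c)"

definition transition :: "('a, 'n) chart \<Rightarrow> ('a, 'n) chart \<Rightarrow> real ^ 'n \<Rightarrow> real ^ 'n" where
  "transition c c' = snd c' \<circ> chart_inv c"

definition compatible :: "('a, 'n::finite) chart \<Rightarrow> ('a, 'n) chart \<Rightarrow> bool" where
  "compatible c c' \<longleftrightarrow>
     smooth_on (snd c ` (fst c \<inter> fst c')) (transition c c') \<and>
     smooth_on (snd c' ` (fst c \<inter> fst c')) (transition c' c)"

text \<open>Maximal smooth atlas. The manifold is the whole underlying type, which is taken in the
  classes of Hausdorff and second countable spaces; its dimension is \<open>CARD('n)\<close>.\<close>

definition smooth_structure ::
  "('a::{t2_space, second_countable_topology}, 'n::finite) chart set \<Rightarrow> bool" where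
  "smooth_structure A \<longleftrightarrow>
     (\<forall>c\<in>A. is_chart c) \<and> (\<Union>c\<in>A. fst c) = UNIV \<and>
     (\<forall>c\<in>A. \<forall>c'\<in>A. compatible c c') \<and>
     (\<forall>c. is_chart c \<and> (\<forall>c'\<in>A. compatible c c') \<longrightarrow> c \<in> A)"


section \<open>Tangent vectors and vector fields\<close>

text \<open>A tangent vector at \<open>p\<close> is the family of its coordinate vectors in all charts around \<open>p\<close>,
  related by the derivatives of the coordinate changes (and zero for all other indices).\<close>

type_synonym ('a, 'n) tvec = "('a, 'n) chart \<Rightarrow> real ^ 'n"

definition tangent_space ::
  "('a, 'n::finite) chart set \<Rightarrow> 'a \<Rightarrow> ('a, 'n) tvec set" where
  "tangent_space A p = {v.
     (\<forall>c. c \<notin> A \<or> p \<notin> fst c \<longrightarrow> v c = 0) \<and>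
     (\<forall>c\<in>A. \<forall>c'\<in>A. p \<in> fst c \<and> p \<in> fst c' \<longrightarrow>
        v c' = frechet_derivative (transition c c') (at (snd c p)) (v c))}"

text \<open>The tangent vector at \<open>p\<close> with coordinate vector \<open>x\<close> in the chart \<open>c\<close>.\<close>

definition tvec_of ::
  "('a, 'n::finite) chart set \<Rightarrow> ('a, 'n) chart \<Rightarrow> 'a \<Rightarrow> real ^ 'n \<Rightarrow> ('a, 'n) tvec" where
  "tvec_of A c p x = (\<lambda>c'. if c' \<in> A \<and> p \<in> fst c'
     then frechet_derivative (transition c c') (at (snd c p)) x else 0)"

definition smooth_function_on ::
  "('a, 'n::finite) chart set \<Rightarrow> 'a set \<Rightarrow> ('a \<Rightarrow> real) \<Rightarrow> bool" where
  "smooth_function_on A U f \<longleftrightarrow>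
     (\<forall>c\<in>A. smooth_on (snd c ` (fst c \<inter> U)) (f \<circ> chart_inv c))"

definition vector_field_on ::
  "('a, 'n::finite) chart set \<Rightarrow> 'a set \<Rightarrow> ('a \<Rightarrow> ('a, 'n) tvec) \<Rightarrow> bool" where
  "vector_field_on A U X \<longleftrightarrow>
     (\<forall>p\<in>U. X p \<in> tangent_space A p) \<and>
     (\<forall>c\<in>A. smooth_on (snd c ` (fst c \<inter> U)) (\<lambda>x. X (chart_inv c x) c))"

text \<open>In each chart, \<open>[X, Y] = DY(X) - DX(Y)\<close>.\<close>

definition lie_bracket ::
  "('a, 'n::finite) chart set \<Rightarrow> ('a \<Rightarrow> ('a, 'n) tvec) \<Rightarrow> ('a \<Rightarrow> ('a, 'n) tvec) \<Rightarrow>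
     'a \<Rightarrow> ('a, 'n) tvec" where
  "lie_bracket A X Y p = (\<lambda>c. if c \<in> A \<and> p \<in> fst c
     then frechet_derivative (\<lambda>x. Y (chart_inv c x) c) (at (snd c p)) (X p c)
        - frechet_derivative (\<lambda>x. X (chart_inv c x) c) (at (snd c p)) (Y p c)
     else 0)"


section \<open>Linear algebra on a subspace\<close>

definition linear_map_on ::
  "'v::real_vector set \<Rightarrow> 'w::real_vector set \<Rightarrow> ('v \<Rightarrow> 'w) \<Rightarrow> bool" where
  "linear_map_on V W f \<longleftrightarrow> f ` V \<subseteq> W \<and>
     (\<forall>u\<in>V. \<forall>v\<in>V. \<forall>a b. f (a *\<^sub>R u + b *\<^sub>R v) = a *\<^sub>R f u + b *\<^sub>R f v)"

text \<open>A \<open>k\<close>-form on the space \<open>V\<close> is a function of lists of vectors; only its values on lists of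
  length \<open>k\<close> with entries in \<open>V\<close> matter.\<close>

definition vectors :: "nat \<Rightarrow> 'v set \<Rightarrow> 'v list set" where
  "vectors k V = {vs. length vs = k \<and> set vs \<subseteq> V}"

definition alternating_form :: "'v::real_vector set \<Rightarrow> nat \<Rightarrow> ('v list \<Rightarrow> real) \<Rightarrow> bool" where
  "alternating_form V k \<alpha> \<longleftrightarrow>
     (\<forall>vs\<in>vectors k V. \<forall>i<k. linear_map_on V UNIV (\<lambda>u. \<alpha> (vs[i := u]))) \<and>
     (\<forall>vs\<in>vectors k V. \<not> distinct vs \<longrightarrow> \<alpha> vs = 0)"

text \<open>Wedge product of a \<open>k\<close>-form and an \<open>l\<close>-form, normalised so that
  \<open>(\<alpha> \<and> \<beta>)(X, Y) = \<alpha>(X)\<beta>(Y) - \<alpha>(Y)\<beta>(X)\<close> for 1-forms.\<close>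

definition wedge ::
  "nat \<Rightarrow> nat \<Rightarrow> ('v list \<Rightarrow> real) \<Rightarrow> ('v list \<Rightarrow> real) \<Rightarrow> 'v list \<Rightarrow> real" where
  "wedge k l \<alpha> \<beta> vs =
     (\<Sum>\<sigma> | \<sigma> permutes {..<k + l}. of_int (sign \<sigma>) *
        \<alpha> (map (\<lambda>i. vs ! \<sigma> i) [0..<k]) * \<beta> (map (\<lambda>i. vs ! \<sigma> i) [k..<k + l]))
     / (fact k * fact l)"

definition contract :: "'v \<Rightarrow> ('v list \<Rightarrow> real) \<Rightarrow> 'v list \<Rightarrow> real" where
  "contract v \<alpha> = (\<lambda>vs. \<alpha> (v # vs))"

definition one_form :: "('v \<Rightarrow> real) \<Rightarrow> 'v list \<Rightarrow> real" where
  "one_form f = (\<lambda>vs. f (hd vs))"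

definition dual_basis_on :: "'v::real_vector set \<Rightarrow> ('i::finite \<Rightarrow> 'v \<Rightarrow> real) \<Rightarrow> bool" where
  "dual_basis_on V e \<longleftrightarrow> (\<forall>i. linear_map_on V UNIV (e i)) \<and>
     (\<forall>f. linear_map_on V UNIV f \<longrightarrow>
        (\<exists>!a :: real ^ 'i. \<forall>v\<in>V. f v = (\<Sum>i\<in>UNIV. a $ i * e i v)))"


section \<open>Differential forms\<close>

text \<open>The form \<open>\<alpha>\<close> in the coordinates of the chart \<open>c\<close>.\<close>

definition local_form ::
  "('a, 'n::finite) chart set \<Rightarrow> ('a, 'n) chart \<Rightarrow> ('a \<Rightarrow> ('a, 'n) tvec list \<Rightarrow> real) \<Rightarrow>
     real ^ 'n \<Rightarrow> (real ^ 'n) list \<Rightarrow> real" where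
  "local_form A c \<alpha> x vs =
     \<alpha> (chart_inv c x) (map (tvec_of A c (chart_inv c x)) vs)"

definition differential_form ::
  "('a, 'n::finite) chart set \<Rightarrow> nat \<Rightarrow> ('a \<Rightarrow> ('a, 'n) tvec list \<Rightarrow> real) \<Rightarrow> bool" where
  "differential_form A k \<alpha> \<longleftrightarrow>
     (\<forall>p. alternating_form (tangent_space A p) k (\<alpha> p)) \<and>
     (\<forall>c\<in>A. \<forall>vs. length vs = k \<longrightarrow> smooth_on (snd c ` fst c) (\<lambda>x. local_form A c \<alpha> x vs))"

text \<open>Exterior derivative in the chart \<open>c\<close>, evaluated on the constant coordinate vector fields \<open>vs\<close>.\<close>

definition local_ext_deriv ::
  "('a, 'n::finite) chart set \<Rightarrow> ('a, 'n) chart \<Rightarrow> ('a \<Rightarrow> ('a, 'n) tvec list \<Rightarrow> real) \<Rightarrow>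
     real ^ 'n \<Rightarrow> (real ^ 'n) list \<Rightarrow> real" where
  "local_ext_deriv A c \<alpha> x vs =
     (\<Sum>i<length vs. (-1) ^ i *
        frechet_derivative (\<lambda>y. local_form A c \<alpha> y (take i vs @ drop (Suc i) vs)) (at x) (vs ! i))"

definition closed_form ::
  "('a, 'n::finite) chart set \<Rightarrow> nat \<Rightarrow> ('a \<Rightarrow> ('a, 'n) tvec list \<Rightarrow> real) \<Rightarrow> bool" where
  "closed_form A k \<alpha> \<longleftrightarrow>
     (\<forall>c\<in>A. \<forall>x\<in>snd c ` fst c. \<forall>vs. length vs = Suc k \<longrightarrow> local_ext_deriv A c \<alpha> x vs = 0)"

definition symplectic_form ::
  "('a, 'n::finite) chart set \<Rightarrow> ('a \<Rightarrow> ('a, 'n) tvec list \<Rightarrow> real) \<Rightarrow> bool" where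
  "symplectic_form A \<omega> \<longleftrightarrow> differential_form A 2 \<omega> \<and> closed_form A 2 \<omega> \<and>
     (\<forall>p. \<forall>v\<in>tangent_space A p. (\<forall>w\<in>tangent_space A p. \<omega> p [v, w] = 0) \<longrightarrow> v = 0)"

definition smooth_endomorphism ::
  "('a, 'n::finite) chart set \<Rightarrow> ('a \<Rightarrow> ('a, 'n) tvec \<Rightarrow> ('a, 'n) tvec) \<Rightarrow> bool" where
  "smooth_endomorphism A K \<longleftrightarrow>
     (\<forall>p. linear_map_on (tangent_space A p) (tangent_space A p) (K p)) \<and>
     (\<forall>c\<in>A. \<forall>v. smooth_on (snd c ` fst c)
        (\<lambda>x. K (chart_inv c x) (tvec_of A c (chart_inv c x) v) c))"


section \<open>Primitive 3-forms on symplectic 6-manifolds\<close>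

definition primitive ::
  "('a, 6) chart set \<Rightarrow> ('a \<Rightarrow> ('a, 6) tvec list \<Rightarrow> real) \<Rightarrow>
     ('a \<Rightarrow> ('a, 6) tvec list \<Rightarrow> real) \<Rightarrow> bool" where
  "primitive A \<omega> \<phi> \<longleftrightarrow>
     (\<forall>p. \<forall>vs\<in>vectors 5 (tangent_space A p). wedge 2 3 (\<omega> p) (\<phi> p) vs = 0)"

text \<open>The volume form \<open>\<omega>\<^sup>3 / 3!\<close> at a point.\<close>

definition liouville_form :: "('v list \<Rightarrow> real) \<Rightarrow> 'v list \<Rightarrow> real" where
  "liouville_form \<omega> vs = wedge 4 2 (wedge 2 2 \<omega> \<omega>) \<omega> vs / fact 3"

definition K_endo ::
  "('a, 6) chart set \<Rightarrow> ('a \<Rightarrow> ('a, 6) tvec list \<Rightarrow> real) \<Rightarrow>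
     ('a \<Rightarrow> ('a, 6) tvec list \<Rightarrow> real) \<Rightarrow> 'a \<Rightarrow> ('a, 6) tvec \<Rightarrow> ('a, 6) tvec" where
  "K_endo A \<omega> \<phi> p X = (THE Y. Y \<in> tangent_space A p \<and>
     (\<forall>vs\<in>vectors 5 (tangent_space A p).
        contract Y (liouville_form (\<omega> p)) vs = - wedge 2 3 (contract X (\<phi> p)) (\<phi> p) vs))"

definition F_form ::
  "('a, 6) chart set \<Rightarrow> ('a \<Rightarrow> ('a, 6) tvec list \<Rightarrow> real) \<Rightarrow>
     ('a \<Rightarrow> ('a, 6) tvec list \<Rightarrow> real) \<Rightarrow> 'a \<Rightarrow> ('a, 6) tvec list \<Rightarrow> real" where
  "F_form A \<omega> \<phi> p vs = - 2 * \<phi> p (K_endo A \<omega> \<phi> p (hd vs) # tl vs)"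

definition in_orbit_0_plus ::
  "('a, 6) chart set \<Rightarrow> ('a \<Rightarrow> ('a, 6) tvec list \<Rightarrow> real) \<Rightarrow>
     ('a \<Rightarrow> ('a, 6) tvec list \<Rightarrow> real) \<Rightarrow> 'a \<Rightarrow> bool" where
  "in_orbit_0_plus A \<omega> \<phi> p \<longleftrightarrow> (\<exists>e :: 6 \<Rightarrow> ('a, 6) tvec \<Rightarrow> real.
     let e2 = (\<lambda>i j. wedge 1 1 (one_form (e i)) (one_form (e j)));
         e3 = (\<lambda>i j k. wedge 2 1 (e2 i j) (one_form (e k)))
     in dual_basis_on (tangent_space A p) e \<and>
        (\<forall>vs\<in>vectors 2 (tangent_space A p). \<omega> p vs = e2 1 2 vs + e2 3 4 vs + e2 5 6 vs) \<and>
        (\<forall>vs\<in>vectors 3 (tangent_space A p). \<phi> p vs = e3 1 4 6 vs + e3 2 3 6 vs + e3 2 4 5 vs))"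

definition nijenhuis ::
  "('a, 'n::finite) chart set \<Rightarrow> ('a \<Rightarrow> ('a, 'n) tvec \<Rightarrow> ('a, 'n) tvec) \<Rightarrow>
     ('a \<Rightarrow> ('a, 'n) tvec) \<Rightarrow> ('a \<Rightarrow> ('a, 'n) tvec) \<Rightarrow> 'a \<Rightarrow> ('a, 'n) tvec" where
  "nijenhuis A K X Y p =
     (let KX = (\<lambda>q. K q (X q)); KY = (\<lambda>q. K q (Y q)) in
      - K p (K p (lie_bracket A X Y p))
      + K p (lie_bracket A KX Y p + lie_bracket A X KY p)
      - lie_bracket A KX KY p)"


section \<open>Distributions and foliations\<close>

definition lagrangian_distribution ::
  "('a, 'n::finite) chart set \<Rightarrow> ('a \<Rightarrow> ('a, 'n) tvec list \<Rightarrow> real) \<Rightarrow>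
     ('a \<Rightarrow> ('a, 'n) tvec set) \<Rightarrow> bool" where
  "lagrangian_distribution A \<omega> L \<longleftrightarrow> (\<forall>p. subspace (L p) \<and>
     L p = {v \<in> tangent_space A p. \<forall>w\<in>L p. \<omega> p [v, w] = 0})"

text \<open>A distribution is (the tangent distribution of) a foliation by \<open>k\<close>-dimensional leaves if the
  manifold is covered by foliated charts, in which it is spanned by \<open>k\<close> of the coordinate
  directions; the plaques are the corresponding coordinate slices.\<close>

definition foliation ::
  "('a, 'n::finite) chart set \<Rightarrow> nat \<Rightarrow> ('a \<Rightarrow> ('a, 'n) tvec set) \<Rightarrow> bool" where
  "foliation A k L \<longleftrightarrow> (\<forall>p. \<exists>c\<in>A. p \<in> fst c \<and> (\<exists>I. card I = k \<and>
     (\<forall>q\<in>fst c. L q = {v \<in> tangent_space A q. \<forall>i. i \<notin> I \<longrightarrow> v c $ i = 0})))"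


section \<open>Metrics and orientations on quotient bundles\<close>

text \<open>Below, \<open>W p \<subseteq> V p\<close> are the fibres of distributions, and tensors on the quotient bundle
  \<open>V/W\<close> are represented by tensors on \<open>V\<close> whose values depend only on the classes modulo \<open>W\<close>.
  For \<open>W p = {0}\<close> this gives the notions for the bundle \<open>V\<close> itself.\<close>

definition bundle_metric ::
  "('a::topological_space, 'n::finite) chart set \<Rightarrow> ('a \<Rightarrow> ('a, 'n) tvec set) \<Rightarrow>
     ('a \<Rightarrow> ('a, 'n) tvec set) \<Rightarrow>
     ('a \<Rightarrow> ('a, 'n) tvec \<Rightarrow> ('a, 'n) tvec \<Rightarrow> real) \<Rightarrow> bool" where
  "bundle_metric A V W g \<longleftrightarrow>
     (\<forall>p. \<forall>u\<in>V p. linear_map_on (V p) UNIV (g p u) \<and> linear_map_on (V p) UNIV (\<lambda>v. g p v u)) \<and>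
     (\<forall>p. \<forall>u\<in>V p. \<forall>v\<in>V p. g p u v = g p v u) \<and>
     (\<forall>p. \<forall>u\<in>V p. \<forall>u'\<in>V p. \<forall>v\<in>V p. \<forall>v'\<in>V p.
        u - u' \<in> W p \<and> v - v' \<in> W p \<longrightarrow> g p u v = g p u' v') \<and>
     (\<forall>p. \<forall>v\<in>V p. v \<notin> W p \<longrightarrow> g p v v > 0) \<and>
     (\<forall>U X Y. open U \<and> vector_field_on A U X \<and> vector_field_on A U Y \<and>
        (\<forall>p\<in>U. X p \<in> V p \<and> Y p \<in> V p) \<longrightarrow>
        smooth_function_on A U (\<lambda>p. g p (X p) (Y p)))"

text \<open>Families of vectors in \<open>V\<close> whose classes form a basis of \<open>V/W\<close>.\<close>

definition quotient_frames ::
  "'v::real_vector set \<Rightarrow> 'v set \<Rightarrow> ('k::finite \<Rightarrow> 'v) set" where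
  "quotient_frames V W = {b. range b \<subseteq> V \<and>
     (\<forall>v\<in>V. \<exists>!a :: real ^ 'k. v - (\<Sum>i\<in>UNIV. a $ i *\<^sub>R b i) \<in> W)}"

definition same_orientation :: "'v::real_vector set \<Rightarrow> ('k::finite \<Rightarrow> 'v) \<Rightarrow> ('k \<Rightarrow> 'v) \<Rightarrow> bool" where
  "same_orientation W b b' \<longleftrightarrow>
     (\<exists>P :: real ^ 'k ^ 'k. (\<forall>i. b' i - (\<Sum>j\<in>UNIV. P $ i $ j *\<^sub>R b j) \<in> W) \<and> det P > 0)"

text \<open>An orientation of \<open>V/W\<close> is given by the sets of positively oriented frames; each of them is an
  equivalence class of frames, and locally they contain a smooth frame.\<close>

definition bundle_orientation ::
  "('a::topological_space, 'n::finite) chart set \<Rightarrow> ('a \<Rightarrow> ('a, 'n) tvec set) \<Rightarrow>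
     ('a \<Rightarrow> ('a, 'n) tvec set) \<Rightarrow> ('a \<Rightarrow> ('k::finite \<Rightarrow> ('a, 'n) tvec) set) \<Rightarrow> bool" where
  "bundle_orientation A V W Or \<longleftrightarrow>
     (\<forall>p. \<exists>b\<in>quotient_frames (V p) (W p).
        Or p = {b' \<in> quotient_frames (V p) (W p). same_orientation (W p) b b'}) \<and>
     (\<forall>p. \<exists>U X. open U \<and> p \<in> U \<and> (\<forall>i. vector_field_on A U (X i)) \<and>
        (\<forall>q\<in>U. (\<lambda>i. X i q) \<in> Or q))"

definition riemannian_volume_form ::
  "('a \<Rightarrow> ('a, 'n::finite) tvec set) \<Rightarrow> ('a \<Rightarrow> ('a, 'n) tvec set) \<Rightarrow>
     ('a \<Rightarrow> ('a, 'n) tvec \<Rightarrow> ('a, 'n) tvec \<Rightarrow> real) \<Rightarrow> ('a \<Rightarrow> (3 \<Rightarrow> ('a, 'n) tvec) set) \<Rightarrow>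
     ('a \<Rightarrow> ('a, 'n) tvec list \<Rightarrow> real) \<Rightarrow> bool" where
  "riemannian_volume_form V W g Or \<mu> \<longleftrightarrow> (\<forall>p.
     alternating_form (V p) 3 (\<mu> p) \<and>
     (\<forall>vs\<in>vectors 3 (V p). \<forall>ws\<in>vectors 3 (V p).
        (\<forall>i<3. vs ! i - ws ! i \<in> W p) \<longrightarrow> \<mu> p vs = \<mu> p ws) \<and>
     (\<forall>b\<in>Or p. (\<forall>i j. g p (b i) (b j) = (if i = j then 1 else 0)) \<longrightarrow> \<mu> p [b 1, b 2, b 3] = 1))"

text \<open>The bundle endomorphism \<open>K\<close> induces an isomorphism from \<open>V/W\<close> onto \<open>V'\<close>.\<close>

definition induces_iso ::
  "('a \<Rightarrow> 'v::real_vector set) \<Rightarrow> ('a \<Rightarrow> 'v set) \<Rightarrow> ('a \<Rightarrow> 'v set) \<Rightarrow> ('a \<Rightarrow> 'v \<Rightarrow> 'v) \<Rightarrow> bool" where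
  "induces_iso V W V' K \<longleftrightarrow> (\<forall>p. linear_map_on (V p) (V' p) (K p) \<and> K p ` V p = V' p \<and>
     (\<forall>u\<in>V p. \<forall>v\<in>V p. K p u = K p v \<longleftrightarrow> u - v \<in> W p))"

end

theory Submission
  imports Defs
begin

text \<open>In an adapted coframe, \<open>K\<close> maps \<open>f\<^sub>2, f\<^sub>4, f\<^sub>6\<close> to \<open>- 2 f\<^sub>1, - 2 f\<^sub>3, - 2 f\<^sub>5\<close> and kills \<open>f\<^sub>1, f\<^sub>3, f\<^sub>5\<close>, and
  \<open>F = 4 e\<^sup>2\<^sup>4\<^sup>6\<close>, which settles everything that is pointwise. The Nijenhuis tensor vanishes because the form
  \<open>F / 4 + \<epsilon> \<phi>\<close> with values in the dual numbers is closed and its kernel contains the graph-like distribution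
  spanned by the vectors \<open>K X + 2 \<epsilon> X\<close>. The foliated charts are obtained from \<open>N\<^sub>K = 0\<close> without the Frobenius
  theorem: they are inverse to the time 1 maps of the flows of the vector fields \<open>x \<mapsto> K\<^sub>x b\<close> with constant \<open>b\<close>.
  Smooth dependence of these flows on parameters comes from Picard iteration, by differentiating the linear
  variational equation repeatedly. Finally, \<open>F\<close> plays the role of a determinant on \<open>T / L\<close> and so selects
  the orientation.\<close>

text \<open>Since \<epsilon>^2 = 0, in an adapted coframe (e^2 + \<epsilon> e^1) \<and> (e^4 +
  \<epsilon> e^3) \<and> (e^6 + \<epsilon> e^5) = F / 4 + \<epsilon> \<phi>. The dual numbers thus
  play the part of the complex numbers for an almost complex structure with a closed decomposable
  complex volume form, and N_K = 0 is the analogue of the integrability of such a structure. The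
  adapted coframe is chosen at each point separately, without regularity from point to point. It
  serves for pointwise identities only; every smoothness statement is derived from \<omega>, \<phi>
  and K, with quotients whose denominators are nonzero nearby. The fields x \<mapsto> K_x b need not
  commute, so the charts do not compose flows of a frame. As in an exponential map, each direction b
  has its own flow, and N_K = 0 controls how the end point varies with b. Because K_x b is linear in
  b, scaling b replaces scaling the time. This permits the fixed time 1, and then the integrals that
  depend on parameters all run over one interval.\<close>

section \<open>Maps that are smooth and depend continuously on a parameter\<close>

text \<open>\<open>C\<^sup>k\<close> in the second variable, with derivatives that are jointly continuous in both; the first variable
  is the time of a flow. A one-point \<open>P\<close> gives \<open>Ck_on\<close>, so that both notions share one calculus.\<close>

primrec Ck_param :: "nat \<Rightarrow> 'p::topological_space set \<Rightarrow> 'a::euclidean_space set \<Rightarrow>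
    ('p \<Rightarrow> 'a \<Rightarrow> 'b::real_normed_vector) \<Rightarrow> bool" where
  "Ck_param 0 P S f \<longleftrightarrow> continuous_on (P \<times> S) (\<lambda>(t, x). f t x)"
| "Ck_param (Suc k) P S f \<longleftrightarrow> continuous_on (P \<times> S) (\<lambda>(t, x). f t x) \<and>
     (\<forall>t\<in>P. \<forall>x\<in>S. f t differentiable (at x)) \<and>
     (\<forall>v. Ck_param k P S (\<lambda>t x. frechet_derivative (f t) (at x) v))"

lemma Ck_param_continuous: "Ck_param k P S f \<Longrightarrow> continuous_on (P \<times> S) (\<lambda>(t, x). f t x)"
  by (cases k) auto

lemma Ck_param_Suc_D: "Ck_param (Suc k) P S f \<Longrightarrow> Ck_param k P S f"
proof (induction k arbitrary: f)
  case (Suc k)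
  have "Ck_param (Suc k) P S (\<lambda>t x. frechet_derivative (f t) (at x) v)" for v
    using Suc.prems by simp
  then have "Ck_param k P S (\<lambda>t x. frechet_derivative (f t) (at x) v)" for v
    using Suc.IH by blast
  then show ?case using Suc.prems by simp
qed auto

lemma Ck_param_subset: "Ck_param k P S f \<Longrightarrow> P' \<subseteq> P \<Longrightarrow> S' \<subseteq> S \<Longrightarrow> Ck_param k P' S' f"
proof (induction k arbitrary: f)
  case (Suc k)
  then show ?case
    by (auto intro: continuous_on_subset[where s="P \<times> S"] simp: subset_iff)
qed (auto intro: continuous_on_subset[where s="P \<times> S"])

text \<open>Derivatives are taken in the whole space, so the values on \<open>S\<close> determine
  them only because \<open>S\<close> is open.\<close>

lemma Ck_param_cong:
  assumes "open S" "\<And>t x. t \<in> P \<Longrightarrow> x \<in> S \<Longrightarrow> f t x = g t x" "Ck_param k P S f"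
  shows "Ck_param k P S g"
  using assms(2,3)
proof (induction k arbitrary: f g)
  case 0
  then show ?case by (auto intro: continuous_on_eq)
next
  case (Suc k)
  have c: "continuous_on (P \<times> S) (\<lambda>(t, x). g t x)"
    using Suc.prems by (auto intro: continuous_on_eq)
  have hd: "(g t has_derivative frechet_derivative (f t) (at x)) (at x)" if "t \<in> P" "x \<in> S" for t x
  proof -
    have "(f t has_derivative frechet_derivative (f t) (at x)) (at x)"
      using Suc.prems(2) that by (simp add: frechet_derivative_works)
    then show ?thesis
      using has_derivative_transform_within_open[OF _ assms(1) that(2)] Suc.prems(1)[OF that(1)] by blast
  qed
  have eq: "frechet_derivative (g t) (at x) = frechet_derivative (f t) (at x)" if "t \<in> P" "x \<in> S" for t x
    using frechet_derivative_at[OF hd[OF that]] by simp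
  have "Ck_param k P S (\<lambda>t x. frechet_derivative (g t) (at x) v)" for v
    by (rule Suc.IH[of "\<lambda>t x. frechet_derivative (f t) (at x) v"]) (use eq Suc.prems(2) in auto)
  then show ?case using c hd unfolding Ck_param.simps differentiable_def by blast
qed

text \<open>The derivative may be given by any formula \<open>f'\<close>. Together with the converse
  \<open>Ck_param_SucE\<close> this lets the inductions below work with the Leibniz and chain rules
  instead of \<open>frechet_derivative\<close>.\<close>

lemma Ck_param_SucI:
  assumes "open S" "continuous_on (P \<times> S) (\<lambda>(t, x). f t x)"
    and "\<And>t x. t \<in> P \<Longrightarrow> x \<in> S \<Longrightarrow> (f t has_derivative f' t x) (at x)"
    and "\<And>v. Ck_param k P S (\<lambda>t x. f' t x v)"
  shows "Ck_param (Suc k) P S f"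
proof -
  have eq: "frechet_derivative (f t) (at x) = f' t x" if "t \<in> P" "x \<in> S" for t x
    using frechet_derivative_at[OF assms(3)[OF that]] by simp
  have "Ck_param k P S (\<lambda>t x. frechet_derivative (f t) (at x) v)" for v
    by (rule Ck_param_cong[OF assms(1) _ assms(4)[of v]]) (simp add: eq)
  then show ?thesis using assms(2,3) unfolding Ck_param.simps differentiable_def by blast
qed

lemma Ck_param_SucE:
  assumes "Ck_param (Suc k) P S f"
  obtains f' where "\<And>t x. t \<in> P \<Longrightarrow> x \<in> S \<Longrightarrow> (f t has_derivative f' t x) (at x)"
    "\<And>v. Ck_param k P S (\<lambda>t x. f' t x v)"
  using assms that[of "\<lambda>t x. frechet_derivative (f t) (at x)"] frechet_derivative_works by fastforce

lemma Ck_param_const: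
  fixes c :: "'p::topological_space \<Rightarrow> 'b::real_normed_vector"
  shows "continuous_on P c \<Longrightarrow> open S \<Longrightarrow> Ck_param k P S (\<lambda>t x. c t)"
proof (induction k arbitrary: c)
  case 0
  then show ?case
    using continuous_on_compose2[of P c "P \<times> S" fst] by (auto simp: case_prod_unfold continuous_on_fst)
next
  case (Suc k)
  have "continuous_on (P \<times> S) (\<lambda>(t, x). c t)"
    using Suc.prems continuous_on_compose2[of P c "P \<times> S" fst]
    by (auto simp: case_prod_unfold continuous_on_fst)
  moreover have "Ck_param k P S (\<lambda>t x. 0 :: 'b)" using Suc.IH[of "\<lambda>_. 0"] Suc.prems by auto
  ultimately show ?case
    using Suc.prems by (intro Ck_param_SucI[where f'="\<lambda>t x v. 0"]) auto
qed

lemma Ck_param_bounded_linear: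
  assumes "bounded_linear h" "open S" "Ck_param k P S f"
  shows "Ck_param k P S (\<lambda>t x. h (f t x))"
  using assms(3)
proof (induction k arbitrary: f)
  case 0
  then show ?case
    using bounded_linear.continuous_on[OF assms(1)] by (auto simp: case_prod_unfold)
next
  case (Suc k)
  obtain f' where f': "\<And>t x. t \<in> P \<Longrightarrow> x \<in> S \<Longrightarrow> (f t has_derivative f' t x) (at x)"
    "\<And>v. Ck_param k P S (\<lambda>t x. f' t x v)" using Ck_param_SucE[OF Suc.prems] by blast
  show ?case
  proof (rule Ck_param_SucI[OF assms(2), where f'="\<lambda>t x v. h (f' t x v)"])
    show "continuous_on (P \<times> S) (\<lambda>(t, x). h (f t x))"
      using bounded_linear.continuous_on[OF assms(1)] Ck_param_continuous[OF Suc.prems]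
      by (auto simp: case_prod_unfold)
    show "((\<lambda>x. h (f t x)) has_derivative (\<lambda>v. h (f' t x v))) (at x)" if "t \<in> P" "x \<in> S" for t x
      by (rule bounded_linear.has_derivative[OF assms(1) f'(1)[OF that]])
  qed (rule Suc.IH[OF f'(2)])
qed

lemma Ck_param_add:
  assumes "open S" "Ck_param k P S f" "Ck_param k P S g"
  shows "Ck_param k P S (\<lambda>t x. f t x + g t x)"
  using assms(2,3)
proof (induction k arbitrary: f g)
  case 0
  then show ?case by (auto simp: case_prod_unfold intro: continuous_on_add)
next
  case (Suc k)
  obtain f' where f': "\<And>t x. t \<in> P \<Longrightarrow> x \<in> S \<Longrightarrow> (f t has_derivative f' t x) (at x)"
    "\<And>v. Ck_param k P S (\<lambda>t x. f' t x v)" using Ck_param_SucE[OF Suc.prems(1)] by blast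
  obtain g' where g': "\<And>t x. t \<in> P \<Longrightarrow> x \<in> S \<Longrightarrow> (g t has_derivative g' t x) (at x)"
    "\<And>v. Ck_param k P S (\<lambda>t x. g' t x v)" using Ck_param_SucE[OF Suc.prems(2)] by blast
  show ?case
  proof (rule Ck_param_SucI[OF assms(1), where f'="\<lambda>t x v. f' t x v + g' t x v"])
    show "continuous_on (P \<times> S) (\<lambda>(t, x). f t x + g t x)"
      using Suc.prems[THEN Ck_param_continuous] by (auto simp: case_prod_unfold intro: continuous_on_add)
  qed (use f' g' Suc.IH has_derivative_add in auto)
qed

lemma Ck_param_bilinear:
  assumes "bounded_bilinear h" "open S" "Ck_param k P S f" "Ck_param k P S g"
  shows "Ck_param k P S (\<lambda>t x. h (f t x) (g t x))"
  using assms(3,4)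
proof (induction k arbitrary: f g)
  case 0
  then show ?case
    using bounded_bilinear.continuous_on[OF assms(1)] by (auto simp: case_prod_unfold)
next
  case (Suc k)
  obtain f' where f': "\<And>t x. t \<in> P \<Longrightarrow> x \<in> S \<Longrightarrow> (f t has_derivative f' t x) (at x)"
    "\<And>v. Ck_param k P S (\<lambda>t x. f' t x v)" using Ck_param_SucE[OF Suc.prems(1)] by blast
  obtain g' where g': "\<And>t x. t \<in> P \<Longrightarrow> x \<in> S \<Longrightarrow> (g t has_derivative g' t x) (at x)"
    "\<And>v. Ck_param k P S (\<lambda>t x. g' t x v)" using Ck_param_SucE[OF Suc.prems(2)] by blast
  show ?case
  proof (rule Ck_param_SucI[OF assms(2), where f'="\<lambda>t x v. h (f t x) (g' t x v) + h (f' t x v) (g t x)"])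
    show "continuous_on (P \<times> S) (\<lambda>(t, x). h (f t x) (g t x))"
      using Suc.prems[THEN Ck_param_continuous] bounded_bilinear.continuous_on[OF assms(1)]
      by (auto simp: case_prod_unfold)
    show "Ck_param k P S (\<lambda>t x. h (f t x) (g' t x v) + h (f' t x v) (g t x))" for v
      using f' g' Suc.IH Suc.prems[THEN Ck_param_Suc_D] by (intro Ck_param_add assms) auto
    show "((\<lambda>x. h (f t x) (g t x)) has_derivative (\<lambda>v. h (f t x) (g' t x v) + h (f' t x v) (g t x))) (at x)"
      if "t \<in> P" "x \<in> S" for t x
      by (rule bounded_bilinear.FDERIV[OF assms(1) f'(1)[OF that] g'(1)[OF that]])
  qed
qed

lemma Ck_param_sum:
  assumes "open S" "\<And>i. i \<in> I \<Longrightarrow> Ck_param k P S (f i)"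
  shows "Ck_param k P S (\<lambda>t x. \<Sum>i\<in>I. f i t x)"
  using assms(2)
  by (induction I rule: infinite_finite_induct)
    (auto intro!: Ck_param_add[OF assms(1)] Ck_param_const[OF _ assms(1)])

lemma Ck_param_proj:
  assumes "open S" shows "Ck_param k P S (\<lambda>t x. x)"
proof -
  have c: "continuous_on (P \<times> S) (\<lambda>(t, x). x)" by (simp add: case_prod_unfold continuous_on_snd)
  show ?thesis
  proof (cases k)
    case (Suc j)
    have "Ck_param (Suc j) P S (\<lambda>t x. x)"
      by (rule Ck_param_SucI[OF assms c, where f'="\<lambda>t x v. v"])
        (auto intro: Ck_param_const[OF _ assms])
    then show ?thesis using Suc by simp
  qed (use c in auto)
qed

text \<open>Regularity of a derivative is always stated for a fixed direction. A direction that
  itself varies is expanded in \<open>Basis\<close> by this identity, which leaves products of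
  scalar functions with values in fixed directions.\<close>

lemma euclidean_linear_sum:
  fixes x :: "'a::euclidean_space" assumes "linear h" shows "h x = (\<Sum>b\<in>Basis. (x \<bullet> b) *\<^sub>R h b)"
proof -
  have "h x = h (\<Sum>b\<in>Basis. (x \<bullet> b) *\<^sub>R b)" by (simp add: euclidean_representation)
  also have "\<dots> = (\<Sum>b\<in>Basis. (x \<bullet> b) *\<^sub>R h b)"
    by (simp add: linear_sum[OF assms] linear_cmul[OF assms])
  finally show ?thesis .
qed

lemma Ck_param_compose:
  fixes f :: "'p::topological_space \<Rightarrow> 'a::euclidean_space \<Rightarrow> 'b::euclidean_space"
    and g :: "'p \<Rightarrow> 'b \<Rightarrow> 'c::real_normed_vector"
  assumes "open S" "open T" "\<And>t x. t \<in> P \<Longrightarrow> x \<in> S \<Longrightarrow> f t x \<in> T"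
    and "Ck_param k P T g" "Ck_param k P S f"
  shows "Ck_param k P S (\<lambda>t x. g t (f t x))"
  using assms(4,5)
proof (induction k arbitrary: g)
  case 0
  have "continuous_on (P \<times> S) ((\<lambda>(t, y). g t y) \<circ> (\<lambda>(t, x). (t, f t x)))"
    using 0 assms(3)
    by (intro continuous_on_compose) (auto simp: case_prod_unfold intro!: continuous_intros
      elim!: continuous_on_subset)
  then show ?case by (auto simp: o_def case_prod_unfold)
next
  case (Suc k)
  obtain g' where g': "\<And>t x. t \<in> P \<Longrightarrow> x \<in> T \<Longrightarrow> (g t has_derivative g' t x) (at x)"
    "\<And>v. Ck_param k P T (\<lambda>t x. g' t x v)" using Ck_param_SucE[OF Suc.prems(1)] by blast
  obtain f' where f': "\<And>t x. t \<in> P \<Longrightarrow> x \<in> S \<Longrightarrow> (f t has_derivative f' t x) (at x)"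
    "\<And>v. Ck_param k P S (\<lambda>t x. f' t x v)" using Ck_param_SucE[OF Suc.prems(2)] by blast
  \<comment> \<open>The chain rule gives \<open>g' t (f t x) (f' t x v)\<close>, whose direction
    depends on \<open>x\<close>. In the expanded form the induction hypothesis and the product rule
    apply to each factor.\<close>
  have comp: "((\<lambda>x. g t (f t x)) has_derivative (\<lambda>v. \<Sum>b\<in>Basis. (f' t x v \<bullet> b) *\<^sub>R g' t (f t x) b)) (at x)"
    if "t \<in> P" "x \<in> S" for t x
  proof -
    have "(g t has_derivative g' t (f t x)) (at (f t x))" using g'(1) assms(3) that by auto
    moreover have "linear (g' t (f t x))" using calculation has_derivative_linear by blast
    ultimately have "(\<lambda>v. g' t (f t x) (f' t x v)) = (\<lambda>v. \<Sum>b\<in>Basis. (f' t x v \<bullet> b) *\<^sub>R g' t (f t x) b)"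
      using euclidean_linear_sum by blast
    then show ?thesis
      using has_derivative_compose[OF f'(1)[OF that] \<open>(g t has_derivative _) _\<close>] by simp
  qed
  show ?case
  proof (rule Ck_param_SucI[OF assms(1) _ comp])
    show "continuous_on (P \<times> S) (\<lambda>(t, x). g t (f t x))"
    proof -
      have "continuous_on (P \<times> S) ((\<lambda>(t, y). g t y) \<circ> (\<lambda>(t, x). (t, f t x)))"
        using Suc.prems[THEN Ck_param_continuous] assms(3)
        by (intro continuous_on_compose) (auto simp: case_prod_unfold intro!: continuous_intros
          elim!: continuous_on_subset)
      then show ?thesis by (auto simp: o_def case_prod_unfold)
    qed
    show "Ck_param k P S (\<lambda>t x. \<Sum>b\<in>Basis. (f' t x v \<bullet> b) *\<^sub>R g' t (f t x) b)" for v
    proof (intro Ck_param_sum[OF assms(1)] Ck_param_bilinear[OF bounded_bilinear_scaleR assms(1)])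
      show "Ck_param k P S (\<lambda>t x. f' t x v \<bullet> b)" for b
        by (intro Ck_param_bounded_linear[OF bounded_linear_inner_left assms(1)] f')
      show "Ck_param k P S (\<lambda>t x. g' t (f t x) b)" for b
        by (rule Suc.IH[OF g'(2)]) (rule Ck_param_Suc_D[OF Suc.prems(2)])
    qed
  qed
qed

lemma continuous_on_local_Times:
  assumes "\<And>x. x \<in> S \<Longrightarrow> \<exists>T. open T \<and> x \<in> T \<and> T \<subseteq> S \<and> continuous_on (P \<times> T) f"
  shows "continuous_on (P \<times> S) f"
  unfolding continuous_on_def
proof safe
  fix t x assume tx: "t \<in> P" "x \<in> S"
  obtain T where T: "open T" "x \<in> T" "T \<subseteq> S" "continuous_on (P \<times> T) f"
    using assms[OF tx(2)] by auto
  have "(f \<longlongrightarrow> f (t, x)) (at (t, x) within P \<times> T)"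
    using T tx by (auto simp: continuous_on_def)
  moreover have "at (t, x) within P \<times> T = at (t, x) within P \<times> S"
    by (rule at_within_nhd[where S="UNIV \<times> T"]) (use T in \<open>auto intro: open_Times\<close>)
  ultimately show "(f \<longlongrightarrow> f (t, x)) (at (t, x) within P \<times> S)" by simp
qed

lemma Ck_param_local:
  assumes "\<And>x. x \<in> S \<Longrightarrow> \<exists>T. open T \<and> x \<in> T \<and> T \<subseteq> S \<and> Ck_param k P T f"
  shows "Ck_param k P S f"
  using assms
proof (induction k arbitrary: f)
  case 0
  then show ?case unfolding Ck_param.simps by (rule continuous_on_local_Times)
next
  case (Suc k)
  have loc: "\<exists>T. open T \<and> x \<in> T \<and> T \<subseteq> S \<and> continuous_on (P \<times> T) (\<lambda>(t, x). f t x) \<and>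
      (\<forall>t\<in>P. f t differentiable (at x)) \<and>
      (\<forall>v. Ck_param k P T (\<lambda>t x. frechet_derivative (f t) (at x) v))" if x: "x \<in> S" for x
  proof -
    obtain T where "open T" "x \<in> T" "T \<subseteq> S" "Ck_param (Suc k) P T f" using Suc.prems[OF x] by auto
    then show ?thesis by (intro exI[of _ T]) auto
  qed
  have "continuous_on (P \<times> S) (\<lambda>(t, x). f t x)"
    by (rule continuous_on_local_Times) (use loc in meson)
  moreover have "Ck_param k P S (\<lambda>t x. frechet_derivative (f t) (at x) v)" for v
    by (rule Suc.IH) (use loc in meson)
  moreover have "\<forall>t\<in>P. \<forall>x\<in>S. f t differentiable (at x)"
    using loc by meson
  ultimately show ?case by simp
qed

section \<open>Transfer to \<open>Ck_on\<close> and \<open>smooth_on\<close>\<close>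

lemma Ck_on_param:
  assumes "open S" shows "Ck_on k S f \<longleftrightarrow> Ck_param k {t} S (\<lambda>_. f)"
proof (induction k arbitrary: f)
  case 0
  have "continuous_on S f \<longleftrightarrow> continuous_on ({t} \<times> S) (\<lambda>(t, x). f x)"
  proof
    assume "continuous_on ({t} \<times> S) (\<lambda>(t, x). f x)"
    then have "continuous_on S ((\<lambda>(t, x). f x) \<circ> (\<lambda>x. (t, x)))"
      by (intro continuous_on_compose) (auto intro!: continuous_intros elim: continuous_on_subset)
    then show "continuous_on S f" by (simp add: o_def)
  next
    assume "continuous_on S f"
    then show "continuous_on ({t} \<times> S) (\<lambda>(t, x). f x)"
      using continuous_on_compose2[of S f "{t} \<times> S" snd] by (auto simp: case_prod_unfold continuous_on_snd)
  qed
  then show ?case by simp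
next
  case (Suc k)
  \<comment> \<open>\<open>Ck_param\<close> records continuity at every order, \<open>Ck_on\<close>
    only at order 0. At higher orders it comes from differentiability.\<close>
  have "continuous_on ({t} \<times> S) (\<lambda>(t, x). f x)" if "\<forall>x\<in>S. f differentiable at x"
  proof -
    have "continuous_on S f"
      using that differentiable_imp_continuous_within by (auto simp: continuous_on_eq_continuous_at[OF assms])
    then show ?thesis
      using continuous_on_compose2[of S f "{t} \<times> S" snd] by (auto simp: case_prod_unfold continuous_on_snd)
  qed
  then show ?case using Suc by auto
qed

lemma Ck_param_of_Ck_on:
  assumes "open S" "Ck_on k S f" shows "Ck_param k P S (\<lambda>_. f)"
  using assms(2)
proof (induction k arbitrary: f)
  case 0
  then show ?case
    using continuous_on_compose2[of S f "P \<times> S" snd] by (auto simp: case_prod_unfold continuous_on_snd)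
next
  case (Suc k)
  have "continuous_on S f"
    using Suc.prems differentiable_imp_continuous_within by (auto simp: continuous_on_eq_continuous_at[OF assms(1)])
  then have "continuous_on (P \<times> S) (\<lambda>(t, x). f x)"
    using continuous_on_compose2[of S f "P \<times> S" snd] by (auto simp: case_prod_unfold continuous_on_snd)
  then show ?case using Suc by auto
qed

lemma Ck_on_of_param: "open S \<Longrightarrow> Ck_param k P S f \<Longrightarrow> t \<in> P \<Longrightarrow> Ck_on k S (f t)"
proof (induction k arbitrary: f)
  case 0
  have "continuous_on S ((\<lambda>(t, x). f t x) \<circ> (\<lambda>x. (t, x)))"
    using 0 by (intro continuous_on_compose) (auto intro!: continuous_intros elim: continuous_on_subset)
  then show ?case by (simp add: o_def)
qed auto

lemma Ck_on_cong:
  assumes "open S" "\<And>x. x \<in> S \<Longrightarrow> f x = g x" "Ck_on k S f" shows "Ck_on k S g"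
proof -
  have "Ck_param k {0::real} S (\<lambda>_. g)"
    by (rule Ck_param_cong[OF assms(1), of "{0::real}" "\<lambda>_. f"])
      (use assms Ck_on_param[OF assms(1), of _ _ "0::real"] in auto)
  then show ?thesis using Ck_on_param[OF assms(1)] by blast
qed

lemma Ck_on_SucI:
  assumes "open S" "\<And>x. x \<in> S \<Longrightarrow> (f has_derivative f' x) (at x)" "\<And>v. Ck_on k S (\<lambda>x. f' x v)"
  shows "Ck_on (Suc k) S f"
proof -
  have "frechet_derivative f (at x) = f' x" if "x \<in> S" for x
    using frechet_derivative_at[OF assms(2)[OF that]] by simp
  then have "Ck_on k S (\<lambda>x. frechet_derivative f (at x) v)" for v
    by (intro Ck_on_cong[OF assms(1) _ assms(3)[of v]]) auto
  then show ?thesis using assms(2) by (auto simp: differentiable_def)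
qed

lemma Ck_on_compose:
  fixes f :: "'a::euclidean_space \<Rightarrow> 'b::euclidean_space" and g :: "'b \<Rightarrow> 'c::real_normed_vector"
  assumes "open S" "open T" "\<And>x. x \<in> S \<Longrightarrow> f x \<in> T" "Ck_on k T g" "Ck_on k S f"
  shows "Ck_on k S (\<lambda>x. g (f x))"
  using Ck_param_compose[of S T "{0::real}" "\<lambda>_. f" k "\<lambda>_. g"] assms by (simp add: Ck_on_param[symmetric])

lemma smooth_on_subset: "smooth_on S f \<Longrightarrow> open S \<Longrightarrow> T \<subseteq> S \<Longrightarrow> open T \<Longrightarrow> smooth_on T f"
  unfolding smooth_on_def using Ck_param_subset[of _ "{0::real}" S "\<lambda>_. f" "{0::real}" T]
  by (auto simp: Ck_on_param[symmetric])

lemma smooth_on_cong: "open S \<Longrightarrow> (\<And>x. x \<in> S \<Longrightarrow> f x = g x) \<Longrightarrow> smooth_on S f \<Longrightarrow> smooth_on S g"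
  unfolding smooth_on_def using Ck_on_cong by blast

lemma smooth_on_local:
  assumes "\<And>x. x \<in> S \<Longrightarrow> \<exists>T. open T \<and> x \<in> T \<and> T \<subseteq> S \<and> smooth_on T f"
  shows "smooth_on S f"
proof -
  have "open S" using assms open_subopen[of S] by blast
  have "Ck_param k {0::real} S (\<lambda>_. f)" for k
  proof (rule Ck_param_local)
    fix x assume "x \<in> S"
    then show "\<exists>T. open T \<and> x \<in> T \<and> T \<subseteq> S \<and> Ck_param k {0::real} T (\<lambda>_. f)"
      using assms[of x] unfolding smooth_on_def by (metis Ck_on_param)
  qed
  then show ?thesis unfolding smooth_on_def using Ck_on_param[OF \<open>open S\<close>] by blast
qed

lemma smooth_on_const: "open S \<Longrightarrow> smooth_on S (\<lambda>x. c)"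
  unfolding smooth_on_def using Ck_param_const[of "{0::real}" "\<lambda>_. c" S] by (simp add: Ck_on_param[symmetric])

lemma smooth_on_id: "open S \<Longrightarrow> smooth_on S (\<lambda>x. x)"
  unfolding smooth_on_def using Ck_param_proj[of S _ "{0::real}"] by (simp add: Ck_on_param[symmetric])

lemma smooth_on_bounded_linear: "bounded_linear h \<Longrightarrow> open S \<Longrightarrow> smooth_on S f \<Longrightarrow> smooth_on S (\<lambda>x. h (f x))"
  unfolding smooth_on_def using Ck_param_bounded_linear[of h S _ "{0::real}" "\<lambda>_. f"]
  by (simp add: Ck_on_param[symmetric])

lemma smooth_on_add: "open S \<Longrightarrow> smooth_on S f \<Longrightarrow> smooth_on S g \<Longrightarrow> smooth_on S (\<lambda>x. f x + g x)"
  unfolding smooth_on_def using Ck_param_add[of S _ "{0::real}" "\<lambda>_. f" "\<lambda>_. g"]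
  by (simp add: Ck_on_param[symmetric])

lemma smooth_on_bilinear:
  "bounded_bilinear h \<Longrightarrow> open S \<Longrightarrow> smooth_on S f \<Longrightarrow> smooth_on S g \<Longrightarrow> smooth_on S (\<lambda>x. h (f x) (g x))"
  unfolding smooth_on_def using Ck_param_bilinear[of h S _ "{0::real}" "\<lambda>_. f" "\<lambda>_. g"]
  by (simp add: Ck_on_param[symmetric])

lemmas smooth_on_scaleR = smooth_on_bilinear[OF bounded_bilinear_scaleR]
lemmas smooth_on_mult = smooth_on_bilinear[OF bounded_bilinear_mult]

lemma smooth_on_sum:
  assumes "open S" "\<And>i. i \<in> I \<Longrightarrow> smooth_on S (f i)"
  shows "smooth_on S (\<lambda>x. \<Sum>i\<in>I. f i x)"
  using assms(2)
  by (induction I rule: infinite_finite_induct) (auto intro!: smooth_on_add smooth_on_const assms(1))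

lemma smooth_on_prod:
  fixes f :: "'i \<Rightarrow> 'a::euclidean_space \<Rightarrow> real"
  assumes "open S" "\<And>i. i \<in> I \<Longrightarrow> smooth_on S (f i)"
  shows "smooth_on S (\<lambda>x. \<Prod>i\<in>I. f i x)"
  using assms(2)
  by (induction I rule: infinite_finite_induct) (auto intro!: smooth_on_mult smooth_on_const assms(1))

lemma smooth_on_minus: "open S \<Longrightarrow> smooth_on S f \<Longrightarrow> smooth_on S (\<lambda>x. - f x)"
  using smooth_on_bounded_linear[OF bounded_linear_minus[OF bounded_linear_ident]] by auto

lemma smooth_on_compose:
  fixes f :: "'a::euclidean_space \<Rightarrow> 'b::euclidean_space" and g :: "'b \<Rightarrow> 'c::real_normed_vector"
  assumes "open S" "open T" "\<And>x. x \<in> S \<Longrightarrow> f x \<in> T" "smooth_on T g" "smooth_on S f"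
  shows "smooth_on S (\<lambda>x. g (f x))"
  using assms Ck_on_compose unfolding smooth_on_def by metis

lemma smooth_on_derivative: "smooth_on S f \<Longrightarrow> smooth_on S (\<lambda>x. frechet_derivative f (at x) v)"
  unfolding smooth_on_def using Ck_on.simps(2) by metis

lemma smooth_on_differentiable: "smooth_on S f \<Longrightarrow> x \<in> S \<Longrightarrow> f differentiable (at x)"
  unfolding smooth_on_def using Ck_on.simps(2) by blast

lemma smooth_on_has_derivative:
  "smooth_on S f \<Longrightarrow> x \<in> S \<Longrightarrow> (f has_derivative frechet_derivative f (at x)) (at x)"
  using smooth_on_differentiable frechet_derivative_works by blast

lemma smooth_on_continuous: "smooth_on S f \<Longrightarrow> continuous_on S f"
  unfolding smooth_on_def using Ck_on.simps(1) by blast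

text \<open>The derivative is a polynomial in \<open>inverse x\<close>, so the regularity of
  \<open>inverse\<close> raises itself by one order at a time.\<close>

lemma smooth_on_inverse_real: "smooth_on (- {0}) (inverse :: real \<Rightarrow> real)"
proof -
  have o: "open (- {0::real})" by auto
  have "Ck_on k (- {0::real}) inverse" for k
  proof (induction k)
    case 0
    then show ?case by (auto intro!: continuous_intros)
  next
    case (Suc k)
    show ?case
    proof (rule Ck_on_SucI[OF o, where f'="\<lambda>x h. - (inverse x * h * inverse x)"])
      have "Ck_param k {0::real} (-{0::real}) (\<lambda>_. inverse)" using Suc Ck_on_param[OF o] by blast
      then have "Ck_param k {0::real} (-{0::real}) (\<lambda>_ x. - (inverse x * v * inverse x))" for v
        by (intro Ck_param_bounded_linear[OF bounded_linear_minus[OF bounded_linear_ident] o]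
          Ck_param_bilinear[OF bounded_bilinear_mult o] Ck_param_const[OF _ o]) auto
      then show "Ck_on k (- {0::real}) (\<lambda>x. - (inverse x * v * inverse x))" for v
        using Ck_on_param[OF o] by blast
    qed (auto intro!: has_derivative_inverse')
  qed
  then show ?thesis unfolding smooth_on_def by blast
qed

lemma smooth_on_divide:
  fixes f g :: "'a::euclidean_space \<Rightarrow> real"
  assumes "open S" "smooth_on S f" "smooth_on S g" "\<And>x. x \<in> S \<Longrightarrow> g x \<noteq> 0"
  shows "smooth_on S (\<lambda>x. f x / g x)"
  unfolding divide_inverse
  by (intro smooth_on_mult assms smooth_on_compose[OF assms(1) _ _ smooth_on_inverse_real]) (use assms in auto)

lemma Ck_on_vec:
  fixes f :: "'a::euclidean_space \<Rightarrow> real ^ 'n"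
  assumes "open S" "\<And>i. Ck_on k S (\<lambda>x. f x $ i)" shows "Ck_on k S f"
proof -
  have "Ck_param k {0::real} S (\<lambda>_ x. \<Sum>i\<in>UNIV. (f x $ i) *\<^sub>R axis i 1)"
    by (intro Ck_param_sum[OF assms(1)] Ck_param_bilinear[OF bounded_bilinear_scaleR assms(1)]
      Ck_param_const[OF _ assms(1)]) (use assms in \<open>auto simp: Ck_on_param[symmetric]\<close>)
  moreover have "f x = (\<Sum>i\<in>UNIV. (f x $ i) *\<^sub>R axis i 1)" for x
    using basis_expansion[of "f x"] by (simp add: scalar_mult_eq_scaleR)
  ultimately show ?thesis using Ck_on_param[OF assms(1)] by (metis (no_types, lifting) ext)
qed

lemma smooth_on_vec:
  fixes f :: "'a::euclidean_space \<Rightarrow> real ^ 'n"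
  assumes "open S" "\<And>i. smooth_on S (\<lambda>x. f x $ i)" shows "smooth_on S f"
  using Ck_on_vec assms unfolding smooth_on_def by blast

lemma smooth_on_vec_nth: "open S \<Longrightarrow> smooth_on S f \<Longrightarrow> smooth_on S (\<lambda>x. f x $ i)"
  by (rule smooth_on_bounded_linear[OF bounded_linear_vec_nth])

lemma smooth_on_det:
  fixes M :: "'a::euclidean_space \<Rightarrow> real ^ 'n ^ 'n"
  assumes "open S" "\<And>i j. smooth_on S (\<lambda>x. M x $ i $ j)" shows "smooth_on S (\<lambda>x. det (M x))"
  unfolding det_def
  by (intro smooth_on_sum smooth_on_mult smooth_on_prod smooth_on_const assms)

section \<open>Integrals depending on parameters\<close>

lemma continuous_on_curried:
  assumes "continuous_on (P \<times> S) (\<lambda>(t, x). f t x)" "continuous_on D a" "continuous_on D b"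
    and "\<And>s. s \<in> D \<Longrightarrow> a s \<in> P" "\<And>s. s \<in> D \<Longrightarrow> b s \<in> S"
  shows "continuous_on D (\<lambda>s. f (a s) (b s))"
proof -
  have "continuous_on D (\<lambda>s. (\<lambda>(t, x). f t x) (a s, b s))"
    by (rule continuous_on_compose2[OF assms(1)]) (use assms in \<open>auto intro!: continuous_on_Pair\<close>)
  then show ?thesis by simp
qed

lemma param_integral_has_derivative:
  fixes f :: "'a::euclidean_space \<Rightarrow> real \<Rightarrow> 'b::banach"
  assumes S: "open S" "convex S" and x: "x \<in> S"
    and f: "continuous_on (S \<times> {0..1}) (\<lambda>(x, t). f x t)"
    and der: "\<And>x t. x \<in> S \<Longrightarrow> t \<in> {0..1} \<Longrightarrow> ((\<lambda>x. f x t) has_derivative f' x t) (at x)"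
    and f': "\<And>v. continuous_on (S \<times> {0..1}) (\<lambda>(x, t). f' x t v)"
  shows "((\<lambda>x. integral {0..1} (f x)) has_derivative (\<lambda>v. integral {0..1} (\<lambda>t. f' x t v))) (at x)"
proof -
  \<comment> \<open>\<open>leibniz_rule\<close> asks for the derivative as a continuous map into the
    bounded linear functions. In finite dimension this follows from continuity in each basis
    direction, which is what \<open>f'\<close> provides.\<close>
  define F where "F x t = Blinfun (f' x t)" for x t
  have ap: "blinfun_apply (F x t) = f' x t" if "x \<in> S" "t \<in> {0..1}" for x t
    unfolding F_def using bounded_linear_Blinfun_apply has_derivative_bounded_linear[OF der[OF that]] by blast
  have cF: "continuous_on (S \<times> {0..1}) (\<lambda>(x, t). F x t)"
  proof (rule continuous_on_blinfun_componentwise)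
    fix i :: 'a
    show "continuous_on (S \<times> {0..1}) (\<lambda>p. blinfun_apply (case p of (x, t) \<Rightarrow> F x t) i)"
      by (rule continuous_on_eq[OF f'[of i]]) (auto simp: ap)
  qed
  have slice: "continuous_on {0..1} (g y)" if "continuous_on (S \<times> {0..1}) (\<lambda>(x, t). g x t)" "y \<in> S"
    for g :: "'a \<Rightarrow> real \<Rightarrow> 'c::topological_space" and y
    by (rule continuous_on_curried[OF that(1)]) (use that(2) in auto)
  have "((\<lambda>x. integral (cbox 0 1) (f x)) has_derivative integral (cbox 0 1) (F x)) (at x within S)"
  proof (rule leibniz_rule)
    show "((\<lambda>x. f x t) has_derivative blinfun_apply (F y t)) (at y within S)" if "y \<in> S" "t \<in> cbox 0 1" for y t
      using der[of y t] ap[of y t] that by (auto simp: has_derivative_at_withinI)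
    show "f y integrable_on cbox 0 1" if "y \<in> S" for y
      using slice[OF f that] by (simp add: integrable_continuous_interval)
  qed (use cF S x in auto)
  then have hd: "((\<lambda>x. integral {0..1} (f x)) has_derivative integral {0..1} (F x)) (at x)"
    using at_within_open[OF x S(1)] by simp
  have ev: "blinfun_apply (integral {0..1} (F x)) v = integral {0..1} (\<lambda>t. f' x t v)" for v
  proof -
    have "F x integrable_on {0..1}"
      using slice[OF cF x] by (simp add: integrable_continuous_interval)
    then have "blinfun_apply (integral {0..1} (F x)) v = integral {0..1} (\<lambda>t. F x t v)"
      by (rule blinfun_apply_integral)
    also have "\<dots> = integral {0..1} (\<lambda>t. f' x t v)"
      by (rule integral_cong) (simp add: ap[OF x])
    finally show ?thesis .
  qed
  show ?thesis
    by (rule has_derivative_eq_rhs[OF hd]) (intro ext, rule ev)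
qed

text \<open>Applied to a sequence of functions at each point, the explicit rate is the same at all
  points and so gives uniform convergence.\<close>

lemma geometric_limit:
  fixes f :: "nat \<Rightarrow> 'b::banach"
  assumes q: "0 \<le> q" "q < 1" and C: "\<And>n. norm (f (Suc n) - f n) \<le> C * q ^ n"
  shows "\<exists>l. f \<longlonglongrightarrow> l \<and> (\<forall>n. norm (f n - l) \<le> C * q ^ n / (1 - q))"
proof -
  have C0: "0 \<le> C" using order_trans[OF norm_ge_zero C[of 0]] by simp
  \<comment> \<open>The induction on \<open>k\<close> needs the exact partial sum of the geometric
    series; the cruder bound by the full series is taken afterwards in \<open>bd\<close>.\<close>
  have step: "norm (f (n + k) - f n) \<le> C * q ^ n * (1 - q ^ k) / (1 - q)" for n k
  proof (induction k)
    case (Suc k)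
    have "norm (f (n + Suc k) - f n) \<le> norm (f (Suc (n + k)) - f (n + k)) + norm (f (n + k) - f n)"
      using norm_triangle_ineq[of "f (Suc (n + k)) - f (n + k)" "f (n + k) - f n"] by simp
    also have "\<dots> \<le> C * q ^ (n + k) + C * q ^ n * (1 - q ^ k) / (1 - q)"
      using C[of "n + k"] Suc by simp
    also have "\<dots> = C * q ^ n * (1 - q ^ Suc k) / (1 - q)"
      using q by (simp add: field_simps power_add)
    finally show ?case .
  qed simp
  have bd: "norm (f m - f n) \<le> C * q ^ n / (1 - q)" if "n \<le> m" for m n
  proof -
    have "norm (f m - f n) \<le> C * q ^ n * (1 - q ^ (m - n)) / (1 - q)" using step[of n "m - n"] that by simp
    also have "\<dots> \<le> C * q ^ n * 1 / (1 - q)"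
      using q C0 by (intro divide_right_mono mult_left_mono) auto
    finally show ?thesis by simp
  qed
  have "(\<lambda>n. C * q ^ n / (1 - q)) \<longlonglongrightarrow> C * 0 / (1 - q)"
    by (intro tendsto_intros LIMSEQ_power_zero) (use q in auto)
  then have z: "(\<lambda>n. C * q ^ n / (1 - q)) \<longlonglongrightarrow> 0" by simp
  have "Cauchy f"
  proof (rule metric_CauchyI)
    fix e :: real assume "0 < e"
    then obtain N where N: "\<And>n. n \<ge> N \<Longrightarrow> norm (C * q ^ n / (1 - q)) < e / 2"
      using LIMSEQ_D[OF z, of "e/2"] by auto
    have "dist (f m) (f n) < e" if "m \<ge> N" "n \<ge> N" for m n
    proof -
      have "norm (f m - f N) < e / 2" "norm (f n - f N) < e / 2"
        using bd[OF that(1)] bd[OF that(2)] N[of N] abs_ge_self[of "C * q ^ N / (1 - q)"]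
        unfolding real_norm_def by linarith+
      then show ?thesis by (metis dist_norm dist_triangle_half_l)
    qed
    then show "\<exists>N. \<forall>m\<ge>N. \<forall>n\<ge>N. dist (f m) (f n) < e" by blast
  qed
  then obtain l where l: "f \<longlonglongrightarrow> l" using Cauchy_convergent convergent_def by blast
  have "norm (f n - l) \<le> C * q ^ n / (1 - q)" for n
  proof (rule Lim_bounded)
    show "(\<lambda>m. norm (f n - f m)) \<longlonglongrightarrow> norm (f n - l)" by (intro tendsto_intros l)
    show "\<forall>m\<ge>n. norm (f n - f m) \<le> C * q ^ n / (1 - q)" using bd by (metis norm_minus_commute)
  qed
  then show ?thesis using l by blast
qed

text \<open>The integral from \<open>0\<close> to \<open>t\<close>, rescaled to the unit interval so that its dependence on all
  variables is that of an integral over a fixed domain.\<close>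

definition rint :: "(real \<Rightarrow> 'z \<Rightarrow> 'u::banach) \<Rightarrow> real \<Rightarrow> 'z \<Rightarrow> 'u" where
  "rint f t z = t *\<^sub>R integral {0..1} (\<lambda>s. f (t * s) z)"

lemma rint_cont_slice:
  fixes f :: "real \<Rightarrow> 'z::topological_space \<Rightarrow> 'u::banach"
  assumes "continuous_on ({0..1} \<times> S) (\<lambda>(s, z). f s z)" "t \<in> {0..1}" "z \<in> S"
  shows "continuous_on {0..1} (\<lambda>s. f (t * s) z)"
  by (rule continuous_on_curried[OF assms(1)])
    (use assms(2,3) in \<open>auto intro!: continuous_intros intro: mult_nonneg_nonneg mult_le_one\<close>)

lemma rint_integrable:
  fixes f :: "real \<Rightarrow> 'z::topological_space \<Rightarrow> 'u::banach"
  assumes "continuous_on ({0..1} \<times> S) (\<lambda>(s, z). f s z)" "t \<in> {0..1}" "z \<in> S"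
  shows "(\<lambda>s. f (t * s) z) integrable_on {0..1}"
  using rint_cont_slice[OF assms] by (rule integrable_continuous_interval)

lemma rint_norm:
  fixes f :: "real \<Rightarrow> 'z::topological_space \<Rightarrow> 'u::banach"
  assumes "continuous_on ({0..1} \<times> S) (\<lambda>(s, z). f s z)" "t \<in> {0..1}" "z \<in> S"
    and "\<And>s. s \<in> {0..1} \<Longrightarrow> norm (f s z) \<le> C"
  shows "norm (rint f t z) \<le> C"
proof -
  have C: "0 \<le> C" using order_trans[OF norm_ge_zero assms(4)[of 0]] by simp
  have "norm (integral {0..1} (\<lambda>s. f (t * s) z)) \<le> C * (1 - 0)"
    by (rule integral_bound)
      (use assms rint_cont_slice[OF assms(1-3)] in \<open>auto intro: mult_nonneg_nonneg mult_le_one\<close>)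
  then have "\<bar>t\<bar> * norm (integral {0..1} (\<lambda>s. f (t * s) z)) \<le> 1 * C"
    using assms(2) C by (intro mult_mono) auto
  then show ?thesis by (simp add: rint_def)
qed

lemma rint_diff:
  fixes f g :: "real \<Rightarrow> 'z::topological_space \<Rightarrow> 'u::banach"
  assumes "continuous_on ({0..1} \<times> S) (\<lambda>(s, z). f s z)" "continuous_on ({0..1} \<times> S) (\<lambda>(s, z). g s z)"
    "t \<in> {0..1}" "z \<in> S"
  shows "rint f t z - rint g t z = rint (\<lambda>s z. f s z - g s z) t z"
  unfolding rint_def
  by (simp add: integral_diff rint_integrable[OF assms(1,3,4)] rint_integrable[OF assms(2,3,4)] scaleR_diff_right)

lemma rint_cong:
  assumes "\<And>s. s \<in> {0..1} \<Longrightarrow> f s z = g s z" "t \<in> {0..1}"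
  shows "rint f t z = rint g t z"
proof -
  have "integral {0..1} (\<lambda>s. f (t * s) z) = integral {0..1} (\<lambda>s. g (t * s) z)"
    by (rule integral_cong) (use assms in \<open>auto intro!: assms(1) mult_nonneg_nonneg mult_le_one\<close>)
  then show ?thesis by (simp add: rint_def)
qed

lemma rint_continuous:
  fixes f :: "real \<Rightarrow> 'z::topological_space \<Rightarrow> 'u::banach"
  assumes "continuous_on ({0..1} \<times> S) (\<lambda>(s, z). f s z)"
  shows "continuous_on ({0..1} \<times> S) (\<lambda>(t, z). rint f t z)"
proof -
  have "continuous_on (({0..1} \<times> S) \<times> cbox 0 1) (\<lambda>p. (\<lambda>(s, z). f s z) (fst (fst p) * snd p, snd (fst p)))"
    by (rule continuous_on_compose2[OF assms])
      (auto intro!: continuous_intros intro: mult_nonneg_nonneg mult_le_one)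
  then have "continuous_on (({0..1} \<times> S) \<times> cbox 0 1) (\<lambda>(p, s). f (fst p * s) (snd p))"
    by (simp add: case_prod_unfold)
  then have "continuous_on ({0..1} \<times> S) (\<lambda>p. integral (cbox 0 1) (\<lambda>s. f (fst p * s) (snd p)))"
    by (rule integral_continuous_on_param)
  then show ?thesis
    by (auto simp: rint_def case_prod_unfold intro!: continuous_intros)
qed

lemma rint_has_derivative:
  fixes f :: "real \<Rightarrow> 'z::euclidean_space \<Rightarrow> 'u::banach"
  assumes S: "open S" "convex S" and t: "t \<in> {0..1}" and z: "z \<in> S"
    and f: "continuous_on ({0..1} \<times> S) (\<lambda>(s, z). f s z)"
    and der: "\<And>s z. s \<in> {0..1} \<Longrightarrow> z \<in> S \<Longrightarrow> (f s has_derivative f' s z) (at z)"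
    and f': "\<And>v. continuous_on ({0..1} \<times> S) (\<lambda>(s, z). f' s z v)"
  shows "(rint f t has_derivative (\<lambda>v. rint (\<lambda>s z. f' s z v) t z)) (at z)"
proof -
  have c: "continuous_on (S \<times> {0..1}) (\<lambda>(z, s). g (t * s) z)"
    if "continuous_on ({0..1} \<times> S) (\<lambda>(s, z). g s z)" for g :: "real \<Rightarrow> 'z \<Rightarrow> 'u"
  proof -
    have "continuous_on (S \<times> {0..1}) (\<lambda>p. (\<lambda>(s, z). g s z) (t * snd p, fst p))"
      by (rule continuous_on_compose2[OF that])
        (use t in \<open>auto intro!: continuous_intros intro: mult_nonneg_nonneg mult_le_one\<close>)
    then show ?thesis by (simp add: case_prod_unfold)
  qed
  have "((\<lambda>z. integral {0..1} (\<lambda>s. f (t * s) z)) has_derivative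
      (\<lambda>v. integral {0..1} (\<lambda>s. f' (t * s) z v))) (at z)"
  proof (rule param_integral_has_derivative[OF S z c[OF f]])
    show "((\<lambda>x. f (t * s) x) has_derivative f' (t * s) x) (at x)" if "x \<in> S" "s \<in> {0..1}" for x s
      by (rule der) (use that t in \<open>auto intro: mult_nonneg_nonneg mult_le_one\<close>)
    show "continuous_on (S \<times> {0..1}) (\<lambda>(x, s). f' (t * s) x v)" for v
      by (rule c[OF f'])
  qed
  then show ?thesis unfolding rint_def by (rule has_derivative_scaleR_right)
qed

lemma rint_eq_integral:
  fixes f :: "real \<Rightarrow> 'z::topological_space \<Rightarrow> 'u::banach"
  assumes "continuous_on ({0..1} \<times> S) (\<lambda>(s, z). f s z)" "t \<in> {0..1}" "z \<in> S"
  shows "rint f t z = integral {0..t} (\<lambda>s. f s z)"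
proof (cases "t = 0")
  case False
  then have t: "t > 0" using assms(2) by auto
  have "continuous_on {0..t} (\<lambda>s. f s z)"
    by (rule continuous_on_curried[OF assms(1)]) (use assms(2,3) in auto)
  then have "((\<lambda>s. f s z) has_integral integral {0..t} (\<lambda>s. f s z)) (cbox 0 t)"
    using integrable_continuous_interval integrable_integral by fastforce
  from has_integral_affinity[OF this, of t 0] t
  have "((\<lambda>x. f (t * x) z) has_integral (1 / t) *\<^sub>R integral {0..t} (\<lambda>s. f s z)) ((\<lambda>x. x / t) ` {0..t})"
    by (simp add: divide_inverse mult.commute)
  moreover have "(\<lambda>x. x / t) ` {0..t} = {0..1}"
    using image_divide_atLeastAtMost[of t 0 t] t by simp
  ultimately have "integral {0..1} (\<lambda>x. f (t * x) z) = (1 / t) *\<^sub>R integral {0..t} (\<lambda>s. f s z)"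
    by (simp add: integral_unique)
  then show ?thesis using t by (simp add: rint_def)
qed (simp add: rint_def)

text \<open>Differentiate \<open>f (y + t w) - f y = \<integral> Df (y + s w) w ds\<close> with respect to \<open>y\<close>, and then to \<open>t\<close>.\<close>

lemma symmetric_second_derivative:
  fixes f :: "'a::euclidean_space \<Rightarrow> 'b::banach"
  assumes S: "open S" and f: "smooth_on S f" and x: "x \<in> S"
  shows "frechet_derivative (\<lambda>y. frechet_derivative f (at y) v) (at x) w =
    frechet_derivative (\<lambda>y. frechet_derivative f (at y) w) (at x) v"
proof -
  define D where "D v y = frechet_derivative f (at y) v" for v y
  define DD where "DD v w y = frechet_derivative (D v) (at y) w" for v w y
  have sD: "smooth_on S (D v)" for v unfolding D_def by (rule smooth_on_derivative[OF f])
  have sDD: "smooth_on S (DD v w)" for v w unfolding DD_def by (rule smooth_on_derivative[OF sD])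
  obtain e where e: "e > 0" "cball x e \<subseteq> S" using S x open_contains_cball by blast
  \<comment> \<open>A small \<open>d\<close> keeps the segments from \<open>y\<close> to
    \<open>y + d *\<^sub>R w\<close> inside \<open>S\<close> for all \<open>y\<close> near
    \<open>x\<close>, so that the time runs over the whole unit interval, as \<open>rint\<close>
    requires. It cancels at the end.\<close>
  obtain d where d: "d > 0" "d * norm w < e / 2"
    using that[of "e / (2 * norm w + 2)"] e(1) by (auto simp: field_simps add_pos_nonneg)
  define B where "B = ball x (e/2)"
  have B: "open B" "convex B" "x \<in> B" using e by (auto simp: B_def)
  have inS: "y + (d * s) *\<^sub>R w \<in> S" if "y \<in> B" "s \<in> {0..1}" for y s
  proof -
    have "norm ((d * s) *\<^sub>R w) \<le> d * norm w"
      using that d by (simp add: abs_mult mult_right_mono mult_left_le)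
    moreover have "dist y (y + (d * s) *\<^sub>R w) = norm ((d * s) *\<^sub>R w)" by (simp add: dist_norm)
    moreover have "dist x y < e / 2" using that by (simp add: B_def)
    ultimately have "dist x (y + (d * s) *\<^sub>R w) \<le> e"
      using d dist_triangle[of x "y + (d * s) *\<^sub>R w" y] by linarith
    then show ?thesis using e by (auto simp: mem_cball)
  qed
  have inS': "y + (d * r) *\<^sub>R w \<in> S" if "y \<in> B" "0 \<le> r" "r \<le> 1" for y r
    using inS that by auto
  have c: "continuous_on (B \<times> {0..1}) (\<lambda>(y, s). h (y + (d * s) *\<^sub>R w))"
    if "continuous_on S h" for h :: "'a \<Rightarrow> 'b"
    unfolding case_prod_unfold
    by (rule continuous_on_compose2[OF that]) (auto intro!: continuous_intros inS)
  have fund: "f (y + (d * t) *\<^sub>R w) - f y = d *\<^sub>R rint (\<lambda>s y. D w (y + (d * s) *\<^sub>R w)) t y"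
    if y: "y \<in> B" and t: "t \<in> {0..1}" for y t
  proof -
    have "((\<lambda>s. f (y + (d * s) *\<^sub>R w)) has_vector_derivative (d *\<^sub>R D w (y + (d * s) *\<^sub>R w))) (at s within {0..t})"
      if "s \<in> {0..t}" for s
    proof -
      have "y + (d * s) *\<^sub>R w \<in> S" using inS' y t that by auto
      note h = smooth_on_has_derivative[OF f this]
      have "((\<lambda>s. y + (d * s) *\<^sub>R w) has_derivative (\<lambda>h. (d * h) *\<^sub>R w)) (at s within {0..t})"
        by (auto intro!: derivative_eq_intros)
      from has_derivative_compose[OF this h]
      show ?thesis
        using linear_cmul[OF has_derivative_linear[OF h]]
        by (simp add: has_vector_derivative_def D_def mult.commute)
    qed
    then have "((\<lambda>s. d *\<^sub>R D w (y + (d * s) *\<^sub>R w)) has_integral (f (y + (d * t) *\<^sub>R w) - f y)) {0..t}"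
      using fundamental_theorem_of_calculus[of 0 t "\<lambda>s. f (y + (d * s) *\<^sub>R w)"] t by auto
    then have "f (y + (d * t) *\<^sub>R w) - f y = integral {0..t} (\<lambda>s. d *\<^sub>R D w (y + (d * s) *\<^sub>R w))"
      by (rule integral_unique[symmetric])
    also have "\<dots> = d *\<^sub>R integral {0..t} (\<lambda>s. D w (y + (d * s) *\<^sub>R w))" by simp
    also have "integral {0..t} (\<lambda>s. D w (y + (d * s) *\<^sub>R w)) = rint (\<lambda>s y. D w (y + (d * s) *\<^sub>R w)) t y"
    proof (rule rint_eq_integral[symmetric, OF _ t y])
      show "continuous_on ({0..1} \<times> B) (\<lambda>(s, y). D w (y + (d * s) *\<^sub>R w))"
        unfolding case_prod_unfold
        by (rule continuous_on_compose2[OF smooth_on_continuous[OF sD]]) (auto intro!: continuous_intros inS)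
    qed
    finally show ?thesis .
  qed
  have shift: "((\<lambda>y. h (y + a)) has_derivative frechet_derivative h (at (y + a))) (at y)"
    if "smooth_on S h" "y + a \<in> S" for h :: "'a \<Rightarrow> 'b" and y a
  proof -
    have "((\<lambda>y. y + a) has_derivative (\<lambda>h. h)) (at y)" by (auto intro!: derivative_eq_intros)
    from has_derivative_compose[OF this smooth_on_has_derivative[OF that]] show ?thesis by simp
  qed
  have cc: "continuous_on ({0..1} \<times> B) (\<lambda>(s, y). h (y + (d * s) *\<^sub>R w))"
    if "continuous_on S h" for h :: "'a \<Rightarrow> 'b"
    unfolding case_prod_unfold
    by (rule continuous_on_compose2[OF that]) (auto intro!: continuous_intros inS)
  have key: "D v (x + (d * t) *\<^sub>R w) - D v x = d *\<^sub>R rint (\<lambda>s y. DD w v (y + (d * s) *\<^sub>R w)) t x"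
    if t: "t \<in> {0..1}" for t
  proof -
    have 1: "((\<lambda>y. d *\<^sub>R rint (\<lambda>s y. D w (y + (d * s) *\<^sub>R w)) t y) has_derivative
      (\<lambda>v. d *\<^sub>R rint (\<lambda>s y. DD w v (y + (d * s) *\<^sub>R w)) t x)) (at x)"
    proof (rule has_derivative_scaleR_right, rule rint_has_derivative[OF B(1,2) t B(3)])
      show "((\<lambda>y. D w (y + (d * s) *\<^sub>R w)) has_derivative (\<lambda>v. DD w v (y + (d * s) *\<^sub>R w))) (at y)"
        if "s \<in> {0..1}" "y \<in> B" for s y
        using shift[OF sD inS[OF that(2,1)]] by (simp add: DD_def)
    qed (rule cc smooth_on_continuous sD sDD)+
    have 2: "((\<lambda>y. f (y + (d * t) *\<^sub>R w) - f y) has_derivative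
       (\<lambda>v. D v (x + (d * t) *\<^sub>R w) - D v x)) (at x)"
      unfolding D_def
      by (intro has_derivative_diff shift[OF f] smooth_on_has_derivative[OF f]) (use inS[OF B(3) t] x in auto)
    have "((\<lambda>y. d *\<^sub>R rint (\<lambda>s y. D w (y + (d * s) *\<^sub>R w)) t y) has_derivative
       (\<lambda>v. D v (x + (d * t) *\<^sub>R w) - D v x)) (at x)"
      by (rule has_derivative_transform_within_open[OF 2 B(1,3)]) (use fund t in auto)
    from has_derivative_unique[OF this 1] show ?thesis by (metis (no_types))
  qed
  \<comment> \<open>The same function of \<open>t\<close> is differentiated at 0 twice: here by the
    chain rule, next through its representation \<open>key\<close> as an integral. The results are
    \<open>DD v w x\<close> and \<open>DD w v x\<close>, up to the factor \<open>d\<close>.\<close>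
  have "((\<lambda>t. D v (x + (d * t) *\<^sub>R w)) has_vector_derivative d *\<^sub>R DD v w x) (at 0 within {0..1})"
  proof -
    have l: "((\<lambda>t. x + (d * t) *\<^sub>R w) has_derivative (\<lambda>h. (d * h) *\<^sub>R w)) (at 0 within {0..1})"
      by (auto intro!: derivative_eq_intros)
    have h: "(D v has_derivative frechet_derivative (D v) (at x)) (at x)"
      by (rule smooth_on_has_derivative[OF sD x])
    have "((\<lambda>t. D v (x + (d * t) *\<^sub>R w)) has_derivative (\<lambda>h. frechet_derivative (D v) (at x) ((d * h) *\<^sub>R w)))
        (at 0 within {0..1})"
      by (rule has_derivative_compose[OF l]) (use h in simp)
    then show ?thesis
      using linear_cmul[OF has_derivative_linear[OF h]]
      by (simp add: has_vector_derivative_def DD_def mult.commute)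
  qed
  moreover have "((\<lambda>t. D v (x + (d * t) *\<^sub>R w)) has_vector_derivative d *\<^sub>R DD w v x) (at 0 within {0..1})"
  proof -
    let ?h = "\<lambda>s. DD w v (x + (d * s) *\<^sub>R w)"
    have ch: "continuous_on {0..1} ?h"
      by (rule continuous_on_compose2[OF smooth_on_continuous[OF sDD]]) (auto intro!: continuous_intros inS B)
    have "((\<lambda>t. integral {0..t} ?h) has_vector_derivative ?h 0) (at 0 within {0..1})"
      by (rule integral_has_vector_derivative[OF ch]) auto
    then have "((\<lambda>t. D v x + d *\<^sub>R integral {0..t} ?h) has_vector_derivative (0 + d *\<^sub>R DD w v x)) (at 0 within {0..1})"
      using B(3) by (intro has_vector_derivative_add has_vector_derivative_const
        bounded_linear.has_vector_derivative[OF bounded_linear_scaleR_right]) simp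
    then have "((\<lambda>t. D v x + d *\<^sub>R integral {0..t} ?h) has_vector_derivative (d *\<^sub>R DD w v x)) (at 0 within {0..1})"
      by simp
    then show ?thesis
    proof (rule has_vector_derivative_transform[rotated 2])
      show "D v (x + (d * t) *\<^sub>R w) = D v x + d *\<^sub>R integral {0..t} ?h" if t: "t \<in> {0..1}" for t
        using key[OF t] rint_eq_integral[OF cc[OF smooth_on_continuous[OF sDD]] t B(3), of w v]
        by (simp add: algebra_simps)
    qed simp
  qed
  ultimately have "d *\<^sub>R DD v w x = d *\<^sub>R DD w v x"
    by (rule vector_derivative_unique_within[rotated]) (simp add: trivial_limit_within islimpt_Icc)
  moreover have "D u = (\<lambda>y. frechet_derivative f (at y) u)" for u
    by (rule ext) (simp add: D_def)
  ultimately show ?thesis using d by (simp add: DD_def)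
qed

section \<open>Picard iteration\<close>

text \<open>\<open>Gz\<close> and \<open>Gu\<close> are the partial derivatives of \<open>G\<close>. The Lipschitz constant \<open>1/2\<close> in \<open>u\<close> makes the Picard
  iteration on \<open>[0, 1]\<close> a contraction; the iterates \<open>W\<close> of the derivative with respect to the parameter \<open>z\<close>
  converge along with the iterates \<open>V\<close> of the solution.\<close>

locale picard =
  fixes Om :: "'z::euclidean_space set" and r M :: real
    and G :: "real \<Rightarrow> 'z \<Rightarrow> 'u::euclidean_space \<Rightarrow> 'u"
    and Gz :: "real \<Rightarrow> 'z \<Rightarrow> 'u \<Rightarrow> 'z \<Rightarrow> 'u"
    and Gu :: "real \<Rightarrow> 'z \<Rightarrow> 'u \<Rightarrow> 'u \<Rightarrow> 'u"
  assumes Om: "open Om" "convex Om" and r: "0 \<le> r" and M: "0 \<le> M"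
    and Gz_lin: "\<And>s z u. s \<in> {0..1} \<Longrightarrow> z \<in> Om \<Longrightarrow> norm u \<le> r \<Longrightarrow> linear (Gz s z u)"
    and Gu_lin: "\<And>s z u. s \<in> {0..1} \<Longrightarrow> z \<in> Om \<Longrightarrow> norm u \<le> r \<Longrightarrow> linear (Gu s z u)"
    and G_der: "\<And>s z u. s \<in> {0..1} \<Longrightarrow> z \<in> Om \<Longrightarrow> norm u \<le> r \<Longrightarrow>
      ((\<lambda>(z, u). G s z u) has_derivative (\<lambda>(h, k). Gz s z u h + Gu s z u k)) (at (z, u))"
    and G_bd: "\<And>s z u. s \<in> {0..1} \<Longrightarrow> z \<in> Om \<Longrightarrow> norm u \<le> r \<Longrightarrow> norm (G s z u) \<le> r"
    and Gz_bd: "\<And>s z u h. s \<in> {0..1} \<Longrightarrow> z \<in> Om \<Longrightarrow> norm u \<le> r \<Longrightarrow> norm (Gz s z u h) \<le> M * norm h"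
    and Gu_bd: "\<And>s z u k. s \<in> {0..1} \<Longrightarrow> z \<in> Om \<Longrightarrow> norm u \<le> r \<Longrightarrow> norm (Gu s z u k) \<le> norm k / 2"
    and Gz_lip: "\<And>s z u u' h. s \<in> {0..1} \<Longrightarrow> z \<in> Om \<Longrightarrow> norm u \<le> r \<Longrightarrow> norm u' \<le> r \<Longrightarrow>
      norm (Gz s z u h - Gz s z u' h) \<le> M * norm (u - u') * norm h"
    and Gu_lip: "\<And>s z u u' k. s \<in> {0..1} \<Longrightarrow> z \<in> Om \<Longrightarrow> norm u \<le> r \<Longrightarrow> norm u' \<le> r \<Longrightarrow>
      norm (Gu s z u k - Gu s z u' k) \<le> M * norm (u - u') * norm k"
    and G_cont: "continuous_on ({0..1} \<times> (Om \<times> cball 0 r)) (\<lambda>(s, z, u). G s z u)"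
    and Gz_cont: "\<And>h. continuous_on ({0..1} \<times> (Om \<times> cball 0 r)) (\<lambda>(s, z, u). Gz s z u h)"
    and Gu_cont: "\<And>k. continuous_on ({0..1} \<times> (Om \<times> cball 0 r)) (\<lambda>(s, z, u). Gu s z u k)"
begin

section \<open>The iterates, with bounds uniform in time and parameter\<close>

fun V :: "nat \<Rightarrow> real \<Rightarrow> 'z \<Rightarrow> 'u" where
  "V 0 = (\<lambda>t z. 0)"
| "V (Suc n) = rint (\<lambda>s z. G s z (V n s z))"

fun W :: "nat \<Rightarrow> real \<Rightarrow> 'z \<Rightarrow> 'z \<Rightarrow> 'u" where
  "W 0 = (\<lambda>t z v. 0)"
| "W (Suc n) = (\<lambda>t z v. rint (\<lambda>s z. Gz s z (V n s z) v + Gu s z (V n s z) (W n s z v)) t z)"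

lemma cont_comp:
  assumes "continuous_on ({0..1} \<times> (Om \<times> cball 0 r)) (\<lambda>(s, z, u). H s z u)"
    and "continuous_on ({0..1} \<times> Om) (\<lambda>(s, z). f s z)"
    and "\<And>s z. s \<in> {0..1} \<Longrightarrow> z \<in> Om \<Longrightarrow> norm (f s z) \<le> r"
  shows "continuous_on ({0..1} \<times> Om) (\<lambda>(s, z). H s z (f s z))"
proof -
  have "continuous_on ({0..1} \<times> Om) (\<lambda>p. (\<lambda>(s, z, u). H s z u) (fst p, snd p, f (fst p) (snd p)))"
    by (rule continuous_on_compose2[OF assms(1)])
      (use assms(2,3) in \<open>auto simp: case_prod_unfold intro!: continuous_intros\<close>)
  then show ?thesis by (simp add: case_prod_unfold)
qed

lemma Gu_cont_comp:
  assumes "continuous_on ({0..1} \<times> Om) (\<lambda>(s, z). f s z)"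
    and b: "\<And>s z. s \<in> {0..1} \<Longrightarrow> z \<in> Om \<Longrightarrow> norm (f s z) \<le> r"
    and "continuous_on ({0..1} \<times> Om) (\<lambda>(s, z). k s z)"
  shows "continuous_on ({0..1} \<times> Om) (\<lambda>(s, z). Gu s z (f s z) (k s z))"
proof -
  have "continuous_on ({0..1} \<times> Om) (\<lambda>(s, z). Gu s z (f s z) b)" for b
    by (rule cont_comp[OF Gu_cont assms(1,2)])
  then have "continuous_on ({0..1} \<times> Om) (\<lambda>p :: real \<times> 'z. \<Sum>b\<in>Basis. (k (fst p) (snd p) \<bullet> b) *\<^sub>R Gu (fst p) (snd p) (f (fst p) (snd p)) b)"
    using assms(3) by (auto simp: case_prod_unfold intro!: continuous_intros)
  then show ?thesis
  proof (rule continuous_on_eq)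
    fix p :: "real \<times> 'z" assume "p \<in> {0..1} \<times> Om"
    then have "linear (Gu (fst p) (snd p) (f (fst p) (snd p)))" by (intro Gu_lin b) auto
    from euclidean_linear_sum[OF this, of "k (fst p) (snd p)"]
    show "(\<Sum>b\<in>Basis. (k (fst p) (snd p) \<bullet> b) *\<^sub>R Gu (fst p) (snd p) (f (fst p) (snd p)) b) =
      (case p of (s, z) \<Rightarrow> Gu s z (f s z) (k s z))" by (simp add: case_prod_unfold)
  qed
qed

lemma G_Lip:
  assumes "s \<in> {0..1}" "z \<in> Om" "norm u \<le> r" "norm u' \<le> r"
  shows "norm (G s z u - G s z u') \<le> norm (u - u') / 2"
proof -
  have "norm (G s z u - G s z u') \<le> (1/2) * norm (u - u')"
  proof (rule differentiable_bound[of "cball 0 r"])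
    show "((\<lambda>u. G s z u) has_derivative Gu s z y) (at y within cball 0 r)" if "y \<in> cball 0 r" for y
    proof -
      have y: "norm y \<le> r" using that by simp
      have "((\<lambda>u. (z, u)) has_derivative (\<lambda>k. (0, k))) (at y within cball 0 r)"
        by (auto intro!: derivative_eq_intros)
      from has_derivative_compose[OF this G_der[OF assms(1,2) y]]
      show ?thesis using linear_0[OF Gz_lin[OF assms(1,2) y]] by simp
    qed
    show "onorm (Gu s z y) \<le> 1 / 2" if "y \<in> cball 0 r" for y
      using Gu_bd[OF assms(1,2), of y] that by (intro onorm_le) auto
  qed (use assms in auto)
  then show ?thesis by simp
qed

lemma V_props: "continuous_on ({0..1} \<times> Om) (\<lambda>(t, z). V n t z) \<and>
    (\<forall>t\<in>{0..1}. \<forall>z\<in>Om. norm (V n t z) \<le> r)"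
proof (induction n)
  case 0
  then show ?case using r by (simp add: case_prod_unfold)
next
  case (Suc n)
  have c: "continuous_on ({0..1} \<times> Om) (\<lambda>(s, z). G s z (V n s z))"
    by (rule cont_comp[OF G_cont]) (use Suc in auto)
  show ?case using rint_continuous[OF c] rint_norm[OF c] G_bd Suc by simp
qed

lemma V_cont: "continuous_on ({0..1} \<times> Om) (\<lambda>(t, z). V n t z)"
  and V_ball: "t \<in> {0..1} \<Longrightarrow> z \<in> Om \<Longrightarrow> norm (V n t z) \<le> r"
  using V_props by blast+

lemma GV_cont: "continuous_on ({0..1} \<times> Om) (\<lambda>(s, z). G s z (V n s z))"
  by (rule cont_comp[OF G_cont V_cont V_ball])

text \<open>The bound \<open>2 * M\<close> is the fixed point of
  \<open>x \<mapsto> M + x / 2\<close>, which is the effect of one step of the iteration on a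
  bound.\<close>

lemma W_props: "(\<forall>v. continuous_on ({0..1} \<times> Om) (\<lambda>(t, z). W n t z v)) \<and>
    (\<forall>t\<in>{0..1}. \<forall>z\<in>Om. \<forall>v. norm (W n t z v) \<le> 2 * M * norm v)"
proof (induction n)
  case 0
  then show ?case using M by (simp add: case_prod_unfold)
next
  case (Suc n)
  have c: "continuous_on ({0..1} \<times> Om) (\<lambda>(s, z). Gz s z (V n s z) v + Gu s z (V n s z) (W n s z v))" for v
    using cont_comp[OF Gz_cont[of v] V_cont[of n] V_ball] Gu_cont_comp[OF V_cont[of n] V_ball, of "\<lambda>s z. W n s z v"] Suc
    by (auto simp: case_prod_unfold intro!: continuous_intros)
  have "norm (Gz s z (V n s z) v + Gu s z (V n s z) (W n s z v)) \<le> 2 * M * norm v"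
    if "s \<in> {0..1}" "z \<in> Om" for s z v
  proof -
    have "norm (Gz s z (V n s z) v + Gu s z (V n s z) (W n s z v)) \<le> M * norm v + norm (W n s z v) / 2"
      by (intro norm_triangle_mono Gz_bd Gu_bd V_ball that)
    also have "\<dots> \<le> M * norm v + (2 * M * norm v) / 2"
      by (intro add_left_mono divide_right_mono) (use Suc that in blast, simp)
    finally show ?thesis by simp
  qed
  then have "norm (W (Suc n) t z v) \<le> 2 * M * norm v" if "t \<in> {0..1}" "z \<in> Om" for t z v
    using rint_norm[OF c that] that by simp
  then show ?case using rint_continuous[OF c] by simp
qed

lemma W_cont: "continuous_on ({0..1} \<times> Om) (\<lambda>(t, z). W n t z v)"
  and W_bd: "t \<in> {0..1} \<Longrightarrow> z \<in> Om \<Longrightarrow> norm (W n t z v) \<le> 2 * M * norm v"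
  using W_props by blast+

lemma GW_cont: "continuous_on ({0..1} \<times> Om) (\<lambda>(s, z). Gz s z (V n s z) v + Gu s z (V n s z) (W n s z v))"
  using cont_comp[OF Gz_cont[of v] V_cont[of n] V_ball] Gu_cont_comp[OF V_cont[of n] V_ball W_cont[of n v]]
  by (auto simp: case_prod_unfold intro!: continuous_intros)

lemma V_der: "t \<in> {0..1} \<Longrightarrow> z \<in> Om \<Longrightarrow> (V n t has_derivative W n t z) (at z)"
proof (induction n arbitrary: t z)
  case (Suc n)
  have "(rint (\<lambda>s z. G s z (V n s z)) t has_derivative
      (\<lambda>v. rint (\<lambda>s z. Gz s z (V n s z) v + Gu s z (V n s z) (W n s z v)) t z)) (at z)"
  proof (rule rint_has_derivative[OF Om Suc.prems GV_cont _ GW_cont])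
    fix s z assume sz: "s \<in> {0..1::real}" "z \<in> Om"
    have "((\<lambda>z. (z, V n s z)) has_derivative (\<lambda>v. (v, W n s z v))) (at z)"
      using Suc.IH[OF sz] by (auto intro!: derivative_eq_intros)
    from has_derivative_compose[OF this G_der[OF sz V_ball[OF sz]]]
    show "((\<lambda>z. G s z (V n s z)) has_derivative
      (\<lambda>v. Gz s z (V n s z) v + Gu s z (V n s z) (W n s z v))) (at z)" by simp
  qed
  then show ?case by simp
qed simp

lemma V_step: "t \<in> {0..1} \<Longrightarrow> z \<in> Om \<Longrightarrow> norm (V (Suc n) t z - V n t z) \<le> r * (1/2) ^ n"
proof (induction n arbitrary: t z)
  case 0
  then show ?case using V_ball[OF 0, of "Suc 0"] by simp
next
  case (Suc n)
  have "V (Suc (Suc n)) t z - V (Suc n) t z = rint (\<lambda>s z. G s z (V (Suc n) s z) - G s z (V n s z)) t z"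
    using rint_diff[OF GV_cont GV_cont Suc.prems, of "Suc n" n] by simp
  also have "norm \<dots> \<le> r * (1/2) ^ Suc n"
  proof (rule rint_norm[OF _ Suc.prems])
    show "continuous_on ({0..1} \<times> Om) (\<lambda>(s, z). G s z (V (Suc n) s z) - G s z (V n s z))"
      using GV_cont[of n] GV_cont[of "Suc n"] by (auto simp del: V.simps simp: case_prod_unfold intro!: continuous_intros)
    fix s assume s: "s \<in> {0..1::real}"
    show "norm (G s z (V (Suc n) s z) - G s z (V n s z)) \<le> r * (1/2) ^ Suc n"
      using G_Lip[OF s Suc.prems(2) V_ball[OF s Suc.prems(2)] V_ball[OF s Suc.prems(2)], of "Suc n" n]
        Suc.IH[OF s Suc.prems(2)] by (simp del: V.simps)
  qed
  finally show ?case .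
qed

text \<open>A step halves the difference of successive \<open>W\<close>, but adds an error of the
  order of the difference of successive \<open>V\<close>, which is \<open>(1/2) ^ n\<close>. A bound
  with ratio 1/2 would acquire a factor \<open>n\<close>; the ratio 3/4 absorbs the error. The
  constant \<open>C\<close> in front of \<open>norm v\<close> must satisfy
  \<open>C / 2 + (M * r + 2 * M * M * r) \<le> 3 / 4 * C\<close>, and \<open>2 * M \<le> C\<close>
  for \<open>n = 0\<close>.\<close>

lemma W_step: "t \<in> {0..1} \<Longrightarrow> z \<in> Om \<Longrightarrow>
    norm (W (Suc n) t z v - W n t z v) \<le> (2 * M + 4 * (M * r + 2 * M * M * r)) * norm v * (3/4) ^ n"
proof (induction n arbitrary: t z)
  case 0
  have "2 * M \<le> 2 * M + 4 * (M * r + 2 * M * M * r)" using M r by simp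
  then have "2 * M * norm v \<le> (2 * M + 4 * (M * r + 2 * M * M * r)) * norm v"
    by (intro mult_right_mono) auto
  then show ?case using W_bd[OF 0, of "Suc 0" v] by simp
next
  case (Suc n)
  let ?C = "2 * M + 4 * (M * r + 2 * M * M * r)"
  have "W (Suc (Suc n)) t z v - W (Suc n) t z v =
      rint (\<lambda>s z. (Gz s z (V (Suc n) s z) v + Gu s z (V (Suc n) s z) (W (Suc n) s z v)) -
        (Gz s z (V n s z) v + Gu s z (V n s z) (W n s z v))) t z"
    using rint_diff[OF GW_cont GW_cont Suc.prems, of "Suc n" v n v] by simp
  also have "norm \<dots> \<le> ?C * norm v * (3/4) ^ Suc n"
  proof (rule rint_norm[OF _ Suc.prems])
    show "continuous_on ({0..1} \<times> Om) (\<lambda>(s, z). (Gz s z (V (Suc n) s z) v + Gu s z (V (Suc n) s z) (W (Suc n) s z v)) -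
        (Gz s z (V n s z) v + Gu s z (V n s z) (W n s z v)))"
      using continuous_on_diff[OF GW_cont[of "Suc n" v] GW_cont[of n v]]
      by (simp del: V.simps W.simps add: case_prod_unfold)
    fix s assume s: "s \<in> {0..1::real}"
    note b = V_ball[OF s Suc.prems(2)]
    define d where "d = norm (V (Suc n) s z - V n s z)"
    have d: "d \<le> r * (3/4) ^ n"
    proof -
      have "d \<le> r * (1/2) ^ n" unfolding d_def by (rule V_step[OF s Suc.prems(2)])
      also have "\<dots> \<le> r * (3/4) ^ n" using r by (intro mult_left_mono power_mono) auto
      finally show ?thesis .
    qed
    have 1: "norm (Gz s z (V (Suc n) s z) v - Gz s z (V n s z) v) \<le> M * d * norm v"
      unfolding d_def by (rule Gz_lip[OF s Suc.prems(2) b b])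
    have 2: "norm (Gu s z (V (Suc n) s z) (W n s z v) - Gu s z (V n s z) (W n s z v)) \<le> M * d * (2 * M * norm v)"
    proof -
      have "norm (Gu s z (V (Suc n) s z) (W n s z v) - Gu s z (V n s z) (W n s z v)) \<le> M * d * norm (W n s z v)"
        unfolding d_def by (rule Gu_lip[OF s Suc.prems(2) b b])
      also have "\<dots> \<le> M * d * (2 * M * norm v)"
        using M by (intro mult_left_mono W_bd s Suc.prems) (auto simp: d_def)
      finally show ?thesis .
    qed
    have 3: "norm (Gu s z (V (Suc n) s z) (W (Suc n) s z v - W n s z v)) \<le> (?C * norm v * (3/4) ^ n) / 2"
      using Gu_bd[OF s Suc.prems(2) b[of "Suc n"], of "W (Suc n) s z v - W n s z v"] Suc.IH[OF s Suc.prems(2)]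
      by (simp del: V.simps W.simps)
    have eq: "(Gz s z (V (Suc n) s z) v + Gu s z (V (Suc n) s z) (W (Suc n) s z v)) -
        (Gz s z (V n s z) v + Gu s z (V n s z) (W n s z v)) =
        (Gz s z (V (Suc n) s z) v - Gz s z (V n s z) v) +
        ((Gu s z (V (Suc n) s z) (W n s z v) - Gu s z (V n s z) (W n s z v)) +
        Gu s z (V (Suc n) s z) (W (Suc n) s z v - W n s z v))"
      using linear_diff[OF Gu_lin[OF s Suc.prems(2) b[of "Suc n"]]] by (simp del: V.simps W.simps)
    have "norm ((Gz s z (V (Suc n) s z) v + Gu s z (V (Suc n) s z) (W (Suc n) s z v)) -
        (Gz s z (V n s z) v + Gu s z (V n s z) (W n s z v))) \<le>
        M * d * norm v + (M * d * (2 * M * norm v) + (?C * norm v * (3/4) ^ n) / 2)"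
      unfolding eq by (intro norm_triangle_mono 1 2 3)
    also have "\<dots> = d * ((M + 2 * M * M) * norm v) + (?C * norm v * (3/4) ^ n) / 2"
      by (simp add: algebra_simps)
    also have "\<dots> \<le> (r * (3/4) ^ n) * ((M + 2 * M * M) * norm v) + (?C * norm v * (3/4) ^ n) / 2"
      using d M by (intro add_right_mono mult_right_mono) auto
    also have "\<dots> \<le> ?C * norm v * (3/4) ^ Suc n"
    proof -
      have "0 \<le> M * norm v * (3/4) ^ n" using M by simp
      then show ?thesis by (simp add: algebra_simps)
    qed
    finally show "norm ((Gz s z (V (Suc n) s z) v + Gu s z (V (Suc n) s z) (W (Suc n) s z v)) -
        (Gz s z (V n s z) v + Gu s z (V n s z) (W n s z v))) \<le> ?C * norm v * (3/4) ^ Suc n" .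
  qed
  finally show ?case .
qed

section \<open>The limits, their derivatives and their integral equations\<close>

definition "Vl t z = lim (\<lambda>n. V n t z)"
definition "Wl t z v = lim (\<lambda>n. W n t z v)"

lemma Vl: 
  assumes "t \<in> {0..1}" "z \<in> Om"
  shows "(\<lambda>n. V n t z) \<longlonglongrightarrow> Vl t z" "norm (V n t z - Vl t z) \<le> r * (1/2) ^ n / (1 - 1/2)"
proof -
  obtain l where l: "(\<lambda>n. V n t z) \<longlonglongrightarrow> l" "\<forall>n. norm (V n t z - l) \<le> r * (1/2) ^ n / (1 - 1/2)"
    using geometric_limit[of "1/2" "\<lambda>n. V n t z" r] V_step[OF assms] by fastforce
  have "Vl t z = l" unfolding Vl_def using l(1) by (rule limI)
  then show "(\<lambda>n. V n t z) \<longlonglongrightarrow> Vl t z" "norm (V n t z - Vl t z) \<le> r * (1/2) ^ n / (1 - 1/2)"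
    using l by auto
qed

lemma Wl: 
  assumes "t \<in> {0..1}" "z \<in> Om"
  shows "(\<lambda>n. W n t z v) \<longlonglongrightarrow> Wl t z v"
    "norm (W n t z v - Wl t z v) \<le> (2 * M + 4 * (M * r + 2 * M * M * r)) * norm v * (3/4) ^ n / (1 - 3/4)"
proof -
  let ?C = "(2 * M + 4 * (M * r + 2 * M * M * r)) * norm v"
  obtain l where l: "(\<lambda>n. W n t z v) \<longlonglongrightarrow> l" "\<forall>n. norm (W n t z v - l) \<le> ?C * (3/4) ^ n / (1 - 3/4)"
    using geometric_limit[of "3/4" "\<lambda>n. W n t z v" ?C] W_step[OF assms, of _ v] by fastforce
  have "Wl t z v = l" unfolding Wl_def using l(1) by (rule limI)
  then show "(\<lambda>n. W n t z v) \<longlonglongrightarrow> Wl t z v"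
    "norm (W n t z v - Wl t z v) \<le> ?C * (3/4) ^ n / (1 - 3/4)"
    using l by auto
qed

lemma geometric_eventually:
  assumes "0 \<le> q" "q < (1::real)" "e > 0"
  shows "\<forall>\<^sub>F n in sequentially. C * q ^ n / (1 - q) \<le> e"
proof -
  have "(\<lambda>n. C * q ^ n / (1 - q)) \<longlonglongrightarrow> C * 0 / (1 - q)"
    by (intro tendsto_intros LIMSEQ_power_zero) (use assms in auto)
  then have "\<forall>\<^sub>F n in sequentially. C * q ^ n / (1 - q) < e"
    using assms by (intro order_tendstoD(2)) auto
  then show ?thesis by (rule eventually_mono) auto
qed

lemma uniform_limit_geometric:
  fixes f :: "nat \<Rightarrow> 'c \<Rightarrow> 'd::real_normed_vector"
  assumes "0 \<le> q" "q < (1::real)" "\<And>n x. x \<in> S \<Longrightarrow> norm (f n x - l x) \<le> C * q ^ n / (1 - q)"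
  shows "uniform_limit S f l sequentially"
proof (rule uniform_limitI)
  fix e :: real assume "0 < e"
  then have "\<forall>\<^sub>F n in sequentially. C * q ^ n / (1 - q) \<le> e / 2" using assms by (intro geometric_eventually) auto
  then show "\<forall>\<^sub>F n in sequentially. \<forall>x\<in>S. dist (f n x) (l x) < e"
  proof (rule eventually_mono, intro ballI)
    fix n x assume "C * q ^ n / (1 - q) \<le> e / 2" "x \<in> S"
    then show "dist (f n x) (l x) < e" using assms(3)[of x n] \<open>0 < e\<close> unfolding dist_norm by linarith
  qed
qed

lemma Vl_cont: "continuous_on ({0..1} \<times> Om) (\<lambda>(t, z). Vl t z)"
proof (rule uniform_limit_theorem)
  show "\<forall>\<^sub>F n in sequentially. continuous_on ({0..1} \<times> Om) (\<lambda>(t, z). V n t z)"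
    using V_cont by simp
  show "uniform_limit ({0..1} \<times> Om) (\<lambda>n (t, z). V n t z) (\<lambda>(t, z). Vl t z) sequentially"
    by (rule uniform_limit_geometric[where q="1/2" and C=r]) (use Vl(2) in auto)
qed simp

lemma Wl_cont: "continuous_on ({0..1} \<times> Om) (\<lambda>(t, z). Wl t z v)"
proof (rule uniform_limit_theorem)
  show "\<forall>\<^sub>F n in sequentially. continuous_on ({0..1} \<times> Om) (\<lambda>(t, z). W n t z v)"
    using W_cont by simp
  show "uniform_limit ({0..1} \<times> Om) (\<lambda>n (t, z). W n t z v) (\<lambda>(t, z). Wl t z v) sequentially"
    by (rule uniform_limit_geometric[where q="3/4" and C="(2 * M + 4 * (M * r + 2 * M * M * r)) * norm v"])
      (use Wl(2)[of _ _ _ v] in auto)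
qed simp

lemma Vl_ball: "t \<in> {0..1} \<Longrightarrow> z \<in> Om \<Longrightarrow> norm (Vl t z) \<le> r"
  using Lim_bounded[OF tendsto_norm[OF Vl(1)], of t z 0 r] V_ball by auto

text \<open>The error bound for \<open>W\<close> is proportional to \<open>norm v\<close>. Hence the
  derivatives converge uniformly in operator norm, and the limit may be differentiated.\<close>

lemma Vl_der:
  assumes "t \<in> {0..1}" "z \<in> Om" shows "(Vl t has_derivative Wl t z) (at z)"
proof -
  let ?C = "2 * M + 4 * (M * r + 2 * M * M * r)"
  have "\<exists>g. \<forall>x\<in>Om. (\<lambda>n. V n t x) \<longlonglongrightarrow> g x \<and> (g has_derivative Wl t x) (at x within Om)"
  proof (rule has_derivative_sequence[where f'="\<lambda>n. W n t" and ?x0.0=z and l="Vl t z"])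
    show "(V n t has_derivative W n t x) (at x within Om)" if "x \<in> Om" for n x
      using V_der[OF assms(1) that] has_derivative_at_withinI by blast
    show "\<forall>\<^sub>F n in sequentially. \<forall>x\<in>Om. \<forall>h. norm (W n t x h - Wl t x h) \<le> e * norm h" if "e > 0" for e
    proof -
      have "\<forall>\<^sub>F n in sequentially. ?C * (3/4) ^ n / (1 - 3/4) \<le> e"
        using that by (intro geometric_eventually) auto
      then show ?thesis
      proof (rule eventually_mono, intro ballI allI)
        fix n x h assume *: "?C * (3/4) ^ n / (1 - 3/4) \<le> e" "x \<in> Om"
        have "norm (W n t x h - Wl t x h) \<le> ?C * norm h * (3/4) ^ n / (1 - 3/4)"
          by (rule Wl(2)[OF assms(1) *(2)])
        also have "\<dots> = (?C * (3/4) ^ n / (1 - 3/4)) * norm h" by simp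
        also have "\<dots> \<le> e * norm h" by (rule mult_right_mono[OF *(1)]) simp
        finally show "norm (W n t x h - Wl t x h) \<le> e * norm h" .
      qed
    qed
  qed (use Om assms Vl(1) in auto)
  then obtain g where g: "\<And>x. x \<in> Om \<Longrightarrow> (\<lambda>n. V n t x) \<longlonglongrightarrow> g x"
    "\<And>x. x \<in> Om \<Longrightarrow> (g has_derivative Wl t x) (at x within Om)" by blast
  have "g x = Vl t x" if "x \<in> Om" for x
    using LIMSEQ_unique[OF g(1)[OF that] Vl(1)[OF assms(1) that]] .
  moreover have "(g has_derivative Wl t z) (at z)"
    using g(2)[OF assms(2)] at_within_open[OF assms(2) Om(1)] by simp
  ultimately show ?thesis
    using has_derivative_transform_within_open[OF _ Om(1) assms(2)] by blast
qed

lemma Vl_eq: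
  assumes "t \<in> {0..1}" "z \<in> Om" shows "Vl t z = rint (\<lambda>s z. G s z (Vl s z)) t z"
proof -
  have c: "continuous_on ({0..1} \<times> Om) (\<lambda>(s, z). G s z (Vl s z))"
    by (rule cont_comp[OF G_cont Vl_cont Vl_ball])
  have "norm (V (Suc n) t z - rint (\<lambda>s z. G s z (Vl s z)) t z) \<le> r * (1/2) ^ n / (1 - 1/2)" for n
  proof -
    have "V (Suc n) t z - rint (\<lambda>s z. G s z (Vl s z)) t z = rint (\<lambda>s z. G s z (V n s z) - G s z (Vl s z)) t z"
      using rint_diff[OF GV_cont c assms, of n] by simp
    also have "norm \<dots> \<le> r * (1/2) ^ n / (1 - 1/2)"
    proof (rule rint_norm[OF _ assms])
      show "continuous_on ({0..1} \<times> Om) (\<lambda>(s, z). G s z (V n s z) - G s z (Vl s z))"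
        using continuous_on_diff[OF GV_cont[of n] c] by (simp add: case_prod_unfold)
      fix s assume s: "s \<in> {0..1::real}"
      show "norm (G s z (V n s z) - G s z (Vl s z)) \<le> r * (1/2) ^ n / (1 - 1/2)"
        using G_Lip[OF s assms(2) V_ball[OF s assms(2)] Vl_ball[OF s assms(2)], of n] Vl(2)[OF s assms(2), of n]
          norm_ge_zero[of "V n s z - Vl s z"] by linarith
    qed
    finally show ?thesis .
  qed
  note bound = this
  have lim: "(\<lambda>n. r * (1/2) ^ n / (1 - 1/2)) \<longlonglongrightarrow> r * 0 / (1 - 1/2)"
    by (intro tendsto_intros LIMSEQ_power_zero) auto
  have "(\<lambda>n. V (Suc n) t z - rint (\<lambda>s z. G s z (Vl s z)) t z) \<longlonglongrightarrow> 0"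
  proof (rule Lim_null_comparison)
    show "\<forall>\<^sub>F n in sequentially. norm (V (Suc n) t z - rint (\<lambda>s z. G s z (Vl s z)) t z) \<le> r * (1/2) ^ n / (1 - 1/2)"
      by (intro always_eventually allI bound)
  qed (use lim in simp)
  then have "(\<lambda>n. V (Suc n) t z) \<longlonglongrightarrow> rint (\<lambda>s z. G s z (Vl s z)) t z"
    by (rule LIM_zero_cancel)
  moreover have "(\<lambda>n. V (Suc n) t z) \<longlonglongrightarrow> Vl t z"
    using LIMSEQ_Suc[OF Vl(1)[OF assms]] .
  ultimately show ?thesis using LIMSEQ_unique by blast
qed

lemma Wl_eq:
  assumes "t \<in> {0..1}" "z \<in> Om"
  shows "Wl t z v = rint (\<lambda>s z. Gz s z (Vl s z) v + Gu s z (Vl s z) (Wl s z v)) t z"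
proof -
  let ?I = "\<lambda>s z. Gz s z (Vl s z) v + Gu s z (Vl s z) (Wl s z v)"
  let ?C = "2 * M + 4 * (M * r + 2 * M * M * r)"
  \<comment> \<open>The first two summands come from the distance of \<open>V n\<close> to its
    limit, at most \<open>2 * r * (3/4) ^ n\<close>; the third bounds the contribution of the
    distance of \<open>W n\<close> to its limit.\<close>
  let ?K = "(2 * M * r + 4 * M * M * r + 4 * ?C) * norm v"
  have c: "continuous_on ({0..1} \<times> Om) (\<lambda>(s, z). ?I s z)"
    using cont_comp[OF Gz_cont[of v] Vl_cont Vl_ball] Gu_cont_comp[OF Vl_cont Vl_ball Wl_cont[of v]]
    by (auto simp: case_prod_unfold intro!: continuous_intros)
  have "norm (W (Suc n) t z v - rint ?I t z) \<le> ?K * (3/4) ^ n" for n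
  proof -
    have "W (Suc n) t z v - rint ?I t z =
        rint (\<lambda>s z. (Gz s z (V n s z) v + Gu s z (V n s z) (W n s z v)) - ?I s z) t z"
      using rint_diff[OF GW_cont c assms, of n v] by simp
    also have "norm \<dots> \<le> ?K * (3/4) ^ n"
    proof (rule rint_norm[OF _ assms])
      show "continuous_on ({0..1} \<times> Om) (\<lambda>(s, z). (Gz s z (V n s z) v + Gu s z (V n s z) (W n s z v)) - ?I s z)"
        using continuous_on_diff[OF GW_cont[of n v] c] by (simp add: case_prod_unfold)
      fix s assume s: "s \<in> {0..1::real}"
      note b = V_ball[OF s assms(2), of n] Vl_ball[OF s assms(2)]
      define d where "d = norm (V n s z - Vl s z)"
      have d: "d \<le> 2 * r * (3/4) ^ n"
      proof -
        have "d \<le> 2 * r * (1/2) ^ n" unfolding d_def using Vl(2)[OF s assms(2), of n] by simp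
        also have "\<dots> \<le> 2 * r * (3/4) ^ n" using r by (intro mult_left_mono power_mono) auto
        finally show ?thesis .
      qed
      have 1: "norm (Gz s z (V n s z) v - Gz s z (Vl s z) v) \<le> M * d * norm v"
        unfolding d_def by (rule Gz_lip[OF s assms(2) b])
      have 2: "norm (Gu s z (V n s z) (W n s z v) - Gu s z (Vl s z) (W n s z v)) \<le> M * d * (2 * M * norm v)"
      proof -
        have "norm (Gu s z (V n s z) (W n s z v) - Gu s z (Vl s z) (W n s z v)) \<le> M * d * norm (W n s z v)"
          unfolding d_def by (rule Gu_lip[OF s assms(2) b])
        also have "\<dots> \<le> M * d * (2 * M * norm v)"
          using M by (intro mult_left_mono W_bd s assms) (auto simp: d_def)
        finally show ?thesis .
      qed
      have 3: "norm (Gu s z (Vl s z) (W n s z v - Wl s z v)) \<le> (?C * norm v * (3/4) ^ n / (1 - 3/4)) / 2"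
        by (rule order_trans[OF Gu_bd[OF s assms(2) b(2)]])
          (intro divide_right_mono Wl(2) s assms, simp)
      have eq: "(Gz s z (V n s z) v + Gu s z (V n s z) (W n s z v)) - ?I s z =
        (Gz s z (V n s z) v - Gz s z (Vl s z) v) +
        ((Gu s z (V n s z) (W n s z v) - Gu s z (Vl s z) (W n s z v)) + Gu s z (Vl s z) (W n s z v - Wl s z v))"
        using linear_diff[OF Gu_lin[OF s assms(2) b(2)]] by simp
      have "norm ((Gz s z (V n s z) v + Gu s z (V n s z) (W n s z v)) - ?I s z) \<le>
          M * d * norm v + (M * d * (2 * M * norm v) + (?C * norm v * (3/4) ^ n / (1 - 3/4)) / 2)"
        unfolding eq by (intro norm_triangle_mono 1 2 3)
      also have "\<dots> = d * ((M + 2 * M * M) * norm v) + 2 * (?C * norm v * (3/4) ^ n)"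
        by (simp add: algebra_simps)
      also have "\<dots> \<le> (2 * r * (3/4) ^ n) * ((M + 2 * M * M) * norm v) + 2 * (?C * norm v * (3/4) ^ n)"
        using d M by (intro add_right_mono mult_right_mono) auto
      also have "\<dots> \<le> (2 * r * (3/4) ^ n) * ((M + 2 * M * M) * norm v) + 4 * (?C * norm v * (3/4) ^ n)"
        using M r by (intro add_left_mono mult_right_mono) auto
      also have "\<dots> = ?K * (3/4) ^ n" by (simp add: algebra_simps)
      finally show "norm ((Gz s z (V n s z) v + Gu s z (V n s z) (W n s z v)) - ?I s z) \<le> ?K * (3/4) ^ n" .
    qed
    finally show ?thesis .
  qed
  note bound = this
  have lim: "(\<lambda>n. ?K * (3/4) ^ n) \<longlonglongrightarrow> ?K * 0"
    by (intro tendsto_intros LIMSEQ_power_zero) auto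
  have "(\<lambda>n. W (Suc n) t z v - rint ?I t z) \<longlonglongrightarrow> 0"
  proof (rule Lim_null_comparison)
    show "\<forall>\<^sub>F n in sequentially. norm (W (Suc n) t z v - rint ?I t z) \<le> ?K * (3/4) ^ n"
      by (intro always_eventually allI bound)
  qed (use lim in simp)
  then have "(\<lambda>n. W (Suc n) t z v) \<longlonglongrightarrow> rint ?I t z"
    by (rule LIM_zero_cancel)
  moreover have "(\<lambda>n. W (Suc n) t z v) \<longlonglongrightarrow> Wl t z v"
    using LIMSEQ_Suc[OF Wl(1)[OF assms]] .
  ultimately show ?thesis using LIMSEQ_unique by blast
qed

end

section \<open>Flows of smooth vector fields\<close>

text \<open>At a time where the difference of the two solutions is largest, its norm is at most half
  of itself.\<close>

lemma rint_fixpoint_unique: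
  fixes f1 f2 F1 F2 :: "real \<Rightarrow> 'z::topological_space \<Rightarrow> 'u::banach"
  assumes c: "continuous_on ({0..1} \<times> S) (\<lambda>(s, z). f1 s z)" "continuous_on ({0..1} \<times> S) (\<lambda>(s, z). f2 s z)"
    and C: "continuous_on ({0..1} \<times> S) (\<lambda>(s, z). F1 s z)" "continuous_on ({0..1} \<times> S) (\<lambda>(s, z). F2 s z)"
    and z: "z \<in> S"
    and e: "\<And>t. t \<in> {0..1} \<Longrightarrow> f1 t z = rint F1 t z" "\<And>t. t \<in> {0..1} \<Longrightarrow> f2 t z = rint F2 t z"
    and l: "\<And>t. t \<in> {0..1} \<Longrightarrow> norm (F1 t z - F2 t z) \<le> norm (f1 t z - f2 t z) / 2"
    and t: "t \<in> {0..1}"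
  shows "f1 t z = f2 t z"
proof -
  have "continuous_on {0..1} (\<lambda>s. norm (f1 s z - f2 s z))"
    using continuous_on_curried[OF c(1), of "{0..1}" "\<lambda>s. s" "\<lambda>_. z"]
      continuous_on_curried[OF c(2), of "{0..1}" "\<lambda>s. s" "\<lambda>_. z"] z
    by (intro continuous_intros) auto
  then obtain t0 where t0: "t0 \<in> {0..1}" "\<And>s. s \<in> {0..1} \<Longrightarrow> norm (f1 s z - f2 s z) \<le> norm (f1 t0 z - f2 t0 z)"
    using continuous_attains_sup[of "{0..1::real}" "\<lambda>s. norm (f1 s z - f2 s z)"] by auto
  have "f1 t0 z - f2 t0 z = rint (\<lambda>s z. F1 s z - F2 s z) t0 z"
    using rint_diff[OF C t0(1) z] e t0(1) by simp
  also have "norm \<dots> \<le> norm (f1 t0 z - f2 t0 z) / 2"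
  proof (rule rint_norm[OF _ t0(1) z])
    show "continuous_on ({0..1} \<times> S) (\<lambda>(s, z). F1 s z - F2 s z)"
      using continuous_on_diff[OF C] by (simp add: case_prod_unfold)
    show "norm (F1 s z - F2 s z) \<le> norm (f1 t0 z - f2 t0 z) / 2" if "s \<in> {0..1}" for s
      using l[OF that] t0(2)[OF that] by linarith
  qed
  finally have "norm (f1 t0 z - f2 t0 z) \<le> 0" by simp
  then have "norm (f1 t z - f2 t z) \<le> 0" using t0(2)[OF t] by linarith
  then show ?thesis by simp
qed

lemma continuous_family_bounded:
  fixes f :: "'q::topological_space \<Rightarrow> 'b::real_normed_vector"
  assumes "compact Q" "continuous_on Q f" shows "\<exists>M\<ge>0. \<forall>q\<in>Q. norm (f q) \<le> M"
proof -
  have "bounded (f ` Q)" using compact_continuous_image[OF assms(2,1)] compact_imp_bounded by blast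
  then obtain M where "\<forall>x\<in>f ` Q. norm x \<le> M" unfolding bounded_iff by blast
  then show ?thesis by (intro exI[of _ "max M 0"]) auto
qed

lemma linear_family_bounded:
  fixes L :: "'q::topological_space \<Rightarrow> 'a::euclidean_space \<Rightarrow> 'b::real_normed_vector"
  assumes "compact Q" "\<And>q. q \<in> Q \<Longrightarrow> linear (L q)" "\<And>b. continuous_on Q (\<lambda>q. L q b)"
  shows "\<exists>M\<ge>0. \<forall>q\<in>Q. \<forall>h. norm (L q h) \<le> M * norm h"
proof -
  have "\<forall>b. \<exists>M\<ge>0. \<forall>q\<in>Q. norm (L q b) \<le> M"
    using continuous_family_bounded[OF assms(1,3)] by blast
  then obtain m where m: "\<And>b. 0 \<le> m b" "\<And>q b. q \<in> Q \<Longrightarrow> norm (L q b) \<le> m b" by metis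
  have "norm (L q h) \<le> (\<Sum>b\<in>Basis. m b) * norm h" if "q \<in> Q" for q h
  proof -
    have "L q h = (\<Sum>b\<in>Basis. (h \<bullet> b) *\<^sub>R L q b)" by (rule euclidean_linear_sum[OF assms(2)[OF that]])
    also have "norm \<dots> \<le> (\<Sum>b\<in>Basis. norm h * m b)"
      by (intro sum_norm_le) (auto intro!: mult_mono m that simp: Basis_le_norm)
    finally show ?thesis by (simp add: sum_distrib_left mult.commute)
  qed
  then show ?thesis using m by (intro exI[of _ "\<Sum>b\<in>Basis. m b"]) (auto intro: sum_nonneg)
qed

lemma linear_family_bounded_curried:
  fixes L :: "'p::topological_space \<Rightarrow> 'q::topological_space \<Rightarrow> 'a::euclidean_space \<Rightarrow> 'b::real_normed_vector"
  assumes "compact Q" "\<And>s z. (s, z) \<in> Q \<Longrightarrow> linear (L s z)" "\<And>b. continuous_on Q (\<lambda>(s, z). L s z b)"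
  shows "\<exists>M\<ge>0. \<forall>s z h. (s, z) \<in> Q \<longrightarrow> norm (L s z h) \<le> M * norm h"
proof -
  have "\<exists>M\<ge>0. \<forall>q\<in>Q. \<forall>h. norm (L (fst q) (snd q) h) \<le> M * norm h"
  proof (rule linear_family_bounded[OF assms(1)])
    show "linear (L (fst q) (snd q))" if "q \<in> Q" for q using assms(2)[of "fst q" "snd q"] that by simp
    show "continuous_on Q (\<lambda>q. L (fst q) (snd q) b)" for b using assms(3)[of b] by (simp add: case_prod_unfold)
  qed
  then show ?thesis by (metis fst_conv snd_conv)
qed

text \<open>\<open>picard\<close> yields a differentiable solution, and uniqueness identifies it
  with the given \<open>W\<close>. The statement is local because \<open>picard\<close> wants a
  convex parameter set and uniform bounds, which a small ball with compact closure provides. The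
  derivative in direction \<open>v\<close> solves an equation with the same \<open>B\<close> and a
  new inhomogeneous term.\<close>

lemma linear_ode_local:
  fixes c :: "real \<Rightarrow> 'z::euclidean_space \<Rightarrow> 'u::euclidean_space" and B :: "real \<Rightarrow> 'z \<Rightarrow> 'u \<Rightarrow> 'u"
  assumes Om: "open Om" and z0: "z0 \<in> Om"
    and lin: "\<And>s z. s \<in> {0..1} \<Longrightarrow> z \<in> Om \<Longrightarrow> linear (B s z)"
    and bd: "\<And>s z u. s \<in> {0..1} \<Longrightarrow> z \<in> Om \<Longrightarrow> norm (B s z u) \<le> norm u / 2"
    and cB: "\<And>u. continuous_on ({0..1} \<times> Om) (\<lambda>(s, z). B s z u)"
    and cc: "continuous_on ({0..1} \<times> Om) (\<lambda>(s, z). c s z)"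
    and dB: "\<And>s z u. s \<in> {0..1} \<Longrightarrow> z \<in> Om \<Longrightarrow> ((\<lambda>z. B s z u) has_derivative D s z u) (at z)"
    and dc: "\<And>s z. s \<in> {0..1} \<Longrightarrow> z \<in> Om \<Longrightarrow> (c s has_derivative c' s z) (at z)"
    and cD: "\<And>u v. continuous_on ({0..1} \<times> Om) (\<lambda>(s, z). D s z u v)"
    and cc': "\<And>v. continuous_on ({0..1} \<times> Om) (\<lambda>(s, z). c' s z v)"
    and W: "continuous_on ({0..1} \<times> Om) (\<lambda>(s, z). W s z)"
    and eq: "\<And>t z. t \<in> {0..1} \<Longrightarrow> z \<in> Om \<Longrightarrow> W t z = rint (\<lambda>s z. c s z + B s z (W s z)) t z"
  shows "\<exists>U W'. open U \<and> z0 \<in> U \<and> U \<subseteq> Om \<and>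
    (\<forall>t\<in>{0..1}. \<forall>z\<in>U. (W t has_derivative W' t z) (at z)) \<and>
    (\<forall>v. continuous_on ({0..1} \<times> U) (\<lambda>(t, z). W' t z v)) \<and>
    (\<forall>v. \<forall>t\<in>{0..1}. \<forall>z\<in>U. W' t z v =
      rint (\<lambda>s z. (c' s z v + (\<Sum>b\<in>Basis. (W s z \<bullet> b) *\<^sub>R D s z b v)) + B s z (W' s z v)) t z)"
proof -
  obtain e where e: "e > 0" "cball z0 e \<subseteq> Om" using Om z0 open_contains_cball by blast
  define U where "U = ball z0 e"
  define Q where "Q = {0..1::real} \<times> cball z0 e"
  have Q: "compact Q" "Q \<subseteq> {0..1} \<times> Om" unfolding Q_def using e by (auto intro: compact_Times)
  have U: "open U" "convex U" "z0 \<in> U" "U \<subseteq> Om" using e by (auto simp: U_def)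
  have UQ: "(s, z) \<in> Q" if "s \<in> {0..1}" "z \<in> U" for s z using that by (auto simp: U_def Q_def)
  obtain C where C: "C \<ge> 0" "\<And>s z. (s, z) \<in> Q \<Longrightarrow> norm (c s z) \<le> C"
    using continuous_family_bounded[OF Q(1) continuous_on_subset[OF cc Q(2)]] by fastforce
  have Dlin: "linear (D s z b)" and c'lin: "linear (c' s z)" if "s \<in> {0..1}" "z \<in> Om" for s z b
    using dB[OF that] dc[OF that] has_derivative_linear by blast+
  have QD: "s \<in> {0..1}" "z \<in> Om" if "(s, z) \<in> Q" for s z using Q(2) that by auto
  have "\<exists>M\<ge>0. \<forall>s z h. (s, z) \<in> Q \<longrightarrow> norm (c' s z h) \<le> M * norm h"
  proof (rule linear_family_bounded_curried[OF Q(1)])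
    show "linear (c' s z)" if "(s, z) \<in> Q" for s z by (rule c'lin[OF QD[OF that]])
    show "continuous_on Q (\<lambda>(s, z). c' s z b)" for b by (rule continuous_on_subset[OF cc' Q(2)])
  qed
  then obtain M1 where M1: "M1 \<ge> 0" "\<And>s z h. (s, z) \<in> Q \<Longrightarrow> norm (c' s z h) \<le> M1 * norm h" by blast
  have "\<exists>M\<ge>0. \<forall>s z h. (s, z) \<in> Q \<longrightarrow> norm (D s z b h) \<le> M * norm h" for b
  proof (rule linear_family_bounded_curried[OF Q(1)])
    show "linear (D s z b)" if "(s, z) \<in> Q" for s z by (rule Dlin[OF QD[OF that]])
    show "continuous_on Q (\<lambda>(s, z). D s z b v)" for v by (rule continuous_on_subset[OF cD Q(2)])
  qed
  then obtain m where m: "\<And>b. 0 \<le> m b" "\<And>b s z h. (s, z) \<in> Q \<Longrightarrow> norm (D s z b h) \<le> m b * norm h" by metis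
  define D' where "D' s z u v = (\<Sum>b\<in>Basis. (u \<bullet> b) *\<^sub>R D s z b v)" for s z u v
  define M2 where "M2 = (\<Sum>b\<in>(Basis::'u set). m b)"
  have M2: "M2 \<ge> 0" unfolding M2_def by (rule sum_nonneg) (use m in auto)
  have D'_bd: "norm (D' s z u h) \<le> M2 * norm u * norm h" if "(s, z) \<in> Q" for s z u h
  proof -
    have "norm (D' s z u h) \<le> (\<Sum>b\<in>Basis. norm u * (m b * norm h))"
      unfolding D'_def by (intro sum_norm_le) (auto intro!: mult_mono m that simp: Basis_le_norm)
    also have "\<dots> = M2 * norm u * norm h" by (simp add: M2_def sum_distrib_left sum_distrib_right mult_ac)
    finally show ?thesis .
  qed
  have D'_diff: "D' s z u h - D' s z u' h = D' s z (u - u') h" for s z u u' h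
    by (simp add: D'_def inner_diff_left scaleR_diff_left sum_subtractf)
  \<comment> \<open>For \<open>norm u \<le> r\<close> this makes
    \<open>norm (G s z u) \<le> C + r / 2 \<le> r\<close>.\<close>
  define r where "r = 2 * C + 1"
  define M where "M = M1 + M2 * r + M2"
  have rM: "r \<ge> 0" "M \<ge> 0" "M2 \<le> M" using C M1 M2 by (auto simp: r_def M_def)
  \<comment> \<open>\<open>B s z u\<close> is known to be differentiable in \<open>z\<close> only
    for fixed \<open>u\<close>. In the expanded form the joint derivative in \<open>(z, u)\<close>
    is the product rule.\<close>
  define G where "G s z u = c s z + (\<Sum>b\<in>Basis. (u \<bullet> b) *\<^sub>R B s z b)" for s z u
  have GB: "G s z u = c s z + B s z u" if "s \<in> {0..1}" "z \<in> Om" for s z u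
    unfolding G_def using euclidean_linear_sum[OF lin[OF that]] by metis
  have proj: "continuous_on ({0..1} \<times> (U \<times> cball 0 r)) (\<lambda>p. f (fst p) (fst (snd p)))"
    if "continuous_on ({0..1} \<times> Om) (\<lambda>(s, z). f s z)" for f :: "real \<Rightarrow> 'z \<Rightarrow> 'u"
    by (rule continuous_on_curried[OF that]) (use U in \<open>auto intro!: continuous_intros\<close>)
  interpret picard U r M G "\<lambda>s z u h. c' s z h + D' s z u h" "\<lambda>s z u. B s z"
  proof (rule picard.intro)
    fix s z assume sz: "s \<in> {0..1::real}" "z \<in> U"
    then have sz': "z \<in> Om" "(s, z) \<in> Q" using U UQ by auto
    fix u :: 'u and h k assume u: "norm u \<le> r"
    show "linear (\<lambda>h. c' s z h + D' s z u h)" unfolding D'_def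
      using Dlin[OF sz(1) sz'(1)] c'lin[OF sz(1) sz'(1)]
      by (intro linear_compose_add linear_compose_sum ballI linear_compose_scale_right) auto
    show "((\<lambda>(z, u). G s z u) has_derivative (\<lambda>(h, k). c' s z h + D' s z u h + B s z k)) (at (z, u))"
    proof -
      have f: "((\<lambda>p. fst p) has_derivative (\<lambda>h. fst h)) (at (z, u))" by (auto intro!: derivative_eq_intros)
      have 1: "((\<lambda>p. c s (fst p)) has_derivative (\<lambda>h. c' s z (fst h))) (at (z, u))"
        by (rule has_derivative_compose[OF f]) (use dc[OF sz(1) sz'(1)] in simp)
      have 2: "((\<lambda>p. B s (fst p) b) has_derivative (\<lambda>h. D s z b (fst h))) (at (z, u))" for b
        by (rule has_derivative_compose[OF f]) (use dB[OF sz(1) sz'(1)] in simp)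
      have "((\<lambda>p. c s (fst p) + (\<Sum>b\<in>Basis. (snd p \<bullet> b) *\<^sub>R B s (fst p) b)) has_derivative
        (\<lambda>h. c' s z (fst h) + (\<Sum>b\<in>Basis. (u \<bullet> b) *\<^sub>R D s z b (fst h) + (snd h \<bullet> b) *\<^sub>R B s z b))) (at (z, u))"
        by (auto intro!: derivative_eq_intros 1 2)
      moreover have "(\<lambda>h. c' s z (fst h) + (\<Sum>b\<in>Basis. (u \<bullet> b) *\<^sub>R D s z b (fst h) + (snd h \<bullet> b) *\<^sub>R B s z b)) =
        (\<lambda>(h, k). c' s z h + D' s z u h + B s z k)"
      proof
        fix p :: "'z \<times> 'u"
        show "c' s z (fst p) + (\<Sum>b\<in>Basis. (u \<bullet> b) *\<^sub>R D s z b (fst p) + (snd p \<bullet> b) *\<^sub>R B s z b) =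
          (case p of (h, k) \<Rightarrow> c' s z h + D' s z u h + B s z k)"
          using euclidean_linear_sum[OF lin[OF sz(1) sz'(1)], of "snd p"]
          by (simp add: case_prod_unfold D'_def sum.distrib)
      qed
      ultimately show ?thesis by (simp add: G_def case_prod_unfold)
    qed
    show "norm (G s z u) \<le> r"
    proof -
      have "norm (G s z u) \<le> C + norm u / 2"
        unfolding GB[OF sz(1) sz'(1)] by (intro norm_triangle_mono C bd sz sz')
      then show ?thesis using u C by (simp add: r_def)
    qed
    show "norm (c' s z h + D' s z u h) \<le> M * norm h"
    proof -
      have "norm (c' s z h + D' s z u h) \<le> M1 * norm h + M2 * norm u * norm h"
        by (intro norm_triangle_mono M1 D'_bd sz')
      also have "\<dots> \<le> M1 * norm h + M2 * r * norm h"
        using M2 u by (intro add_left_mono mult_right_mono mult_left_mono) auto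
      also have "\<dots> \<le> M * norm h" using M2 by (simp add: M_def algebra_simps)
      finally show ?thesis .
    qed
    fix u' :: 'u
    show "norm (c' s z h + D' s z u h - (c' s z h + D' s z u' h)) \<le> M * norm (u - u') * norm h"
    proof -
      have "norm (c' s z h + D' s z u h - (c' s z h + D' s z u' h)) \<le> M2 * norm (u - u') * norm h"
        using D'_bd[OF sz'(2), of "u - u'" h] D'_diff[of s z u h u'] by simp
      also have "\<dots> \<le> M * norm (u - u') * norm h" using rM by (intro mult_right_mono) auto
      finally show ?thesis .
    qed
  next
    show "continuous_on ({0..1} \<times> U \<times> cball 0 r) (\<lambda>(s, z, u). G s z u)"
      unfolding G_def case_prod_unfold
      by (intro continuous_intros proj[OF cc] proj[OF cB])
    show "continuous_on ({0..1} \<times> U \<times> cball 0 r) (\<lambda>(s, z, u). c' s z h + D' s z u h)" for h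
      unfolding D'_def case_prod_unfold
      by (intro continuous_intros proj[OF cc'] proj[OF cD])
    show "continuous_on ({0..1} \<times> U \<times> cball 0 r) (\<lambda>(s, z, u). B s z k)" for k
      unfolding case_prod_unfold by (rule proj[OF cB])
  qed (use U rM lin bd in auto)
  have WVl: "W t z = Vl t z" if "t \<in> {0..1}" "z \<in> U" for t z
  proof (rule rint_fixpoint_unique[where S=U and ?F1.0="\<lambda>s z. c s z + B s z (W s z)" and ?F2.0="\<lambda>s z. G s z (Vl s z)"])
    show "continuous_on ({0..1} \<times> U) (\<lambda>(s, z). W s z)"
      by (rule continuous_on_subset[OF W]) (use U in auto)
    show "continuous_on ({0..1} \<times> U) (\<lambda>(s, z). G s z (Vl s z))"
      by (rule cont_comp[OF G_cont Vl_cont Vl_ball])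
    have "continuous_on ({0..1} \<times> U) (\<lambda>p. c (fst p) (snd p) + (\<Sum>b\<in>Basis. (W (fst p) (snd p) \<bullet> b) *\<^sub>R B (fst p) (snd p) b))"
      using continuous_on_subset[OF W, of "{0..1} \<times> U"] continuous_on_subset[OF cc, of "{0..1} \<times> U"]
        continuous_on_subset[OF cB, of "{0..1} \<times> U"] U
      by (intro continuous_intros) (auto simp: case_prod_unfold)
    then show "continuous_on ({0..1} \<times> U) (\<lambda>(s, z). c s z + B s z (W s z))"
    proof (rule continuous_on_eq)
      fix p :: "real \<times> 'z" assume "p \<in> {0..1} \<times> U"
      then show "c (fst p) (snd p) + (\<Sum>b\<in>Basis. (W (fst p) (snd p) \<bullet> b) *\<^sub>R B (fst p) (snd p) b) =
          (case p of (s, z) \<Rightarrow> c s z + B s z (W s z))"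
        using euclidean_linear_sum[OF lin, of "fst p" "snd p" "W (fst p) (snd p)"] U
        by (auto simp: case_prod_unfold)
    qed
    show "W t z = rint (\<lambda>s z. c s z + B s z (W s z)) t z" if "t \<in> {0..1}" for t
      by (rule eq) (use that \<open>z \<in> U\<close> U in auto)
    show "Vl t z = rint (\<lambda>s z. G s z (Vl s z)) t z" if "t \<in> {0..1}" for t
      by (rule Vl_eq[OF that \<open>z \<in> U\<close>])
    show "norm (c t z + B t z (W t z) - G t z (Vl t z)) \<le> norm (W t z - Vl t z) / 2" if t: "t \<in> {0..1}" for t
    proof -
      have z: "z \<in> Om" using U \<open>z \<in> U\<close> by auto
      have "c t z + B t z (W t z) - G t z (Vl t z) = B t z (W t z - Vl t z)"
        using GB[OF t z] linear_diff[OF lin[OF t z]] by simp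
      then show ?thesis using bd[OF t z] by simp
    qed
  qed (use that Vl_cont in auto)
  show ?thesis
  proof (intro exI[of _ U] exI[of _ Wl] conjI ballI allI)
    fix t z assume tz: "t \<in> {0..1::real}" "z \<in> U"
    show "(W t has_derivative Wl t z) (at z)"
      by (rule has_derivative_transform_within_open[OF Vl_der[OF tz] U(1) tz(2)]) (use WVl tz in auto)
    show "Wl t z v = rint (\<lambda>s z. (c' s z v + (\<Sum>b\<in>Basis. (W s z \<bullet> b) *\<^sub>R D s z b v)) + B s z (Wl s z v)) t z" for v
      unfolding Wl_eq[OF tz, of v]
      by (rule rint_cong[OF _ tz(1)]) (use WVl[OF _ tz(2)] in \<open>auto simp: D'_def\<close>)
  qed (use U Wl_cont in auto)
qed

text \<open>The induction keeps \<open>c\<close> and \<open>W\<close> general: the derivative of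
  \<open>W\<close> in a fixed direction solves an equation of the same form. Its inhomogeneous term
  involves \<open>W\<close>, which is of class \<open>k\<close> by the induction hypothesis, so the
  hypothesis applies again to the derivative.\<close>

lemma linear_ode_Ck:
  fixes c :: "real \<Rightarrow> 'z::euclidean_space \<Rightarrow> 'u::euclidean_space" and B :: "real \<Rightarrow> 'z \<Rightarrow> 'u \<Rightarrow> 'u"
  assumes Om: "open Om"
    and lin: "\<And>s z. s \<in> {0..1} \<Longrightarrow> z \<in> Om \<Longrightarrow> linear (B s z)"
    and bd: "\<And>s z u. s \<in> {0..1} \<Longrightarrow> z \<in> Om \<Longrightarrow> norm (B s z u) \<le> norm u / 2"
    and B: "\<And>u. Ck_param k {0..1} Om (\<lambda>s z. B s z u)"
    and c: "Ck_param k {0..1} Om c"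
    and W: "continuous_on ({0..1} \<times> Om) (\<lambda>(s, z). W s z)"
    and eq: "\<And>t z. t \<in> {0..1} \<Longrightarrow> z \<in> Om \<Longrightarrow> W t z = rint (\<lambda>s z. c s z + B s z (W s z)) t z"
  shows "Ck_param k {0..1} Om W"
  using B c W eq
proof (induction k arbitrary: c W)
  case (Suc k)
  have B': "Ck_param k {0..1} Om (\<lambda>s z. B s z u)" for u by (rule Ck_param_Suc_D[OF Suc.prems(1)])
  have Wk: "Ck_param k {0..1} Om W"
    by (rule Suc.IH[OF B' Ck_param_Suc_D[OF Suc.prems(2)] Suc.prems(3,4)])
  define D where "D s z u = frechet_derivative (\<lambda>z. B s z u) (at z)" for s z u
  have D: "((\<lambda>z. B s z u) has_derivative D s z u) (at z)" if "s \<in> {0..1}" "z \<in> Om" for s z u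
    using Suc.prems(1)[of u] that unfolding D_def by (simp add: frechet_derivative_works)
  have Dk: "Ck_param k {0..1} Om (\<lambda>s z. D s z u v)" for u v
    using Suc.prems(1)[of u] unfolding D_def by simp
  obtain c' where c': "\<And>s z. s \<in> {0..1} \<Longrightarrow> z \<in> Om \<Longrightarrow> (c s has_derivative c' s z) (at z)"
    "\<And>v. Ck_param k {0..1} Om (\<lambda>s z. c' s z v)" using Ck_param_SucE[OF Suc.prems(2)] by blast
  \<comment> \<open>The derivatives that \<open>linear_ode_local\<close> supplies near each point
    agree with this one and thus fit together over \<open>Om\<close>.\<close>
  define W' where "W' t z = frechet_derivative (W t) (at z)" for t z
  have loc: "\<exists>U. open U \<and> z0 \<in> U \<and> U \<subseteq> Om \<and>
    (\<forall>t\<in>{0..1}. \<forall>z\<in>U. (W t has_derivative W' t z) (at z)) \<and>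
    (\<forall>v. continuous_on ({0..1} \<times> U) (\<lambda>(t, z). W' t z v)) \<and>
    (\<forall>v. \<forall>t\<in>{0..1}. \<forall>z\<in>U. W' t z v =
      rint (\<lambda>s z. (c' s z v + (\<Sum>b\<in>Basis. (W s z \<bullet> b) *\<^sub>R D s z b v)) + B s z (W' s z v)) t z)"
    if z0: "z0 \<in> Om" for z0
  proof -
    have "\<exists>U W'. open U \<and> z0 \<in> U \<and> U \<subseteq> Om \<and>
      (\<forall>t\<in>{0..1}. \<forall>z\<in>U. (W t has_derivative W' t z) (at z)) \<and>
      (\<forall>v. continuous_on ({0..1} \<times> U) (\<lambda>(t, z). W' t z v)) \<and>
      (\<forall>v. \<forall>t\<in>{0..1}. \<forall>z\<in>U. W' t z v =
        rint (\<lambda>s z. (c' s z v + (\<Sum>b\<in>Basis. (W s z \<bullet> b) *\<^sub>R D s z b v)) + B s z (W' s z v)) t z)"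
      by (rule linear_ode_local[OF Om z0 lin bd Ck_param_continuous[OF B'] Ck_param_continuous[OF Suc.prems(2)]
        D c'(1) Ck_param_continuous[OF Dk] Ck_param_continuous[OF c'(2)] Suc.prems(3,4)])
    then obtain U W'' where U: "open U" "z0 \<in> U" "U \<subseteq> Om"
      and der: "\<forall>t\<in>{0..1}. \<forall>z\<in>U. (W t has_derivative W'' t z) (at z)"
      and cont: "\<forall>v. continuous_on ({0..1} \<times> U) (\<lambda>(t, z). W'' t z v)"
      and e: "\<forall>v. \<forall>t\<in>{0..1}. \<forall>z\<in>U. W'' t z v =
        rint (\<lambda>s z. (c' s z v + (\<Sum>b\<in>Basis. (W s z \<bullet> b) *\<^sub>R D s z b v)) + B s z (W'' s z v)) t z"
      by blast
    have WW: "W' t z = W'' t z" if "t \<in> {0..1}" "z \<in> U" for t z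
      using frechet_derivative_at der that unfolding W'_def by metis
    show ?thesis
    proof (intro exI[of _ U] conjI allI ballI)
      show "continuous_on ({0..1} \<times> U) (\<lambda>(t, z). W' t z v)" for v
        by (rule continuous_on_eq[OF cont[rule_format, of v]]) (auto simp: WW)
      fix t z assume tz: "t \<in> {0..1::real}" "z \<in> U"
      show "(W t has_derivative W' t z) (at z)" using der tz WW by simp
      show "W' t z v = rint (\<lambda>s z. (c' s z v + (\<Sum>b\<in>Basis. (W s z \<bullet> b) *\<^sub>R D s z b v)) + B s z (W' s z v)) t z" for v
        unfolding WW[OF tz] e[rule_format, OF tz, of v]
        by (rule rint_cong[OF _ tz(1)]) (use WW tz in auto)
    qed (use U in auto)
  qed
  show ?case
  proof (rule Ck_param_SucI[OF Om Suc.prems(3), where f'=W'])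
    show "(W t has_derivative W' t z) (at z)" if "t \<in> {0..1}" "z \<in> Om" for t z
      using loc[OF that(2)] that(1) by blast
    fix v
    show "Ck_param k {0..1} Om (\<lambda>t z. W' t z v)"
    proof (rule Suc.IH[OF B', of "\<lambda>s z. c' s z v + (\<Sum>b\<in>Basis. (W s z \<bullet> b) *\<^sub>R D s z b v)"])
      show "Ck_param k {0..1} Om (\<lambda>s z. c' s z v + (\<Sum>b\<in>Basis. (W s z \<bullet> b) *\<^sub>R D s z b v))"
        by (intro Ck_param_add[OF Om] Ck_param_sum[OF Om] Ck_param_bilinear[OF bounded_bilinear_scaleR Om]
          Ck_param_bounded_linear[OF bounded_linear_inner_left Om] c' Wk Dk)
      show "continuous_on ({0..1} \<times> Om) (\<lambda>(t, z). W' t z v)"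
        by (rule continuous_on_local_Times) (use loc in meson)
      show "W' t z v = rint (\<lambda>s z. (c' s z v + (\<Sum>b\<in>Basis. (W s z \<bullet> b) *\<^sub>R D s z b v)) + B s z (W' s z v)) t z"
        if "t \<in> {0..1}" "z \<in> Om" for t z
        using loc[OF that(2)] that(1) by blast
    qed
  qed
qed auto

text \<open>The variational equation is linear, with coefficients given by the derivative of
  \<open>H\<close> along the solution. If \<open>V\<close> is of class \<open>k\<close>, then so are
  these coefficients, hence \<open>W\<close> by \<open>linear_ode_Ck\<close>, and \<open>V\<close>
  is of class \<open>k + 1\<close>.\<close>

lemma nonlinear_ode_Ck:
  fixes H :: "'z::euclidean_space \<times> 'u::euclidean_space \<Rightarrow> 'u" and W :: "real \<Rightarrow> 'z \<Rightarrow> 'z \<Rightarrow> 'u"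
  assumes Om: "open Om" and N: "open N" and H: "smooth_on N H"
    and V: "continuous_on ({0..1} \<times> Om) (\<lambda>(s, z). V s z)"
    and inN: "\<And>s z. s \<in> {0..1} \<Longrightarrow> z \<in> Om \<Longrightarrow> (z, V s z) \<in> N"
    and der: "\<And>s z. s \<in> {0..1} \<Longrightarrow> z \<in> Om \<Longrightarrow> (V s has_derivative W s z) (at z)"
    and W: "\<And>v. continuous_on ({0..1} \<times> Om) (\<lambda>(s, z). W s z v)"
    and eq: "\<And>t z v. t \<in> {0..1} \<Longrightarrow> z \<in> Om \<Longrightarrow> W t z v =
      rint (\<lambda>s z. frechet_derivative H (at (z, V s z)) (v, 0) + frechet_derivative H (at (z, V s z)) (0, W s z v)) t z"
    and bd: "\<And>s z k. s \<in> {0..1} \<Longrightarrow> z \<in> Om \<Longrightarrow> norm (frechet_derivative H (at (z, V s z)) (0, k)) \<le> norm k / 2"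
  shows "Ck_param k {0..1} Om V"
proof (induction k)
  case 0
  then show ?case using V by simp
next
  case (Suc k)
  have pair: "Ck_param k {0..1} Om (\<lambda>s z. (z, V s z))"
  proof -
    have "bounded_linear (\<lambda>z::'z. (z, 0::'u))" "bounded_linear (\<lambda>u::'u. (0::'z, u))"
      by (intro bounded_linear_Pair bounded_linear_ident bounded_linear_zero)+
    from Ck_param_add[OF Om Ck_param_bounded_linear[OF this(1) Om Ck_param_proj[OF Om]]
      Ck_param_bounded_linear[OF this(2) Om Suc]]
    show ?thesis by simp
  qed
  have D: "Ck_param k {0..1} Om (\<lambda>s z. frechet_derivative H (at (z, V s z)) w)" for w
  proof (rule Ck_param_compose[OF Om N inN _ pair, where g="\<lambda>s y. frechet_derivative H (at y) w"])
    show "Ck_param k {0..1} N (\<lambda>s y. frechet_derivative H (at y) w)"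
      using Ck_param_of_Ck_on[OF N] smooth_on_derivative[OF H] unfolding smooth_on_def by blast
  qed
  show ?case
  proof (rule Ck_param_SucI[OF Om V der])
    show "Ck_param k {0..1} Om (\<lambda>t z. W t z v)" for v
    proof (rule linear_ode_Ck[OF Om _ bd D D W eq])
      fix s z assume "s \<in> {0..1::real}" "z \<in> Om"
      then have "linear (frechet_derivative H (at (z, V s z)))"
        using smooth_on_has_derivative[OF H inN] has_derivative_linear by blast
      from linear_compose[OF _ this, of "\<lambda>k. (0, k)"]
      show "linear (\<lambda>k. frechet_derivative H (at (z, V s z)) (0, k))"
        by (simp add: o_def linear_iff)
    qed
  qed
qed

lemma smooth_on_Lipschitz:
  fixes f :: "'a::euclidean_space \<Rightarrow> 'b::real_normed_vector"
  assumes "smooth_on N f" "compact Q" "convex Q" "Q \<subseteq> N"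
  shows "\<exists>M\<ge>0. \<forall>p\<in>Q. \<forall>q\<in>Q. norm (f p - f q) \<le> M * norm (p - q)"
proof -
  have "\<exists>M\<ge>0. \<forall>p\<in>Q. \<forall>h. norm (frechet_derivative f (at p) h) \<le> M * norm h"
  proof (rule linear_family_bounded[OF assms(2)])
    show "linear (frechet_derivative f (at p))" if "p \<in> Q" for p
      using smooth_on_has_derivative[OF assms(1)] has_derivative_linear that assms(4) by blast
    show "continuous_on Q (\<lambda>p. frechet_derivative f (at p) b)" for b
      using continuous_on_subset[OF smooth_on_continuous[OF smooth_on_derivative[OF assms(1)]] assms(4)] .
  qed
  then obtain M where M: "M \<ge> 0" "\<And>p h. p \<in> Q \<Longrightarrow> norm (frechet_derivative f (at p) h) \<le> M * norm h" by blast
  have "norm (f p - f q) \<le> M * norm (p - q)" if "p \<in> Q" "q \<in> Q" for p q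
  proof (rule differentiable_bound[OF assms(3)])
    show "(f has_derivative frechet_derivative f (at x)) (at x within Q)" if "x \<in> Q" for x
      using smooth_on_has_derivative[OF assms(1)] that assms(4) has_derivative_at_withinI by blast
    show "onorm (frechet_derivative f (at x)) \<le> M" if "x \<in> Q" for x
      using M that by (intro onorm_le) auto
  qed (use that in auto)
  then show ?thesis using M by blast
qed

text \<open>Since \<open>H (0, u) = 0\<close>, the derivative of \<open>H\<close> in \<open>u\<close> is small for small \<open>z\<close>, which gives the solution up to
  time 1 and the contraction constant.\<close>

theorem smooth_flow:
  fixes H :: "'z::euclidean_space \<times> 'u::euclidean_space \<Rightarrow> 'u"
  assumes N: "open N" and H: "smooth_on N H" and 0: "(0, 0) \<in> N"
    and H0: "\<And>u. (0, u) \<in> N \<Longrightarrow> H (0, u) = 0"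
  obtains d V W where "d > 0"
    "\<And>t z. t \<in> {0..1} \<Longrightarrow> z \<in> ball 0 d \<Longrightarrow> (z, V t z) \<in> N"
    "continuous_on ({0..1} \<times> ball 0 d) (\<lambda>(t, z). V t z)"
    "\<And>t z. t \<in> {0..1} \<Longrightarrow> z \<in> ball 0 d \<Longrightarrow> V t z = rint (\<lambda>s z. H (z, V s z)) t z"
    "\<And>t z. t \<in> {0..1} \<Longrightarrow> z \<in> ball 0 d \<Longrightarrow> (V t has_derivative W t z) (at z)"
    "\<And>v. continuous_on ({0..1} \<times> ball 0 d) (\<lambda>(t, z). W t z v)"
    "\<And>t z v. t \<in> {0..1} \<Longrightarrow> z \<in> ball 0 d \<Longrightarrow> W t z v =
      rint (\<lambda>s z. frechet_derivative H (at (z, V s z)) (v, 0) + frechet_derivative H (at (z, V s z)) (0, W s z v)) t z"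
    "\<And>t. t \<in> {0..1} \<Longrightarrow> smooth_on (ball 0 d) (V t)"
proof -
  let ?D = "\<lambda>p. frechet_derivative H (at p)"
  obtain A B where AB: "open A" "open B" "(0, 0) \<in> A \<times> B" "A \<times> B \<subseteq> N"
    using open_prod_elim[OF N 0] by metis
  obtain e1 e2 where e: "e1 > 0" "cball 0 e1 \<subseteq> A" "e2 > 0" "cball 0 e2 \<subseteq> B"
    using AB open_contains_cball by (metis mem_Sigma_iff)
  define r where "r = min e1 e2"
  define Q where "Q = cball (0::'z) r \<times> cball (0::'u) r"
  have r: "r > 0" using e by (simp add: r_def)
  have "cball 0 r \<subseteq> A" "cball 0 r \<subseteq> B" using e by (auto simp: r_def)
  then have QN: "Q \<subseteq> N" using AB(4) by (auto simp: Q_def)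
  have Q: "compact Q" "convex Q" by (auto simp: Q_def intro: compact_Times convex_Times)
  have lin: "linear (?D p)" if "p \<in> Q" for p
    using smooth_on_has_derivative[OF H] has_derivative_linear that QN by blast
  obtain M1 where M1: "M1 \<ge> 0" "\<And>p q. p \<in> Q \<Longrightarrow> q \<in> Q \<Longrightarrow> norm (H p - H q) \<le> M1 * norm (p - q)"
    using smooth_on_Lipschitz[OF H Q QN] by blast
  have "\<exists>M\<ge>0. \<forall>p\<in>Q. \<forall>h. norm (?D p h) \<le> M * norm h"
    using continuous_on_subset[OF smooth_on_continuous[OF smooth_on_derivative[OF H]] QN]
    by (intro linear_family_bounded[OF Q(1) lin])
  then obtain M3 where M3: "M3 \<ge> 0" "\<And>p h. p \<in> Q \<Longrightarrow> norm (?D p h) \<le> M3 * norm h" by blast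
  have "\<forall>b. \<exists>M\<ge>0. \<forall>p\<in>Q. \<forall>q\<in>Q. norm (?D p b - ?D q b) \<le> M * norm (p - q)"
    using smooth_on_Lipschitz[OF smooth_on_derivative[OF H] Q QN] by blast
  then obtain m where m: "\<And>b. 0 \<le> m b" "\<And>b p q. p \<in> Q \<Longrightarrow> q \<in> Q \<Longrightarrow> norm (?D p b - ?D q b) \<le> m b * norm (p - q)"
    by metis
  define M2 where "M2 = (\<Sum>b\<in>(Basis::('z \<times> 'u) set). m b)"
  have M2: "M2 \<ge> 0" unfolding M2_def by (rule sum_nonneg) (use m in auto)
  have DL: "norm (?D p h - ?D q h) \<le> M2 * norm (p - q) * norm h" if "p \<in> Q" "q \<in> Q" for p q h
  proof -
    have "?D p h - ?D q h = (\<Sum>b\<in>Basis. (h \<bullet> b) *\<^sub>R (?D p b - ?D q b))"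
      using euclidean_linear_sum[OF lin[OF that(1)], of h] euclidean_linear_sum[OF lin[OF that(2)], of h]
      by (simp only: sum_subtractf scaleR_diff_right)
    also have "norm \<dots> \<le> (\<Sum>b\<in>Basis. norm h * (m b * norm (p - q)))"
      by (intro sum_norm_le) (auto intro!: mult_mono m that simp: Basis_le_norm)
    also have "\<dots> = M2 * norm (p - q) * norm h" by (simp add: M2_def sum_distrib_left sum_distrib_right mult_ac)
    finally show ?thesis .
  qed
  \<comment> \<open>The three bounds on \<open>z\<close> put \<open>(z, u)\<close> into the compact
    set \<open>Q\<close>, keep \<open>H (z, u)\<close> in the ball of radius \<open>r\<close>, and
    make the derivative in \<open>u\<close> a contraction by 1/2.\<close>
  define d where "d = min r (min (r / (M1 + 1)) (1 / (2 * M2 + 2)))"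
  have d: "d > 0" "d \<le> r" "M1 * d \<le> r" "M2 * d \<le> 1/2"
  proof -
    show "d > 0" "d \<le> r" using r M1 M2 by (auto simp: d_def)
    have "M1 * d \<le> M1 * (r / (M1 + 1))" using M1 by (intro mult_left_mono) (auto simp: d_def)
    also have "\<dots> \<le> r" using M1 r by (simp add: field_simps)
    finally show "M1 * d \<le> r" .
    have "M2 * d \<le> M2 * (1 / (2 * M2 + 2))" using M2 by (intro mult_left_mono) (auto simp: d_def)
    also have "\<dots> \<le> 1/2" using M2 by (simp add: field_simps)
    finally show "M2 * d \<le> 1/2" .
  qed
  have inQ: "(z, u) \<in> Q" "(0, u) \<in> Q" if "z \<in> ball 0 d" "norm u \<le> r" for z u
    using that d r by (auto simp: Q_def)
  have D2: "norm (?D (z, u) (0, k)) \<le> norm k / 2" if zu: "z \<in> ball 0 d" "norm u \<le> r" for z u k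
  proof -
    have "?D (0, u) (0, k) = 0"
    proof -
      have h: "(H has_derivative ?D (0, u)) (at (0, u))"
        using smooth_on_has_derivative[OF H] QN inQ(2)[OF that] by blast
      have 1: "((\<lambda>u. H (0, u)) has_derivative (\<lambda>k. ?D (0, u) (0, k))) (at u)"
        by (rule has_derivative_compose[where g=H and f="\<lambda>u. (0, u)", OF _ h]) (auto intro!: derivative_eq_intros)
      have "open ((\<lambda>u. (0, u)) -` N)" by (intro open_vimage N continuous_intros)
      moreover have "u \<in> (\<lambda>u. (0, u)) -` N" using QN inQ(2)[OF that] by auto
      ultimately have "((\<lambda>u. 0) has_derivative (\<lambda>k. ?D (0, u) (0, k))) (at u)"
        using has_derivative_transform_within_open[OF 1] H0 by fastforce
      from has_derivative_unique[OF this has_derivative_const] show ?thesis by metis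
    qed
    then have "norm (?D (z, u) (0, k)) \<le> M2 * norm ((z, u) - (0, u)) * norm (0::'z, k)"
      using DL[OF inQ[OF zu], of "(0, k)"] by simp
    also have "\<dots> = M2 * norm z * norm k" by (simp add: norm_Pair)
    also have "\<dots> \<le> (M2 * d) * norm k" using that M2 by (intro mult_right_mono mult_left_mono) auto
    also have "\<dots> \<le> 1/2 * norm k" using d by (intro mult_right_mono) auto
    finally show ?thesis by simp
  qed
  have hD: "(H has_derivative ?D p) (at p)" if "p \<in> Q" for p
    using smooth_on_has_derivative[OF H] QN that by blast
  have proj: "continuous_on ({0..1::real} \<times> ball 0 d \<times> cball 0 r) (\<lambda>(s, z, u). f (z, u))"
    if "continuous_on N f" for f :: "'z \<times> 'u \<Rightarrow> 'u"
    unfolding case_prod_unfold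
    by (rule continuous_on_compose2[OF that]) (use inQ QN in \<open>auto intro!: continuous_intros\<close>)
  have Dcont: "continuous_on N (\<lambda>p. ?D p h)" for h
    by (rule smooth_on_continuous[OF smooth_on_derivative[OF H]])
  interpret picard "ball 0 d" r "M2 + M3" "\<lambda>s z u. H (z, u)" "\<lambda>s z u h. ?D (z, u) (h, 0)" "\<lambda>s z u k. ?D (z, u) (0, k)"
  proof (rule picard.intro)
    fix s :: real and z :: 'z and u :: 'u assume s: "s \<in> {0..1}" and zu: "z \<in> ball 0 d" "norm u \<le> r"
    note i = inQ[OF zu]
    fix h k
    show "linear (\<lambda>h. ?D (z, u) (h, 0))"
      using linear_compose[OF _ lin[OF i(1)], of "\<lambda>h. (h, 0)"] by (simp add: o_def linear_iff)
    show "linear (\<lambda>k. ?D (z, u) (0, k))"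
      using linear_compose[OF _ lin[OF i(1)], of "\<lambda>k. (0, k)"] by (simp add: o_def linear_iff)
    show "((\<lambda>(z, u). H (z, u)) has_derivative (\<lambda>(h, k). ?D (z, u) (h, 0) + ?D (z, u) (0, k))) (at (z, u))"
      using hD[OF i(1)] linear_add[OF lin[OF i(1)], symmetric] by (simp add: case_prod_unfold)
    show "norm (H (z, u)) \<le> r"
    proof -
      have "norm (H (z, u) - H (0, u)) \<le> M1 * norm ((z, u) - (0, u))" by (rule M1(2)[OF i])
      then have "norm (H (z, u)) \<le> M1 * norm z" using H0[of u] i QN by (auto simp: norm_Pair)
      also have "\<dots> \<le> M1 * d" using zu M1 by (intro mult_left_mono) auto
      finally show ?thesis using d by linarith
    qed
    show "norm (?D (z, u) (h, 0)) \<le> (M2 + M3) * norm h"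
    proof -
      have "norm (?D (z, u) (h, 0)) \<le> M3 * norm h" using M3(2)[OF i(1), of "(h, 0)"] by (simp add: norm_Pair)
      also have "\<dots> \<le> (M2 + M3) * norm h" using M2 by (intro mult_right_mono) auto
      finally show ?thesis .
    qed
    show "norm (?D (z, u) (0, k)) \<le> norm k / 2" by (rule D2[OF zu])
    fix u' :: 'u assume u': "norm u' \<le> r"
    have L: "norm (?D (z, u) h - ?D (z, u') h) \<le> (M2 + M3) * norm (u - u') * norm h" for h
    proof -
      have "norm (?D (z, u) h - ?D (z, u') h) \<le> M2 * norm ((z, u) - (z, u')) * norm h"
        by (rule DL[OF i(1) inQ(1)[OF zu(1) u']])
      also have "\<dots> = M2 * norm (u - u') * norm h" by (simp add: norm_Pair)
      also have "\<dots> \<le> (M2 + M3) * norm (u - u') * norm h" using M3 by (intro mult_right_mono) auto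
      finally show ?thesis .
    qed
    show "norm (?D (z, u) (h, 0) - ?D (z, u') (h, 0)) \<le> (M2 + M3) * norm (u - u') * norm h"
      using L[of "(h, 0)"] by (simp add: norm_Pair)
    show "norm (?D (z, u) (0, k) - ?D (z, u') (0, k)) \<le> (M2 + M3) * norm (u - u') * norm k"
      using L[of "(0, k)"] by (simp add: norm_Pair)
  qed (use r M2 M3 proj[OF smooth_on_continuous[OF H]] proj[OF Dcont] in auto)
  have inN: "(z, Vl t z) \<in> N" if "t \<in> {0..1}" "z \<in> ball 0 d" for t z
    using inQ(1)[OF that(2) Vl_ball[OF that]] QN by blast
  have "Ck_param k {0..1} (ball 0 d) Vl" for k
    by (rule nonlinear_ode_Ck[OF _ N H Vl_cont inN Vl_der Wl_cont Wl_eq D2[OF _ Vl_ball]]) auto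
  then have "smooth_on (ball 0 d) (Vl t)" if "t \<in> {0..1}" for t
    unfolding smooth_on_def using Ck_on_of_param[OF _ _ that] by blast
  then show ?thesis
    by (intro that[of d Vl Wl] d inN Vl_cont Vl_eq Vl_der Wl_cont Wl_eq)
qed

text \<open>The derivative of \<open>g\<close> at \<open>y\<close> is \<open>q v (g y)\<close>,
  where \<open>q\<close> is Cramer's rule for the derivative of \<open>f\<close> and hence smooth.
  So if \<open>g\<close> is of class \<open>k\<close>, it is of class \<open>k + 1\<close>.\<close>

lemma smooth_inverse_function:
  fixes f :: "real ^ 'n::finite \<Rightarrow> real ^ 'n"
  assumes U: "open U" and f: "smooth_on U f" and x0: "x0 \<in> U" and inj: "inj (frechet_derivative f (at x0))"
  obtains U' V g where "open U'" "U' \<subseteq> U" "x0 \<in> U'" "open V" "f x0 \<in> V" "homeomorphism U' V f g"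
    "smooth_on V g" "\<And>x. x \<in> U' \<Longrightarrow> inj (frechet_derivative f (at x))"
    "\<And>y v. y \<in> V \<Longrightarrow> frechet_derivative f (at (g y)) (frechet_derivative g (at y) v) = v"
proof -
  let ?D = "\<lambda>x. frechet_derivative f (at x)"
  have hd: "(f has_derivative ?D x) (at x)" if "x \<in> U" for x using smooth_on_has_derivative[OF f that] .
  have bl: "bounded_linear (?D x)" if "x \<in> U" for x using has_derivative_bounded_linear[OF hd[OF that]] .
  define F where "F x = Blinfun (?D x)" for x
  have F: "blinfun_apply (F x) = ?D x" if "x \<in> U" for x
    unfolding F_def using bounded_linear_Blinfun_apply bl[OF that] by blast
  have cF: "continuous_on U F"
  proof (rule continuous_on_blinfun_componentwise)
    show "continuous_on U (\<lambda>x. blinfun_apply (F x) i)" for i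
      by (rule continuous_on_eq[OF smooth_on_continuous[OF smooth_on_derivative[OF f, of i]]]) (simp add: F)
  qed
  have linx0: "linear (?D x0)" using bl[OF x0] bounded_linear.linear by blast
  obtain h where h: "linear h" "h \<circ> ?D x0 = id" using linear_injective_left_inverse[OF linx0 inj] by blast
  have inv: "Blinfun h o\<^sub>L F x0 = id_blinfun"
  proof (rule blinfun_eqI)
    have "blinfun_apply (Blinfun h) = h"
      using h(1) bounded_linear_Blinfun_apply linear_conv_bounded_linear by blast
    then show "blinfun_apply (Blinfun h o\<^sub>L F x0) i = blinfun_apply id_blinfun i" for i
      using F[OF x0] h(2) by (auto simp: fun_eq_iff)
  qed
  obtain U' V g g' where g: "open U'" "U' \<subseteq> U" "x0 \<in> U'" "open V" "f x0 \<in> V" "homeomorphism U' V f g"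
    "\<And>y. y \<in> V \<Longrightarrow> (g has_derivative (g' y)) (at y)"
    "\<And>y. y \<in> V \<Longrightarrow> g' y = Hilbert_Choice.inv (blinfun_apply (F (g y)))"
    "\<And>y. y \<in> V \<Longrightarrow> bij (blinfun_apply (F (g y)))"
  proof (rule inverse_function_theorem[OF U _ cF x0 inv])
    show "(f has_derivative blinfun_apply (F x)) (at x)" if "x \<in> U" for x using hd[OF that] F[OF that] by simp
  qed blast
  have gV: "g y \<in> U'" if "y \<in> V" for y using g(6) that by (auto simp: homeomorphism_def)
  have fU: "f x \<in> V" "g (f x) = x" if "x \<in> U'" for x using g(6) that by (auto simp: homeomorphism_def)
  have bij: "bij (?D x)" if "x \<in> U'" for x
    using g(9)[OF fU(1)[OF that]] fU(2)[OF that] F that g(2) by auto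
  have gd: "frechet_derivative g (at y) = g' y" if "y \<in> V" for y
    using frechet_derivative_at[OF g(7)[OF that]] by simp
  have sol: "?D (g y) (g' y v) = v" if "y \<in> V" for y v
    using g(8)[OF that] g(9)[OF that] F[of "g y"] gV[OF that] g(2) by (auto simp: bij_is_surj surj_f_inv_f)
  define q where "q v x = (\<chi> k. det (\<chi> i j. if j = k then v $ i else matrix (?D x) $ i $ j) / det (matrix (?D x)))"
    for v x
  have det: "det (matrix (?D x)) \<noteq> 0" if "x \<in> U'" for x
    using det_nz_iff_inj[of "?D x"] bij[OF that] bl[of x] that g(2) bounded_linear.linear bij_is_inj by blast
  have q: "g' y v = q v (g y)" if "y \<in> V" for y v
  proof -
    have l: "linear (?D (g y))" using bl gV[OF that] g(2) bounded_linear.linear by blast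
    have "matrix (?D (g y)) *v g' y v = v" using sol[OF that] fun_cong[OF matrix_vector_mul(2)[OF l]] by simp
    then show ?thesis unfolding q_def using cramer[OF det[OF gV[OF that]]] by blast
  qed
  have f': "smooth_on U' f" using smooth_on_subset[OF f U g(2,1)] .
  have ent: "smooth_on U' (\<lambda>x. matrix (?D x) $ i $ j)" for i j
    unfolding matrix_def using smooth_on_vec_nth[OF g(1) smooth_on_derivative[OF f']] by simp
  have qs: "smooth_on U' (q v)" for v
    unfolding q_def
  proof (rule smooth_on_vec[OF g(1)], simp, intro smooth_on_divide[OF g(1)] smooth_on_det[OF g(1)])
    show "smooth_on U' (\<lambda>x. (\<chi> i j. if j = k then v $ i else matrix (?D x) $ i $ j) $ i $ j)" for i j k
      by (cases "j = k") (simp_all add: ent smooth_on_const[OF g(1)])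
  qed (auto simp: det ent)
  have "Ck_on k V g" for k
  proof (induction k)
    case 0
    then show ?case using g(6) by (simp add: homeomorphism_def)
  next
    case (Suc k)
    show ?case
    proof (rule Ck_on_SucI[OF g(4) g(7)])
      fix v
      have "Ck_on k V (\<lambda>y. q v (g y))"
        by (rule Ck_on_compose[OF g(4) g(1) gV _ Suc]) (use qs in \<open>auto simp: smooth_on_def\<close>)
      then show "Ck_on k V (\<lambda>y. g' y v)" by (rule Ck_on_cong[OF g(4), rotated]) (use q in auto)
    qed
  qed
  then have "smooth_on V g" by (simp add: smooth_on_def)
  then show ?thesis
    using that[OF g(1-6)] bij bij_is_inj sol gd by metis
qed

section \<open>Exterior algebra\<close>

lemma UNIV_6: "(UNIV :: 6 set) = {1, 2, 3, 4, 5, 6}"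
proof -
  have "x \<in> {1, 2, 3, 4, 5, 6}" for x :: 6
  proof (induct x)
    case (of_int z)
    \<comment> \<open>In this type 0 and 6 are the same element.\<close>
    then have "z = 0 \<or> z = 1 \<or> z = 2 \<or> z = 3 \<or> z = 4 \<or> z = 5" by auto
    then show ?case by auto
  qed
  then show ?thesis by auto
qed

lemma sum_6: "sum h (UNIV :: 6 set) = h 1 + h 2 + h 3 + h 4 + h 5 + h 6"
  unfolding UNIV_6 by (simp add: ac_simps)

lemma forall_6: "(\<forall>i::6. P i) \<longleftrightarrow> P 1 \<and> P 2 \<and> P 3 \<and> P 4 \<and> P 5 \<and> P 6"
  using UNIV_6 by (metis UNIV_I empty_iff insert_iff)

section \<open>Permutations of a shifted block of indices\<close>

definition shift_perm :: "nat \<Rightarrow> (nat \<Rightarrow> nat) \<Rightarrow> nat \<Rightarrow> nat" where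
  "shift_perm k p i = (if i < k then i else k + p (i - k))"

lemma shift_perm_simps [simp]: "i < k \<Longrightarrow> shift_perm k p i = i" "shift_perm k p (k + i) = k + p i"
  by (simp_all add: shift_perm_def)

lemma shift_perm_compose: "shift_perm k (p \<circ> q) = shift_perm k p \<circ> shift_perm k q"
  by (auto simp: shift_perm_def fun_eq_iff)

lemma shift_perm_transpose: "shift_perm k (Transposition.transpose a b) = Transposition.transpose (k + a) (k + b)"
  by (auto simp: shift_perm_def fun_eq_iff Transposition.transpose_def)

text \<open>The sign is followed by building \<open>p\<close> from transpositions, which the shift
  sends to transpositions.\<close>

lemma shift_perm_sign:
  assumes "p permutes {..<l}"
  shows "shift_perm k p permutes {k..<k + l} \<and> sign (shift_perm k p) = sign p"
  using assms finite_lessThan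
proof (induction rule: permutes_induct)
  case id
  have "shift_perm k id = id" by (auto simp: shift_perm_def)
  then show ?case unfolding \<open>shift_perm k id = id\<close> by (simp only: permutes_id simp_thms)
next
  case (swap a b p)
  have t: "Transposition.transpose (k + a) (k + b) permutes {k..<k + l}"
    using swap by (intro permutes_swap_id) auto
  have perm: "permutation (shift_perm k p)" "permutation p"
    using swap permutes_imp_permutation by blast+
  have e: "shift_perm k (Transposition.transpose a b \<circ> p) =
      Transposition.transpose (k + a) (k + b) \<circ> shift_perm k p"
    by (simp only: shift_perm_compose shift_perm_transpose)
  have "shift_perm k p permutes {k..<k + l}" using swap by blast
  from permutes_compose[OF this t] show ?case
    unfolding e sign_compose[OF permutation_swap_id perm(1)] sign_compose[OF permutation_swap_id perm(2)]
    by (rule conjI) (use swap in \<open>simp add: sign_swap_id\<close>)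
qed

lemma bij_shift_perm: "bij_betw (shift_perm k) {p. p permutes {..<l}} {p. p permutes {k..<k + l}}"
proof (rule bij_betwI[where g="\<lambda>q i. q (k + i) - k"])
  show "shift_perm k \<in> {p. p permutes {..<l}} \<rightarrow> {p. p permutes {k..<k + l}}"
    using shift_perm_sign by auto
  show "(\<lambda>i. shift_perm k p (k + i) - k) = p" if "p \<in> {p. p permutes {..<l}}" for p
    by simp
  have ge: "k \<le> q (k + i)" if "q permutes {k..<k + l}" for q i
  proof (cases "i < l")
    case True
    then have "q (k + i) \<in> {k..<k + l}" using permutes_in_image[OF that, of "k + i"] by auto
    then show ?thesis by auto
  next
    case False
    then have "q (k + i) = k + i" using permutes_not_in[OF that, of "k + i"] by auto
    then show ?thesis by auto
  qed
  show eq: "shift_perm k (\<lambda>i. q (k + i) - k) = q" if q: "q \<in> {p. p permutes {k..<k + l}}" for q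
  proof
    fix j
    show "shift_perm k (\<lambda>i. q (k + i) - k) j = q j"
      using ge[of q "j - k"] permutes_not_in[of q "{k..<k + l}" j] q by (auto simp: shift_perm_def)
  qed
  show "(\<lambda>q i. q (k + i) - k) \<in> {p. p permutes {k..<k + l}} \<rightarrow> {p. p permutes {..<l}}"
  proof
    fix q assume q: "q \<in> {p. p permutes {k..<k + l}}"
    let ?p = "\<lambda>i. q (k + i) - k"
    have "bij_betw ?p {..<l} {..<l}"
    proof -
      have "inj_on ?p {..<l}"
      proof (rule inj_onI)
        fix i j assume "?p i = ?p j"
        then have "q (k + i) = q (k + j)" using ge[of q i] ge[of q j] q by auto
        then show "i = j" using permutes_inj[of q "{k..<k + l}"] q by (simp add: inj_eq)
      qed
      moreover have "?p ` {..<l} \<subseteq> {..<l}"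
      proof clarsimp
        fix i assume "i < l"
        then have "q (k + i) \<in> {k..<k + l}" using permutes_in_image[of q "{k..<k + l}" "k + i"] q by simp
        then show "q (k + i) - k < l" by auto
      qed
      ultimately show ?thesis by (simp add: bij_betw_def endo_inj_surj)
    qed
    moreover have "?p i = i" if "i \<notin> {..<l}" for i
      using permutes_not_in[of q "{k..<k + l}" "k + i"] q that by auto
    ultimately show "?p \<in> {p. p permutes {..<l}}" using bij_imp_permutes by blast
  qed
qed

text \<open>The determinant form \<open>a\<^sub>1 \<and> \<dots> \<and> a\<^sub>k\<close> of a list of 1-forms.\<close>

definition dform :: "('v \<Rightarrow> real) list \<Rightarrow> 'v list \<Rightarrow> real" where
  "dform as vs = (\<Sum>\<sigma> | \<sigma> permutes {..<length as}.
     of_int (sign \<sigma>) * (\<Prod>i<length as. (as ! \<sigma> i) (vs ! i)))"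

lemma dform_Nil [simp]: "dform [] vs = 1"
proof -
  have "{p. p permutes ({} :: nat set)} = {id}" by auto
  then show ?thesis by (simp add: dform_def)
qed

text \<open>A permutation of \<open>{..<Suc n}\<close> is, in a unique way, one that fixes 0
  followed by a transposition of 0 with some \<open>b\<close>. The transposition puts
  \<open>a\<close> in the place of another form, so the minors arise by replacing an entry instead
  of deleting one, and all of them carry the same sign -1.\<close>

lemma dform_Cons:
  assumes "length as = length vs"
  shows "dform (a # as) (v # vs) = a v * dform as vs - (\<Sum>b<length as. (as ! b) v * dform (as[b := a]) vs)"
proof -
  define n where "n = length as"
  let ?P = "\<lambda>\<sigma>. of_int (sign \<sigma>) * (\<Prod>i<Suc n. ((a # as) ! \<sigma> i) ((v # vs) ! i)) :: real"
  have S: "{..<Suc n} = insert 0 {1..<1 + n}" by auto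
  have trm: "(\<Sum>q | q permutes {1..<1 + n}. ?P (Transposition.transpose 0 b \<circ> q)) =
      (if b = 0 then a v * dform as vs else - ((as ! (b - 1)) v * dform (as[b - 1 := a]) vs))"
    if b: "b \<le> n" for b
  proof -
    define as' where "as' = (if b = 0 then as else as[b - 1 := a])"
    define c where "c = (if b = 0 then 1 else -1 :: real) * ((a # as) ! b) v"
    have len: "length as' = n" by (simp add: as'_def n_def)
    have "(\<Sum>q | q permutes {1..<1 + n}. ?P (Transposition.transpose 0 b \<circ> q)) =
        (\<Sum>p | p permutes {..<n}. ?P (Transposition.transpose 0 b \<circ> shift_perm 1 p))"
      by (rule sum.reindex_bij_betw[OF bij_shift_perm, symmetric])
    also have "\<dots> = (\<Sum>p | p permutes {..<n}. c * (of_int (sign p) * (\<Prod>i<n. (as' ! p i) (vs ! i))))"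
    proof (rule sum.cong)
      fix p assume "p \<in> {p. p permutes {..<n}}"
      then have p: "p permutes {..<n}" by simp
      note sp = shift_perm_sign[OF p, of 1]
      have perm: "permutation (shift_perm 1 p)" using sp permutes_imp_permutation by blast
      have sg: "real_of_int (sign (Transposition.transpose 0 b \<circ> shift_perm 1 p)) = (if b = 0 then 1 else -1) * of_int (sign p)"
        unfolding sign_compose[OF permutation_swap_id perm] sign_swap_id of_int_mult using sp by auto
      have pr: "(\<Prod>i<Suc n. ((a # as) ! (Transposition.transpose 0 b \<circ> shift_perm 1 p) i) ((v # vs) ! i)) =
          ((a # as) ! b) v * (\<Prod>i<n. (as' ! p i) (vs ! i))"
      proof -
        have "((a # as) ! (Transposition.transpose 0 b (Suc (p i)))) (vs ! i) = (as' ! p i) (vs ! i)" if "i < n" for i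
          using permutes_in_image[OF p, of i] that b
          by (auto simp: as'_def Transposition.transpose_def n_def nth_Cons')
        then show ?thesis
          unfolding prod.lessThan_Suc_shift by (simp add: shift_perm_def)
      qed
      show "?P (Transposition.transpose 0 b \<circ> shift_perm 1 p) = c * (of_int (sign p) * (\<Prod>i<n. (as' ! p i) (vs ! i)))"
        unfolding sg pr c_def by simp
    qed simp
    also have "\<dots> = c * dform as' vs"
      by (simp add: dform_def len sum_distrib_left)
    finally show ?thesis by (cases b) (auto simp: c_def as'_def)
  qed
  have "dform (a # as) (v # vs) = (\<Sum>\<sigma> | \<sigma> permutes insert 0 {1..<1 + n}. ?P \<sigma>)"
    unfolding S[symmetric] by (simp add: dform_def n_def)
  also have "\<dots> = (\<Sum>b\<in>insert 0 {1..<1 + n}. \<Sum>q | q permutes {1..<1 + n}. ?P (Transposition.transpose 0 b \<circ> q))"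
    by (rule sum_over_permutations_insert) auto
  also have "\<dots> = (\<Sum>b<Suc n. \<Sum>q | q permutes {1..<1 + n}. ?P (Transposition.transpose 0 b \<circ> q))"
    unfolding S ..
  also have "\<dots> = (\<Sum>b<Suc n. if b = 0 then a v * dform as vs else - ((as ! (b - 1)) v * dform (as[b - 1 := a]) vs))"
    by (rule sum.cong) (use trm in auto)
  also have "\<dots> = a v * dform as vs - (\<Sum>b<n. (as ! b) v * dform (as[b := a]) vs)"
    unfolding sum.lessThan_Suc_shift by (simp add: sum_negf)
  finally show ?thesis by (simp add: n_def)
qed

lemma dform_swap:
  assumes "i < length as" "j < length as" "i \<noteq> j"
  shows "dform (as[i := as ! j, j := as ! i]) vs = - dform as vs"
proof -
  let ?n = "length as" and ?t = "Transposition.transpose i j"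
  have t: "?t permutes {..<?n}" using assms by (intro permutes_swap_id) auto
  have nt: "as[i := as ! j, j := as ! i] ! m = as ! ?t m" if "m < ?n" for m
    using that assms by (auto simp: Transposition.transpose_def nth_list_update)
  have "dform (as[i := as ! j, j := as ! i]) vs =
      (\<Sum>\<sigma> | \<sigma> permutes {..<?n}. of_int (sign \<sigma>) * (\<Prod>m<?n. (as ! (?t (\<sigma> m))) (vs ! m)))"
    unfolding dform_def length_list_update
  proof (rule sum.cong)
    fix \<sigma> assume "\<sigma> \<in> {\<sigma>. \<sigma> permutes {..<?n}}"
    then have "\<sigma> m < ?n" if "m < ?n" for m using permutes_in_image[of \<sigma> "{..<?n}" m] that by auto
    then show "of_int (sign \<sigma>) * (\<Prod>m<?n. (as[i := as ! j, j := as ! i] ! \<sigma> m) (vs ! m)) =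
        of_int (sign \<sigma>) * (\<Prod>m<?n. (as ! (?t (\<sigma> m))) (vs ! m))"
      by (simp add: nt)
  qed simp
  also have "\<dots> = (\<Sum>\<sigma> | \<sigma> permutes {..<?n}. - (of_int (sign (?t \<circ> \<sigma>)) * (\<Prod>m<?n. (as ! ((?t \<circ> \<sigma>) m)) (vs ! m))))"
  proof (rule sum.cong)
    fix \<sigma> assume "\<sigma> \<in> {\<sigma>. \<sigma> permutes {..<?n}}"
    then have "permutation \<sigma>" using permutes_imp_permutation by blast
    then have "sign (?t \<circ> \<sigma>) = - sign \<sigma>"
      using assms by (simp add: sign_compose permutation_swap_id sign_swap_id)
    then show "of_int (sign \<sigma>) * (\<Prod>m<?n. (as ! (?t (\<sigma> m))) (vs ! m)) =
        - (of_int (sign (?t \<circ> \<sigma>)) * (\<Prod>m<?n. (as ! ((?t \<circ> \<sigma>) m)) (vs ! m)))" by simp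
  qed simp
  also have "\<dots> = - dform as vs"
    unfolding dform_def sum_negf setum_permutations_compose_left[OF t, symmetric, of "\<lambda>\<sigma>. of_int (sign \<sigma>) * (\<Prod>m<?n. (as ! \<sigma> m) (vs ! m))"] ..
  finally show ?thesis .
qed

text \<open>Composition on the right with the transposition of \<open>i\<close> and \<open>j\<close>
  changes the sign of a permutation but not its product, as the two vectors are equal. The sum is
  its own negative.\<close>

lemma dform_repeated_vector:
  assumes "i < length as" "j < length as" "i \<noteq> j" "vs ! i = vs ! j"
  shows "dform as vs = 0"
proof -
  let ?n = "length as" and ?t = "Transposition.transpose i j"
  have t: "?t permutes {..<?n}" using assms by (intro permutes_swap_id) auto
  have "dform as vs = (\<Sum>\<sigma> | \<sigma> permutes {..<?n}. of_int (sign (\<sigma> \<circ> ?t)) * (\<Prod>m<?n. (as ! ((\<sigma> \<circ> ?t) m)) (vs ! m)))"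
    unfolding dform_def by (rule sum_permutations_compose_right[OF t])
  also have "\<dots> = (\<Sum>\<sigma> | \<sigma> permutes {..<?n}. - (of_int (sign \<sigma>) * (\<Prod>m<?n. (as ! \<sigma> m) (vs ! m))))"
  proof (rule sum.cong)
    fix \<sigma> assume "\<sigma> \<in> {\<sigma>. \<sigma> permutes {..<?n}}"
    then have "permutation \<sigma>" using permutes_imp_permutation by blast
    then have s: "sign (\<sigma> \<circ> ?t) = - sign \<sigma>"
      using assms by (simp add: sign_compose permutation_swap_id sign_swap_id)
    have "(\<Prod>m<?n. (as ! \<sigma> m) (vs ! m)) = (\<Prod>m<?n. (as ! \<sigma> (?t m)) (vs ! ?t m))"
      using prod.permute[OF t, of "\<lambda>m. (as ! \<sigma> m) (vs ! m)"] by (simp add: o_def)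
    also have "\<dots> = (\<Prod>m<?n. (as ! ((\<sigma> \<circ> ?t) m)) (vs ! m))"
      by (rule prod.cong) (use assms in \<open>auto simp: Transposition.transpose_def\<close>)
    finally show "of_int (sign (\<sigma> \<circ> ?t)) * (\<Prod>m<?n. (as ! ((\<sigma> \<circ> ?t) m)) (vs ! m)) =
        - (of_int (sign \<sigma>) * (\<Prod>m<?n. (as ! \<sigma> m) (vs ! m)))" using s by simp
  qed simp
  also have "\<dots> = - dform as vs" by (simp add: dform_def sum_negf)
  finally show ?thesis by simp
qed

text \<open>Every permutation pairs \<open>a\<close> with one of the vectors, so every product has a
  vanishing factor.\<close>

lemma dform_eq_0:
  assumes "a \<in> set as" "length vs = length as" "\<And>v. v \<in> set vs \<Longrightarrow> a v = 0"
  shows "dform as vs = 0"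
proof -
  obtain j where j: "j < length as" "as ! j = a" using assms(1) by (auto simp: in_set_conv_nth)
  have z: "(\<Prod>i<length as. (as ! \<sigma> i) (vs ! i)) = 0" if s: "\<sigma> permutes {..<length as}" for \<sigma>
  proof -
    obtain i where "i < length as" "\<sigma> i = j"
      using permutes_image[OF s] j by (metis imageE lessThan_iff)
    then have "(as ! \<sigma> i) (vs ! i) = 0" using j assms(2,3) by simp
    then show ?thesis using \<open>i < length as\<close> by (intro prod_zero) auto
  qed
  show ?thesis unfolding dform_def by (rule sum.neutral) (metis z mem_Collect_eq mult_zero_right)
qed

lemma dform_dual:
  assumes "length vs = length as" "distinct as"
    "\<And>i j. i < length as \<Longrightarrow> j < length as \<Longrightarrow> (as ! i) (vs ! j) = (if i = j then 1 else 0)"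
  shows "dform as vs = 1"
proof -
  let ?n = "length as"
  have "(\<Prod>i<?n. (as ! \<sigma> i) (vs ! i)) = (if \<sigma> = id then 1 else 0)" if s: "\<sigma> permutes {..<?n}" for \<sigma>
  proof (cases "\<sigma> = id")
    case False
    then obtain i where i: "\<sigma> i \<noteq> i" by fastforce
    then have "i < ?n" using permutes_not_in[OF s] by (meson lessThan_iff)
    moreover have "\<sigma> i < ?n" using permutes_in_image[OF s, of i] calculation by auto
    ultimately show ?thesis using False i assms(3)[of "\<sigma> i" i] by (auto intro!: prod_zero bexI[of _ i])
  qed (use assms in auto)
  then have "dform as vs = (\<Sum>\<sigma> | \<sigma> permutes {..<?n}. if \<sigma> = id then 1 else 0)"
    unfolding dform_def by (intro sum.cong) auto
  then show ?thesis by (simp add: permutes_id finite_permutations)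
qed

text \<open>Expanding both factors gives a sum over \<sigma> and over pairs of permutations \<tau>,
  \<rho> of the two blocks. For a fixed pair, \<open>R \<tau> \<rho> \<circ> inv \<sigma>\<close>
  runs through all permutations together with \<sigma>, so each pair contributes the whole form on
  \<open>as @ bs\<close>. There are \<open>fact k * fact l\<close> pairs, which is the denominator
  in \<open>wedge\<close>.\<close>

lemma wedge_dform:
  assumes k: "length as = k" and l: "length bs = l"
  shows "wedge k l (dform as) (dform bs) vs = dform (as @ bs) vs"
proof -
  let ?n = "k + l"
  define R :: "(nat \<Rightarrow> nat) \<Rightarrow> (nat \<Rightarrow> nat) \<Rightarrow> nat \<Rightarrow> nat" where "R \<tau> \<rho> = \<tau> \<circ> shift_perm k \<rho>" for \<tau> \<rho>
  have R: "R \<tau> \<rho> permutes {..<?n} \<and> sign (R \<tau> \<rho>) = sign \<tau> * sign \<rho>"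
    if "\<tau> permutes {..<k}" "\<rho> permutes {..<l}" for \<tau> \<rho>
  proof -
    have 1: "\<tau> permutes {..<?n}" by (rule permutes_subset[OF that(1)]) auto
    have 2: "shift_perm k \<rho> permutes {..<?n}" using shift_perm_sign[OF that(2), of k]
      by (auto intro: permutes_subset)
    have "permutation \<tau>" "permutation (shift_perm k \<rho>)" using 1 2 permutes_imp_permutation by blast+
    then show ?thesis unfolding R_def
      using permutes_compose[OF 2 1] shift_perm_sign[OF that(2), of k] by (simp add: sign_compose)
  qed
  let ?f = "\<lambda>\<sigma>. real_of_int (sign \<sigma>) * (\<Prod>i<?n. ((as @ bs) ! \<sigma> i) (vs ! i))"
  let ?T = "{\<tau>. \<tau> permutes {..<k}}" and ?R = "{\<rho>. \<rho> permutes {..<l}}" and ?S = "{\<sigma>. \<sigma> permutes {..<?n}}"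
  have trm: "of_int (sign \<sigma>) * dform as (map (\<lambda>i. vs ! \<sigma> i) [0..<k]) * dform bs (map (\<lambda>i. vs ! \<sigma> i) [k..<?n]) =
      (\<Sum>\<tau>\<in>?T. \<Sum>\<rho>\<in>?R. ?f (R \<tau> \<rho> \<circ> Hilbert_Choice.inv \<sigma>))" if s: "\<sigma> permutes {..<?n}" for \<sigma>
  proof -
    have A: "dform as (map (\<lambda>i. vs ! \<sigma> i) [0..<k]) =
        (\<Sum>\<tau>\<in>?T. of_int (sign \<tau>) * (\<Prod>i<k. (as ! \<tau> i) (vs ! \<sigma> i)))"
      by (simp add: dform_def k)
    have B: "dform bs (map (\<lambda>i. vs ! \<sigma> i) [k..<?n]) =
        (\<Sum>\<rho>\<in>?R. of_int (sign \<rho>) * (\<Prod>i<l. (bs ! \<rho> i) (vs ! \<sigma> (k + i))))"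
      by (simp add: dform_def l)
    have prod: "(\<Prod>i<k. (as ! \<tau> i) (vs ! \<sigma> i)) * (\<Prod>i<l. (bs ! \<rho> i) (vs ! \<sigma> (k + i))) =
        (\<Prod>i<?n. ((as @ bs) ! (R \<tau> \<rho> \<circ> Hilbert_Choice.inv \<sigma>) i) (vs ! i))"
      if t: "\<tau> permutes {..<k}" "\<rho> permutes {..<l}" for \<tau> \<rho>
    proof -
      have "(\<Prod>i<?n. ((as @ bs) ! (R \<tau> \<rho> \<circ> Hilbert_Choice.inv \<sigma>) i) (vs ! i)) =
          (\<Prod>i<?n. ((as @ bs) ! (R \<tau> \<rho> i)) (vs ! \<sigma> i))"
        using prod.permute[OF s, of "\<lambda>i. ((as @ bs) ! (R \<tau> \<rho> \<circ> Hilbert_Choice.inv \<sigma>) i) (vs ! i)"] permutes_inverses[OF s]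
        by (simp add: o_def)
      also have "\<dots> = (\<Prod>i<k. ((as @ bs) ! (R \<tau> \<rho> i)) (vs ! \<sigma> i)) * (\<Prod>i<l. ((as @ bs) ! (R \<tau> \<rho> (k + i))) (vs ! \<sigma> (k + i)))"
      proof -
        have "(\<Prod>i<k + m. g i) = (\<Prod>i<k. g i) * (\<Prod>i<m. g (k + i))" for g :: "nat \<Rightarrow> real" and m
          by (induction m) (simp_all add: mult_ac)
        then show ?thesis .
      qed
      also have "(\<Prod>i<k. ((as @ bs) ! (R \<tau> \<rho> i)) (vs ! \<sigma> i)) = (\<Prod>i<k. (as ! \<tau> i) (vs ! \<sigma> i))"
      proof (rule prod.cong)
        fix i assume "i \<in> {..<k}"
        moreover have "\<tau> i < k" using permutes_in_image[OF t(1), of i] calculation by auto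
        ultimately show "((as @ bs) ! (R \<tau> \<rho> i)) (vs ! \<sigma> i) = (as ! \<tau> i) (vs ! \<sigma> i)"
          by (simp add: R_def k nth_append)
      qed simp
      also have "(\<Prod>i<l. ((as @ bs) ! (R \<tau> \<rho> (k + i))) (vs ! \<sigma> (k + i))) = (\<Prod>i<l. (bs ! \<rho> i) (vs ! \<sigma> (k + i)))"
      proof (rule prod.cong)
        fix i assume "i \<in> {..<l}"
        moreover have "\<tau> (k + \<rho> i) = k + \<rho> i" using permutes_not_in[OF t(1), of "k + \<rho> i"] by auto
        ultimately show "((as @ bs) ! (R \<tau> \<rho> (k + i))) (vs ! \<sigma> (k + i)) = (bs ! \<rho> i) (vs ! \<sigma> (k + i))"
          by (simp add: R_def k nth_append)
      qed simp
      finally show ?thesis by simp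
    qed
    have sgn: "sign (R \<tau> \<rho> \<circ> Hilbert_Choice.inv \<sigma>) = sign \<sigma> * sign \<tau> * sign \<rho>"
      if "\<tau> permutes {..<k}" "\<rho> permutes {..<l}" for \<tau> \<rho>
    proof -
      have "permutation \<sigma>" "permutation (Hilbert_Choice.inv \<sigma>)" "permutation (R \<tau> \<rho>)"
        using s permutes_inv[OF s] R[OF that] permutes_imp_permutation by blast+
      then show ?thesis using R[OF that] by (simp add: sign_compose sign_inverse)
    qed
    have dist: "c * (\<Sum>i\<in>X. h i) * (\<Sum>j\<in>Y. h' j) = (\<Sum>i\<in>X. \<Sum>j\<in>Y. c * (h i * h' j))"
      for c :: real and X Y :: "(nat \<Rightarrow> nat) set" and h h'
      unfolding mult.assoc[of c] by (subst sum_product) (simp only: sum_distrib_left)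
    show ?thesis unfolding A B dist
    proof (intro sum.cong refl)
      fix \<tau> \<rho> assume "\<tau> \<in> ?T" "\<rho> \<in> ?R"
      then have t: "\<tau> permutes {..<k}" "\<rho> permutes {..<l}" by auto
      show "real_of_int (sign \<sigma>) * ((real_of_int (sign \<tau>) * (\<Prod>i<k. (as ! \<tau> i) (vs ! \<sigma> i))) *
          (real_of_int (sign \<rho>) * (\<Prod>i<l. (bs ! \<rho> i) (vs ! \<sigma> (k + i))))) = ?f (R \<tau> \<rho> \<circ> Hilbert_Choice.inv \<sigma>)"
        unfolding prod[OF t, symmetric] sgn[OF t] of_int_mult by (simp only: mult_ac)
    qed
  qed
  have "(\<Sum>\<sigma>\<in>?S. of_int (sign \<sigma>) * dform as (map (\<lambda>i. vs ! \<sigma> i) [0..<k]) * dform bs (map (\<lambda>i. vs ! \<sigma> i) [k..<?n])) =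
      (\<Sum>\<sigma>\<in>?S. \<Sum>\<tau>\<in>?T. \<Sum>\<rho>\<in>?R. ?f (R \<tau> \<rho> \<circ> Hilbert_Choice.inv \<sigma>))"
    by (rule sum.cong) (use trm in auto)
  also have "\<dots> = (\<Sum>\<tau>\<in>?T. \<Sum>\<rho>\<in>?R. \<Sum>\<sigma>\<in>?S. ?f (R \<tau> \<rho> \<circ> Hilbert_Choice.inv \<sigma>))"
    by (subst sum.swap, rule sum.cong[OF refl], rule sum.swap)
  also have "\<dots> = (\<Sum>\<tau>\<in>?T. \<Sum>\<rho>\<in>?R. dform (as @ bs) vs)"
  proof (intro sum.cong refl)
    fix \<tau> \<rho> assume "\<tau> \<in> ?T" "\<rho> \<in> ?R"
    then have r: "R \<tau> \<rho> permutes {..<?n}" using R by auto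
    have "(\<Sum>\<sigma>\<in>?S. ?f (R \<tau> \<rho> \<circ> Hilbert_Choice.inv \<sigma>)) = (\<Sum>\<sigma>\<in>?S. ?f (R \<tau> \<rho> \<circ> \<sigma>))"
      using sum_permutations_inverse[of "\<lambda>\<sigma>. ?f (R \<tau> \<rho> \<circ> \<sigma>)" "{..<?n}"] by simp
    also have "\<dots> = (\<Sum>\<sigma>\<in>?S. ?f \<sigma>)"
      by (rule setum_permutations_compose_left[OF r, symmetric])
    also have "\<dots> = dform (as @ bs) vs" by (simp add: dform_def k l)
    finally show "(\<Sum>\<sigma>\<in>?S. ?f (R \<tau> \<rho> \<circ> Hilbert_Choice.inv \<sigma>)) = dform (as @ bs) vs" .
  qed
  also have "\<dots> = fact k * fact l * dform (as @ bs) vs"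
    using card_permutations[of "{..<k}" k] card_permutations[of "{..<l}" l] by simp
  finally show ?thesis unfolding wedge_def by simp
qed

text \<open>The forms of the orbit are prescribed only on tangent vectors, and every sublist of a
  permuted list of tangent vectors consists of tangent vectors again.\<close>

lemma wedge_cong:
  assumes "\<And>us. us \<in> vectors k V \<Longrightarrow> \<alpha> us = \<alpha>' us" "\<And>us. us \<in> vectors l V \<Longrightarrow> \<beta> us = \<beta>' us"
    "vs \<in> vectors (k + l) V"
  shows "wedge k l \<alpha> \<beta> vs = wedge k l \<alpha>' \<beta>' vs"
  unfolding wedge_def
proof (rule arg_cong[where f="\<lambda>x. x / (fact k * fact l)"], rule sum.cong)
  fix \<sigma> assume "\<sigma> \<in> {\<sigma>. \<sigma> permutes {..<k + l}}"
  then have inV: "vs ! \<sigma> i \<in> V" if "i < k + l" for i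
    using permutes_in_image[of \<sigma> "{..<k + l}" i] that assms(3) by (auto simp: vectors_def subset_iff)
  have "map (\<lambda>i. vs ! \<sigma> i) [0..<k] \<in> vectors k V" "map (\<lambda>i. vs ! \<sigma> i) [k..<k + l] \<in> vectors l V"
    using inV by (auto simp: vectors_def)
  from assms(1)[OF this(1)] assms(2)[OF this(2)]
  show "of_int (sign \<sigma>) * \<alpha> (map (\<lambda>i. vs ! \<sigma> i) [0..<k]) * \<beta> (map (\<lambda>i. vs ! \<sigma> i) [k..<k + l]) =
      of_int (sign \<sigma>) * \<alpha>' (map (\<lambda>i. vs ! \<sigma> i) [0..<k]) * \<beta>' (map (\<lambda>i. vs ! \<sigma> i) [k..<k + l])"
    by (simp only:)
qed simp

lemma wedge_add_left: "wedge k l (\<lambda>vs. \<alpha> vs + \<beta> vs) \<gamma> vs = wedge k l \<alpha> \<gamma> vs + wedge k l \<beta> \<gamma> vs"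
  by (simp add: wedge_def algebra_simps sum.distrib add_divide_distrib)

lemma wedge_add_right: "wedge k l \<gamma> (\<lambda>vs. \<alpha> vs + \<beta> vs) vs = wedge k l \<gamma> \<alpha> vs + wedge k l \<gamma> \<beta> vs"
  by (simp add: wedge_def algebra_simps sum.distrib add_divide_distrib)

lemma wedge_cmult_left: "wedge k l (\<lambda>vs. c * \<alpha> vs) \<beta> vs = c * wedge k l \<alpha> \<beta> vs"
  by (simp add: wedge_def sum_distrib_left sum_divide_distrib algebra_simps)

lemma dform_swaps:
  "dform (a # b # as) vs = - dform (b # a # as) vs"
  "dform (x1 # a # b # as) vs = - dform (x1 # b # a # as) vs"
  "dform (x1 # x2 # a # b # as) vs = - dform (x1 # x2 # b # a # as) vs"
  "dform (x1 # x2 # x3 # a # b # as) vs = - dform (x1 # x2 # x3 # b # a # as) vs"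
  "dform (x1 # x2 # x3 # x4 # a # b # as) vs = - dform (x1 # x2 # x3 # x4 # b # a # as) vs"
  using dform_swap[of 0 "a # b # as" 1 vs] dform_swap[of 1 "x1 # a # b # as" 2 vs]
    dform_swap[of 2 "x1 # x2 # a # b # as" 3 vs] dform_swap[of 3 "x1 # x2 # x3 # a # b # as" 4 vs]
    dform_swap[of 4 "x1 # x2 # x3 # x4 # a # b # as" 5 vs]
  by (simp_all add: eval_nat_numeral)

lemma dform_repeats:
  "dform (a # a # as) vs = 0"
  "dform (x1 # a # a # as) vs = 0"
  "dform (x1 # x2 # a # a # as) vs = 0"
  "dform (x1 # x2 # x3 # a # a # as) vs = 0"
  "dform (x1 # x2 # x3 # x4 # a # a # as) vs = 0"
  using dform_swaps(1)[of a a as vs] dform_swaps(2)[of x1 a a as vs] dform_swaps(3)[of x1 x2 a a as vs]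
    dform_swaps(4)[of x1 x2 x3 a a as vs] dform_swaps(5)[of x1 x2 x3 x4 a a as vs] by simp_all

section \<open>Linear algebra of the orbit\<close>

lemma dform_2: "dform [a, b] [u, v] = a u * b v - b u * a v"
  by (simp add: dform_Cons)

lemma dform_3: "dform [a, b, c] [u, v, x] =
    a u * (b v * c x - c v * b x) - b u * (a v * c x - c v * a x) - c u * (b v * a x - a v * b x)"
  by (simp add: dform_Cons lessThan_Suc)

lemma linear_map_on_add: "linear_map_on V UNIV h \<Longrightarrow> u \<in> V \<Longrightarrow> v \<in> V \<Longrightarrow> h (u + v) = h u + h v"
  unfolding linear_map_on_def by (metis scaleR_one)

lemma linear_map_on_scale: "linear_map_on V UNIV h \<Longrightarrow> u \<in> V \<Longrightarrow> h (c *\<^sub>R u) = c *\<^sub>R h u"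
  unfolding linear_map_on_def by (metis add.right_neutral scaleR_zero_left)

locale orbit_point =
  fixes T :: "'v::real_vector set" and e :: "6 \<Rightarrow> 'v \<Rightarrow> real" and f :: "6 \<Rightarrow> 'v"
    and w p :: "'v list \<Rightarrow> real"
  assumes sub: "subspace T"
    and e_lin: "linear_map_on T UNIV (e i)"
    and f_T [simp]: "f i \<in> T" and e_f [simp]: "e i (f j) = (if i = j then 1 else 0)"
    and e_expand: "v \<in> T \<Longrightarrow> v = (\<Sum>i\<in>UNIV. e i v *\<^sub>R f i)"
    and w: "vs \<in> vectors 2 T \<Longrightarrow> w vs = dform [e 1, e 2] vs + dform [e 3, e 4] vs + dform [e 5, e 6] vs"
    and p: "vs \<in> vectors 3 T \<Longrightarrow>
      p vs = dform [e 1, e 4, e 6] vs + dform [e 2, e 3, e 6] vs + dform [e 2, e 4, e 5] vs"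
begin

lemma e_add [simp]: "u \<in> T \<Longrightarrow> v \<in> T \<Longrightarrow> e i (u + v) = e i u + e i v"
  using linear_map_on_add[OF e_lin] .

lemma e_scale [simp]: "u \<in> T \<Longrightarrow> e i (c *\<^sub>R u) = c * e i u"
  using linear_map_on_scale[OF e_lin] by simp

lemma T_add [simp]: "u \<in> T \<Longrightarrow> v \<in> T \<Longrightarrow> u + v \<in> T"
  and T_scale [simp]: "u \<in> T \<Longrightarrow> c *\<^sub>R u \<in> T"
  and T_0 [simp]: "0 \<in> T"
  and T_diff [simp]: "u \<in> T \<Longrightarrow> v \<in> T \<Longrightarrow> u - v \<in> T"
  using sub by (auto simp: subspace_add subspace_scale subspace_0 subspace_diff)

lemma e_0 [simp]: "e i 0 = 0" using e_scale[of 0 i 0] by simp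

lemma e_diff [simp]: "u \<in> T \<Longrightarrow> v \<in> T \<Longrightarrow> e i (u - v) = e i u - e i v"
  using e_add[of "u - v" v i] by simp

lemma e_minus [simp]: "u \<in> T \<Longrightarrow> e i (- u) = - e i u"
  using e_scale[of u i "-1"] by simp

lemma T_minus [simp]: "u \<in> T \<Longrightarrow> - u \<in> T" using sub by (rule subspace_neg)

lemma eqI: "u \<in> T \<Longrightarrow> v \<in> T \<Longrightarrow> (\<And>i. e i u = e i v) \<Longrightarrow> u = v"
  using e_expand[of u] e_expand[of v] by simp

lemma w_eq: "u \<in> T \<Longrightarrow> v \<in> T \<Longrightarrow> w [u, v] = (e 1 u * e 2 v - e 2 u * e 1 v) +
    (e 3 u * e 4 v - e 4 u * e 3 v) + (e 5 u * e 6 v - e 6 u * e 5 v)"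
  using w[of "[u, v]"] by (simp add: vectors_def dform_2)

lemmas p_eq = p[of "[u, v, x]" for u v x, unfolded dform_3]

section \<open>The endomorphism in the adapted frame\<close>

definition Kv :: "'v \<Rightarrow> 'v" where
  "Kv X = (- 2 * e 2 X) *\<^sub>R f 1 + (- 2 * e 4 X) *\<^sub>R f 3 + (- 2 * e 6 X) *\<^sub>R f 5"

lemma Kv_T [simp]: "Kv X \<in> T" by (simp add: Kv_def)

lemma e_Kv [simp]: "e 1 (Kv X) = - 2 * e 2 X" "e 2 (Kv X) = 0" "e 3 (Kv X) = - 2 * e 4 X"
  "e 4 (Kv X) = 0" "e 5 (Kv X) = - 2 * e 6 X" "e 6 (Kv X) = 0"
  unfolding Kv_def by simp_all

definition "D is = dform (map e is)"

lemma D_swaps: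
  "D (a # b # as) vs = - D (b # a # as) vs"
  "D (x1 # a # b # as) vs = - D (x1 # b # a # as) vs"
  "D (x1 # x2 # a # b # as) vs = - D (x1 # x2 # b # a # as) vs"
  "D (x1 # x2 # x3 # a # b # as) vs = - D (x1 # x2 # x3 # b # a # as) vs"
  "D (x1 # x2 # x3 # x4 # a # b # as) vs = - D (x1 # x2 # x3 # x4 # b # a # as) vs"
  using dform_swaps by (simp_all add: D_def)

lemma D_repeats:
  "D (a # a # as) vs = 0"
  "D (x1 # a # a # as) vs = 0"
  "D (x1 # x2 # a # a # as) vs = 0"
  "D (x1 # x2 # x3 # a # a # as) vs = 0"
  "D (x1 # x2 # x3 # x4 # a # a # as) vs = 0"
  using dform_repeats by (simp_all add: D_def)

text \<open>Only swaps with \<open>a\<close> greater than \<open>b\<close> are included, so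
  rewriting sorts the indices and terminates; a repeated index then becomes adjacent and gives
  0.\<close>

lemmas D_sort = D_repeats
  D_swaps[where a=2 and b=1] D_swaps[where a=3 and b=1] D_swaps[where a=3 and b=2]
  D_swaps[where a=4 and b=1] D_swaps[where a=4 and b=2] D_swaps[where a=4 and b=3]
  D_swaps[where a=5 and b=1] D_swaps[where a=5 and b=2] D_swaps[where a=5 and b=3]
  D_swaps[where a=5 and b=4] D_swaps[where a=6 and b=1] D_swaps[where a=6 and b=2]
  D_swaps[where a=6 and b=3] D_swaps[where a=6 and b=4] D_swaps[where a=6 and b=5]

lemma wedge_D: "length is = k \<Longrightarrow> length js = l \<Longrightarrow> wedge k l (D is) (D js) vs = D (is @ js) vs"
  using wedge_dform[of "map e is" k "map e js" l] by (simp add: D_def)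

lemma w_D: "vs \<in> vectors 2 T \<Longrightarrow> w vs = D [1, 2] vs + D [3, 4] vs + D [5, 6] vs"
  and p_D: "vs \<in> vectors 3 T \<Longrightarrow> p vs = D [1, 4, 6] vs + D [2, 3, 6] vs + D [2, 4, 5] vs"
  by (simp_all add: w p D_def)

lemma wedge_22:
  assumes us: "us \<in> vectors 4 T"
  shows "wedge 2 2 w w us = 2 * D [1,2,3,4] us + 2 * D [1,2,5,6] us + 2 * D [3,4,5,6] us"
proof -
  have "wedge 2 2 w w us = wedge 2 2 (\<lambda>vs. D [1,2] vs + D [3,4] vs + D [5,6] vs)
      (\<lambda>vs. D [1,2] vs + D [3,4] vs + D [5,6] vs) us"
    by (rule wedge_cong[where V=T]) (use us in \<open>auto simp: w_D\<close>)
  then show ?thesis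
    by (simp add: wedge_add_left wedge_add_right wedge_D D_sort)
qed

lemma liouville_D:
  assumes us: "us \<in> vectors 6 T"
  shows "liouville_form w us = D [1,2,3,4,5,6] us"
proof -
  have "wedge 4 2 (wedge 2 2 w w) w us =
      wedge 4 2 (\<lambda>us. 2 * D [1,2,3,4] us + 2 * D [1,2,5,6] us + 2 * D [3,4,5,6] us)
        (\<lambda>vs. D [1,2] vs + D [3,4] vs + D [5,6] vs) us"
    by (rule wedge_cong[where V=T]) (use us in \<open>auto simp: w_D wedge_22\<close>)
  then show ?thesis
    by (simp add: liouville_form_def wedge_add_left wedge_add_right wedge_cmult_left wedge_D D_sort fact_numeral)
qed

lemma contract_p:
  assumes X: "X \<in> T" and us: "us \<in> vectors 2 T"
  shows "contract X p us = e 1 X * D [4,6] us + (- e 4 X) * D [1,6] us + e 6 X * D [1,4] us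
    + e 2 X * D [3,6] us + (- e 3 X) * D [2,6] us + e 6 X * D [2,3] us
    + e 2 X * D [4,5] us + (- e 4 X) * D [2,5] us + e 5 X * D [2,4] us"
proof -
  have "X # us \<in> vectors 3 T" "length us = 2" using X us by (auto simp: vectors_def)
  then have "contract X p us = dform [e 1, e 4, e 6] (X # us) + dform [e 2, e 3, e 6] (X # us) + dform [e 2, e 4, e 5] (X # us)"
    by (simp add: contract_def p)
  then show ?thesis
    using \<open>length us = 2\<close> D_swaps(1)[where a=4 and b=1 and as="[]" and vs=us]
      D_swaps(1)[where a=3 and b=2 and as="[]" and vs=us] D_swaps(1)[where a=4 and b=2 and as="[]" and vs=us]
    by (simp add: dform_Cons D_def lessThan_Suc)
qed

text \<open>Each of the three 5-forms that survive comes from two of the products. This is the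
  origin of the factor 2 in \<open>Kv\<close>.\<close>

lemma wedge_contract_p:
  assumes X: "X \<in> T" and us: "us \<in> vectors 5 T"
  shows "wedge 2 3 (contract X p) p us =
    2 * (e 2 X * D [2,3,4,5,6] us + e 4 X * D [1,2,4,5,6] us + e 6 X * D [1,2,3,4,6] us)"
proof -
  have "wedge 2 3 (contract X p) p us =
      wedge 2 3 (\<lambda>us. e 1 X * D [4,6] us + (- e 4 X) * D [1,6] us + e 6 X * D [1,4] us
        + e 2 X * D [3,6] us + (- e 3 X) * D [2,6] us + e 6 X * D [2,3] us
        + e 2 X * D [4,5] us + (- e 4 X) * D [2,5] us + e 5 X * D [2,4] us)
        (\<lambda>vs. D [1,4,6] vs + D [2,3,6] vs + D [2,4,5] vs) us"
    by (rule wedge_cong[where V=T]) (use us X in \<open>auto simp: p_D contract_p\<close>)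
  then show ?thesis
    by (simp only: wedge_add_left wedge_add_right wedge_cmult_left)
      (simp add: wedge_D D_sort algebra_simps)
qed

lemma contract_D:
  assumes us: "length us = 5"
  shows "D [1,2,3,4,5,6] (Y # us) = e 1 Y * D [2,3,4,5,6] us - e 2 Y * D [1,3,4,5,6] us
    + e 3 Y * D [1,2,4,5,6] us - e 4 Y * D [1,2,3,5,6] us + e 5 Y * D [1,2,3,4,6] us - e 6 Y * D [1,2,3,4,5] us"
proof -
  have "D [1,2,3,4,5,6] (Y # us) = e 1 Y * D [2,3,4,5,6] us - e 2 Y * D [1,3,4,5,6] us
    - e 3 Y * D [2,1,4,5,6] us - e 4 Y * D [2,3,1,5,6] us - e 5 Y * D [2,3,4,1,6] us - e 6 Y * D [2,3,4,5,1] us"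
    using us by (simp add: dform_Cons D_def lessThan_Suc)
  then show ?thesis by (simp add: D_sort)
qed

text \<open>The relation under \<open>THE\<close> in \<open>K_endo\<close>, at a single
  point.\<close>

definition K_rel :: "'v \<Rightarrow> 'v \<Rightarrow> bool" where
  "K_rel X Y \<longleftrightarrow> Y \<in> T \<and> (\<forall>vs\<in>vectors 5 T.
    contract Y (liouville_form w) vs = - wedge 2 3 (contract X p) p vs)"

lemma contract_liouville:
  assumes "Y \<in> T" "vs \<in> vectors 5 T"
  shows "contract Y (liouville_form w) vs = e 1 Y * D [2,3,4,5,6] vs - e 2 Y * D [1,3,4,5,6] vs
    + e 3 Y * D [1,2,4,5,6] vs - e 4 Y * D [1,2,3,5,6] vs + e 5 Y * D [1,2,3,4,6] vs - e 6 Y * D [1,2,3,4,5] vs"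
proof -
  have "Y # vs \<in> vectors 6 T" "length vs = 5" using assms by (auto simp: vectors_def)
  then show ?thesis by (simp add: contract_def liouville_D contract_D)
qed

lemma D_dual:
  assumes "distinct is" "set is \<noteq> {}" shows "D is (map f is) = 1"
proof -
  have "distinct (map e is)"
    using assms(1) by (auto simp: distinct_map inj_on_def) (metis e_f zero_neq_one)
  then show ?thesis unfolding D_def
    by (intro dform_dual) (use assms(1) in \<open>auto simp: nth_eq_iff_index_eq\<close>)
qed

lemma D_zero:
  assumes "a \<in> set is" "a \<notin> set js" "length js = length is" shows "D is (map f js) = 0"
  unfolding D_def by (rule dform_eq_0[of "e a"]) (use assms in auto)

lemma K_rel_iff:
  assumes X: "X \<in> T" shows "K_rel X Y \<longleftrightarrow> Y = Kv X"
proof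
  show "K_rel X Y" if "Y = Kv X"
    unfolding K_rel_def that by (auto simp: contract_liouville wedge_contract_p X)
next
  assume Y: "K_rel X Y"
  have YT: "Y \<in> T" using Y by (simp add: K_rel_def)
  have eq: "e 1 Y * D [2,3,4,5,6] vs - e 2 Y * D [1,3,4,5,6] vs
    + e 3 Y * D [1,2,4,5,6] vs - e 4 Y * D [1,2,3,5,6] vs + e 5 Y * D [1,2,3,4,6] vs - e 6 Y * D [1,2,3,4,5] vs =
    - (2 * (e 2 X * D [2,3,4,5,6] vs + e 4 X * D [1,2,4,5,6] vs + e 6 X * D [1,2,3,4,6] vs))"
    if "vs \<in> vectors 5 T" for vs
    using Y that contract_liouville[OF YT that] wedge_contract_p[OF X that] unfolding K_rel_def by simp
  have v: "map f is \<in> vectors 5 T" if "length is = 5" for "is" using that by (auto simp: vectors_def)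
  show "Y = Kv X"
  proof (rule eqI[OF YT Kv_T])
    fix i :: 6
    note z = D_zero[of 1] D_zero[of 2] D_zero[of 3] D_zero[of 4] D_zero[of 5] D_zero[of 6]
    \<comment> \<open>On the frame with \<open>f j\<close> left out, exactly one of the six 5-forms
      is nonzero, so each evaluation isolates one coordinate \<open>e j Y\<close>.\<close>
    have "e 1 Y = - 2 * e 2 X" using eq[OF v, of "[2,3,4,5,6]"] D_dual[of "[2,3,4,5,6]"]
      by (simp add: z del: list.map)
    moreover have "e 2 Y = 0" using eq[OF v, of "[1,3,4,5,6]"] D_dual[of "[1,3,4,5,6]"]
      by (simp add: z del: list.map)
    moreover have "e 3 Y = - 2 * e 4 X" using eq[OF v, of "[1,2,4,5,6]"] D_dual[of "[1,2,4,5,6]"]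
      by (simp add: z del: list.map)
    moreover have "e 4 Y = 0" using eq[OF v, of "[1,2,3,5,6]"] D_dual[of "[1,2,3,5,6]"]
      by (simp add: z del: list.map)
    moreover have "e 5 Y = - 2 * e 6 X" using eq[OF v, of "[1,2,3,4,6]"] D_dual[of "[1,2,3,4,6]"]
      by (simp add: z del: list.map)
    moreover have "e 6 Y = 0" using eq[OF v, of "[1,2,3,4,5]"] D_dual[of "[1,2,3,4,5]"]
      by (simp add: z del: list.map)
    moreover have "\<forall>i. e i Y = e i (Kv X)"
      unfolding forall_6 using calculation by simp
    ultimately show "e i Y = e i (Kv X)" by blast
  qed
qed

lemma Kv_the: "X \<in> T \<Longrightarrow> (THE Y. Y \<in> T \<and> (\<forall>vs\<in>vectors 5 T.
    contract Y (liouville_form w) vs = - wedge 2 3 (contract X p) p vs)) = Kv X"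
  using K_rel_iff unfolding K_rel_def by auto

lemma Kv_linear: "linear_map_on T T Kv"
  unfolding linear_map_on_def
proof (intro conjI ballI allI)
  fix u v a b assume uv: "u \<in> T" "v \<in> T"
  have "\<forall>i. e i (Kv (a *\<^sub>R u + b *\<^sub>R v)) = e i (a *\<^sub>R Kv u + b *\<^sub>R Kv v)"
    unfolding forall_6 using uv by (simp add: algebra_simps)
  then show "Kv (a *\<^sub>R u + b *\<^sub>R v) = a *\<^sub>R Kv u + b *\<^sub>R Kv v"
    using uv by (intro eqI) auto
qed auto

lemma Kv_eq_0_iff: "v \<in> T \<Longrightarrow> Kv v = 0 \<longleftrightarrow> e 2 v = 0 \<and> e 4 v = 0 \<and> e 6 v = 0"
proof
  assume "Kv v = 0"
  then have "e i (Kv v) = 0" for i by simp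
  from this[of 1] this[of 3] this[of 5] show "e 2 v = 0 \<and> e 4 v = 0 \<and> e 6 v = 0" by simp
qed (simp add: Kv_def)

lemma Kv_Kv [simp]: "Kv (Kv v) = 0" by (subst Kv_eq_0_iff) auto

lemma Kv_image: "{v \<in> T. Kv v = 0} = Kv ` T"
proof safe
  fix v assume v: "v \<in> T" "Kv v = 0"
  \<comment> \<open>The factor -1/2 inverts the -2 in \<open>Kv\<close>.\<close>
  let ?u = "(- e 1 v / 2) *\<^sub>R f 2 + (- e 3 v / 2) *\<^sub>R f 4 + (- e 5 v / 2) *\<^sub>R f 6"
  have u: "?u \<in> T" by (intro T_add T_scale f_T)
  have "\<forall>i. e i v = e i (Kv ?u)" unfolding forall_6 using v by (simp add: Kv_eq_0_iff)
  then have "v = Kv ?u" by (intro eqI[OF v(1) Kv_T]) blast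
  then show "v \<in> Kv ` T" using u by blast
qed auto

lemma lagrangian: "v \<in> T \<Longrightarrow> (\<forall>u\<in>T. Kv u = 0 \<longrightarrow> w [v, u] = 0) \<longleftrightarrow> Kv v = 0"
proof
  assume v: "v \<in> T" and *: "\<forall>u\<in>T. Kv u = 0 \<longrightarrow> w [v, u] = 0"
  have "w [v, f 1] = 0" "w [v, f 3] = 0" "w [v, f 5] = 0"
    using * by (auto simp: Kv_eq_0_iff)
  then show "Kv v = 0" using v by (simp add: w_eq Kv_eq_0_iff)
qed (auto simp: w_eq Kv_eq_0_iff)

lemma g_eq: "u \<in> T \<Longrightarrow> v \<in> T \<Longrightarrow> w [u, Kv v] = 2 * (e 2 u * e 2 v + e 4 u * e 4 v + e 6 u * e 6 v)"
  by (simp add: w_eq)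

lemma F_eq: "u \<in> T \<Longrightarrow> v \<in> T \<Longrightarrow> x \<in> T \<Longrightarrow> - 2 * p [Kv u, v, x] = 4 * dform [e 2, e 4, e 6] [u, v, x]"
  by (simp add: p_eq vectors_def dform_3 algebra_simps)

lemma p_nondegenerate:
  assumes v: "v \<in> T" and *: "\<And>x y. x \<in> T \<Longrightarrow> y \<in> T \<Longrightarrow> p [v, x, y] = 0" shows "v = 0"
proof (rule eqI[OF v T_0])
  fix i
  \<comment> \<open>In this order, the six values are \<open>e 1 v\<close> to
    \<open>e 6 v\<close>.\<close>
  have "p [v, f 4, f 6] = 0" "p [v, f 3, f 6] = 0" "p [v, f 6, f 2] = 0" "p [v, f 5, f 2] = 0"
    "p [v, f 2, f 4] = 0" "p [v, f 1, f 4] = 0" using * by auto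
  then have "\<forall>i. e i v = e i 0" unfolding forall_6 using v by (simp add: p_eq vectors_def)
  then show "e i v = e i 0" by blast
qed

end

section \<open>Tangent vectors in charts\<close>

text \<open>The Leibniz rule for a field of linear maps whose derivative is known only at each fixed
  vector. It serves wherever \<open>K\<close> or \<phi> is differentiated along a varying vector
  field.\<close>

lemma has_derivative_apply_family:
  fixes L :: "'a::real_normed_vector \<Rightarrow> 'b::euclidean_space \<Rightarrow> 'c::real_normed_vector"
  assumes N: "open N" "x0 \<in> N" and lin: "\<And>x. x \<in> N \<Longrightarrow> linear (L x)"
    and L': "\<And>v. ((\<lambda>x. L x v) has_derivative L' v) (at x0)" and h: "(h has_derivative h') (at x0)"
  shows "((\<lambda>x. L x (h x)) has_derivative (\<lambda>w. L' (h x0) w + L x0 (h' w))) (at x0)"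
proof -
  have exp: "L x v = (\<Sum>b\<in>Basis. (v \<bullet> b) *\<^sub>R L x b)" if "x \<in> N" for x v
    by (rule euclidean_linear_sum[OF lin[OF that]])
  \<comment> \<open>That \<open>L'\<close> is linear in \<open>v\<close> follows from the uniqueness
    of the derivative.\<close>
  have L'exp: "L' v w = (\<Sum>b\<in>Basis. (v \<bullet> b) *\<^sub>R L' b w)" for v w
  proof -
    have "((\<lambda>x. \<Sum>b\<in>Basis. (v \<bullet> b) *\<^sub>R L x b) has_derivative (\<lambda>w. \<Sum>b\<in>Basis. (v \<bullet> b) *\<^sub>R L' b w)) (at x0)"
      by (intro has_derivative_sum has_derivative_scaleR_right L')
    then have "((\<lambda>x. L x v) has_derivative (\<lambda>w. \<Sum>b\<in>Basis. (v \<bullet> b) *\<^sub>R L' b w)) (at x0)"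
      by (rule has_derivative_transform_within_open[OF _ N]) (rule exp[symmetric])
    from has_derivative_unique[OF L' this] show ?thesis by metis
  qed
  have "((\<lambda>x. \<Sum>b\<in>Basis. (h x \<bullet> b) *\<^sub>R L x b) has_derivative
      (\<lambda>w. \<Sum>b\<in>Basis. (h x0 \<bullet> b) *\<^sub>R L' b w + (h' w \<bullet> b) *\<^sub>R L x0 b)) (at x0)"
    by (intro has_derivative_sum has_derivative_scaleR L' has_derivative_inner_left h)
  then have "((\<lambda>x. L x (h x)) has_derivative
      (\<lambda>w. \<Sum>b\<in>Basis. (h x0 \<bullet> b) *\<^sub>R L' b w + (h' w \<bullet> b) *\<^sub>R L x0 b)) (at x0)"
    by (rule has_derivative_transform_within_open[OF _ N]) (rule exp[symmetric])
  then show ?thesis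
    unfolding sum.distrib L'exp[symmetric] exp[OF N(2), symmetric] .
qed

lemma smooth_on_apply_family:
  fixes L :: "'a::euclidean_space \<Rightarrow> 'b::euclidean_space \<Rightarrow> 'c::real_normed_vector"
  assumes N: "open N" and lin: "\<And>x. x \<in> N \<Longrightarrow> linear (L x)"
    and L: "\<And>v. smooth_on N (\<lambda>x. L x v)" and h: "smooth_on N h"
  shows "smooth_on N (\<lambda>x. L x (h x))"
proof (rule smooth_on_cong[OF N])
  show "smooth_on N (\<lambda>x. \<Sum>b\<in>Basis. (h x \<bullet> b) *\<^sub>R L x b)"
    by (intro smooth_on_sum[OF N] smooth_on_scaleR[OF N] L smooth_on_bounded_linear[OF bounded_linear_inner_left N h])
qed (rule euclidean_linear_sum[OF lin, symmetric])

locale smooth_mfd =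
  fixes A :: "('a::{t2_space, second_countable_topology}, 'n::finite) chart set"
  assumes smooth_str: "smooth_structure A"
begin

abbreviation "T \<equiv> tangent_space A"

abbreviation img :: "('a, 'n) chart \<Rightarrow> (real ^ 'n) set" where "img c \<equiv> snd c ` fst c"

lemma chartD: assumes "c \<in> A" shows "open (fst c)" "open (img c)"
    "homeomorphism (fst c) (img c) (snd c) (chart_inv c)"
  using smooth_str assms by (auto simp: smooth_structure_def is_chart_def)

lemmas chart_open = chartD(1) and image_open = chartD(2)

lemma chart_inv_snd [simp]: "c \<in> A \<Longrightarrow> p \<in> fst c \<Longrightarrow> chart_inv c (snd c p) = p"
  and snd_chart_inv [simp]: "c \<in> A \<Longrightarrow> x \<in> img c \<Longrightarrow> snd c (chart_inv c x) = x"
  and chart_inv_in [simp]: "c \<in> A \<Longrightarrow> x \<in> img c \<Longrightarrow> chart_inv c x \<in> fst c"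
  using chartD(3)[of c] unfolding homeomorphism_def by blast+

lemma chart_at: obtains c where "c \<in> A" "p \<in> fst c"
proof -
  have "p \<in> (\<Union>c\<in>A. fst c)" using smooth_str unfolding smooth_structure_def by simp
  then show ?thesis using that by (elim UN_E)
qed

lemma img_Int: "c \<in> A \<Longrightarrow> snd c ` (fst c \<inter> U) = img c \<inter> chart_inv c -` U"
proof (intro equalityI subsetI)
  fix x assume c: "c \<in> A" and "x \<in> img c \<inter> chart_inv c -` U"
  then have "x \<in> img c" "chart_inv c x \<in> fst c \<inter> U" by auto
  then show "x \<in> snd c ` (fst c \<inter> U)" using snd_chart_inv[OF c] by (metis imageI)
qed auto

lemma open_img_Int: "c \<in> A \<Longrightarrow> open U \<Longrightarrow> open (snd c ` (fst c \<inter> U))"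
  unfolding img_Int using chartD[of c] continuous_on_open_vimage[of "img c" "chart_inv c"]
  by (auto simp: homeomorphism_def Int_commute)

lemma transition_smooth:
  "c \<in> A \<Longrightarrow> c' \<in> A \<Longrightarrow> smooth_on (snd c ` (fst c \<inter> fst c')) (transition c c')"
  using smooth_str by (auto simp: smooth_structure_def compatible_def)

definition dtr :: "('a, 'n) chart \<Rightarrow> ('a, 'n) chart \<Rightarrow> 'a \<Rightarrow> real ^ 'n \<Rightarrow> real ^ 'n" where
  "dtr c c' p = frechet_derivative (transition c c') (at (snd c p))"

lemma transition_snd: "c \<in> A \<Longrightarrow> p \<in> fst c \<Longrightarrow> transition c c' (snd c p) = snd c' p"
  by (simp add: transition_def)

lemma dtr: 
  assumes "c \<in> A" "c' \<in> A" "p \<in> fst c" "p \<in> fst c'"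
  shows "(transition c c' has_derivative dtr c c' p) (at (snd c p))"
  unfolding dtr_def
  by (rule smooth_on_has_derivative[OF transition_smooth[OF assms(1,2)]]) (use assms in auto)

lemma dtr_linear:
  assumes "c \<in> A" "c' \<in> A" "p \<in> fst c" "p \<in> fst c'" shows "linear (dtr c c' p)"
  using dtr[OF assms] has_derivative_linear by blast

lemma dtr_id: 
  assumes "c \<in> A" "p \<in> fst c" shows "dtr c c p v = v"
proof -
  have "((\<lambda>x. x) has_derivative (\<lambda>v. v)) (at (snd c p))" by (rule has_derivative_ident)
  then have "(transition c c has_derivative (\<lambda>v. v)) (at (snd c p))"
    by (rule has_derivative_transform_within_open[OF _ chartD(2)[OF assms(1)]])
      (use assms in \<open>auto simp: transition_snd\<close>)
  from has_derivative_unique[OF dtr[OF assms(1,1,2,2)] this] show ?thesis by metis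
qed

lemma dtr_dtr: 
  assumes "c \<in> A" "c' \<in> A" "c'' \<in> A" "p \<in> fst c" "p \<in> fst c'" "p \<in> fst c''"
  shows "dtr c' c'' p (dtr c c' p v) = dtr c c'' p v"
proof -
  have "(transition c' c'' has_derivative dtr c' c'' p) (at (transition c c' (snd c p)))"
    using dtr[of c' c'' p] assms by (simp add: transition_snd)
  from has_derivative_compose[OF dtr[of c c' p] this]
  have "((\<lambda>x. transition c' c'' (transition c c' x)) has_derivative (\<lambda>v. dtr c' c'' p (dtr c c' p v))) (at (snd c p))"
    using assms by blast
  then have "(transition c c'' has_derivative (\<lambda>v. dtr c' c'' p (dtr c c' p v))) (at (snd c p))"
    by (rule has_derivative_transform_within_open[OF _ open_img_Int[of c "fst c'"]])
      (use assms chart_open in \<open>auto simp: transition_snd\<close>)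
  from has_derivative_unique[OF dtr[of c c'' p] this] assms show ?thesis by metis
qed

section \<open>Tangent spaces and coordinates of tangent vectors\<close>

lemma tangent_space_dtr:
  "v \<in> T p \<Longrightarrow> c \<in> A \<Longrightarrow> c' \<in> A \<Longrightarrow> p \<in> fst c \<Longrightarrow> p \<in> fst c' \<Longrightarrow> v c' = dtr c c' p (v c)"
  unfolding tangent_space_def dtr_def mem_Collect_eq by meson

lemma tangent_space_0: "v \<in> T p \<Longrightarrow> c \<notin> A \<or> p \<notin> fst c \<Longrightarrow> v c = 0"
  unfolding tangent_space_def mem_Collect_eq by meson

lemma tangent_spaceI:
  assumes "\<And>c. c \<notin> A \<or> p \<notin> fst c \<Longrightarrow> v c = 0"
    "\<And>c c'. c \<in> A \<Longrightarrow> c' \<in> A \<Longrightarrow> p \<in> fst c \<Longrightarrow> p \<in> fst c' \<Longrightarrow> v c' = dtr c c' p (v c)"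
  shows "v \<in> T p"
  unfolding tangent_space_def mem_Collect_eq
proof (intro conjI allI impI ballI)
  fix c c' assume c: "c \<in> A" "c' \<in> A" "p \<in> fst c \<and> p \<in> fst c'"
  then have "p \<in> fst c" "p \<in> fst c'" by blast+
  then show "v c' = frechet_derivative (transition c c') (at (snd c p)) (v c)"
    using assms(2)[OF c(1,2)] unfolding dtr_def by blast
qed (rule assms(1))

lemma tvec_of_apply: "c' \<in> A \<Longrightarrow> p \<in> fst c' \<Longrightarrow> tvec_of A c p x c' = dtr c c' p x"
  by (simp add: tvec_of_def dtr_def)

lemma tvec_of_self [simp]: "c \<in> A \<Longrightarrow> p \<in> fst c \<Longrightarrow> tvec_of A c p x c = x"
  by (simp add: tvec_of_apply dtr_id)

lemma tvec_of_T [simp]: "c \<in> A \<Longrightarrow> p \<in> fst c \<Longrightarrow> tvec_of A c p x \<in> T p"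
proof (rule tangent_spaceI)
  fix c1 c2 assume "c \<in> A" "p \<in> fst c" "c1 \<in> A" "c2 \<in> A" "p \<in> fst c1" "p \<in> fst c2"
  then show "tvec_of A c p x c2 = dtr c1 c2 p (tvec_of A c p x c1)"
    by (simp add: tvec_of_apply dtr_dtr)
qed (unfold tvec_of_def, rule if_not_P, blast)

lemma tangent_eqI:
  assumes "u \<in> T p" "v \<in> T p" "c \<in> A" "p \<in> fst c" "u c = v c" shows "u = v"
proof
  fix c'
  show "u c' = v c'"
  proof (cases "c' \<in> A \<and> p \<in> fst c'")
    case True
    then show ?thesis
      using tangent_space_dtr[OF assms(1,3), of c'] tangent_space_dtr[OF assms(2,3), of c'] assms(4,5) by simp
  next
    case False
    then show ?thesis
      using tangent_space_0[OF assms(1), of c'] tangent_space_0[OF assms(2), of c'] by simp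
  qed
qed

lemma tvec_of_chart: "v \<in> T p \<Longrightarrow> c \<in> A \<Longrightarrow> p \<in> fst c \<Longrightarrow> tvec_of A c p (v c) = v"
  by (rule tangent_eqI) auto

lemma tangent_add: "(u + v) c = u c + v c" and tangent_scale: "(r *\<^sub>R u) c = r *\<^sub>R u c"
  for u v :: "('a, 'n) tvec"
  by (simp_all add: scaleR_fun_def)

lemma subspace_T: "subspace (T p)"
proof (rule subspaceI)
  show "0 \<in> T p"
    by (rule tangent_spaceI) (simp_all add: linear_0[OF dtr_linear])
  fix u v and r :: real assume u: "u \<in> T p" and v: "v \<in> T p"
  have d: "u c' + v c' = dtr c c' p (u c + v c)" "r *\<^sub>R u c' = dtr c c' p (r *\<^sub>R u c)"
    if "c \<in> A" "c' \<in> A" "p \<in> fst c" "p \<in> fst c'" for c c'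
    using tangent_space_dtr[OF u that] tangent_space_dtr[OF v that] dtr_linear[OF that]
    by (simp_all add: linear_add linear_cmul)
  show "u + v \<in> T p"
    by (rule tangent_spaceI; unfold tangent_add) (simp add: tangent_space_0[OF u] tangent_space_0[OF v], rule d)
  show "r *\<^sub>R u \<in> T p"
    by (rule tangent_spaceI; unfold tangent_scale) (simp add: tangent_space_0[OF u], rule d)
qed

lemma tvec_of_add:
  assumes c: "c \<in> A" "p \<in> fst c"
  shows "tvec_of A c p (x + y) = tvec_of A c p x + tvec_of A c p y"
proof (rule tangent_eqI[OF _ _ c])
  show "tvec_of A c p x + tvec_of A c p y \<in> T p"
    by (intro subspace_add[OF subspace_T] tvec_of_T c)
qed (use c in simp_all)

lemma tvec_of_scale:
  assumes c: "c \<in> A" "p \<in> fst c"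
  shows "tvec_of A c p (r *\<^sub>R x) = r *\<^sub>R tvec_of A c p x"
proof (rule tangent_eqI[OF _ _ c])
  show "r *\<^sub>R tvec_of A c p x \<in> T p"
    by (intro subspace_scale[OF subspace_T] tvec_of_T c)
qed (use c in \<open>simp_all add: tangent_scale\<close>)

lemma tvec_of_0: "c \<in> A \<Longrightarrow> p \<in> fst c \<Longrightarrow> tvec_of A c p 0 = 0"
  using tvec_of_scale[of c p 0 0] by simp

lemma sum_apply_chart: "(\<Sum>i\<in>I. v i) c = (\<Sum>i\<in>I. v i c)" for v :: "'i \<Rightarrow> ('a, 'n) tvec"
  by (induction I rule: infinite_finite_induct) auto

text \<open>The coordinates of a tangent vector in a chart are linear functionals, hence
  combinations of the \<open>e i\<close>, and the columns of the coefficient matrix form the frame.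
  Comparing two expansions of \<open>e i\<close> then gives duality, because the coefficients are
  unique.\<close>

lemma dual_basis_frame:
  fixes e :: "'n \<Rightarrow> ('a, 'n) tvec \<Rightarrow> real"
  assumes e: "dual_basis_on (T p) e"
  obtains f where "\<And>i. f i \<in> T p" "\<And>i j. e i (f j) = (if i = j then 1 else 0)"
    "\<And>v. v \<in> T p \<Longrightarrow> v = (\<Sum>i\<in>UNIV. e i v *\<^sub>R f i)"
proof -
  obtain c where c: "c \<in> A" "p \<in> fst c" by (rule chart_at)
  have lin: "linear_map_on (T p) UNIV (e i)" for i using e by (simp add: dual_basis_on_def)
  have uniq: "\<exists>!a :: real ^ 'n. \<forall>v\<in>T p. h v = (\<Sum>i\<in>UNIV. a $ i * e i v)" if "linear_map_on (T p) UNIV h" for h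
    using e that by (simp add: dual_basis_on_def)
  have "linear_map_on (T p) UNIV (\<lambda>v. v c $ k)" for k
    by (simp add: linear_map_on_def scaleR_fun_def)
  then have "\<forall>k. \<exists>a :: real ^ 'n. \<forall>v\<in>T p. v c $ k = (\<Sum>i\<in>UNIV. a $ i * e i v)" using uniq by blast
  then obtain a :: "'n \<Rightarrow> real ^ 'n" where a: "\<And>k v. v \<in> T p \<Longrightarrow> v c $ k = (\<Sum>i\<in>UNIV. a k $ i * e i v)" by metis
  define f where "f j = tvec_of A c p (\<chi> k. a k $ j)" for j
  have fT: "f j \<in> T p" for j using c by (simp add: f_def)
  have exp: "v = (\<Sum>i\<in>UNIV. e i v *\<^sub>R f i)" if v: "v \<in> T p" for v
  proof (rule tangent_eqI[OF v _ c])
    show "(\<Sum>i\<in>UNIV. e i v *\<^sub>R f i) \<in> T p"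
      using fT by (intro subspace_sum[OF subspace_T] subspace_scale[OF subspace_T])
    show "v c = (\<Sum>i\<in>UNIV. e i v *\<^sub>R f i) c"
      using a[OF v] c by (simp add: vec_eq_iff sum_apply_chart f_def scaleR_fun_def mult.commute)
  qed
  have e0: "e i 0 = 0" for i
    using linear_map_on_scale[OF lin subspace_0[OF subspace_T], of i 0] by (simp only: scaleR_zero_left)
  have esum: "e i (\<Sum>j\<in>J. r j *\<^sub>R f j) = (\<Sum>j\<in>J. r j * e i (f j))" for i J r
  proof (induction J rule: infinite_finite_induct)
    case (insert j J)
    have J: "(\<Sum>j\<in>J. r j *\<^sub>R f j) \<in> T p"
      using fT by (intro subspace_sum[OF subspace_T] subspace_scale[OF subspace_T])
    show ?case
      unfolding sum.insert[OF insert(1,2)] linear_map_on_add[OF lin subspace_scale[OF subspace_T fT] J]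
        insert(3) linear_map_on_scale[OF lin fT] by simp
  next
    case empty
    show ?case by (simp only: sum.empty e0)
  next
    case (infinite J)
    show ?case unfolding sum.infinite[OF infinite] e0 by (rule refl)
  qed
  have "e i (f j) = (if i = j then 1 else 0)" for i j
  proof -
    have 1: "\<forall>v\<in>T p. e i v = (\<Sum>j\<in>UNIV. (\<chi> j. e i (f j)) $ j * e j v)"
    proof
      fix v assume v: "v \<in> T p"
      have "e i v = e i (\<Sum>j\<in>UNIV. e j v *\<^sub>R f j)" using exp[OF v] by (rule arg_cong)
      then show "e i v = (\<Sum>j\<in>UNIV. (\<chi> j. e i (f j)) $ j * e j v)"
        unfolding esum by (simp add: mult.commute)
    qed
    have 2: "\<forall>v\<in>T p. e i v = (\<Sum>j\<in>UNIV. (\<chi> j. if i = j then 1 else 0) $ j * e j v)"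
      by (simp add: if_distrib if_distribR cong: if_cong)
    have "(\<chi> j. e i (f j)) = (\<chi> j. if i = j then 1 else (0 :: real))"
      using uniq[OF lin, of i] 1 2 by blast
    then show ?thesis by (simp add: vec_eq_iff)
  qed
  then show ?thesis using that[of f] fT exp by blast
qed

section \<open>Vector fields and the Lie bracket\<close>

lemma vector_field_T: "vector_field_on A U X \<Longrightarrow> p \<in> U \<Longrightarrow> X p \<in> T p"
  and vector_field_smooth: "vector_field_on A U X \<Longrightarrow> c \<in> A \<Longrightarrow>
    smooth_on (snd c ` (fst c \<inter> U)) (\<lambda>x. X (chart_inv c x) c)"
  by (auto simp: vector_field_on_def)

text \<open>The coordinates of \<open>X\<close> in the two charts are related by the derivative of
  the transition map, and this relation is differentiated. The term with the second derivative of
  the transition map is symmetric in its two directions, so it cancels in the bracket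
  (\<open>lie_bracket_T\<close>).\<close>

lemma vector_field_chart_change:
  assumes X: "vector_field_on A U X" and U: "open U" and c: "c \<in> A" "c' \<in> A"
    and p: "p \<in> U" "p \<in> fst c" "p \<in> fst c'"
  defines "Xc \<equiv> \<lambda>x. X (chart_inv c x) c" and "Xc' \<equiv> \<lambda>x. X (chart_inv c' x) c'"
  shows "frechet_derivative Xc' (at (snd c' p)) (dtr c c' p w) =
    frechet_derivative (\<lambda>y. frechet_derivative (transition c c') (at y) (X p c)) (at (snd c p)) w
      + dtr c c' p (frechet_derivative Xc (at (snd c p)) w)"
proof -
  define S where "S = snd c ` (fst c \<inter> (fst c' \<inter> U))"
  have S: "open S" "snd c p \<in> S" unfolding S_def using c p U by (auto intro!: open_img_Int open_Int chart_open)
  have in_S: "x \<in> img c" "chart_inv c x \<in> fst c'" "chart_inv c x \<in> U" if "x \<in> S" for x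
    using that c by (auto simp: S_def)
  let ?D = "\<lambda>y. frechet_derivative (transition c c') (at y)"
  have sS: "S \<subseteq> snd c ` (fst c \<inter> fst c')" by (auto simp: S_def)
  have tS: "smooth_on S (transition c c')"
    by (rule smooth_on_subset[OF transition_smooth[OF c] _ sS S(1)]) (use c chart_open open_img_Int in auto)
  have "(Xc' has_derivative frechet_derivative Xc' (at (snd c' p))) (at (transition c c' (snd c p)))"
    unfolding Xc'_def transition_snd[OF c(1) p(2)]
    by (rule smooth_on_has_derivative[OF vector_field_smooth[OF X c(2)]]) (use p in auto)
  from has_derivative_compose[OF dtr[OF c p(2,3)] this]
  have 1: "((\<lambda>x. Xc' (transition c c' x)) has_derivative (\<lambda>w. frechet_derivative Xc' (at (snd c' p)) (dtr c c' p w))) (at (snd c p))" .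
  have hX: "(Xc has_derivative frechet_derivative Xc (at (snd c p))) (at (snd c p))"
    unfolding Xc_def
    by (rule smooth_on_has_derivative[OF vector_field_smooth[OF X c(1)]]) (use p in auto)
  have "((\<lambda>x. ?D x (Xc x)) has_derivative (\<lambda>w. frechet_derivative (\<lambda>y. ?D y (Xc (snd c p))) (at (snd c p)) w
      + ?D (snd c p) (frechet_derivative Xc (at (snd c p)) w))) (at (snd c p))"
  proof (rule has_derivative_apply_family[OF S _ _ hX])
    show "linear (?D x)" if "x \<in> S" for x
      using smooth_on_has_derivative[OF tS that] has_derivative_linear by blast
    show "((\<lambda>x. ?D x v) has_derivative frechet_derivative (\<lambda>y. ?D y v) (at (snd c p))) (at (snd c p))" for v
      by (rule smooth_on_has_derivative[OF smooth_on_derivative[OF tS] S(2)])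
  qed
  then have 2: "((\<lambda>x. Xc' (transition c c' x)) has_derivative (\<lambda>w. frechet_derivative (\<lambda>y. ?D y (Xc (snd c p))) (at (snd c p)) w
      + ?D (snd c p) (frechet_derivative Xc (at (snd c p)) w))) (at (snd c p))"
  proof (rule has_derivative_transform_within_open[OF _ S])
    fix x assume x: "x \<in> S"
    have "X (chart_inv c x) c' = dtr c c' (chart_inv c x) (X (chart_inv c x) c)"
      by (rule tangent_space_dtr[OF vector_field_T[OF X]]) (use x in_S c in auto)
    then show "?D x (Xc x) = Xc' (transition c c' x)"
      using x in_S c by (simp add: Xc'_def Xc_def transition_def dtr_def)
  qed
  from has_derivative_unique[OF 1 2] show ?thesis
    using p c by (simp add: fun_eq_iff Xc_def dtr_def)
qed

lemma lie_bracket_T: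
  assumes X: "vector_field_on A U X" and Y: "vector_field_on A U Y" and U: "open U" and p: "p \<in> U"
  shows "lie_bracket A X Y p \<in> T p"
proof (rule tangent_spaceI)
  fix c c' assume c: "c \<in> A" "c' \<in> A" and pc: "p \<in> fst c" "p \<in> fst c'"
  have sym: "frechet_derivative (\<lambda>y. frechet_derivative (transition c c') (at y) u) (at (snd c p)) v =
     frechet_derivative (\<lambda>y. frechet_derivative (transition c c') (at y) v) (at (snd c p)) u" for u v
    by (rule symmetric_second_derivative[OF _ transition_smooth[OF c]]) (use c pc chart_open open_img_Int in auto)
  show "lie_bracket A X Y p c' = dtr c c' p (lie_bracket A X Y p c)"
    using vector_field_chart_change[OF X U c p pc, of "Y p c"] vector_field_chart_change[OF Y U c p pc, of "X p c"]
      tangent_space_dtr[OF vector_field_T[OF X p] c pc] tangent_space_dtr[OF vector_field_T[OF Y p] c pc]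
      sym[of "X p c" "Y p c"] linear_diff[OF dtr_linear[OF c pc]] c pc
    by (simp add: lie_bracket_def)
qed (auto simp: lie_bracket_def)

text \<open>These fields extend tangent vectors to a neighbourhood. They supply the smooth local
  frames needed for the metric on the kernel and for the orientations.\<close>

lemma const_vector_field:
  assumes c: "c \<in> A" shows "vector_field_on A (fst c) (\<lambda>p. tvec_of A c p v)"
  unfolding vector_field_on_def
proof (intro conjI ballI)
  fix c' assume c': "c' \<in> A"
  have o: "open (snd c' ` (fst c' \<inter> fst c))" "open (snd c ` (fst c \<inter> fst c'))"
    using open_img_Int chart_open c c' by auto
  have "smooth_on (snd c' ` (fst c' \<inter> fst c)) (\<lambda>x. frechet_derivative (transition c c') (at (transition c' c x)) v)"
    by (rule smooth_on_compose[OF o _ smooth_on_derivative[OF transition_smooth[OF c c']] transition_smooth[OF c' c]])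
      (use c c' in \<open>auto simp: transition_snd\<close>)
  then show "smooth_on (snd c' ` (fst c' \<inter> fst c)) (\<lambda>x. tvec_of A c (chart_inv c' x) v c')"
    by (rule smooth_on_cong[OF o(1), rotated]) (use c c' in \<open>auto simp: tvec_of_apply dtr_def transition_snd\<close>)
qed (use c in auto)

end

lemma orbit_point_exists:
  fixes A :: "('a::{t2_space, second_countable_topology}, 6) chart set"
  assumes "smooth_structure A" "in_orbit_0_plus A \<omega> \<phi> p"
  shows "\<exists>e f. orbit_point (tangent_space A p) e f (\<omega> p) (\<phi> p)"
proof -
  interpret smooth_mfd A by unfold_locales (rule assms(1))
  obtain e :: "6 \<Rightarrow> ('a, 6) tvec \<Rightarrow> real" where e: "dual_basis_on (T p) e"
    and w: "\<forall>vs\<in>vectors 2 (T p). \<omega> p vs = wedge 1 1 (one_form (e 1)) (one_form (e 2)) vs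
      + wedge 1 1 (one_form (e 3)) (one_form (e 4)) vs + wedge 1 1 (one_form (e 5)) (one_form (e 6)) vs"
    and p: "\<forall>vs\<in>vectors 3 (T p). \<phi> p vs = wedge 2 1 (wedge 1 1 (one_form (e 1)) (one_form (e 4))) (one_form (e 6)) vs
      + wedge 2 1 (wedge 1 1 (one_form (e 2)) (one_form (e 3))) (one_form (e 6)) vs
      + wedge 2 1 (wedge 1 1 (one_form (e 2)) (one_form (e 4))) (one_form (e 5)) vs"
    using assms(2) unfolding in_orbit_0_plus_def Let_def by blast
  obtain f where f: "\<And>i. f i \<in> T p" "\<And>i j. e i (f j) = (if i = j then 1 else 0)"
    "\<And>v. v \<in> T p \<Longrightarrow> v = (\<Sum>i\<in>UNIV. e i v *\<^sub>R f i)"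
    using dual_basis_frame[OF e] by blast
  have of: "one_form a us = dform [a] us" if "us \<in> vectors 1 (T p)" for a us
    using that by (cases us) (auto simp: vectors_def one_form_def dform_Cons)
  have w2: "wedge 1 1 (one_form a) (one_form b) us = dform [a, b] us" if "us \<in> vectors 2 (T p)" for a b us
  proof -
    have "wedge 1 1 (one_form a) (one_form b) us = wedge 1 1 (dform [a]) (dform [b]) us"
      by (rule wedge_cong[where V="T p"]) (use of that in \<open>auto simp: numeral_2_eq_2\<close>)
    then show ?thesis by (simp add: wedge_dform)
  qed
  have w3: "wedge 2 1 (wedge 1 1 (one_form a) (one_form b)) (one_form d) us = dform [a, b, d] us"
    if "us \<in> vectors 3 (T p)" for a b d us
  proof -
    have "wedge 2 1 (wedge 1 1 (one_form a) (one_form b)) (one_form d) us = wedge 2 1 (dform [a, b]) (dform [d]) us"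
      by (rule wedge_cong[where V="T p"]) (use of w2 that in \<open>auto simp: eval_nat_numeral\<close>)
    then show ?thesis by (simp add: wedge_dform)
  qed
  have "orbit_point (T p) e f (\<omega> p) (\<phi> p)"
  proof (rule orbit_point.intro)
    show "linear_map_on (T p) UNIV (e i)" for i using e by (simp add: dual_basis_on_def)
    show "\<omega> p vs = dform [e 1, e 2] vs + dform [e 3, e 4] vs + dform [e 5, e 6] vs"
      if "vs \<in> vectors 2 (T p)" for vs using w that by (simp only: w2 ball_simps)
    show "\<phi> p vs = dform [e 1, e 4, e 6] vs + dform [e 2, e 3, e 6] vs + dform [e 2, e 4, e 5] vs"
      if "vs \<in> vectors 3 (T p)" for vs using p that by (simp only: w3 ball_simps)
  qed (rule subspace_T f | assumption)+
  then show ?thesis by blast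
qed

section \<open>The Nijenhuis tensor\<close>

locale nilpotent_field =
  fixes S :: "'a::euclidean_space set" and K :: "'a \<Rightarrow> 'a \<Rightarrow> 'a"
  assumes S: "open S" and K_lin: "\<And>x. x \<in> S \<Longrightarrow> linear (K x)"
    and K_smooth: "\<And>v. smooth_on S (\<lambda>x. K x v)" and K_K: "\<And>x v. x \<in> S \<Longrightarrow> K x (K x v) = 0"
begin

definition dK :: "'a \<Rightarrow> 'a \<Rightarrow> 'a \<Rightarrow> 'a" where
  "dK x w v = frechet_derivative (\<lambda>y. K y v) (at x) w"

lemma dK: "x \<in> S \<Longrightarrow> ((\<lambda>y. K y v) has_derivative (\<lambda>w. dK x w v)) (at x)"
  unfolding dK_def by (rule smooth_on_has_derivative[OF K_smooth])

lemma dK_linear_left: "x \<in> S \<Longrightarrow> linear (\<lambda>w. dK x w v)"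
  using dK has_derivative_linear by blast

lemma dK_smooth: "smooth_on S (\<lambda>x. dK x w v)"
  unfolding dK_def by (rule smooth_on_derivative[OF K_smooth])

lemma K_apply_has_derivative:
  "x \<in> S \<Longrightarrow> (h has_derivative h') (at x) \<Longrightarrow>
    ((\<lambda>y. K y (h y)) has_derivative (\<lambda>w. dK x w (h x) + K x (h' w))) (at x)"
  by (rule has_derivative_apply_family[OF S _ K_lin dK])

lemma dK_linear_right: assumes x: "x \<in> S" shows "linear (dK x w)"
proof (rule linearI)
  fix u v and r :: real
  have "((\<lambda>y. K y u + K y v) has_derivative (\<lambda>w. dK x w u + dK x w v)) (at x)"
    by (intro has_derivative_add dK x)
  then have "((\<lambda>y. K y (u + v)) has_derivative (\<lambda>w. dK x w u + dK x w v)) (at x)"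
    by (rule has_derivative_transform_within_open[OF _ S x]) (simp add: K_lin linear_add)
  from has_derivative_unique[OF dK[OF x] this] show "dK x w (u + v) = dK x w u + dK x w v" by metis
  have "((\<lambda>y. r *\<^sub>R K y v) has_derivative (\<lambda>w. r *\<^sub>R dK x w v)) (at x)"
    by (intro has_derivative_scaleR_right dK x)
  then have "((\<lambda>y. K y (r *\<^sub>R v)) has_derivative (\<lambda>w. r *\<^sub>R dK x w v)) (at x)"
    by (rule has_derivative_transform_within_open[OF _ S x]) (simp add: K_lin linear_cmul)
  from has_derivative_unique[OF dK[OF x] this] show "dK x w (r *\<^sub>R v) = r *\<^sub>R dK x w v" by metis
qed

text \<open>The derivative of the identity \<open>K x (K x v) = 0\<close>; it moves \<open>K\<close>
  past \<open>dK\<close> at the price of a sign.\<close>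

lemma dK_K: assumes x: "x \<in> S" shows "dK x w (K x v) = - K x (dK x w v)"
proof -
  have "((\<lambda>y. K y (K y v)) has_derivative (\<lambda>w. dK x w (K x v) + K x (dK x w v))) (at x)"
    by (rule K_apply_has_derivative[OF x dK[OF x]])
  moreover have "((\<lambda>y. K y (K y v)) has_derivative (\<lambda>w. 0)) (at x)"
    by (rule has_derivative_transform_within_open[OF has_derivative_const[of 0] S x]) (simp add: K_K)
  ultimately have "(\<lambda>w. dK x w (K x v) + K x (dK x w v)) = (\<lambda>w. 0)" by (rule has_derivative_unique)
  then show ?thesis by (metis add_eq_0_iff2)
qed

text \<open>The Nijenhuis tensor of \<open>K\<close> on the constant fields \<open>X\<close> and \<open>Y\<close>, whose bracket vanishes.\<close>

definition nij :: "'a \<Rightarrow> 'a \<Rightarrow> 'a \<Rightarrow> 'a" where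
  "nij x X Y = K x (dK x X Y - dK x Y X) - dK x (K x X) Y + dK x (K x Y) X"

end

locale closed_nilpotent = nilpotent_field +
  fixes p F :: "'a \<Rightarrow> 'a \<Rightarrow> 'a \<Rightarrow> 'a \<Rightarrow> real"
  assumes p_smooth: "\<And>a b c. smooth_on S (\<lambda>x. p x a b c)"
    and F_smooth: "\<And>a b c. smooth_on S (\<lambda>x. F x a b c)"
    and p_lin: "\<And>x b c. x \<in> S \<Longrightarrow> linear (\<lambda>a. p x a b c)"
    and F_lin: "\<And>x b c. x \<in> S \<Longrightarrow> linear (\<lambda>a. F x a b c)"
    and p_skew: "\<And>x a b c. x \<in> S \<Longrightarrow> p x b a c = - p x a b c"
    and F_skew: "\<And>x a b c. x \<in> S \<Longrightarrow> F x b a c = - F x a b c"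
    and F_p: "\<And>x a b c. x \<in> S \<Longrightarrow> F x a b c = - 2 * p x (K x a) b c"
    and F_K: "\<And>x a b c. x \<in> S \<Longrightarrow> F x (K x a) b c = 0"
    and p_nondeg: "\<And>x v. x \<in> S \<Longrightarrow> (\<And>b c. p x v b c = 0) \<Longrightarrow> v = 0"
    and p_closed: "\<And>x a b c d. x \<in> S \<Longrightarrow>
      frechet_derivative (\<lambda>y. p y b c d) (at x) a - frechet_derivative (\<lambda>y. p y a c d) (at x) b
      + frechet_derivative (\<lambda>y. p y a b d) (at x) c - frechet_derivative (\<lambda>y. p y a b c) (at x) d = 0"
    and F_closed: "\<And>x a b c d. x \<in> S \<Longrightarrow>
      frechet_derivative (\<lambda>y. F y b c d) (at x) a - frechet_derivative (\<lambda>y. F y a c d) (at x) b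
      + frechet_derivative (\<lambda>y. F y a b d) (at x) c - frechet_derivative (\<lambda>y. F y a b c) (at x) d = 0"
begin

text \<open>\<open>F / 4 + \<epsilon> p\<close> is a closed form with values in the dual numbers (\<open>\<epsilon>\<^sup>2 = 0\<close>) that is annihilated by the
  vectors \<open>K X + 2 \<epsilon> X\<close>. Hence the bracket of two such vector fields annihilates it as well, which says
  that \<open>p\<close> is annihilated by the Nijenhuis tensor.\<close>

lemma nij_eq_0:
  assumes x: "x \<in> S" shows "nij x X Y = 0"
proof (rule p_nondeg[OF x])
  fix Z W
  define p' where "p' a b c w = frechet_derivative (\<lambda>y. p y a b c) (at x) w" for a b c w
  define F' where "F' a b c w = frechet_derivative (\<lambda>y. F y a b c) (at x) w" for a b c w
  have p': "((\<lambda>y. p y a b c) has_derivative p' a b c) (at x)" for a b c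
    unfolding p'_def by (rule smooth_on_has_derivative[OF p_smooth x])
  have F': "((\<lambda>y. F y a b c) has_derivative F' a b c) (at x)" for a b c
    unfolding F'_def by (rule smooth_on_has_derivative[OF F_smooth x])
  have zero: "((\<lambda>y. h y) has_derivative (\<lambda>w. 0)) (at x)" if "\<And>y. y \<in> S \<Longrightarrow> h y = 0" for h :: "'a \<Rightarrow> real"
    by (rule has_derivative_transform_within_open[OF has_derivative_const[of 0] S x]) (simp add: that)
  \<comment> \<open>\<open>J\<close> and \<open>I\<close> are the derivatives of the relations
    \<open>F a + 2 * p (K a) = 0\<close> and \<open>F (K a) = 0\<close>. These are the two
    components of the statement that \<open>F / 4 + \<epsilon> p\<close> annihilates
    \<open>K a + 2 \<epsilon> a\<close>.\<close>
  have J: "F' a b c w + 2 * (p' (K x a) b c w + p x (dK x w a) b c) = 0" for a b c w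
  proof -
    have "((\<lambda>y. p y (K y a) b c) has_derivative (\<lambda>w. p' (K x a) b c w + p x (dK x w a) b c)) (at x)"
      by (rule has_derivative_apply_family[where L="\<lambda>y v. p y v b c", OF S x p_lin p' dK[OF x]])
    then have "((\<lambda>y. F y a b c + 2 * p y (K y a) b c) has_derivative
        (\<lambda>w. F' a b c w + 2 * (p' (K x a) b c w + p x (dK x w a) b c))) (at x)"
      by (intro has_derivative_add has_derivative_mult_right F')
    moreover have "((\<lambda>y. F y a b c + 2 * p y (K y a) b c) has_derivative (\<lambda>w. 0)) (at x)"
      by (rule zero) (simp add: F_p)
    ultimately have "(\<lambda>w. F' a b c w + 2 * (p' (K x a) b c w + p x (dK x w a) b c)) = (\<lambda>w. 0)"
      by (rule has_derivative_unique)
    then show ?thesis by metis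
  qed
  have I: "F' (K x a) b c w + F x (dK x w a) b c = 0" for a b c w
  proof -
    have "((\<lambda>y. F y (K y a) b c) has_derivative (\<lambda>w. F' (K x a) b c w + F x (dK x w a) b c)) (at x)"
      by (rule has_derivative_apply_family[where L="\<lambda>y v. F y v b c", OF S x F_lin F' dK[OF x]])
    moreover have "((\<lambda>y. F y (K y a) b c) has_derivative (\<lambda>w. 0)) (at x)"
      by (rule zero) (simp add: F_K)
    ultimately have "(\<lambda>w. F' (K x a) b c w + F x (dK x w a) b c) = (\<lambda>w. 0)"
      by (rule has_derivative_unique)
    then show ?thesis by metis
  qed
  have F'_skew: "F' b a c w = - F' a b c w" for a b c w
  proof -
    have "((\<lambda>y. F y b a c) has_derivative (\<lambda>w. - F' a b c w)) (at x)"
      by (rule has_derivative_transform_within_open[OF has_derivative_minus[OF F'] S x]) (simp add: F_skew[of _ b a])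
    from has_derivative_unique[OF F' this] show ?thesis by metis
  qed
  \<comment> \<open>The term of \<open>J\<close> with an undifferentiated \<open>p\<close> becomes,
    by \<open>F_p\<close> and skew symmetry, one with an undifferentiated \<open>F\<close>, which
    \<open>I\<close> expresses through a derivative of \<open>F\<close>.\<close>
  have mixed: "F' X (K x Y) c w + 2 * p' (K x X) (K x Y) c w = F' Y (K x X) c w" for c w
    using J[of X "K x Y" c w] F_p[OF x, of Y "dK x w X" c] p_skew[OF x, of "K x Y" "dK x w X" c]
      F_skew[OF x, of Y "dK x w X" c] I[of X Y c w] F'_skew[of Y "K x X" c w]
    by (simp add: algebra_simps)
  have "p x (nij x X Y) Z W = p x (K x (dK x X Y)) Z W - p x (K x (dK x Y X)) Z W
      - p x (dK x (K x X) Y) Z W + p x (dK x (K x Y) X) Z W"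
    using p_lin[OF x, of Z W] K_lin[OF x]
    by (simp add: nij_def linear_add[OF p_lin[OF x]] linear_diff[OF p_lin[OF x]] linear_diff[OF K_lin[OF x]])
  \<comment> \<open>The three instances of closedness make up the \<epsilon>-component of the
    vanishing of \<open>d (F / 4 + \<epsilon> p)\<close> on \<open>K X + 2 \<epsilon> X\<close>,
    \<open>K Y + 2 \<epsilon> Y\<close>, \<open>Z\<close> and \<open>W\<close>.\<close>
  then show "p x (nij x X Y) Z W = 0"
    using F_p[OF x, of "dK x X Y" Z W] F_p[OF x, of "dK x Y X" Z W]
      I[of Y Z W X] I[of X Z W Y] J[of Y Z W "K x X"] J[of X Z W "K x Y"]
      F_closed[OF x, of "K x Y" Z W X, folded F'_def] F_closed[OF x, of "K x X" Z W Y, folded F'_def]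
      p_closed[OF x, of "K x Y" Z W "K x X", folded p'_def]
      mixed[of W Z] mixed[of Z W] by algebra
qed

end

text \<open>Gronwall's argument: \<open>exp (- 2 * M * t)\<close> times the squared norm has
  nonpositive derivative and vanishes at 0.\<close>

lemma linear_growth_zero:
  fixes \<theta> :: "real \<Rightarrow> 'a::real_inner"
  assumes der: "\<And>t. t \<in> {0..1} \<Longrightarrow> (\<theta> has_vector_derivative \<theta>' t) (at t within {0..1})"
    and bd: "\<And>t. t \<in> {0..1} \<Longrightarrow> norm (\<theta>' t) \<le> M * norm (\<theta> t)" and 0: "\<theta> 0 = 0" and t: "t \<in> {0..1}"
  shows "\<theta> t = 0"
proof (cases "t = 0")
  case False
  then have t0: "0 < t" using t by auto
  define q where "q s = exp (- 2 * M * s) * (\<theta> s \<bullet> \<theta> s)" for s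
  have cont: "continuous_on {0..1} \<theta>"
    unfolding continuous_on_eq_continuous_within by (intro ballI has_vector_derivative_continuous[OF der])
  have "q t \<le> q 0"
  proof (rule DERIV_nonpos_imp_decreasing_open[OF less_imp_le[OF t0]])
    show "continuous_on {0..t} q" unfolding q_def
      by (intro continuous_intros continuous_on_subset[OF cont]) (use t in auto)
    fix s assume s: "0 < s" "s < t"
    then have "at s within {0..1} = at s" using t by (intro at_within_interior) auto
    then have d: "(\<theta> has_vector_derivative \<theta>' s) (at s)" using der[of s] s t by auto
    have "((\<lambda>s. \<theta> s \<bullet> \<theta> s) has_derivative (\<lambda>h. \<theta> s \<bullet> (h *\<^sub>R \<theta>' s) + (h *\<^sub>R \<theta>' s) \<bullet> \<theta> s)) (at s)"
      using d unfolding has_vector_derivative_def by (intro has_derivative_inner)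
    then have i: "((\<lambda>s. \<theta> s \<bullet> \<theta> s) has_real_derivative 2 * (\<theta> s \<bullet> \<theta>' s)) (at s)"
      unfolding has_field_derivative_def
      by (rule has_derivative_eq_rhs) (simp add: fun_eq_iff inner_commute)
    have "(q has_real_derivative exp (- 2 * M * s) * (2 * (\<theta> s \<bullet> \<theta>' s)) +
        (exp (- 2 * M * s) * (- 2 * M)) * (\<theta> s \<bullet> \<theta> s)) (at s)"
      unfolding q_def by (rule DERIV_cong, (rule derivative_eq_intros i refl)+, simp)
    moreover have "exp (- 2 * M * s) * (2 * (\<theta> s \<bullet> \<theta>' s)) + (exp (- 2 * M * s) * (- 2 * M)) * (\<theta> s \<bullet> \<theta> s) \<le> 0"
    proof -
      have "\<theta> s \<bullet> \<theta>' s \<le> norm (\<theta> s) * norm (\<theta>' s)" by (rule norm_cauchy_schwarz)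
      also have "\<dots> \<le> norm (\<theta> s) * (M * norm (\<theta> s))" using bd[of s] s t by (intro mult_left_mono) auto
      also have "\<dots> = M * (\<theta> s \<bullet> \<theta> s)" by (simp add: dot_square_norm power2_eq_square)
      finally have "exp (- 2 * M * s) * (2 * (\<theta> s \<bullet> \<theta>' s)) \<le> exp (- 2 * M * s) * (2 * (M * (\<theta> s \<bullet> \<theta> s)))"
        by (intro mult_left_mono) auto
      then show ?thesis by (simp add: algebra_simps)
    qed
    ultimately show "\<exists>y. (q has_real_derivative y) (at s) \<and> y \<le> 0" by blast
  qed
  then have "\<theta> t \<bullet> \<theta> t \<le> 0" using 0 by (simp add: q_def mult_le_0_iff)
  then show ?thesis by (metis antisym inner_ge_zero inner_eq_zero_iff)
qed (use 0 in simp)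

section \<open>Integrability of the kernel\<close>

text \<open>Rank and nullity agree here and add up to the dimension. The rank is computed on the
  orthogonal complement of the kernel, which \<open>h\<close> maps bijectively onto its
  range.\<close>

lemma kernel_dim:
  fixes h :: "'a::euclidean_space \<Rightarrow> 'a"
  assumes "linear h" "{v. h v = 0} = range h" shows "2 * dim {v. h v = 0} = DIM('a)"
proof -
  let ?N = "{v. h v = 0}"
  let ?M = "{y \<in> UNIV. \<forall>x\<in>?N. orthogonal x y}"
  have sN: "subspace ?N" by (rule linear_subspace_kernel[OF assms(1)])
  have sM: "subspace ?M" using subspace_orthogonal_to_vectors[of ?N] by simp
  have 1: "dim ?M + dim ?N = DIM('a)"
    using dim_subspace_orthogonal_to_vectors[OF sN subspace_UNIV] by simp
  have inj: "inj_on h ?M"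
  proof (rule inj_onI)
    fix u v assume uv: "u \<in> ?M" "v \<in> ?M" "h u = h v"
    then have "u - v \<in> ?N" using linear_diff[OF assms(1)] by simp
    moreover have "u - v \<in> ?M" using subspace_diff[OF sM uv(1,2)] .
    ultimately have "orthogonal (u - v) (u - v)" by blast
    then show "u = v" by (simp add: orthogonal_self)
  qed
  have rM: "range h = h ` ?M"
  proof (intro equalityI subsetI)
    fix w assume "w \<in> range h"
    then obtain u where w: "w = h u" by auto
    obtain n m where nm: "n \<in> span ?N" "\<And>x. x \<in> span ?N \<Longrightarrow> orthogonal m x" "u = n + m"
      using orthogonal_subspace_decomp_exists[of ?N u] by blast
    have "span ?N = ?N" by (rule span_eq_iff[THEN iffD2, OF sN])
    then have "n \<in> ?N" using nm(1) by (simp only:)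
    then have "w = h m" using w nm(3) linear_add[OF assms(1)] by simp
    moreover have "orthogonal x m" if "x \<in> ?N" for x
      using nm(2)[OF span_base[OF that]] orthogonal_commute[of x m] by simp
    then have "m \<in> ?M" by simp
    ultimately show "w \<in> h ` ?M" by blast
  qed auto
  have dM: "dim (h ` ?M) = dim ?M"
  proof (rule dim_image_eq[OF assms(1)])
    have "span ?M = ?M" by (rule span_eq_iff[THEN iffD2, OF sM])
    then show "inj_on h (span ?M)" using inj by (simp only:)
  qed
  have "dim ?N = dim (range h)" using assms(2) by (rule arg_cong)
  also have "\<dots> = dim (h ` ?M)" using rM by (rule arg_cong)
  also note dM
  finally have "dim ?N = dim ?M" .
  then show ?thesis using 1 by linarith
qed

locale integrable_nilpotent = nilpotent_field S K for S :: "(real ^ 6) set" and K +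
  assumes nij_0: "\<And>x X Y. x \<in> S \<Longrightarrow> nij x X Y = 0"
    and ker_range: "\<And>x. x \<in> S \<Longrightarrow> {v. K x v = 0} = range (K x)"
begin

text \<open>\<open>\<Psi> z\<close> is the value at time 1 of the solution of \<open>u' = K u (B z)\<close>, \<open>u 0 = x0 + C z\<close>. For \<open>v\<close> in the plane of
  the coordinates 1, 3, 5 we have \<open>C v = 0\<close>, so the variation \<open>J\<close> of \<open>u\<close> in the direction \<open>v\<close> starts at 0.
  Since the Nijenhuis tensor vanishes, \<open>K u J\<close> satisfies a linear homogeneous equation; hence it is 0 and
  \<open>\<Psi>\<close> maps this plane into the kernel of \<open>K\<close>.\<close>

theorem local_foliation:
  fixes f :: "6 \<Rightarrow> real ^ 6"
  assumes x0: "x0 \<in> S" and indep: "inj (\<lambda>v :: real ^ 6. \<Sum>i\<in>UNIV. (v $ i) *\<^sub>R f i)"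
    and Kf: "K x0 (f 2) = - 2 *\<^sub>R f 1" "K x0 (f 4) = - 2 *\<^sub>R f 3" "K x0 (f 6) = - 2 *\<^sub>R f 5"
  obtains U V :: "(real ^ 6) set" and \<Psi> g :: "real ^ 6 \<Rightarrow> real ^ 6"
  where "open U" "open V" "x0 \<in> V" "V \<subseteq> S" "homeomorphism U V \<Psi> g"
    "smooth_on U \<Psi>" "smooth_on V g"
    "\<And>x v. x \<in> V \<Longrightarrow> K x v = 0 \<longleftrightarrow> (\<forall>i. i \<notin> {1, 3, 5} \<longrightarrow> frechet_derivative g (at x) v $ i = 0)"
proof -
  \<comment> \<open>The factor -1/2 inverts the -2 in \<open>Kf\<close>. With it the derivative of
    \<Psi> at 0 sends the coordinate vectors to the frame \<open>f\<close>: \<open>B\<close>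
    accounts, through \<open>K\<close>, for \<open>f 1\<close>, \<open>f 3\<close>,
    \<open>f 5\<close>, and \<open>C\<close> for \<open>f 2\<close>, \<open>f 4\<close>,
    \<open>f 6\<close>.\<close>
  define B :: "real ^ 6 \<Rightarrow> real ^ 6" where "B z = (-1/2) *\<^sub>R (z $ 1 *\<^sub>R f 2 + z $ 3 *\<^sub>R f 4 + z $ 5 *\<^sub>R f 6)" for z
  define C :: "real ^ 6 \<Rightarrow> real ^ 6" where "C z = z $ 2 *\<^sub>R f 2 + z $ 4 *\<^sub>R f 4 + z $ 6 *\<^sub>R f 6" for z
  have lB: "linear B" and lC: "linear C"
    by (auto simp: B_def C_def linear_iff algebra_simps)
  have B0 [simp]: "B 0 = 0" and C0 [simp]: "C 0 = 0" using linear_0 lB lC by auto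
  have bB: "bounded_linear B" and bC: "bounded_linear C" using lB lC linear_conv_bounded_linear by auto
  \<comment> \<open>\<open>smooth_flow\<close> treats solutions that start at 0. The unknown is
    therefore the displacement from \<open>x0 + C z\<close>, and \<open>z\<close> enters
    \<open>H\<close> through the starting point as well as through the field.\<close>
  define yy where "yy p = x0 + C (fst p) + snd p" for p :: "(real ^ 6) \<times> (real ^ 6)"
  define N where "N = {p. yy p \<in> S}"
  define H where "H p = K (yy p) (B (fst p))" for p
  have N: "open N"
  proof -
    have "continuous_on UNIV yy" unfolding yy_def
      by (intro continuous_intros bounded_linear.continuous_on[OF bC])
    then have "open (yy -` S)" using S by (simp add: open_vimage)
    then show ?thesis by (simp add: N_def vimage_def)
  qed
  have yd: "(yy has_derivative (\<lambda>q. C (fst q) + snd q)) (at p)" for p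
    unfolding yy_def by (auto intro!: derivative_eq_intros bounded_linear.has_derivative[OF bC])
  have smooth_yy: "smooth_on N yy"
  proof -
    have "smooth_on N (\<lambda>p. x0 + (C (fst p) + snd p))"
      by (intro smooth_on_add[OF N] smooth_on_const[OF N] smooth_on_bounded_linear[OF bC N]
        smooth_on_bounded_linear[OF bounded_linear_fst N] smooth_on_bounded_linear[OF bounded_linear_snd N]
        smooth_on_id[OF N])
    then show ?thesis by (simp add: yy_def[abs_def] add.assoc)
  qed
  have H: "smooth_on N H"
    unfolding H_def
  proof (rule smooth_on_apply_family[OF N, where L="\<lambda>p. K (yy p)"])
    show "linear (K (yy p))" if "p \<in> N" for p using that K_lin by (simp add: N_def)
    show "smooth_on N (\<lambda>p. K (yy p) v)" for v
      by (rule smooth_on_compose[OF N S _ K_smooth smooth_yy]) (simp add: N_def)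
    show "smooth_on N (\<lambda>p. B (fst p))"
      by (intro smooth_on_bounded_linear[OF bB N] smooth_on_bounded_linear[OF bounded_linear_fst N] smooth_on_id[OF N])
  qed
  have DH: "frechet_derivative H (at p) q = dK (yy p) (C (fst q) + snd q) (B (fst p)) + K (yy p) (B (fst q))"
    if p: "p \<in> N" for p q
  proof -
    have yp: "yy p \<in> S" using p by (simp add: N_def)
    have "((\<lambda>p. K (yy p) (B (fst p))) has_derivative
        (\<lambda>q. dK (yy p) (C (fst q) + snd q) (B (fst p)) + K (yy p) (B (fst q)))) (at p)"
    proof (rule has_derivative_apply_family[OF N p, where L="\<lambda>p. K (yy p)"])
      show "linear (K (yy q))" if "q \<in> N" for q using that K_lin by (simp add: N_def)
      show "((\<lambda>p. K (yy p) v) has_derivative (\<lambda>q. dK (yy p) (C (fst q) + snd q) v)) (at p)" for v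
        using has_derivative_compose[OF yd dK[OF yp]] .
      show "((\<lambda>p. B (fst p)) has_derivative (\<lambda>q. B (fst q))) (at p)"
        by (intro bounded_linear.has_derivative[OF bB] derivative_intros)
    qed
    then have "(H has_derivative (\<lambda>q. dK (yy p) (C (fst q) + snd q) (B (fst p)) + K (yy p) (B (fst q)))) (at p)"
      by (simp add: H_def[abs_def])
    from frechet_derivative_at[OF this, symmetric] show ?thesis by simp
  qed
  have N0: "(0, 0) \<in> N" using x0 by (simp add: N_def yy_def)
  have H0: "H (0, u) = 0" if "(0, u) \<in> N" for u
    using that linear_0[OF K_lin] by (simp add: H_def N_def)
  obtain d V W where d: "d > 0"
    and inN: "\<And>t z. t \<in> {0..1} \<Longrightarrow> z \<in> ball 0 d \<Longrightarrow> (z, V t z) \<in> N"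
    and Vc: "continuous_on ({0..1} \<times> ball 0 d) (\<lambda>(t, z). V t z)"
    and Veq: "\<And>t z. t \<in> {0..1} \<Longrightarrow> z \<in> ball 0 d \<Longrightarrow> V t z = rint (\<lambda>s z. H (z, V s z)) t z"
    and Vd: "\<And>t z. t \<in> {0..1} \<Longrightarrow> z \<in> ball 0 d \<Longrightarrow> (V t has_derivative W t z) (at z)"
    and Wc: "\<And>v. continuous_on ({0..1} \<times> ball 0 d) (\<lambda>(t, z). W t z v)"
    and Weq: "\<And>t z v. t \<in> {0..1} \<Longrightarrow> z \<in> ball 0 d \<Longrightarrow> W t z v =
      rint (\<lambda>s z. frechet_derivative H (at (z, V s z)) (v, 0) + frechet_derivative H (at (z, V s z)) (0, W s z v)) t z"
    and Vs: "\<And>t. t \<in> {0..1} \<Longrightarrow> smooth_on (ball 0 d) (V t)"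
  proof (rule smooth_flow[OF N H N0])
    show "H (0, u) = 0" if "(0, u) \<in> N" for u by (rule H0[OF that])
  qed (rule that; assumption)
  define y where "y t z = x0 + C z + V t z" for t z
  have yS: "y t z \<in> S" if "t \<in> {0..1}" "z \<in> ball 0 d" for t z
    using inN[OF that] by (simp add: N_def yy_def y_def)
  have yyV: "yy (z, V t z) = y t z" for t z by (simp add: yy_def y_def)
  \<comment> \<open>\<open>C v + W s z v\<close> is the variation of \<open>y s z\<close> in the
    direction \<open>v\<close>.\<close>
  define IW where "IW s z v = dK (y s z) (C v + W s z v) (B z) + K (y s z) (B v)" for s z v
  have IW: "frechet_derivative H (at (z, V s z)) (v, 0) + frechet_derivative H (at (z, V s z)) (0, W s z v) = IW s z v"
    if "s \<in> {0..1}" "z \<in> ball 0 d" for s z v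
    using DH[OF inN[OF that]] linear_add[OF dK_linear_left[OF yS[OF that]]] linear_0[OF K_lin[OF yS[OF that]]]
      linear_0[OF dK_linear_left[OF yS[OF that]]]
    by (simp add: IW_def yyV)
  have Weq': "W t z v = rint (\<lambda>s z. IW s z v) t z" if "t \<in> {0..1}" "z \<in> ball 0 d" for t z v
    unfolding Weq[OF that] by (rule rint_cong[OF _ that(1)]) (rule IW[OF _ that(2)])
  have Veq': "V t z = rint (\<lambda>s z. K (y s z) (B z)) t z" if "t \<in> {0..1}" "z \<in> ball 0 d" for t z
    using Veq[OF that] by (simp add: H_def yyV)
  have yc: "continuous_on ({0..1} \<times> ball 0 d) (\<lambda>q. y (fst q) (snd q))"
    using Vc unfolding y_def
    by (intro continuous_intros bounded_linear.continuous_on[OF bC]) (auto simp: case_prod_unfold)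
  have comp_y: "continuous_on ({0..1} \<times> ball 0 d) (\<lambda>q. h (y (fst q) (snd q)))" if "continuous_on S h"
    for h :: "real ^ 6 \<Rightarrow> real ^ 6"
    by (rule continuous_on_compose2[OF that yc]) (use yS in auto)
  have Kc: "continuous_on ({0..1} \<times> ball 0 d) (\<lambda>(s, z). K (y s z) v)" for v
    using comp_y[OF smooth_on_continuous[OF K_smooth]] by (simp add: case_prod_unfold)
  have dKc: "continuous_on ({0..1} \<times> ball 0 d) (\<lambda>(s, z). dK (y s z) w v)" for v w
    using comp_y[OF smooth_on_continuous[OF dK_smooth]] by (simp add: case_prod_unfold)
  have slice: "continuous_on {0..1} (\<lambda>s. h s z)"
    if "continuous_on ({0..1} \<times> ball 0 d) (\<lambda>(s, z). h s z)" "z \<in> ball 0 d"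
    for h :: "real \<Rightarrow> real ^ 6 \<Rightarrow> real ^ 6" and z
    by (rule continuous_on_curried[OF that(1)]) (use that(2) in auto)
  have fundamental: "((\<lambda>t. rint h t z) has_vector_derivative h t z) (at t within {0..1})"
    if h: "continuous_on ({0..1} \<times> {z}) (\<lambda>(s, z). h s z)" and t: "t \<in> {0..1}"
    for h :: "real \<Rightarrow> real ^ 6 \<Rightarrow> real ^ 6" and z t
  proof -
    have "continuous_on {0..1} (\<lambda>s. h s z)"
      by (rule continuous_on_curried[OF h]) auto
    from integral_has_vector_derivative[OF this t] show ?thesis
      by (rule has_vector_derivative_transform[OF t, rotated]) (rule rint_eq_integral[OF h], auto)
  qed
  define \<Psi> where "\<Psi> z = y 1 z" for z
  define D where "D z v = C v + W 1 z v" for z v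
  have \<Psi>d: "(\<Psi> has_derivative D z) (at z)" if "z \<in> ball 0 d" for z
  proof -
    have "((\<lambda>z. x0 + C z + V 1 z) has_derivative (\<lambda>v. 0 + C v + W 1 z v)) (at z)"
      by (intro has_derivative_add has_derivative_const bounded_linear.has_derivative[OF bC] Vd derivative_intros that) simp
    then show ?thesis by (simp add: \<Psi>_def[abs_def] D_def[abs_def] y_def)
  qed
  have \<Psi>s: "smooth_on (ball 0 d) \<Psi>"
  proof -
    have "smooth_on (ball 0 d) (\<lambda>z. x0 + (C z + V 1 z))"
      by (intro smooth_on_add smooth_on_const smooth_on_bounded_linear[OF bC] smooth_on_id Vs) auto
    then show ?thesis by (simp add: \<Psi>_def[abs_def] y_def add.assoc)
  qed
  have 0: "0 \<in> ball 0 d" using d by simp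
  have V0: "V t 0 = 0" if "t \<in> {0..1}" for t
  proof -
    have "V t 0 = rint (\<lambda>s z. 0) t (0 :: real ^ 6)"
      unfolding Veq'[OF that 0] by (rule rint_cong[OF _ that]) (use linear_0[OF K_lin[OF yS[OF _ 0]]] in auto)
    then show ?thesis by (simp add: rint_def)
  qed
  have \<Psi>0: "\<Psi> 0 = x0" using V0[of 1] by (simp add: \<Psi>_def y_def)
  have D0: "D 0 v = (\<Sum>i\<in>UNIV. (v $ i) *\<^sub>R f i)" for v
  proof -
    have "W 1 0 v = rint (\<lambda>s z. K x0 (B v)) 1 (0 :: real ^ 6)"
      unfolding Weq'[OF _ 0, of 1, simplified]
    proof (rule rint_cong)
      fix s :: real assume s: "s \<in> {0..1}"
      show "IW s 0 v = K x0 (B v)"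
        using linear_0[OF dK_linear_right[OF yS[OF s 0]]] V0[OF s] by (simp add: IW_def y_def)
    qed simp
    also have "\<dots> = K x0 (B v)" by (simp add: rint_def)
    also have "\<dots> = v $ 1 *\<^sub>R f 1 + v $ 3 *\<^sub>R f 3 + v $ 5 *\<^sub>R f 5"
      unfolding B_def linear_cmul[OF K_lin[OF x0]] linear_add[OF K_lin[OF x0]] Kf by (simp add: algebra_simps)
    finally show ?thesis by (simp add: D_def C_def sum_6 algebra_simps)
  qed
  have fD: "frechet_derivative \<Psi> (at z) = D z" if "z \<in> ball 0 d" for z
    using frechet_derivative_at[OF \<Psi>d[OF that]] by simp
  have "inj (frechet_derivative \<Psi> (at 0))" unfolding fD[OF 0] using indep D0 by (simp add: inj_def)
  then obtain U V' g where g: "open U" "U \<subseteq> ball 0 d" "0 \<in> U" "open V'" "\<Psi> 0 \<in> V'" "homeomorphism U V' \<Psi> g"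
    "smooth_on V' g" "\<And>z. z \<in> U \<Longrightarrow> inj (frechet_derivative \<Psi> (at z))"
    "\<And>x v. x \<in> V' \<Longrightarrow> frechet_derivative \<Psi> (at (g x)) (frechet_derivative g (at x) v) = v"
    using smooth_inverse_function[OF _ \<Psi>s 0] by (metis open_ball)
  define P where "P = {v :: real ^ 6. \<forall>i. i \<notin> {1, 3, 5} \<longrightarrow> v $ i = 0}"
  have CP: "C v = 0" if "v \<in> P" for v using that by (simp add: P_def C_def)
  have tangent: "K (\<Psi> z) (D z v) = 0" if z: "z \<in> ball 0 d" and v: "v \<in> P" for z v
  proof -
    define J where "J t = W t z v" for t
    define X where "X = B z"
    define \<theta> where "\<theta> t = K (y t z) (J t)" for t
    have sub: "{0..1} \<times> {z} \<subseteq> {0..1::real} \<times> ball 0 d" using z by auto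
    have y': "((\<lambda>t. y t z) has_vector_derivative K (y t z) X) (at t within {0..1})" if t: "t \<in> {0..1}" for t
    proof -
      have "((\<lambda>t. rint (\<lambda>s z. K (y s z) X) t z) has_vector_derivative K (y t z) X) (at t within {0..1})"
        by (rule fundamental[OF continuous_on_subset[OF Kc sub] t])
      then have "((\<lambda>t. x0 + C z + rint (\<lambda>s z. K (y s z) X) t z) has_vector_derivative 0 + K (y t z) X) (at t within {0..1})"
        by (intro has_vector_derivative_add has_vector_derivative_const)
      then have "((\<lambda>t. x0 + C z + rint (\<lambda>s z. K (y s z) X) t z) has_vector_derivative K (y t z) X) (at t within {0..1})"
        by simp
      then show ?thesis
      proof (rule has_vector_derivative_transform[OF t, rotated])
        fix s :: real assume s: "s \<in> {0..1}"
        have "rint (\<lambda>s z. K (y s z) (B z)) s z = rint (\<lambda>s z. K (y s z) X) s z"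
          by (rule rint_cong[OF _ s]) (simp add: X_def)
        then show "y s z = x0 + C z + rint (\<lambda>s z. K (y s z) X) s z"
          unfolding y_def[of s z] Veq'[OF s z] by simp
      qed
    qed
    have J': "(J has_vector_derivative dK (y t z) (J t) X + K (y t z) (B v)) (at t within {0..1})" if t: "t \<in> {0..1}" for t
    proof -
      have c: "continuous_on ({0..1} \<times> {z}) (\<lambda>(s, z). dK (y s z) (J s) X + K (y s z) (B v))"
      proof -
        have Jc: "continuous_on {0..1} J" unfolding J_def by (rule slice[OF Wc z])
        have "continuous_on {0..1} (\<lambda>s. (\<Sum>b\<in>Basis. (J s \<bullet> b) *\<^sub>R dK (y s z) b X) + K (y s z) (B v))"
          by (intro continuous_intros Jc slice[OF dKc z] slice[OF Kc z])
        then have "continuous_on {0..1} (\<lambda>s. dK (y s z) (J s) X + K (y s z) (B v))"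
        proof (rule continuous_on_eq)
          fix s :: real assume s: "s \<in> {0..1}"
          show "(\<Sum>b\<in>Basis. (J s \<bullet> b) *\<^sub>R dK (y s z) b X) + K (y s z) (B v) = dK (y s z) (J s) X + K (y s z) (B v)"
            using euclidean_linear_sum[OF dK_linear_left[OF yS[OF s z]], of "J s" X] by simp
        qed
        then have "continuous_on ({0..1} \<times> {z}) (\<lambda>q. (\<lambda>s. dK (y s z) (J s) X + K (y s z) (B v)) (fst q))"
          by (rule continuous_on_compose2) (auto intro!: continuous_intros)
        then show ?thesis by (rule continuous_on_eq) auto
      qed
      have "((\<lambda>t. rint (\<lambda>s z. dK (y s z) (J s) X + K (y s z) (B v)) t z) has_vector_derivative
          dK (y t z) (J t) X + K (y t z) (B v)) (at t within {0..1})"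
        by (rule fundamental[OF c t])
      then show ?thesis
      proof (rule has_vector_derivative_transform[OF t, rotated])
        fix s :: real assume s: "s \<in> {0..1}"
        show "J s = rint (\<lambda>s z. dK (y s z) (J s) X + K (y s z) (B v)) s z"
          unfolding J_def Weq'[OF s z]
          by (rule rint_cong[OF _ s]) (simp add: IW_def CP[OF v] X_def J_def)
      qed
    qed
    \<comment> \<open>Write K for \<open>K (y t z)\<close>. Since K K = 0, the term
      \<open>K (B v)\<close> in the derivative of \<open>J\<close> drops out, and \<theta>' is
      \<open>dK (K X) J + K (dK J X)\<close>. By \<open>nij_0\<close> this equals
      \<open>K (dK X J) + dK (K J) X\<close>, and \<open>dK_K\<close> turns it into \<Lambda>
      applied to \<theta> = \<open>K J\<close>.\<close>
    define \<Lambda> where "\<Lambda> t h = dK (y t z) h X - dK (y t z) X h" for t h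
    have \<theta>': "(\<theta> has_vector_derivative \<Lambda> t (\<theta> t)) (at t within {0..1})" if t: "t \<in> {0..1}" for t
    proof -
      note yt = yS[OF t z]
      have "((\<lambda>s. \<Sum>b\<in>Basis. (J s \<bullet> b) *\<^sub>R K (y s z) b) has_derivative
         (\<lambda>h. \<Sum>b\<in>Basis. (J t \<bullet> b) *\<^sub>R dK (y t z) (h *\<^sub>R K (y t z) X) b +
           ((h *\<^sub>R (dK (y t z) (J t) X + K (y t z) (B v))) \<bullet> b) *\<^sub>R K (y t z) b)) (at t within {0..1})"
        using J'[OF t] has_derivative_compose[OF y'[OF t, unfolded has_vector_derivative_def] dK[OF yt]]
        unfolding has_vector_derivative_def
        by (intro has_derivative_sum has_derivative_scaleR has_derivative_inner_left)
      moreover have "(\<Sum>b\<in>Basis. (J t \<bullet> b) *\<^sub>R dK (y t z) (h *\<^sub>R K (y t z) X) b +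
           ((h *\<^sub>R (dK (y t z) (J t) X + K (y t z) (B v))) \<bullet> b) *\<^sub>R K (y t z) b) = h *\<^sub>R \<Lambda> t (\<theta> t)" for h
      proof -
        have "(\<Sum>b\<in>Basis. (J t \<bullet> b) *\<^sub>R dK (y t z) (h *\<^sub>R K (y t z) X) b +
           ((h *\<^sub>R (dK (y t z) (J t) X + K (y t z) (B v))) \<bullet> b) *\<^sub>R K (y t z) b) =
           dK (y t z) (h *\<^sub>R K (y t z) X) (J t) + K (y t z) (h *\<^sub>R (dK (y t z) (J t) X + K (y t z) (B v)))"
          unfolding sum.distrib euclidean_linear_sum[OF dK_linear_right[OF yt], symmetric]
            euclidean_linear_sum[OF K_lin[OF yt], symmetric] ..
        also have "\<dots> = h *\<^sub>R (dK (y t z) (K (y t z) X) (J t) + K (y t z) (dK (y t z) (J t) X))"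
          unfolding linear_cmul[OF dK_linear_left[OF yt]] linear_cmul[OF K_lin[OF yt]] linear_add[OF K_lin[OF yt]] K_K[OF yt]
          by (simp add: scaleR_add_right)
        also have "dK (y t z) (K (y t z) X) (J t) + K (y t z) (dK (y t z) (J t) X) = \<Lambda> t (\<theta> t)"
          using nij_0[OF yt, of X "J t"] dK_K[OF yt, of X "J t"] linear_diff[OF K_lin[OF yt]]
          by (simp add: nij_def \<Lambda>_def \<theta>_def algebra_simps)
        finally show ?thesis .
      qed
      ultimately have "((\<lambda>s. \<Sum>b\<in>Basis. (J s \<bullet> b) *\<^sub>R K (y s z) b) has_vector_derivative \<Lambda> t (\<theta> t)) (at t within {0..1})"
        by (simp add: has_vector_derivative_def)
      then show ?thesis
      proof (rule has_vector_derivative_transform[OF t, rotated])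
        show "\<theta> s = (\<Sum>b\<in>Basis. (J s \<bullet> b) *\<^sub>R K (y s z) b)" if s: "s \<in> {0..1}" for s
          unfolding \<theta>_def by (rule euclidean_linear_sum[OF K_lin[OF yS[OF s z]]])
      qed
    qed
    have \<Lambda>_lin: "linear (\<Lambda> t)" if "t \<in> {0..1}" for t unfolding \<Lambda>_def
      by (intro linear_compose_sub dK_linear_left dK_linear_right yS that z)
    have "continuous_on {0..1} (\<lambda>t. \<Lambda> t b)" for b
      unfolding \<Lambda>_def by (intro continuous_intros slice[OF dKc z])
    from linear_family_bounded[OF compact_Icc \<Lambda>_lin this]
    obtain M where M: "\<And>t h. t \<in> {0..1} \<Longrightarrow> norm (\<Lambda> t h) \<le> M * norm h" by blast
    have "J 0 = 0" unfolding J_def using Weq'[OF _ z, of 0] by (simp add: rint_def)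
    then have "\<theta> 0 = 0" unfolding \<theta>_def using linear_0[OF K_lin[OF yS[OF _ z]], of 0] by simp
    from linear_growth_zero[OF \<theta>' M this] have "\<theta> 1 = 0" by simp
    then show ?thesis by (simp add: \<theta>_def \<Psi>_def D_def CP[OF v] J_def)
  qed
  have gU: "g x \<in> U" "\<Psi> (g x) = x" if "x \<in> V'" for x using g(6) that by (auto simp: homeomorphism_def)
  have VS: "V' \<subseteq> S"
  proof
    fix x assume "x \<in> V'"
    then show "x \<in> S" using gU[of x] yS[of 1 "g x"] g(2) by (auto simp: \<Psi>_def)
  qed
  have key: "K x v = 0 \<longleftrightarrow> (\<forall>i. i \<notin> {1, 3, 5} \<longrightarrow> frechet_derivative g (at x) v $ i = 0)"
    if x: "x \<in> V'" for x v
  proof -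
    let ?z = "g x"
    have z: "?z \<in> ball 0 d" using gU[OF x] g(2) by auto
    have Dinj: "inj (D ?z)" using g(8)[OF gU(1)[OF x]] fD[OF z] by simp
    have Dlin: "linear (D ?z)" using \<Psi>d[OF z] has_derivative_linear by blast
    have Dg: "D ?z (frechet_derivative g (at x) v) = v" for v using g(9)[OF x, of v] fD[OF z] by simp
    have xS: "x \<in> S" using VS x by auto
    \<comment> \<open>One inclusion is \<open>tangent\<close>. Both spaces have dimension 3, the
      kernel because it is also the range of \<open>K x\<close>.\<close>
    have "D ?z ` P = {v. K x v = 0}"
    proof (rule subspace_dim_equal)
      have "subspace P" by (auto simp: P_def subspace_def)
      then show "subspace (D ?z ` P)" using linear_subspace_image[OF Dlin] by blast
      show "subspace {v. K x v = 0}" using linear_subspace_kernel[OF K_lin[OF xS]] .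
      show "D ?z ` P \<subseteq> {v. K x v = 0}" using tangent[OF z] gU(2)[OF x] by auto
      have "2 * dim {v. K x v = 0} = 6" using kernel_dim[OF K_lin[OF xS] ker_range[OF xS]] by simp
      moreover have "dim P = 3"
        using dim_substandard_cart[of "{1, 3, 5 :: 6}", where 'a=real] by (simp add: P_def dim_vec_eq)
      moreover have "dim (D ?z ` P) = dim P"
        using dim_image_eq[OF Dlin] inj_on_subset[OF Dinj] by blast
      ultimately show "dim {v. K x v = 0} \<le> dim (D ?z ` P)" by simp
    qed
    then have "K x v = 0 \<longleftrightarrow> D ?z (frechet_derivative g (at x) v) \<in> D ?z ` P" unfolding Dg by blast
    then have "K x v = 0 \<longleftrightarrow> frechet_derivative g (at x) v \<in> P" unfolding inj_image_mem_iff[OF Dinj] .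
    then show ?thesis by (simp add: P_def)
  qed
  show ?thesis
    by (rule that[OF g(1,4) _ VS g(6) smooth_on_subset[OF \<Psi>s _ g(2,1)] g(7) key]) (use g(5) \<Psi>0 in auto)
qed

end

section \<open>The field of endomorphisms on the manifold\<close>

context orbit_point
begin

text \<open>The value is 1 or -1, since the list is a permutation of the frame. The vector moved to
  the front is the one replaced by \<open>K v\<close> in Cramer's rule, so in
  \<open>Kc_smooth\<close> this says that the denominators do not vanish at the chosen
  point.\<close>

lemma D_frame_nonzero: "D [1,2,3,4,5,6] (map f (j # filter (\<lambda>i. i \<noteq> j) [1,2,3,4,5,6])) \<noteq> 0"
proof -
  have "\<forall>j. D [1,2,3,4,5,6] (map f (j # filter (\<lambda>i. i \<noteq> j) [1,2,3,4,5,6])) \<noteq> 0"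
    unfolding forall_6
    using D_dual[of "[1,2,3,4,5,6]"] D_dual[of "[2,1,3,4,5,6]"] D_dual[of "[3,1,2,4,5,6]"]
      D_dual[of "[4,1,2,3,5,6]"] D_dual[of "[5,1,2,3,4,6]"] D_dual[of "[6,1,2,3,4,5]"]
    by (simp add: D_sort)
  then show ?thesis by blast
qed

lemma D_linear: "length us = 5 \<Longrightarrow> linear_map_on T UNIV (\<lambda>Y. D [1,2,3,4,5,6] (Y # us))"
  unfolding linear_map_on_def by (simp add: contract_D algebra_simps)

lemma D_repeated: "v \<in> set us \<Longrightarrow> length us = 5 \<Longrightarrow> D [1,2,3,4,5,6] (v # us) = 0"
proof -
  assume v: "v \<in> set us" and l: "length us = 5"
  obtain i where "i < 5" "us ! i = v" using v l by (auto simp: in_set_conv_nth)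
  then show ?thesis unfolding D_def
    by (intro dform_repeated_vector[of 0 _ "Suc i"]) (auto simp: l)
qed

lemma p_add: "u \<in> T \<Longrightarrow> u' \<in> T \<Longrightarrow> v \<in> T \<Longrightarrow> x \<in> T \<Longrightarrow> p [u + u', v, x] = p [u, v, x] + p [u', v, x]"
  and p_scale: "u \<in> T \<Longrightarrow> v \<in> T \<Longrightarrow> x \<in> T \<Longrightarrow> p [r *\<^sub>R u, v, x] = r * p [u, v, x]"
  and p_skew: "u \<in> T \<Longrightarrow> v \<in> T \<Longrightarrow> x \<in> T \<Longrightarrow> p [v, u, x] = - p [u, v, x]"
  and p_0: "v \<in> T \<Longrightarrow> x \<in> T \<Longrightarrow> p [0, v, x] = 0"
  by (simp_all add: p_eq vectors_def algebra_simps)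

end

lemma local_wedge_smooth:
  assumes S: "open S" and len: "length us = k + l"
    and \<alpha>: "\<And>vs. length vs = k \<Longrightarrow> smooth_on S (\<lambda>x. \<alpha> x (map (h x) vs))"
    and \<beta>: "\<And>vs. length vs = l \<Longrightarrow> smooth_on S (\<lambda>x. \<beta> x (map (h x) vs))"
  shows "smooth_on S (\<lambda>x. wedge k l (\<alpha> x) (\<beta> x) (map (h x) us))"
proof -
  have eq: "map (\<lambda>i. map (h x) us ! \<sigma> i) [a..<b] = map (h x) (map (\<lambda>i. us ! \<sigma> i) [a..<b])"
    if "\<sigma> permutes {..<k + l}" "b \<le> k + l" for x \<sigma> a b
    using permutes_in_image[OF that(1)] that(2) len by (auto simp: subset_iff)
  have "smooth_on S (\<lambda>x. \<alpha> x (map (\<lambda>i. map (h x) us ! \<sigma> i) [0..<k]))"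
    "smooth_on S (\<lambda>x. \<beta> x (map (\<lambda>i. map (h x) us ! \<sigma> i) [k..<k + l]))"
    if s: "\<sigma> permutes {..<k + l}" for \<sigma>
    unfolding eq[OF s le_add1] eq[OF s order_refl] by (intro \<alpha> \<beta>, simp)+
  then show ?thesis unfolding wedge_def divide_inverse
    by (intro smooth_on_mult smooth_on_sum smooth_on_const S) auto
qed

locale orbit_mfd = smooth_mfd A for A :: "('a::{t2_space, second_countable_topology}, 6) chart set" +
  fixes \<omega> \<phi> :: "'a \<Rightarrow> ('a, 6) tvec list \<Rightarrow> real" and E B
  assumes pt: "\<And>p. orbit_point (tangent_space A p) (E p) (B p) (\<omega> p) (\<phi> p)"
    and \<omega>_form: "differential_form A 2 \<omega>" and \<phi>_form: "differential_form A 3 \<phi>"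
    and \<phi>_closed: "closed_form A 3 \<phi>" and F_closed: "closed_form A 3 (F_form A \<omega> \<phi>)"
begin

sublocale pt: orbit_point "tangent_space A p" "E p" "B p" "\<omega> p" "\<phi> p" for p
  by (rule pt)

abbreviation "K \<equiv> K_endo A \<omega> \<phi>"

lemma K_Kv: "v \<in> T p \<Longrightarrow> K p v = pt.Kv p v"
  unfolding K_endo_def by (rule pt.Kv_the)

lemma K_T [simp]: "v \<in> T p \<Longrightarrow> K p v \<in> T p"
  by (simp add: K_Kv)

lemma K_linear_map: "linear_map_on (T p) (T p) (K p)"
  using pt.Kv_linear[of p] unfolding linear_map_on_def
  by (auto simp: K_Kv subspace_add[OF subspace_T] subspace_scale[OF subspace_T])

lemma K_add: "u \<in> T p \<Longrightarrow> v \<in> T p \<Longrightarrow> K p (u + v) = K p u + K p v"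
  using K_linear_map[of p] unfolding linear_map_on_def by (metis scaleR_one)

lemma K_scale: "u \<in> T p \<Longrightarrow> K p (r *\<^sub>R u) = r *\<^sub>R K p u"
  using K_linear_map[of p] unfolding linear_map_on_def by (metis add.right_neutral scaleR_zero_left)

lemma K_K_0 [simp]: "v \<in> T p \<Longrightarrow> K p (K p v) = 0"
  by (simp add: K_Kv)

definition Kc :: "('a, 6) chart \<Rightarrow> real ^ 6 \<Rightarrow> real ^ 6 \<Rightarrow> real ^ 6" where
  "Kc c x v = K (chart_inv c x) (tvec_of A c (chart_inv c x) v) c"

lemma tvec_Kc: "c \<in> A \<Longrightarrow> x \<in> img c \<Longrightarrow>
    tvec_of A c (chart_inv c x) (Kc c x v) = K (chart_inv c x) (tvec_of A c (chart_inv c x) v)"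
  unfolding Kc_def by (rule tvec_of_chart) auto

lemma K_chart: "c \<in> A \<Longrightarrow> p \<in> fst c \<Longrightarrow> v \<in> T p \<Longrightarrow> K p v c = Kc c (snd c p) (v c)"
  by (simp add: Kc_def tvec_of_chart)

lemma Kc_linear: "c \<in> A \<Longrightarrow> x \<in> img c \<Longrightarrow> linear (Kc c x)"
  unfolding Kc_def
  by (rule linearI) (simp_all add: tvec_of_add tvec_of_scale K_add K_scale tangent_scale)

lemma Kc_Kc: "c \<in> A \<Longrightarrow> x \<in> img c \<Longrightarrow> Kc c x (Kc c x v) = 0"
  using tvec_Kc[of c x v] by (simp add: Kc_def[of c x "Kc c x v"])

lemma local_smooth_\<omega>: "c \<in> A \<Longrightarrow> length vs = 2 \<Longrightarrow>
    smooth_on (img c) (\<lambda>x. \<omega> (chart_inv c x) (map (tvec_of A c (chart_inv c x)) vs))"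
  and local_smooth_\<phi>: "c \<in> A \<Longrightarrow> length vs = 3 \<Longrightarrow>
    smooth_on (img c) (\<lambda>x. \<phi> (chart_inv c x) (map (tvec_of A c (chart_inv c x)) vs))"
  using \<omega>_form \<phi>_form unfolding differential_form_def local_form_def by blast+

text \<open>The coefficient of \<open>K v\<close> at a basis vector is the quotient of two values of the Liouville form, one of
  which is given by the defining equation of \<open>K\<close>.\<close>

lemma Kc_smooth:
  assumes c: "c \<in> A" shows "smooth_on (img c) (\<lambda>x. Kc c x v)"
proof (rule smooth_on_local)
  note o = image_open[OF c]
  let ?q = "chart_inv c" and ?\<tau> = "\<lambda>x. tvec_of A c (chart_inv c x)"
  fix x0 assume x0: "x0 \<in> img c"
  have q0: "?q x0 \<in> fst c" using c x0 by simp
  \<comment> \<open>The adapted frame at the single point \<open>x0\<close>, continued by constant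
    coordinates. The frames chosen at nearby points need not vary smoothly and cannot be used
    here.\<close>
  define b where "b i = B (?q x0) i c" for i
  define l where "l i v = E (?q x0) i (?\<tau> x0 v)" for i v
  have l_exp: "v = (\<Sum>i\<in>UNIV. l i v *\<^sub>R b i)" for v
  proof -
    have "?\<tau> x0 v = (\<Sum>i\<in>UNIV. l i v *\<^sub>R B (?q x0) i)"
      unfolding l_def by (rule pt.e_expand) (use c q0 in simp)
    then have "?\<tau> x0 v c = (\<Sum>i\<in>UNIV. l i v *\<^sub>R B (?q x0) i) c" by (rule fun_cong)
    then show ?thesis using c q0 by (simp only: tvec_of_self sum_apply_chart tangent_scale b_def)
  qed
  define os where "os j = map b (filter (\<lambda>i. i \<noteq> j) [1,2,3,4,5,6])" for j
  have "\<forall>j. length (os j) = 5" unfolding forall_6 os_def by simp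
  then have os: "length (os j) = 5" for j by blast
  define vol where "vol x us = liouville_form (\<omega> (?q x)) (map (?\<tau> x) us)" for x us
  define r where "r j x = - wedge 2 3 (contract (?\<tau> x v) (\<phi> (?q x))) (\<phi> (?q x)) (map (?\<tau> x) (os j))" for j x
  have vol_D: "vol x us = pt.D (?q x) [1,2,3,4,5,6] (map (?\<tau> x) us)" if "x \<in> img c" "length us = 6" for x us
    unfolding vol_def by (rule pt.liouville_D) (use that c in \<open>auto simp: vectors_def\<close>)
  have vol_smooth: "smooth_on (img c) (\<lambda>x. vol x us)" if "length us = 6" for us
  proof -
    have w2: "smooth_on (img c) (\<lambda>x. wedge 2 2 (\<omega> (?q x)) (\<omega> (?q x)) (map (?\<tau> x) vs))" if "length vs = 4" for vs
      by (rule local_wedge_smooth[OF o]) (use that local_smooth_\<omega>[OF c] in auto)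
    have "smooth_on (img c) (\<lambda>x. wedge 4 2 (wedge 2 2 (\<omega> (?q x)) (\<omega> (?q x))) (\<omega> (?q x)) (map (?\<tau> x) us))"
      by (rule local_wedge_smooth[OF o]) (use that local_smooth_\<omega>[OF c] w2 in auto)
    then show ?thesis unfolding vol_def liouville_form_def
      by (intro smooth_on_divide[OF o] smooth_on_const[OF o]) auto
  qed
  have r_smooth: "smooth_on (img c) (r j)" for j
    unfolding r_def
  proof (rule smooth_on_minus[OF o], rule local_wedge_smooth[OF o])
    show "smooth_on (img c) (\<lambda>x. contract (?\<tau> x v) (\<phi> (?q x)) (map (?\<tau> x) vs))" if "length vs = 2" for vs
      using local_smooth_\<phi>[OF c, of "v # vs"] that by (simp add: contract_def)
  qed (use os local_smooth_\<phi>[OF c] in auto)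
  \<comment> \<open>Cramer's rule: when \<open>K v\<close> is expanded in the constant frame, every
    component except the \<open>j\<close>-th repeats one of the five vectors in \<open>os j\<close>
    and contributes nothing to the volume.\<close>
  have coef: "l j (Kc c x v) * vol x (b j # os j) = r j x" if x: "x \<in> img c" for j x
  proof -
    have q: "?q x \<in> fst c" using c x by simp
    have T: "?\<tau> x w \<in> T (?q x)" for w using c q by simp
    have osT: "map (?\<tau> x) (os j) \<in> vectors 5 (T (?q x))" using os T by (auto simp: vectors_def)
    have len: "length (map (?\<tau> x) (os j)) = 5" using os by simp
    have "pt.K_rel (?q x) (?\<tau> x v) (?\<tau> x (Kc c x v))"
      using pt.K_rel_iff[OF T[of v]] T[of v] tvec_Kc[OF c x, of v] by (simp add: K_Kv)
    then have "vol x (Kc c x v # os j) = r j x"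
      unfolding pt.K_rel_def using osT by (simp add: vol_def r_def contract_def)
    moreover have "vol x (Kc c x v # os j) = l j (Kc c x v) * vol x (b j # os j)"
    proof -
      let ?h = "\<lambda>u. pt.D (?q x) [1,2,3,4,5,6] (u # map (?\<tau> x) (os j))"
      have lin: "linear (\<lambda>w. ?h (?\<tau> x w))"
        using pt.D_linear[OF len, of "?q x"] T linear_map_on_add[OF pt.D_linear[OF len]]
          linear_map_on_scale[OF pt.D_linear[OF len]] c q
        by (intro linearI) (simp_all add: tvec_of_add tvec_of_scale)
      have z: "?h (?\<tau> x (b i)) = 0" if "i \<noteq> j" for i
      proof (rule pt.D_repeated[OF _ len])
        have "i \<in> set [1,2,3,4,5,6]" using UNIV_6 by auto
        then show "?\<tau> x (b i) \<in> set (map (?\<tau> x) (os j))" using that by (auto simp: os_def)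
      qed
      have "vol x (Kc c x v # os j) = ?h (?\<tau> x (Kc c x v))" using vol_D[OF x, of "_ # os j"] os by simp
      also have "\<dots> = ?h (?\<tau> x (\<Sum>i\<in>UNIV. l i (Kc c x v) *\<^sub>R b i))" using l_exp[of "Kc c x v"] by simp
      also have "\<dots> = (\<Sum>i\<in>UNIV. l i (Kc c x v) * ?h (?\<tau> x (b i)))"
        by (simp add: linear_sum[OF lin] linear_cmul[OF lin])
      also have "\<dots> = (\<Sum>i\<in>UNIV. if i = j then l j (Kc c x v) * ?h (?\<tau> x (b j)) else 0)"
        by (rule sum.cong) (use z in auto)
      also have "\<dots> = l j (Kc c x v) * vol x (b j # os j)" using vol_D[OF x, of "_ # os j"] os by simp
      finally show ?thesis .
    qed
    ultimately show ?thesis by simp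
  qed
  have nz: "vol x0 (b j # os j) \<noteq> 0" for j
  proof -
    have "?\<tau> x0 (b i) = B (?q x0) i" for i unfolding b_def by (rule tvec_of_chart) (use c q0 in auto)
    then have "map (?\<tau> x0) (b j # os j) = map (B (?q x0)) (j # filter (\<lambda>i. i \<noteq> j) [1,2,3,4,5,6])"
      by (simp add: os_def)
    then show ?thesis using pt.D_frame_nonzero[of "?q x0" j] vol_D[OF x0, of "b j # os j"] os by simp
  qed
  define N where "N = (\<Inter>j\<in>UNIV. {x \<in> img c. vol x (b j # os j) \<in> - {0}})"
  have "open {x \<in> img c. vol x (b j # os j) \<in> - {0}}" for j
    using continuous_open_preimage[OF smooth_on_continuous[OF vol_smooth] o, of "b j # os j" "- {0}"] os
      open_Compl[OF closed_singleton[of "0::real"]]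
    by (simp add: vimage_def Int_def)
  then have N: "open N" unfolding N_def by (intro open_INT) auto
  have Nc: "N \<subseteq> img c" by (auto simp: N_def)
  have "smooth_on N (\<lambda>x. \<Sum>j\<in>UNIV. (r j x / vol x (b j # os j)) *\<^sub>R b j)"
    using os by (intro smooth_on_sum smooth_on_scaleR smooth_on_divide smooth_on_const N
      smooth_on_subset[OF r_smooth o Nc N] smooth_on_subset[OF vol_smooth o Nc N]) (auto simp: N_def)
  then have "smooth_on N (\<lambda>x. Kc c x v)"
  proof (rule smooth_on_cong[OF N, rotated])
    fix x assume x: "x \<in> N"
    then have "r j x / vol x (b j # os j) = l j (Kc c x v)" for j
      using coef[of x j] Nc by (auto simp: N_def field_simps)
    then show "(\<Sum>j\<in>UNIV. (r j x / vol x (b j # os j)) *\<^sub>R b j) = Kc c x v"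
      using l_exp[of "Kc c x v"] by simp
  qed
  then show "\<exists>N. open N \<and> x0 \<in> N \<and> N \<subseteq> img c \<and> smooth_on N (\<lambda>x. Kc c x v)"
    using N Nc x0 nz by (intro exI[of _ N]) (auto simp: N_def)
qed

lemma smooth_endomorphism_K: "smooth_endomorphism A K"
  unfolding smooth_endomorphism_def using K_linear_map Kc_smooth unfolding Kc_def by blast

lemma ext_deriv_4: 
  assumes "closed_form A 3 \<alpha>" "c \<in> A" "x \<in> img c"
  shows "frechet_derivative (\<lambda>y. local_form A c \<alpha> y [v2, v3, v4]) (at x) v1
      - frechet_derivative (\<lambda>y. local_form A c \<alpha> y [v1, v3, v4]) (at x) v2
      + frechet_derivative (\<lambda>y. local_form A c \<alpha> y [v1, v2, v4]) (at x) v3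
      - frechet_derivative (\<lambda>y. local_form A c \<alpha> y [v1, v2, v3]) (at x) v4 = 0"
proof -
  have "local_ext_deriv A c \<alpha> x [v1, v2, v3, v4] = 0"
    using assms unfolding closed_form_def by (auto simp: eval_nat_numeral)
  then show ?thesis by (simp add: local_ext_deriv_def lessThan_Suc)
qed

lemma local_F: "c \<in> A \<Longrightarrow> x \<in> img c \<Longrightarrow>
    local_form A c (F_form A \<omega> \<phi>) x [u, v, w] = - 2 * local_form A c \<phi> x [Kc c x u, v, w]"
  by (simp add: local_form_def F_form_def tvec_Kc)

text \<open>Here the two worlds meet: the pointwise algebra comes from the adapted frame at each
  point, the smoothness and closedness from the forms themselves in the chart.\<close>

lemma closed_nilpotent_chart:
  assumes c: "c \<in> A"
  shows "closed_nilpotent (img c) (Kc c) (\<lambda>x u v w. local_form A c \<phi> x [u, v, w])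
    (\<lambda>x u v w. local_form A c (F_form A \<omega> \<phi>) x [u, v, w])"
proof -
  note o = image_open[OF c]
  have \<phi>l: "local_form A c \<phi> x [u + u', v, w] = local_form A c \<phi> x [u, v, w] + local_form A c \<phi> x [u', v, w]"
    "local_form A c \<phi> x [r *\<^sub>R u, v, w] = r * local_form A c \<phi> x [u, v, w]"
    "local_form A c \<phi> x [v, u, w] = - local_form A c \<phi> x [u, v, w]"
    if "x \<in> img c" for x u u' v w and r :: real
  proof -
    have T: "tvec_of A c (chart_inv c x) y \<in> T (chart_inv c x)" for y using that c by simp
    show "local_form A c \<phi> x [u + u', v, w] = local_form A c \<phi> x [u, v, w] + local_form A c \<phi> x [u', v, w]"
      "local_form A c \<phi> x [r *\<^sub>R u, v, w] = r * local_form A c \<phi> x [u, v, w]"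
      using that c by (simp_all add: local_form_def tvec_of_add tvec_of_scale pt.p_add pt.p_scale)
    show "local_form A c \<phi> x [v, u, w] = - local_form A c \<phi> x [u, v, w]"
      unfolding local_form_def list.map by (rule pt.p_skew[OF T T T])
  qed
  have \<phi>lin: "linear (\<lambda>u. local_form A c \<phi> x [u, v, w])" if "x \<in> img c" for x v w
    using \<phi>l(1,2)[OF that] by (intro linearI) auto
  have \<phi>s: "smooth_on (img c) (\<lambda>x. local_form A c \<phi> x [u, v, w])" for u v w
    using local_smooth_\<phi>[OF c, of "[u, v, w]"] by (simp add: local_form_def)
  show ?thesis
  proof (intro closed_nilpotent.intro closed_nilpotent_axioms.intro nilpotent_field.intro)
    show "smooth_on (img c) (\<lambda>x. local_form A c (F_form A \<omega> \<phi>) x [u, v, w])" for u v w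
    proof (rule smooth_on_cong[OF o])
      show "smooth_on (img c) (\<lambda>x. - 2 * local_form A c \<phi> x [Kc c x u, v, w])"
        by (intro smooth_on_mult[OF o] smooth_on_const[OF o]
          smooth_on_apply_family[where L="\<lambda>x u. local_form A c \<phi> x [u, v, w]", OF o \<phi>lin \<phi>s Kc_smooth[OF c]])
    qed (use local_F[OF c] in simp)
    show "linear (\<lambda>u. local_form A c (F_form A \<omega> \<phi>) x [u, v, w])" if x: "x \<in> img c" for x v w
      using linear_compose[OF Kc_linear[OF c x] \<phi>lin[OF x, of v w]]
      by (simp add: local_F[OF c x] o_def linear_iff)
    show "local_form A c (F_form A \<omega> \<phi>) x [v, u, w] = - local_form A c (F_form A \<omega> \<phi>) x [u, v, w]"
      if x: "x \<in> img c" for x u v w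
    proof -
      have T: "tvec_of A c (chart_inv c x) w \<in> T (chart_inv c x)" for w using c x by simp
      show ?thesis
        unfolding local_form_def F_form_def using pt.F_eq[OF T[of u] T[of v] T[of w]] pt.F_eq[OF T[of v] T[of u] T[of w]]
        by (simp add: K_Kv[OF T] dform_3 algebra_simps)
    qed
    show "local_form A c (F_form A \<omega> \<phi>) x [Kc c x u, v, w] = 0" if x: "x \<in> img c" for x u v w
      unfolding local_F[OF c x] Kc_Kc[OF c x] using linear_0[OF \<phi>lin[OF x, of v w]] by simp
    show "v = 0" if x: "x \<in> img c" and *: "\<And>u w. local_form A c \<phi> x [v, u, w] = 0" for x v
    proof -
      let ?q = "chart_inv c x"
      have q: "?q \<in> fst c" using c x by simp
      have "tvec_of A c ?q v = 0"
      proof (rule pt.p_nondegenerate)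
        show "tvec_of A c ?q v \<in> T ?q" using c q by simp
        show "\<phi> ?q [tvec_of A c ?q v, y, z] = 0" if "y \<in> T ?q" "z \<in> T ?q" for y z
          using *[of "y c" "z c"] that c q by (simp add: local_form_def tvec_of_chart)
      qed
      then have "tvec_of A c ?q v c = 0" by simp
      then show ?thesis using c q by simp
    qed
  qed (fact o | rule Kc_linear[OF c] Kc_smooth[OF c] Kc_Kc[OF c] \<phi>lin \<phi>s \<phi>l(3) local_F[OF c]
      ext_deriv_4[OF \<phi>_closed c] ext_deriv_4[OF F_closed c]; assumption)+
qed

lemma ker_range: "c \<in> A \<Longrightarrow> x \<in> img c \<Longrightarrow> {v. Kc c x v = 0} = range (Kc c x)"
proof (intro equalityI subsetI)
  fix v assume c: "c \<in> A" and x: "x \<in> img c" and "v \<in> {v. Kc c x v = 0}"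
  let ?q = "chart_inv c x" and ?v = "tvec_of A c (chart_inv c x) v"
  have q: "?q \<in> fst c" using c x by simp
  then have vT: "?v \<in> T ?q" using c by simp
  have "K ?q ?v = 0" using \<open>v \<in> _\<close> tvec_Kc[OF c x, of v] tvec_of_0[OF c q] by simp
  then have "?v \<in> {v \<in> T ?q. pt.Kv ?q v = 0}" using vT by (simp add: K_Kv)
  then obtain u where u: "u \<in> T ?q" "?v = pt.Kv ?q u" unfolding pt.Kv_image by blast
  have "?v c = Kc c x (u c)" using u K_chart[OF c q u(1)] c x by (simp add: K_Kv)
  then show "v \<in> range (Kc c x)" using c q by simp
qed (auto simp: Kc_Kc)

lemma integrable_nilpotent_chart:
  assumes c: "c \<in> A" shows "integrable_nilpotent (img c) (Kc c)"
proof -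
  interpret closed_nilpotent "img c" "Kc c" "\<lambda>x u v w. local_form A c \<phi> x [u, v, w]"
    "\<lambda>x u v w. local_form A c (F_form A \<omega> \<phi>) x [u, v, w]" by (rule closed_nilpotent_chart[OF c])
  show ?thesis by unfold_locales (use nij_eq_0 ker_range[OF c] in auto)
qed

lemma vector_field_K:
  assumes X: "vector_field_on A U X" and U: "open U"
  shows "vector_field_on A U (\<lambda>q. K q (X q))"
  unfolding vector_field_on_def
proof (intro conjI ballI)
  show "K p (X p) \<in> T p" if "p \<in> U" for p using vector_field_T[OF X that] by simp
  fix c assume c: "c \<in> A"
  let ?S = "snd c ` (fst c \<inter> U)"
  have S: "open ?S" "?S \<subseteq> img c" using open_img_Int[OF c U] by auto
  have "smooth_on ?S (\<lambda>x. Kc c x (X (chart_inv c x) c))"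
    by (rule smooth_on_apply_family[OF S(1) Kc_linear[OF c] smooth_on_subset[OF Kc_smooth[OF c] image_open[OF c] S(2,1)]
      vector_field_smooth[OF X c]]) (use S in auto)
  then show "smooth_on ?S (\<lambda>x. K (chart_inv c x) (X (chart_inv c x)) c)"
  proof (rule smooth_on_cong[OF S(1), rotated])
    fix x assume "x \<in> ?S"
    then have "x \<in> img c" "chart_inv c x \<in> U" using c by auto
    then show "Kc c x (X (chart_inv c x) c) = K (chart_inv c x) (X (chart_inv c x)) c"
      using K_chart[OF c, of "chart_inv c x"] vector_field_T[OF X] c by simp
  qed
qed

text \<open>The bracket of vector fields is tangent, so \<open>K_K_0\<close> removes the first term
  of \<open>nijenhuis\<close>.\<close>

lemma nijenhuis_eq:
  assumes X: "vector_field_on A U X" and Y: "vector_field_on A U Y" and U: "open U" and p: "p \<in> U"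
  shows "nijenhuis A K X Y p = K p (lie_bracket A (\<lambda>q. K q (X q)) Y p) + K p (lie_bracket A X (\<lambda>q. K q (Y q)) p)
      - lie_bracket A (\<lambda>q. K q (X q)) (\<lambda>q. K q (Y q)) p"
  using lie_bracket_T[OF X Y U p] lie_bracket_T[OF vector_field_K[OF X U] Y U p]
    lie_bracket_T[OF X vector_field_K[OF Y U] U p]
  by (simp add: nijenhuis_def Let_def K_add)

text \<open>\<open>nij\<close> covers constant fields only. For general fields, the terms with
  derivatives of \<open>X\<close> and \<open>Y\<close> cancel or are killed by applying
  \<open>K\<close> twice, so the tensor depends only on the values at \<open>p\<close>.\<close>

lemma nijenhuis_0:
  assumes X: "vector_field_on A U X" and Y: "vector_field_on A U Y" and U: "open U" and p: "p \<in> U"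
  shows "nijenhuis A K X Y p = 0"
proof -
  obtain c where c: "c \<in> A" and pc: "p \<in> fst c" by (rule chart_at)
  interpret integrable_nilpotent "img c" "Kc c" by (rule integrable_nilpotent_chart[OF c])
  note KX = vector_field_K[OF X U] and KY = vector_field_K[OF Y U]
  let ?x = "snd c p" and ?S = "snd c ` (fst c \<inter> U)"
  have x: "?x \<in> img c" "?x \<in> ?S" and S: "open ?S" using pc p open_img_Int[OF c U] by auto
  define D where "D Z = frechet_derivative (\<lambda>x. Z (chart_inv c x) c) (at ?x)" for Z :: "'a \<Rightarrow> ('a, 6) tvec"
  have DZ: "((\<lambda>x. Z (chart_inv c x) c) has_derivative D Z) (at ?x)" if "vector_field_on A U Z" for Z
    unfolding D_def by (rule smooth_on_has_derivative[OF vector_field_smooth[OF that c] x(2)])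
  have DK: "D (\<lambda>q. K q (Z q)) w = dK ?x w (Z p c) + Kc c ?x (D Z w)" if Z: "vector_field_on A U Z" for Z w
  proof -
    have "((\<lambda>x. Kc c x (Z (chart_inv c x) c)) has_derivative
        (\<lambda>w. dK ?x w (Z (chart_inv c ?x) c) + Kc c ?x (D Z w))) (at ?x)"
      by (rule K_apply_has_derivative[OF x(1) DZ[OF Z]])
    then have "((\<lambda>x. K (chart_inv c x) (Z (chart_inv c x)) c) has_derivative
        (\<lambda>w. dK ?x w (Z (chart_inv c ?x) c) + Kc c ?x (D Z w))) (at ?x)"
    proof (rule has_derivative_transform_within_open[OF _ S x(2)])
      fix x assume "x \<in> ?S"
      then have "x \<in> img c" "chart_inv c x \<in> U" using c by auto
      then show "Kc c x (Z (chart_inv c x) c) = K (chart_inv c x) (Z (chart_inv c x)) c"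
        using K_chart[OF c, of "chart_inv c x"] vector_field_T[OF Z] c by simp
    qed
    from has_derivative_unique[OF DZ[OF vector_field_K[OF Z U]] this] show ?thesis
      using c pc by (simp add: fun_eq_iff)
  qed
  have lb: "lie_bracket A Z Z' p c = D Z' (Z p c) - D Z (Z' p c)" for Z Z'
    using c pc by (simp add: lie_bracket_def D_def)
  have KZ: "K p (Z p) c = Kc c ?x (Z p c)" if "vector_field_on A U Z" for Z
    by (rule K_chart[OF c pc vector_field_T[OF that p]])
  let ?X = "X p c" and ?Y = "Y p c"
  have 1: "K p (lie_bracket A (\<lambda>q. K q (X q)) Y p) c = Kc c ?x (D Y (Kc c ?x ?X)) - Kc c ?x (dK ?x ?Y ?X)"
    unfolding K_chart[OF c pc lie_bracket_T[OF KX Y U p]] lb DK[OF X] KZ[OF X]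
    by (simp add: linear_diff[OF K_lin[OF x(1)]] linear_add[OF K_lin[OF x(1)]] K_K[OF x(1)])
  have 2: "K p (lie_bracket A X (\<lambda>q. K q (Y q)) p) c = Kc c ?x (dK ?x ?X ?Y) - Kc c ?x (D X (Kc c ?x ?Y))"
    unfolding K_chart[OF c pc lie_bracket_T[OF X KY U p]] lb DK[OF Y] KZ[OF Y]
    by (simp add: linear_diff[OF K_lin[OF x(1)]] linear_add[OF K_lin[OF x(1)]] K_K[OF x(1)])
  have 3: "lie_bracket A (\<lambda>q. K q (X q)) (\<lambda>q. K q (Y q)) p c =
      dK ?x (Kc c ?x ?X) ?Y + Kc c ?x (D Y (Kc c ?x ?X)) - dK ?x (Kc c ?x ?Y) ?X - Kc c ?x (D X (Kc c ?x ?Y))"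
    unfolding lb DK[OF X] DK[OF Y] KZ[OF X] KZ[OF Y] by simp
  have T: "nijenhuis A K X Y p \<in> T p"
    unfolding nijenhuis_eq[OF X Y U p]
    by (intro pt.T_diff pt.T_add K_T lie_bracket_T[OF _ _ U p] X Y KX KY)
  have "nijenhuis A K X Y p c = nij ?x ?X ?Y"
    unfolding nijenhuis_eq[OF X Y U p] minus_apply tangent_add 1 2 3 nij_def
      linear_diff[OF K_lin[OF x(1)]] by simp
  then show ?thesis
    by (intro tangent_eqI[OF T pt.T_0 c pc]) (simp add: nij_0[OF x(1)])
qed

end

section \<open>The Lagrangian foliation\<close>

text \<open>The counterpart of \<open>open_img_Int\<close> for a chart that is not yet known to
  belong to the atlas, as is the case within \<open>compose_chart\<close>.\<close>

lemma is_chart_open_image: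
  assumes c: "is_chart c" and U: "open U" shows "open (snd c ` (fst c \<inter> U))"
proof -
  have h: "homeomorphism (fst c) (snd c ` fst c) (snd c) (chart_inv c)" and o: "open (snd c ` fst c)"
    using c by (auto simp: is_chart_def)
  have "snd c ` (fst c \<inter> U) = (snd c ` fst c) \<inter> chart_inv c -` U"
  proof (intro equalityI subsetI)
    fix x assume "x \<in> (snd c ` fst c) \<inter> chart_inv c -` U"
    then have "chart_inv c x \<in> fst c \<inter> U" "snd c (chart_inv c x) = x"
      using h unfolding homeomorphism_def by auto
    then show "x \<in> snd c ` (fst c \<inter> U)" by (metis imageI)
  next
    fix x assume "x \<in> snd c ` (fst c \<inter> U)"
    then show "x \<in> (snd c ` fst c) \<inter> chart_inv c -` U"
      using h unfolding homeomorphism_def by auto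
  qed
  moreover have "open ((snd c ` fst c) \<inter> chart_inv c -` U)"
    using h o U by (intro continuous_open_preimage) (auto simp: homeomorphism_def)
  ultimately show ?thesis by simp
qed

context smooth_mfd
begin

lemma maximal: "is_chart c \<Longrightarrow> (\<And>c'. c' \<in> A \<Longrightarrow> compatible c c') \<Longrightarrow> c \<in> A"
  using smooth_str unfolding smooth_structure_def by blast

text \<open>A local diffeomorphism of the model space changes coordinates on the part of the chart
  over \<open>V\<close>. The result is compatible with all charts and hence belongs to the atlas by
  maximality.\<close>

lemma compose_chart:
  fixes g \<Psi> :: "real ^ 'n \<Rightarrow> real ^ 'n"
  assumes c: "c \<in> A" and UV: "open U" "open V" "V \<subseteq> img c" and h: "homeomorphism U V \<Psi> g"
    and s: "smooth_on U \<Psi>" "smooth_on V g"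
  defines "c' \<equiv> (fst c \<inter> snd c -` V, g \<circ> snd c)"
  shows "c' \<in> A" and "q \<in> fst c' \<Longrightarrow> v \<in> T q \<Longrightarrow> v c' = frechet_derivative g (at (snd c q)) (v c)"
proof -
  have hc: "homeomorphism (fst c) (img c) (snd c) (chart_inv c)" by (rule chartD(3)[OF c])
  have gV: "g x \<in> U" "\<Psi> (g x) = x" if "x \<in> V" for x using h that by (auto simp: homeomorphism_def)
  have \<Psi>U: "\<Psi> z \<in> V" "g (\<Psi> z) = z" if "z \<in> U" for z using h that by (auto simp: homeomorphism_def)
  have fst': "fst c' = fst c \<inter> snd c -` V" and snd': "snd c' = g \<circ> snd c" by (auto simp: c'_def)
  have ci: "snd c (chart_inv c x) = x" "chart_inv c x \<in> fst c'" if "x \<in> V" for x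
  proof -
    have x: "x \<in> img c" using that UV(3) by (rule subsetD[rotated])
    show "snd c (chart_inv c x) = x" by (rule snd_chart_inv[OF c x])
    then show "chart_inv c x \<in> fst c'" using chart_inv_in[OF c x] that by (simp add: fst')
  qed
  have o': "open (fst c')" unfolding fst'
    by (rule continuous_open_preimage[OF _ chart_open[OF c] UV(2)]) (use hc in \<open>simp add: homeomorphism_def\<close>)
  have img': "snd c' ` fst c' = U"
  proof (intro equalityI subsetI)
    fix z assume z: "z \<in> U"
    have "snd c' (chart_inv c (\<Psi> z)) = z" using ci(1)[OF \<Psi>U(1)[OF z]] \<Psi>U(2)[OF z] by (simp add: snd')
    then show "z \<in> snd c' ` fst c'" using ci(2)[OF \<Psi>U(1)[OF z]] by (metis imageI)
  qed (auto simp: snd' fst' gV)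
  have inj: "inj_on (snd c') (fst c')"
  proof (rule inj_onI)
    fix a b assume ab: "a \<in> fst c'" "b \<in> fst c'" "snd c' a = snd c' b"
    then have V: "snd c a \<in> V" "snd c b \<in> V" and F: "a \<in> fst c" "b \<in> fst c" by (auto simp: fst')
    have "snd c a = \<Psi> (g (snd c a))" by (rule gV(2)[OF V(1), symmetric])
    also have "\<dots> = \<Psi> (g (snd c b))" using ab(3) by (simp add: snd')
    also have "\<dots> = snd c b" by (rule gV(2)[OF V(2)])
    finally have "chart_inv c (snd c a) = chart_inv c (snd c b)" by (rule arg_cong)
    then show "a = b" unfolding chart_inv_snd[OF c F(1)] chart_inv_snd[OF c F(2)] .
  qed
  have inv': "chart_inv c' z = chart_inv c (\<Psi> z)" if z: "z \<in> U" for z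
    unfolding chart_inv_def[of c']
    by (rule inv_into_f_eq[OF inj ci(2)[OF \<Psi>U(1)[OF z]]])
      (use ci(1)[OF \<Psi>U(1)[OF z]] \<Psi>U(2)[OF z] in \<open>simp add: snd'\<close>)
  have "homeomorphism (fst c') U (snd c') (chart_inv c')"
  proof (rule homeomorphismI)
    have cont: "continuous_on (fst c) (snd c)" "continuous_on (img c) (chart_inv c)"
      "continuous_on V g" "continuous_on U \<Psi>"
      using hc h unfolding homeomorphism_def by blast+
    show "continuous_on (fst c') (snd c')" unfolding snd'
    proof (rule continuous_on_compose)
      show "continuous_on (fst c') (snd c)" by (rule continuous_on_subset[OF cont(1)]) (simp add: fst')
      show "continuous_on (snd c ` fst c') g" by (rule continuous_on_subset[OF cont(3)]) (auto simp: fst')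
    qed
    have "\<Psi> ` U \<subseteq> img c" using \<Psi>U(1) UV(3) by blast
    then have "continuous_on U (chart_inv c \<circ> \<Psi>)"
      by (intro continuous_on_compose cont(4) continuous_on_subset[OF cont(2)])
    then show "continuous_on U (chart_inv c')" by (rule continuous_on_eq) (simp add: inv')
    show "chart_inv c' (snd c' q) = q" if "q \<in> fst c'" for q
      unfolding chart_inv_def using inj that by (rule inv_into_f_f)
    show "snd c' (chart_inv c' z) = z" if "z \<in> U" for z
      unfolding chart_inv_def using that img' by (intro f_inv_into_f) simp
    show "chart_inv c' ` U \<subseteq> fst c'"
    proof (intro image_subsetI)
      fix z assume z: "z \<in> U"
      show "chart_inv c' z \<in> fst c'" unfolding inv'[OF z] by (rule ci(2)[OF \<Psi>U(1)[OF z]])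
    qed
  qed (simp add: img')
  then have chart': "is_chart c'" unfolding is_chart_def img' using o' UV(1) by simp
  show c'A: "c' \<in> A"
  proof (rule maximal[OF chart'])
    fix d assume d: "d \<in> A"
    let ?O = "snd c' ` (fst c' \<inter> fst d)" and ?W = "snd c ` (fst c \<inter> fst d)"
    have O: "open ?O" by (rule is_chart_open_image[OF chart' chart_open[OF d]])
    have W: "open ?W" by (rule open_img_Int[OF c chart_open[OF d]])
    have OU: "?O \<subseteq> U" using img' by blast
    have "smooth_on ?O (\<lambda>z. transition c d (\<Psi> z))"
    proof (rule smooth_on_compose[OF O W _ transition_smooth[OF c d] smooth_on_subset[OF s(1) UV(1) OU O]])
      fix z assume "z \<in> ?O"
      then obtain q where q: "q \<in> fst c" "snd c q \<in> V" "q \<in> fst d" "z = g (snd c q)" by (auto simp: fst' snd')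
      then show "\<Psi> z \<in> ?W" using gV(2)[of "snd c q"] by auto
    qed
    then have 1: "smooth_on ?O (transition c' d)"
      by (rule smooth_on_cong[OF O, rotated]) (use OU inv' in \<open>auto simp: transition_def\<close>)
    let ?P = "snd d ` (fst d \<inter> fst c')"
    have P: "open ?P" by (rule open_img_Int[OF d o'])
    have PP: "?P \<subseteq> snd d ` (fst d \<inter> fst c)" by (auto simp: fst')
    have "smooth_on ?P (\<lambda>x. g (transition d c x))"
    proof (rule smooth_on_compose[OF P UV(2) _ s(2)
        smooth_on_subset[OF transition_smooth[OF d c] open_img_Int[OF d chart_open[OF c]] PP P]])
      fix x assume "x \<in> ?P"
      then show "transition d c x \<in> V" using d by (auto simp: fst' transition_def)
    qed
    then have 2: "smooth_on ?P (transition d c')"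
      by (rule smooth_on_cong[OF P, rotated]) (auto simp: transition_def snd')
    show "compatible c' d" unfolding compatible_def using 1 2 by (simp add: Int_commute)
  qed
  assume q: "q \<in> fst c'" and v: "v \<in> T q"
  have qc: "q \<in> fst c" "snd c q \<in> V" using q by (auto simp: fst')
  have "(g has_derivative frechet_derivative g (at (snd c q))) (at (snd c q))"
    by (rule smooth_on_has_derivative[OF s(2) qc(2)])
  then have "(transition c c' has_derivative frechet_derivative g (at (snd c q))) (at (snd c q))"
    by (rule has_derivative_transform_within_open[OF _ UV(2) qc(2)]) (simp add: transition_def snd' ci)
  from has_derivative_unique[OF dtr[OF c c'A qc(1) q] this]
  show "v c' = frechet_derivative g (at (snd c q)) (v c)"
    using tangent_space_dtr[OF v c c'A qc(1) q] by simp
qed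

end

context orbit_mfd
begin

definition L :: "'a \<Rightarrow> ('a, 6) tvec set" where "L p = {v \<in> T p. K p v = 0}"

lemma foliation_L: "foliation A 3 L"
  unfolding foliation_def
proof
  fix p
  obtain c where c: "c \<in> A" and pc: "p \<in> fst c" by (rule chart_at)
  interpret integrable_nilpotent "img c" "Kc c" by (rule integrable_nilpotent_chart[OF c])
  define f where "f i = B p i c" for i
  have x: "snd c p \<in> img c" using pc by simp
  have Kf: "Kc c (snd c p) (f 2) = - 2 *\<^sub>R f 1" "Kc c (snd c p) (f 4) = - 2 *\<^sub>R f 3" "Kc c (snd c p) (f 6) = - 2 *\<^sub>R f 5"
    unfolding f_def K_chart[OF c pc pt.f_T, symmetric]
    by (simp_all add: K_Kv pt.Kv_def scaleR_fun_def)
  have "linear (\<lambda>v :: real ^ 6. \<Sum>i\<in>UNIV. (v $ i) *\<^sub>R f i)"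
    by (auto simp: linear_iff scaleR_sum_right sum.distrib algebra_simps)
  then have inj: "inj (\<lambda>v :: real ^ 6. \<Sum>i\<in>UNIV. (v $ i) *\<^sub>R f i)"
    unfolding linear_injective_0[OF \<open>linear _\<close>]
  proof (intro allI impI)
    fix v :: "real ^ 6" assume v: "(\<Sum>i\<in>UNIV. (v $ i) *\<^sub>R f i) = 0"
    let ?s = "\<Sum>i\<in>UNIV. (v $ i) *\<^sub>R B p i"
    have sT: "?s \<in> T p" by (intro subspace_sum[OF subspace_T] pt.T_scale pt.f_T)
    have "?s c = 0" using v by (simp only: sum_apply_chart tangent_scale f_def)
    then have s0: "?s = 0" by (intro tangent_eqI[OF sT pt.T_0 c pc]) simp
    \<comment> \<open>\<open>E p\<close> is dual to the frame \<open>B p\<close> and thus recovers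
      the coefficients of the combination.\<close>
    have Es: "E p j ?s = v $ j" for j
    proof -
      have "E p j (\<Sum>i\<in>I. (v $ i) *\<^sub>R B p i) = (\<Sum>i\<in>I. v $ i * E p j (B p i))" for I
      proof (induction I rule: infinite_finite_induct)
        case (insert i I)
        have IT: "(\<Sum>i\<in>I. (v $ i) *\<^sub>R B p i) \<in> T p" by (intro subspace_sum[OF subspace_T] pt.T_scale pt.f_T)
        then show ?case
          unfolding sum.insert[OF insert(1,2)] pt.e_add[OF pt.T_scale[OF pt.f_T] IT] insert(3)
          by simp
      qed (simp_all only: sum.empty sum.infinite pt.e_0 not_False_eq_True)
      then show ?thesis by (simp add: if_distrib[of "times _"] cong: if_cong)
    qed
    have "v $ j = 0" for j using Es[of j] unfolding s0 pt.e_0 by simp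
    then show "v = 0" by (simp add: vec_eq_iff)
  qed
  obtain U V :: "(real ^ 6) set" and \<Psi> g :: "real ^ 6 \<Rightarrow> real ^ 6"
    where UV: "open U" "open V" "snd c p \<in> V" "V \<subseteq> img c" and h: "homeomorphism U V \<Psi> g"
    and s: "smooth_on U \<Psi>" "smooth_on V g"
    and key: "\<And>x v. x \<in> V \<Longrightarrow> Kc c x v = 0 \<longleftrightarrow> (\<forall>i. i \<notin> {1, 3, 5} \<longrightarrow> frechet_derivative g (at x) v $ i = 0)"
    using local_foliation[OF x inj Kf] by metis
  \<comment> \<open>In this chart the coordinates of a tangent vector are obtained with the
    derivative of \<open>g\<close>, so \<open>key\<close> says that the kernel is spanned by the
    coordinate directions 1, 3 and 5.\<close>
  define c' where "c' = (fst c \<inter> snd c -` V, g \<circ> snd c)"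
  note cc = compose_chart[OF c UV(1,2,4) h s, folded c'_def]
  have "card {1, 3, 5 :: 6} = 3" by simp
  moreover have "L q = {v \<in> T q. \<forall>i. i \<notin> {1, 3, 5} \<longrightarrow> v c' $ i = 0}" if q: "q \<in> fst c'" for q
  proof -
    have qc: "q \<in> fst c" "snd c q \<in> V" using q by (auto simp: c'_def)
    have "K q v = 0 \<longleftrightarrow> (\<forall>i. i \<notin> {1, 3, 5} \<longrightarrow> v c' $ i = 0)" if v: "v \<in> T q" for v
    proof -
      have "K q v = 0 \<longleftrightarrow> Kc c (snd c q) (v c) = 0"
      proof
        assume "Kc c (snd c q) (v c) = 0"
        then have "K q v c = 0" using K_chart[OF c qc(1) v] by simp
        then show "K q v = 0" by (intro tangent_eqI[OF K_T[OF v] pt.T_0 c qc(1)]) simp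
      next
        assume "K q v = 0"
        then have "K q v c = 0" by simp
        then show "Kc c (snd c q) (v c) = 0" using K_chart[OF c qc(1) v] by simp
      qed
      then show ?thesis unfolding cc(2)[OF q v] key[OF qc(2)] .
    qed
    then show ?thesis unfolding L_def by blast
  qed
  moreover have "p \<in> fst c'" using pc UV by (simp add: c'_def)
  ultimately show "\<exists>c\<in>A. p \<in> fst c \<and> (\<exists>I. card I = 3 \<and>
      (\<forall>q\<in>fst c. L q = {v \<in> T q. \<forall>i. i \<notin> I \<longrightarrow> v c $ i = 0}))"
    using cc(1) by blast
qed

end

section \<open>Frames of the quotient\<close>

lemma forall_less_3: "(\<forall>i<3::nat. P i) \<longleftrightarrow> P 0 \<and> P 1 \<and> P 2"
  by (auto simp: less_Suc_eq eval_nat_numeral)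

context orbit_point
begin

definition ker :: "'v set" where "ker = {v \<in> T. Kv v = 0}"

lemma ker_iff: "v \<in> ker \<longleftrightarrow> v \<in> T \<and> e 2 v = 0 \<and> e 4 v = 0 \<and> e 6 v = 0"
  by (auto simp: ker_def Kv_eq_0_iff)

text \<open>\<open>D3\<close> is \<open>e\<^sup>2\<^sup>4\<^sup>6 = F / 4\<close>.\<close>

definition D3 :: "'v \<Rightarrow> 'v \<Rightarrow> 'v \<Rightarrow> real" where "D3 u v x = dform [e 2, e 4, e 6] [u, v, x]"

lemmas D3_eq = D3_def[unfolded dform_3]

lemma Kv_D3: "u \<in> T \<Longrightarrow> v \<in> T \<Longrightarrow> x \<in> T \<Longrightarrow> - 2 * p [Kv u, v, x] = 4 * D3 u v x"
  unfolding D3_def by (rule F_eq)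

lemma D3_cong:
  assumes "u \<in> T" "v \<in> T" "x \<in> T" "u' \<in> T" "v' \<in> T" "x' \<in> T"
    "u - u' \<in> ker" "v - v' \<in> ker" "x - x' \<in> ker"
  shows "D3 u v x = D3 u' v' x'"
  using assms by (simp add: ker_iff D3_eq)

text \<open>Cramer's rule in the quotient by \<open>ker\<close>, on which \<open>e 2\<close>,
  \<open>e 4\<close>, \<open>e 6\<close> are coordinates and \<open>D3\<close> is the
  determinant.\<close>

lemma D3_Cramer: "e i u * D3 x y z = D3 u y z * e i x + D3 u z x * e i y + D3 u x y * e i z" if "i \<in> {2, 4, 6}"
  using that by (auto simp: D3_eq algebra_simps)

lemma sum_3_T: "range b \<subseteq> T \<Longrightarrow> (\<Sum>i\<in>UNIV. r i *\<^sub>R b (i :: 3)) \<in> T"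
  by (intro subspace_sum[OF sub] T_scale) auto

lemma e_sum_3: "range b \<subseteq> T \<Longrightarrow> e j (\<Sum>i\<in>UNIV. r i *\<^sub>R b (i :: 3)) = (\<Sum>i\<in>UNIV. r i * e j (b i))"
  unfolding sum_3 by (simp add: image_subset_iff)

lemma D3_change:
  assumes b: "range b \<subseteq> T" and b': "range b' \<subseteq> T"
    and P: "\<And>i. b' i - (\<Sum>j\<in>UNIV. P $ i $ j *\<^sub>R b j) \<in> ker"
  shows "D3 (b' 1) (b' 2) (b' 3) = det (P :: real ^ 3 ^ 3) * D3 (b 1) (b 2) (b 3)"
proof -
  have "e k (b' i) = (\<Sum>j\<in>UNIV. P $ i $ j * e k (b j))" if "k \<in> {2, 4, 6}" for k i
  proof -
    have T: "b' i \<in> T" "(\<Sum>j\<in>UNIV. P $ i $ j *\<^sub>R b j) \<in> T" using b' sum_3_T[OF b] by auto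
    have "e k (b' i - (\<Sum>j\<in>UNIV. P $ i $ j *\<^sub>R b j)) = 0" using P[of i] that by (auto simp: ker_iff)
    then show ?thesis using T by (simp add: e_sum_3[OF b])
  qed
  then show ?thesis by (simp add: D3_eq det_3 sum_3 algebra_simps)
qed

text \<open>A frame of the quotient with \<open>D3\<close> equal to 1. For the metric its vectors
  are orthogonal and of length \<open>sqrt 2\<close>.\<close>

definition std :: "3 \<Rightarrow> 'v" where "std i = (if i = 1 then f 2 else if i = 2 then f 4 else f 6)"

lemma std_T: "range std \<subseteq> T" by (auto simp: std_def)

lemma D3_std: "D3 (std 1) (std 2) (std 3) = 1" by (simp add: std_def D3_eq)

text \<open>If \<open>b\<close> is a frame, expressing \<open>std\<close> through it shows that
  \<open>D3\<close> of \<open>b\<close> divides 1. Conversely, a nonzero \<open>D3\<close> lets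
  Cramer's rule produce the coefficients, and the same values of \<open>D3\<close> determine
  them.\<close>

lemma frames_iff:
  "b \<in> quotient_frames T ker \<longleftrightarrow> range b \<subseteq> T \<and> D3 (b 1) (b 2) (b (3 :: 3)) \<noteq> 0"
proof (intro iffI conjI)
  assume b: "b \<in> quotient_frames T ker"
  then show bT: "range b \<subseteq> T" by (simp add: quotient_frames_def)
  have "\<forall>i. \<exists>a :: real ^ 3. std i - (\<Sum>j\<in>UNIV. a $ j *\<^sub>R b j) \<in> ker"
    using b std_T unfolding quotient_frames_def by blast
  then obtain a :: "3 \<Rightarrow> real ^ 3" where a: "\<And>i. std i - (\<Sum>j\<in>UNIV. a i $ j *\<^sub>R b j) \<in> ker" by metis
  have "D3 (std 1) (std 2) (std 3) = det (\<chi> i. a i) * D3 (b 1) (b 2) (b 3)"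
    by (rule D3_change[OF bT std_T]) (simp add: a)
  then show "D3 (b 1) (b 2) (b 3) \<noteq> 0" using D3_std by auto
next
  assume "range b \<subseteq> T \<and> D3 (b 1) (b 2) (b 3) \<noteq> 0"
  then have bT: "range b \<subseteq> T" and nz: "D3 (b 1) (b 2) (b 3) \<noteq> 0" by auto
  have b_T: "b i \<in> T" for i using bT by auto
  let ?D = "D3 (b 1) (b 2) (b 3)"
  show "b \<in> quotient_frames T ker"
    unfolding quotient_frames_def mem_Collect_eq
  proof (intro conjI bT ballI ex1I)
    fix u assume u: "u \<in> T"
    define a :: "real ^ 3" where "a = (\<chi> i. (if i = 1 then D3 u (b 2) (b 3) else if i = 2 then D3 u (b 3) (b 1)
      else D3 u (b 1) (b 2)) / ?D)"
    have "e k (u - (\<Sum>i\<in>UNIV. a $ i *\<^sub>R b i)) = 0" if "k \<in> {2, 4, 6}" for k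
    proof -
      have "e k (u - (\<Sum>i\<in>UNIV. a $ i *\<^sub>R b i)) = e k u - (a $ 1 * e k (b 1) + a $ 2 * e k (b 2) + a $ 3 * e k (b 3))"
        unfolding e_diff[OF u sum_3_T[OF bT]] e_sum_3[OF bT] by (simp only: sum_3)
      then show ?thesis
        using D3_Cramer[OF that, of u "b 1" "b 2" "b 3"] nz by (simp add: a_def field_simps)
    qed
    then show "u - (\<Sum>i\<in>UNIV. a $ i *\<^sub>R b i) \<in> ker"
      using u sum_3_T[OF bT] by (simp add: ker_iff)
    fix a' :: "real ^ 3" assume "u - (\<Sum>i\<in>UNIV. a' $ i *\<^sub>R b i) \<in> ker"
    then have "e k u = (\<Sum>i\<in>UNIV. a' $ i * e k (b i))" if "k \<in> {2, 4, 6}" for k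
      using that u sum_3_T[OF bT] by (auto simp: ker_iff e_sum_3[OF bT])
    then have E: "e k u = a' $ 1 * e k (b 1) + a' $ 2 * e k (b 2) + a' $ 3 * e k (b 3)" if "k \<in> {2, 4, 6}" for k
      using that by (simp add: sum_3)
    have "D3 u (b 2) (b 3) = a' $ 1 * ?D" "D3 u (b 3) (b 1) = a' $ 2 * ?D" "D3 u (b 1) (b 2) = a' $ 3 * ?D"
      using E[of 2] E[of 4] E[of 6] by (simp_all add: D3_eq algebra_simps)
    then have "a' $ i = a $ i" for i using nz exhaust_3[of i] by (auto simp: a_def)
    then show "a' = a" by (simp add: vec_eq_iff)
  qed
qed

text \<open>By \<open>D3_change\<close>, every matrix that expresses \<open>b'\<close> through
  \<open>b\<close> modulo \<open>ker\<close> has the ratio of the two values of \<open>D3\<close> as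
  its determinant; such a matrix exists because \<open>b\<close> is a frame.\<close>

lemma same_orientation_iff:
  assumes b: "b \<in> quotient_frames T ker" and b': "b' \<in> quotient_frames T ker"
  shows "same_orientation ker b b' \<longleftrightarrow> D3 (b 1) (b 2) (b 3) * D3 (b' 1) (b' 2) (b' (3 :: 3)) > 0"
proof -
  let ?D = "D3 (b 1) (b 2) (b 3)"
  have bT: "range b \<subseteq> T" "range b' \<subseteq> T" and nz: "?D \<noteq> 0" using b b' by (auto simp: frames_iff)
  have *: "?D * D3 (b' 1) (b' 2) (b' 3) > 0 \<longleftrightarrow> det P > 0"
    if "\<And>i. b' i - (\<Sum>j\<in>UNIV. P $ i $ j *\<^sub>R b j) \<in> ker" for P :: "real ^ 3 ^ 3"
  proof -
    have "?D * D3 (b' 1) (b' 2) (b' 3) = det P * ?D\<^sup>2"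
      using D3_change[OF bT that] by (simp add: power2_eq_square)
    then show ?thesis using nz by (simp add: zero_less_mult_iff)
  qed
  have "\<forall>i. \<exists>a :: real ^ 3. b' i - (\<Sum>j\<in>UNIV. a $ j *\<^sub>R b j) \<in> ker"
    using b bT unfolding quotient_frames_def by blast
  then obtain a :: "3 \<Rightarrow> real ^ 3" where a: "\<And>i. b' i - (\<Sum>j\<in>UNIV. a i $ j *\<^sub>R b j) \<in> ker" by metis
  have a': "\<And>i. b' i - (\<Sum>j\<in>UNIV. (\<chi> i. a i) $ i $ j *\<^sub>R b j) \<in> ker" by (simp add: a)
  show ?thesis unfolding same_orientation_def
  proof
    assume "?D * D3 (b' 1) (b' 2) (b' 3) > 0"
    then show "\<exists>P :: real ^ 3 ^ 3. (\<forall>i. b' i - (\<Sum>j\<in>UNIV. P $ i $ j *\<^sub>R b j) \<in> ker) \<and> det P > 0"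
      using *[OF a'] a' by blast
  qed (use * in blast)
qed

text \<open>The metric is twice the sum of squares of the coordinates \<open>e 2\<close>,
  \<open>e 4\<close>, \<open>e 6\<close>. So the matrix \<open>Q\<close> of these coordinates has
  Gram matrix 1/2 times the identity, and the square of its determinant \<open>D3\<close> is
  1/8.\<close>

lemma D3_orthonormal:
  assumes b: "range b \<subseteq> T" and on: "\<And>i j. w [b i, Kv (b j)] = (if i = j then 1 else 0)"
  shows "8 * (D3 (b 1) (b 2) (b (3 :: 3)))\<^sup>2 = 1"
proof -
  define Q :: "real ^ 3 ^ 3" where "Q = (\<chi> i k. if k = 1 then e 2 (b i) else if k = 2 then e 4 (b i) else e 6 (b i))"
  have gram: "2 * (e 2 (b i) * e 2 (b j) + e 4 (b i) * e 4 (b j) + e 6 (b i) * e 6 (b j)) = (if i = j then 1 else 0)" for i j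
    using on[of i j] g_eq[OF range_subsetD[OF b] range_subsetD[OF b], of i j] by (simp del: e_Kv)
  have "(Q ** transpose Q) $ i $ j = (if i = j then 1/2 else 0)" for i j
    using gram[of i j] by (cases "i = j") (simp_all add: Q_def matrix_matrix_mult_def transpose_def sum_3)
  then have "Q ** transpose Q = (\<chi> i j. if i = j then 1/2 else 0)" by (simp add: vec_eq_iff)
  then have "det Q * det Q = 1/8"
    using det_mul[of Q "transpose Q"] by (simp add: det_3 det_transpose[of Q, unfolded det_3])
  moreover have "det Q = D3 (b 1) (b 2) (b 3)" by (simp add: det_3 Q_def D3_eq algebra_simps)
  ultimately show ?thesis by (simp add: power2_eq_square)
qed

lemma g_cong:
  assumes "u \<in> T" "u' \<in> T" "v \<in> T" "v' \<in> T" "u - u' \<in> ker" "v - v' \<in> ker"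
  shows "w [u, Kv v] = w [u', Kv v']"
  using assms by (simp add: g_eq ker_iff)

lemma g_pos: "v \<in> T \<Longrightarrow> v \<notin> ker \<Longrightarrow> w [v, Kv v] > 0"
proof -
  assume v: "v \<in> T" "v \<notin> ker"
  have "0 \<le> e 2 v * e 2 v" "0 \<le> e 4 v * e 4 v" "0 \<le> e 6 v * e 6 v" by auto
  moreover have "e 2 v * e 2 v \<noteq> 0 \<or> e 4 v * e 4 v \<noteq> 0 \<or> e 6 v * e 6 v \<noteq> 0" using v by (simp add: ker_iff)
  ultimately have "0 < e 2 v * e 2 v + e 4 v * e 4 v + e 6 v * e 6 v" by (elim disjE) linarith+
  then show ?thesis unfolding g_eq[OF v(1) v(1)] by simp
qed

end

section \<open>Metrics\<close>

lemma (in smooth_mfd) smooth_function_onI: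
  assumes "\<And>c. c \<in> A \<Longrightarrow> smooth_on (snd c ` (fst c \<inter> U)) (\<lambda>x. h (chart_inv c x))"
  shows "smooth_function_on A U h"
  using assms unfolding smooth_function_on_def by (simp add: o_def)

lemma (in smooth_mfd) vector_field_on_subset:
  assumes X: "vector_field_on A U X" and U: "open U" and V: "open V" "V \<subseteq> U"
  shows "vector_field_on A V X"
  unfolding vector_field_on_def
proof (intro conjI ballI)
  fix c assume c: "c \<in> A"
  have o: "open (snd c ` (fst c \<inter> W))" if "open W" for W using open_img_Int[OF c that] .
  show "smooth_on (snd c ` (fst c \<inter> V)) (\<lambda>x. X (chart_inv c x) c)"
    by (rule smooth_on_subset[OF vector_field_smooth[OF X c] o[OF U] _ o[OF V(1)]]) (use V(2) in auto)
qed (use V(2) vector_field_T[OF X] in auto)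

context orbit_mfd
begin

section \<open>The distribution and the metric on the quotient bundle\<close>

lemma L_ker: "L p = pt.ker p"
  unfolding L_def pt.ker_def by (auto simp: K_Kv)

lemma L_T: "v \<in> L p \<Longrightarrow> v \<in> T p" by (simp add: L_def)

lemma L_image: "L p = K p ` T p"
proof -
  have "K p ` T p = pt.Kv p ` T p" by (rule image_cong) (auto simp: K_Kv)
  then show ?thesis using pt.Kv_image[of p] by (simp add: L_ker pt.ker_def)
qed

lemma lagrangian_L: "lagrangian_distribution A \<omega> L"
  unfolding lagrangian_distribution_def
proof (intro allI conjI)
  fix p
  show "subspace (L p)"
    by (rule subspaceI) (auto simp: L_ker pt.ker_iff)
  show "L p = {v \<in> T p. \<forall>w\<in>L p. \<omega> p [v, w] = 0}"
    using pt.lagrangian[of _ p] unfolding L_ker pt.ker_def by blast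
qed

lemma g_Kv: "v \<in> T p \<Longrightarrow> \<omega> p [u, K p v] = \<omega> p [u, pt.Kv p v]" by (simp add: K_Kv)

lemma g_eq: "u \<in> T p \<Longrightarrow> v \<in> T p \<Longrightarrow>
    \<omega> p [u, K p v] = 2 * (E p 2 u * E p 2 v + E p 4 u * E p 4 v + E p 6 u * E p 6 v)"
  unfolding g_Kv by (rule pt.g_eq)

lemma \<omega>_local_linear:
  assumes "c \<in> A" "x \<in> img c"
  shows "linear (\<lambda>u. \<omega> (chart_inv c x) [tvec_of A c (chart_inv c x) u, tvec_of A c (chart_inv c x) v])"
    "linear (\<lambda>v. \<omega> (chart_inv c x) [tvec_of A c (chart_inv c x) u, tvec_of A c (chart_inv c x) v])"
  using assms by (auto intro!: linearI simp: tvec_of_add tvec_of_scale pt.w_eq algebra_simps)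

lemma smooth_\<omega>_fields:
  assumes U: "open U" and X: "vector_field_on A U X" and Y: "vector_field_on A U Y"
  shows "smooth_function_on A U (\<lambda>p. \<omega> p [X p, Y p])"
proof (rule smooth_function_onI)
  fix c assume c: "c \<in> A"
  let ?S = "snd c ` (fst c \<inter> U)" and ?\<tau> = "\<lambda>x. tvec_of A c (chart_inv c x)"
  have S: "open ?S" "?S \<subseteq> img c" using open_img_Int[OF c U] by auto
  have "smooth_on (img c) (\<lambda>x. \<omega> (chart_inv c x) [?\<tau> x u, ?\<tau> x v])" for u v
    using local_smooth_\<omega>[OF c, of "[u, v]"] by simp
  then have w: "smooth_on ?S (\<lambda>x. \<omega> (chart_inv c x) [?\<tau> x u, ?\<tau> x v])" for u v
    by (rule smooth_on_subset[OF _ image_open[OF c] S(2,1)])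
  \<comment> \<open>The constant vectors are replaced by the fields one slot at a time.\<close>
  have 1: "smooth_on ?S (\<lambda>x. \<omega> (chart_inv c x) [?\<tau> x (X (chart_inv c x) c), ?\<tau> x v])" for v
    by (rule smooth_on_apply_family[where L="\<lambda>x u. \<omega> (chart_inv c x) [?\<tau> x u, ?\<tau> x v]",
      OF S(1) \<omega>_local_linear(1)[OF c] w vector_field_smooth[OF X c]]) (use S in auto)
  have "smooth_on ?S (\<lambda>x. \<omega> (chart_inv c x) [?\<tau> x (X (chart_inv c x) c), ?\<tau> x (Y (chart_inv c x) c)])"
    by (rule smooth_on_apply_family[where L="\<lambda>x v. \<omega> (chart_inv c x) [?\<tau> x (X (chart_inv c x) c), ?\<tau> x v]",
      OF S(1) \<omega>_local_linear(2)[OF c] 1 vector_field_smooth[OF Y c]]) (use S in auto)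
  then show "smooth_on ?S (\<lambda>x. \<omega> (chart_inv c x) [X (chart_inv c x), Y (chart_inv c x)])"
  proof (rule smooth_on_cong[OF S(1), rotated])
    fix x assume "x \<in> ?S"
    then have "chart_inv c x \<in> fst c" "chart_inv c x \<in> U" using c by auto
    then show "\<omega> (chart_inv c x) [?\<tau> x (X (chart_inv c x) c), ?\<tau> x (Y (chart_inv c x) c)] =
        \<omega> (chart_inv c x) [X (chart_inv c x), Y (chart_inv c x)]"
      using tvec_of_chart[OF vector_field_T[OF X] c] tvec_of_chart[OF vector_field_T[OF Y] c] by simp
  qed
qed

lemma bundle_metric_g: "bundle_metric A T L (\<lambda>p u v. \<omega> p [u, K p v])"
  unfolding bundle_metric_def
proof (intro conjI allI ballI impI; (elim conjE)?)
  fix p u assume u: "u \<in> T p"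
  show "linear_map_on (T p) UNIV (\<lambda>v. \<omega> p [u, K p v])" "linear_map_on (T p) UNIV (\<lambda>v. \<omega> p [v, K p u])"
    using u by (auto simp: linear_map_on_def g_eq algebra_simps)
  fix v assume v: "v \<in> T p"
  show "\<omega> p [u, K p v] = \<omega> p [v, K p u]" using u v by (simp add: g_eq mult.commute)
next
  fix p u u' v v' assume "u \<in> T p" "u' \<in> T p" "v \<in> T p" "v' \<in> T p" "u - u' \<in> L p" "v - v' \<in> L p"
  then show "\<omega> p [u, K p v] = \<omega> p [u', K p v']" using pt.g_cong[of u p u' v v'] by (simp add: g_Kv L_ker)
next
  fix p v assume "v \<in> T p" "v \<notin> L p"
  then show "\<omega> p [v, K p v] > 0" using pt.g_pos[of v p] by (simp add: g_Kv L_ker)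
next
  fix U X Y assume "open U" "vector_field_on A U X" "vector_field_on A U Y"
  then show "smooth_function_on A U (\<lambda>p. \<omega> p [X p, K p (Y p)])"
    by (intro smooth_\<omega>_fields vector_field_K)
qed

lemma K_eq_iff: "u \<in> T p \<Longrightarrow> v \<in> T p \<Longrightarrow> K p u = K p v \<longleftrightarrow> u - v \<in> L p"
proof -
  assume uv: "u \<in> T p" "v \<in> T p"
  have "K p (u - v) = K p u - K p v"
    using K_add[of "u - v" p v] uv by (simp add: algebra_simps del: plus_fun_apply minus_apply)
  then show ?thesis using uv by (auto simp: L_def simp del: plus_fun_apply minus_apply)
qed

section \<open>Transport of the metric to the kernel\<close>

lemma induces_iso_K: "induces_iso T L L K"
  unfolding induces_iso_def
proof (intro allI conjI ballI)
  show "linear_map_on (T p) (L p) (K p)" for p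
    using K_linear_map[of p] L_image[of p] unfolding linear_map_on_def by auto
qed (use L_image K_eq_iff in auto)

definition gL :: "'a \<Rightarrow> ('a, 6) tvec \<Rightarrow> ('a, 6) tvec \<Rightarrow> real" where
  "gL p X Y = \<omega> p [SOME u. u \<in> T p \<and> K p u = X, Y]"

text \<open>The choice in \<open>gL\<close> is harmless: two preimages differ by an element of
  \<open>L p\<close>, and \<open>L p\<close> is isotropic for \<omega>.\<close>

lemma gL_K: 
  assumes u: "u \<in> T p" and Y: "Y \<in> L p" shows "gL p (K p u) Y = \<omega> p [u, Y]"
proof -
  let ?u = "SOME u'. u' \<in> T p \<and> K p u' = K p u"
  have *: "?u \<in> T p \<and> K p ?u = K p u" by (rule someI[of _ u]) (use u in simp)
  then have "?u - u \<in> L p" using K_eq_iff u by blast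
  then show ?thesis unfolding gL_def
    using * u Y by (simp add: L_ker pt.ker_iff pt.w_eq)
qed

lemma gL_K_K: "u \<in> T p \<Longrightarrow> v \<in> T p \<Longrightarrow> gL p (K p u) (K p v) = \<omega> p [u, K p v]"
  by (rule gL_K) (auto simp: L_image)

text \<open>By Cramer's rule, with \<open>F\<close> in the role of the determinant on \<open>T / L\<close>; this expresses a section of \<open>L\<close>
  through the images of a frame of \<open>T / L\<close> without choosing preimages.\<close>

lemma L_expand:
  fixes z :: "3 \<Rightarrow> ('a, 6) tvec"
  assumes X: "X \<in> L p" and z: "\<And>i. z i \<in> T p" and nz: "\<phi> p [K p (z 1), z 2, z 3] \<noteq> 0"
  defines "d \<equiv> \<phi> p [K p (z 1), z 2, z 3]"
  shows "X = K p ((\<phi> p [X, z 2, z 3] / d) *\<^sub>R z 1 + (\<phi> p [X, z 3, z 1] / d) *\<^sub>R z 2 + (\<phi> p [X, z 1, z 2] / d) *\<^sub>R z 3)"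
    (is "X = K p ?s")
proof -
  obtain u where u: "u \<in> T p" "X = K p u" using X by (auto simp: L_image)
  have D: "- 2 * \<phi> p [K p a, b, c] = 4 * pt.D3 p a b c" if "a \<in> T p" "b \<in> T p" "c \<in> T p" for a b c
    using pt.Kv_D3[OF that] that by (simp only: K_Kv)
  have D': "\<phi> p [K p a, b, c] = - 2 * pt.D3 p a b c" if "a \<in> T p" "b \<in> T p" "c \<in> T p" for a b c
    using D[OF that] by linarith
  have r: "\<phi> p [K p a, b, c] / d = pt.D3 p a b c / pt.D3 p (z 1) (z 2) (z 3)" if "a \<in> T p" "b \<in> T p" "c \<in> T p" for a b c
    unfolding d_def D'[OF that] D'[OF z z z] by simp
  have nD: "pt.D3 p (z 1) (z 2) (z 3) \<noteq> 0" using D[OF z z z, of 1 2 3] nz by auto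
  have s: "?s \<in> T p" using z by (intro pt.T_add pt.T_scale)
  have "E p k u = E p k ?s" if k: "k \<in> {2, 4, 6}" for k
  proof -
    have eq: "E p k ?s = pt.D3 p u (z 2) (z 3) / pt.D3 p (z 1) (z 2) (z 3) * E p k (z 1)
      + pt.D3 p u (z 3) (z 1) / pt.D3 p (z 1) (z 2) (z 3) * E p k (z 2)
      + pt.D3 p u (z 1) (z 2) / pt.D3 p (z 1) (z 2) (z 3) * E p k (z 3)"
      unfolding u(2) r[OF u(1) z z] by (simp only: pt.e_add pt.e_scale pt.T_add pt.T_scale z)
    have "E p k u = (pt.D3 p u (z 2) (z 3) * E p k (z 1) + pt.D3 p u (z 3) (z 1) * E p k (z 2)
      + pt.D3 p u (z 1) (z 2) * E p k (z 3)) / pt.D3 p (z 1) (z 2) (z 3)"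
      using pt.D3_Cramer[OF k, of p u "z 1" "z 2" "z 3"] by (simp only: eq_divide_eq nD) simp
    then show ?thesis unfolding eq by (simp only: add_divide_distrib times_divide_eq_left)
  qed
  then have "u - ?s \<in> L p" using u(1) s unfolding L_ker pt.ker_iff by (simp only: pt.e_diff pt.T_diff) auto
  then show ?thesis using K_eq_iff[OF u(1) s] u(2) by (simp only:)
qed

lemma smooth_\<phi>_fields:
  assumes c: "c \<in> A" and U: "open U" and X: "vector_field_on A U X"
  shows "smooth_on (snd c ` (fst c \<inter> U)) (\<lambda>x. \<phi> (chart_inv c x)
    [X (chart_inv c x), tvec_of A c (chart_inv c x) v, tvec_of A c (chart_inv c x) w])"
proof -
  let ?S = "snd c ` (fst c \<inter> U)" and ?\<tau> = "\<lambda>x. tvec_of A c (chart_inv c x)"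
  have S: "open ?S" "?S \<subseteq> img c" using open_img_Int[OF c U] by auto
  have "smooth_on (img c) (\<lambda>x. \<phi> (chart_inv c x) [?\<tau> x u, ?\<tau> x v, ?\<tau> x w])" for u
    using local_smooth_\<phi>[OF c, of "[u, v, w]"] by simp
  then have 1: "smooth_on ?S (\<lambda>x. \<phi> (chart_inv c x) [?\<tau> x u, ?\<tau> x v, ?\<tau> x w])" for u
    by (rule smooth_on_subset[OF _ image_open[OF c] S(2,1)])
  have lin: "linear (\<lambda>u. \<phi> (chart_inv c x) [?\<tau> x u, ?\<tau> x v, ?\<tau> x w])" if "x \<in> ?S" for x
    using that S c by (intro linearI) (auto simp: tvec_of_add tvec_of_scale pt.p_add pt.p_scale)
  have "smooth_on ?S (\<lambda>x. \<phi> (chart_inv c x) [?\<tau> x (X (chart_inv c x) c), ?\<tau> x v, ?\<tau> x w])"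
    by (rule smooth_on_apply_family[where L="\<lambda>x u. \<phi> (chart_inv c x) [?\<tau> x u, ?\<tau> x v, ?\<tau> x w]",
      OF S(1) lin 1 vector_field_smooth[OF X c]])
  then show ?thesis
  proof (rule smooth_on_cong[OF S(1), rotated])
    fix x assume "x \<in> ?S"
    then have "chart_inv c x \<in> fst c" "chart_inv c x \<in> U" using c by auto
    then show "\<phi> (chart_inv c x) [?\<tau> x (X (chart_inv c x) c), ?\<tau> x v, ?\<tau> x w] =
        \<phi> (chart_inv c x) [X (chart_inv c x), ?\<tau> x v, ?\<tau> x w]"
      using tvec_of_chart[OF vector_field_T[OF X] c] by simp
  qed
qed

text \<open>By continuity \<open>F\<close> stays positive near \<open>p\<close> on the fields with
  constant coordinates on which it is positive at \<open>p\<close>. This yields both an oriented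
  smooth frame of the quotient and a denominator for \<open>L_expand\<close>.\<close>

lemma local_frame:
  assumes c: "c \<in> A" and p: "p \<in> fst c"
  obtains N b where "open N" "snd c p \<in> N" "N \<subseteq> img c"
    "\<And>x. x \<in> N \<Longrightarrow> - 2 * \<phi> (chart_inv c x) [K (chart_inv c x) (tvec_of A c (chart_inv c x) (b (1 :: 3))),
      tvec_of A c (chart_inv c x) (b 2), tvec_of A c (chart_inv c x) (b 3)] > 0"
proof -
  \<comment> \<open>the constant fields that agree at \<open>p\<close> with the standard frame of \<open>T / L\<close>\<close>
  define b where "b i = pt.std p i c" for i
  let ?\<tau> = "\<lambda>x. tvec_of A c (chart_inv c x)"
  let ?h = "\<lambda>x. - 2 * \<phi> (chart_inv c x) [K (chart_inv c x) (?\<tau> x (b 1)), ?\<tau> x (b 2), ?\<tau> x (b 3)]"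
  have "vector_field_on A (fst c) (\<lambda>q. K q (tvec_of A c q (b 1)))"
    by (intro vector_field_K const_vector_field c chart_open)
  from smooth_\<phi>_fields[OF c chart_open[OF c] this]
  have "smooth_on (img c) (\<lambda>x. \<phi> (chart_inv c x) [K (chart_inv c x) (?\<tau> x (b 1)), ?\<tau> x (b 2), ?\<tau> x (b 3)])"
    by simp
  then have cont: "continuous_on (img c) ?h"
    by (intro continuous_intros smooth_on_continuous)
  have x: "snd c p \<in> img c" using p by simp
  have "?\<tau> (snd c p) (b i) = pt.std p i" for i
    using tvec_of_chart[of "pt.std p i" p c] pt.std_T[of p] c p by (auto simp: b_def)
  moreover have "- 2 * \<phi> p [K p (pt.std p 1), pt.std p 2, pt.std p 3] = 4"
  proof -
    have sT: "pt.std p i \<in> T p" for i using pt.std_T[of p] by auto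
    show ?thesis using pt.Kv_D3[OF sT sT sT, of 1 2 3] pt.D3_std[of p] by (simp add: K_Kv[OF sT])
  qed
  ultimately have pos: "?h (snd c p) > 0" using c p by simp
  show ?thesis
  proof (rule that[of "img c \<inter> ?h -` {0<..}" b])
    show "open (img c \<inter> ?h -` {0<..})"
      by (rule continuous_open_preimage[OF cont image_open[OF c] open_greaterThan])
  qed (use pos x in auto)
qed

lemma bundle_metric_gL: "bundle_metric A L (\<lambda>p. {0}) gL"
  unfolding bundle_metric_def
proof (intro conjI allI ballI impI; (elim conjE)?)
  fix p X assume X: "X \<in> L p"
  obtain a where a: "a \<in> T p" "X = K p a" using X by (auto simp: L_image)
  show "linear_map_on (L p) UNIV (gL p X)"
    unfolding linear_map_on_def
  proof (intro conjI ballI allI)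
    fix u v r s assume uv: "u \<in> L p" "v \<in> L p"
    have sL: "subspace (L p)" using lagrangian_L by (simp add: lagrangian_distribution_def)
    have "r *\<^sub>R u + s *\<^sub>R v \<in> L p" using uv by (intro subspace_add[OF sL] subspace_scale[OF sL])
    then show "gL p X (r *\<^sub>R u + s *\<^sub>R v) = r *\<^sub>R gL p X u + s *\<^sub>R gL p X v"
      using uv L_T[OF uv(1)] L_T[OF uv(2)] a(1) unfolding a(2) by (simp add: gL_K pt.w_eq algebra_simps)
  qed auto
  show "linear_map_on (L p) UNIV (\<lambda>v. gL p v X)"
    unfolding linear_map_on_def
  proof (intro conjI ballI allI)
    fix u v r s assume uv: "u \<in> L p" "v \<in> L p"
    obtain u' v' where u': "u' \<in> T p" "u = K p u'" and v': "v' \<in> T p" "v = K p v'"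
      using uv by (auto simp: L_image)
    have "r *\<^sub>R u + s *\<^sub>R v = K p (r *\<^sub>R u' + s *\<^sub>R v')"
      using u' v' by (simp add: K_add K_scale)
    then have "gL p (r *\<^sub>R u + s *\<^sub>R v) X = \<omega> p [r *\<^sub>R u' + s *\<^sub>R v', X]"
      using gL_K[of "r *\<^sub>R u' + s *\<^sub>R v'" p X] u' v' X by simp
    also have "\<dots> = r * \<omega> p [u', X] + s * \<omega> p [v', X]"
      using u'(1) v'(1) L_T[OF X] by (simp add: pt.w_eq algebra_simps)
    finally show "gL p (r *\<^sub>R u + s *\<^sub>R v) X = r *\<^sub>R gL p u X + s *\<^sub>R gL p v X"
      using gL_K[OF u'(1) X] gL_K[OF v'(1) X] u'(2) v'(2) by simp
  qed auto
  fix Y assume Y: "Y \<in> L p"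
  obtain b where b: "b \<in> T p" "Y = K p b" using Y by (auto simp: L_image)
  show "gL p X Y = gL p Y X" unfolding a b using a(1) b(1) by (simp add: gL_K_K g_eq mult.commute)
next
  fix p X X' Y Y' assume "X - X' \<in> {0 :: ('a, 6) tvec}" "Y - Y' \<in> {0 :: ('a, 6) tvec}"
  then show "gL p X Y = gL p X' Y'" by (metis eq_iff_diff_eq_0 singletonD)
next
  fix p X assume X: "X \<in> L p" "X \<notin> {0}"
  then obtain a where a: "a \<in> T p" "X = K p a" by (auto simp: L_image)
  then have "a \<notin> L p" using X by (auto simp: L_def)
  then show "gL p X X > 0" using a pt.g_pos[of a p] by (simp add: gL_K_K g_Kv L_ker)
next
  fix U X Y assume U: "open U" and X: "vector_field_on A U X" and Y: "vector_field_on A U Y"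
    and XY: "\<forall>p\<in>U. X p \<in> L p \<and> Y p \<in> L p"
  \<comment> \<open>The preimage in \<open>gL\<close> is chosen without regularity. Near each point,
    \<open>L_expand\<close> provides another preimage that is a combination of constant fields with
    smooth coefficients, and \<open>gL_K\<close> allows its use.\<close>
  show "smooth_function_on A U (\<lambda>p. gL p (X p) (Y p))"
  proof (rule smooth_function_onI, rule smooth_on_local)
    fix c x0 assume c: "c \<in> A" and x0: "x0 \<in> snd c ` (fst c \<inter> U)"
    let ?S = "snd c ` (fst c \<inter> U)" and ?q = "chart_inv c" and ?\<tau> = "\<lambda>x. tvec_of A c (chart_inv c x)"
    have S: "open ?S" "?S \<subseteq> img c" using open_img_Int[OF c U] by auto
    have "?q x0 \<in> fst c" "snd c (?q x0) = x0" using x0 c by auto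
    then obtain N and b :: "3 \<Rightarrow> real ^ 6" where N: "open N" "x0 \<in> N" "N \<subseteq> img c"
      and pos: "\<And>x. x \<in> N \<Longrightarrow> - 2 * \<phi> (?q x) [K (?q x) (?\<tau> x (b 1)), ?\<tau> x (b 2), ?\<tau> x (b 3)] > 0"
      using local_frame[OF c, of "?q x0"] by metis
    define O' where "O' = N \<inter> ?S"
    have O': "open O'" "x0 \<in> O'" "O' \<subseteq> ?S" using N S x0 by (auto simp: O'_def)
    define d where "d x = \<phi> (?q x) [K (?q x) (?\<tau> x (b 1)), ?\<tau> x (b 2), ?\<tau> x (b 3)]" for x
    have d0: "d x \<noteq> 0" if "x \<in> O'" for x using pos[of x] that unfolding d_def O'_def by auto
    have const: "vector_field_on A (fst c) (\<lambda>q. tvec_of A c q v)" for v by (rule const_vector_field[OF c])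
    have ds: "smooth_on O' d"
    proof -
      have "smooth_on (snd c ` (fst c \<inter> fst c)) d" unfolding d_def
        by (rule smooth_\<phi>_fields[OF c chart_open[OF c] vector_field_K[OF const chart_open[OF c]]])
      then show ?thesis by (rule smooth_on_subset) (use image_open[OF c] O' S in auto)
    qed
    have ps: "smooth_on O' (\<lambda>x. \<phi> (?q x) [X (?q x), ?\<tau> x v, ?\<tau> x w])" for v w
      by (rule smooth_on_subset[OF smooth_\<phi>_fields[OF c U X] S(1) O'(3,1)])
    have ws: "smooth_on O' (\<lambda>x. \<omega> (?q x) [?\<tau> x v, Y (?q x)])" for v
    proof -
      have "smooth_function_on A (U \<inter> fst c) (\<lambda>q. \<omega> q [tvec_of A c q v, Y q])"
        by (intro smooth_\<omega>_fields open_Int U chart_open[OF c] vector_field_on_subset[OF const chart_open[OF c]]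
          vector_field_on_subset[OF Y U]) auto
      then have "smooth_on (snd c ` (fst c \<inter> (U \<inter> fst c))) (\<lambda>x. \<omega> (?q x) [?\<tau> x v, Y (?q x)])"
        using c unfolding smooth_function_on_def by (simp add: o_def)
      moreover have "fst c \<inter> (U \<inter> fst c) = fst c \<inter> U" by auto
      ultimately show ?thesis using smooth_on_subset[OF _ S(1) O'(3,1)] by simp
    qed
    have "smooth_on O' (\<lambda>x. \<phi> (?q x) [X (?q x), ?\<tau> x (b 2), ?\<tau> x (b 3)] / d x * \<omega> (?q x) [?\<tau> x (b 1), Y (?q x)]
      + \<phi> (?q x) [X (?q x), ?\<tau> x (b 3), ?\<tau> x (b 1)] / d x * \<omega> (?q x) [?\<tau> x (b 2), Y (?q x)]
      + \<phi> (?q x) [X (?q x), ?\<tau> x (b 1), ?\<tau> x (b 2)] / d x * \<omega> (?q x) [?\<tau> x (b 3), Y (?q x)])"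
      by (intro smooth_on_add smooth_on_mult smooth_on_divide O'(1) ps ds ws d0)
    then have "smooth_on O' (\<lambda>x. gL (?q x) (X (?q x)) (Y (?q x)))"
    proof (rule smooth_on_cong[OF O'(1), rotated])
      fix x assume x: "x \<in> O'"
      then have q: "?q x \<in> fst c" "?q x \<in> U" using O'(3) c by auto
      have T: "?\<tau> x v \<in> T (?q x)" for v using c q by simp
      have XL: "X (?q x) \<in> L (?q x)" and YL: "Y (?q x) \<in> L (?q x)" using XY q by auto
      let ?s = "(\<phi> (?q x) [X (?q x), ?\<tau> x (b 2), ?\<tau> x (b 3)] / d x) *\<^sub>R ?\<tau> x (b 1)
        + (\<phi> (?q x) [X (?q x), ?\<tau> x (b 3), ?\<tau> x (b 1)] / d x) *\<^sub>R ?\<tau> x (b 2)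
        + (\<phi> (?q x) [X (?q x), ?\<tau> x (b 1), ?\<tau> x (b 2)] / d x) *\<^sub>R ?\<tau> x (b 3)"
      have Xs: "X (?q x) = K (?q x) ?s"
        using L_expand[OF XL, of "\<lambda>i. ?\<tau> x (b i)"] T d0[OF x] unfolding d_def by blast
      have "?s \<in> T (?q x)" by (intro pt.T_add pt.T_scale T)
      from gL_K[OF this YL]
      have "gL (?q x) (X (?q x)) (Y (?q x)) = \<omega> (?q x) [?s, Y (?q x)]" unfolding Xs[symmetric] .
      also have "\<dots> = \<phi> (?q x) [X (?q x), ?\<tau> x (b 2), ?\<tau> x (b 3)] / d x * \<omega> (?q x) [?\<tau> x (b 1), Y (?q x)]
        + \<phi> (?q x) [X (?q x), ?\<tau> x (b 3), ?\<tau> x (b 1)] / d x * \<omega> (?q x) [?\<tau> x (b 2), Y (?q x)]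
        + \<phi> (?q x) [X (?q x), ?\<tau> x (b 1), ?\<tau> x (b 2)] / d x * \<omega> (?q x) [?\<tau> x (b 3), Y (?q x)]"
      proof -
        have lin: "\<omega> (?q x) [r1 *\<^sub>R ?\<tau> x (b 1) + r2 *\<^sub>R ?\<tau> x (b 2) + r3 *\<^sub>R ?\<tau> x (b 3), Y (?q x)] =
          r1 * \<omega> (?q x) [?\<tau> x (b 1), Y (?q x)] + r2 * \<omega> (?q x) [?\<tau> x (b 2), Y (?q x)]
          + r3 * \<omega> (?q x) [?\<tau> x (b 3), Y (?q x)]" for r1 r2 r3
          using T L_T[OF YL] by (simp add: pt.w_eq algebra_simps)
        show ?thesis by (rule lin)
      qed
      finally show "\<phi> (?q x) [X (?q x), ?\<tau> x (b 2), ?\<tau> x (b 3)] / d x * \<omega> (?q x) [?\<tau> x (b 1), Y (?q x)]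
        + \<phi> (?q x) [X (?q x), ?\<tau> x (b 3), ?\<tau> x (b 1)] / d x * \<omega> (?q x) [?\<tau> x (b 2), Y (?q x)]
        + \<phi> (?q x) [X (?q x), ?\<tau> x (b 1), ?\<tau> x (b 2)] / d x * \<omega> (?q x) [?\<tau> x (b 3), Y (?q x)] =
        gL (?q x) (X (?q x)) (Y (?q x))" by simp
    qed
    then show "\<exists>N. open N \<and> x0 \<in> N \<and> N \<subseteq> ?S \<and> smooth_on N (\<lambda>x. gL (?q x) (X (?q x)) (Y (?q x)))"
      using O' by blast
  qed
qed

end

section \<open>Orientations and the volume form\<close>

lemma vectors_3E:
  assumes "vs \<in> vectors 3 V" obtains a b c where "vs = [a, b, c]" "a \<in> V" "b \<in> V" "c \<in> V"
  using assms unfolding vectors_def by (auto simp: length_Suc_conv eval_nat_numeral)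

context orbit_mfd
begin

definition Or :: "'a \<Rightarrow> (3 \<Rightarrow> ('a, 6) tvec) set" where
  "Or p = {b \<in> quotient_frames (T p) (L p). pt.D3 p (b 1) (b 2) (b 3) > 0}"

lemma Or_iff: "b \<in> Or p \<longleftrightarrow> range b \<subseteq> T p \<and> pt.D3 p (b 1) (b 2) (b 3) > 0"
  unfolding Or_def L_ker mem_Collect_eq pt.frames_iff by auto

lemma F_D3: "a \<in> T p \<Longrightarrow> b \<in> T p \<Longrightarrow> c \<in> T p \<Longrightarrow> F_form A \<omega> \<phi> p [a, b, c] = 4 * pt.D3 p a b c"
  using pt.Kv_D3[of a p b c] by (simp add: F_form_def K_Kv)

lemma std_frame: "pt.std p \<in> quotient_frames (T p) (L p)"
  unfolding L_ker pt.frames_iff by (simp add: pt.std_T pt.D3_std)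

lemma Or_std: "Or p = {b \<in> quotient_frames (T p) (L p). same_orientation (L p) (pt.std p) b}"
  using std_frame[of p] unfolding Or_def L_ker
  by (auto simp: pt.same_orientation_iff pt.D3_std)

lemma local_Or_frame:
  obtains U X where "open U" "p \<in> U" "\<And>i. vector_field_on A U (X i)" "\<And>q. q \<in> U \<Longrightarrow> (\<lambda>i. X i q) \<in> Or q"
proof -
  obtain c where c: "c \<in> A" and p: "p \<in> fst c" by (rule chart_at)
  obtain N and b :: "3 \<Rightarrow> real ^ 6" where N: "open N" "snd c p \<in> N" "N \<subseteq> img c"
    and pos: "\<And>x. x \<in> N \<Longrightarrow> - 2 * \<phi> (chart_inv c x) [K (chart_inv c x) (tvec_of A c (chart_inv c x) (b 1)),
      tvec_of A c (chart_inv c x) (b 2), tvec_of A c (chart_inv c x) (b 3)] > 0"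
    using local_frame[OF c p] by metis
  have "is_chart c" using smooth_str c unfolding smooth_structure_def by simp
  then have cont: "continuous_on (fst c) (snd c)"
    unfolding is_chart_def homeomorphism_def by simp
  define U where "U = fst c \<inter> snd c -` N"
  have U: "open U" unfolding U_def
    by (rule continuous_open_preimage[OF cont chart_open[OF c] N(1)])
  show ?thesis
  proof (rule that[of U "\<lambda>i q. tvec_of A c q (b i)"])
    show "vector_field_on A U (\<lambda>q. tvec_of A c q (b i))" for i
      by (rule vector_field_on_subset[OF const_vector_field[OF c] chart_open[OF c] U]) (simp add: U_def)
    fix q assume "q \<in> U"
    then have q: "q \<in> fst c" "snd c q \<in> N" by (auto simp: U_def)
    have T: "tvec_of A c q v \<in> T q" for v using c q by simp
    have "0 < F_form A \<omega> \<phi> q [tvec_of A c q (b 1), tvec_of A c q (b 2), tvec_of A c q (b 3)]"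
      using pos[OF q(2)] c q(1) by (simp add: F_form_def)
    then show "(\<lambda>i. tvec_of A c q (b i)) \<in> Or q"
      unfolding F_D3[OF T T T] Or_iff using T by auto
  qed (use U p N in \<open>auto simp: U_def\<close>)
qed

lemma bundle_orientation_Or: "bundle_orientation A T L Or"
  unfolding bundle_orientation_def
proof (intro conjI allI)
  fix p
  show "\<exists>b\<in>quotient_frames (T p) (L p). Or p = {b' \<in> quotient_frames (T p) (L p). same_orientation (L p) b b'}"
    by (rule rev_bexI[OF std_frame]) (rule Or_std)
  obtain U X where "open U" "p \<in> U" "\<And>i. vector_field_on A U (X i)" "\<And>q. q \<in> U \<Longrightarrow> (\<lambda>i. X i q) \<in> Or q"
    using local_Or_frame[of p] by metis
  then show "\<exists>U X. open U \<and> p \<in> U \<and> (\<forall>i. vector_field_on A U (X i)) \<and> (\<forall>q\<in>U. (\<lambda>i. X i q) \<in> Or q)"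
    by (intro exI[of _ U] exI[of _ X] conjI allI ballI)
qed

abbreviation "vol \<equiv> \<lambda>p vs. F_form A \<omega> \<phi> p vs / sqrt 2"

lemma vol_alternating: "alternating_form (T p) 3 (vol p)"
  unfolding alternating_form_def
proof (intro conjI ballI)
  fix vs assume "vs \<in> vectors 3 (T p)"
  then obtain a b c where vs: "vs = [a, b, c]" and T: "a \<in> T p" "b \<in> T p" "c \<in> T p" by (rule vectors_3E)
  have "pt.D3 p (r *\<^sub>R u + s *\<^sub>R v) b c = r * pt.D3 p u b c + s * pt.D3 p v b c"
    "pt.D3 p a (r *\<^sub>R u + s *\<^sub>R v) c = r * pt.D3 p a u c + s * pt.D3 p a v c"
    "pt.D3 p a b (r *\<^sub>R u + s *\<^sub>R v) = r * pt.D3 p a b u + s * pt.D3 p a b v"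
    if "u \<in> T p" "v \<in> T p" for r s u v
    using T that by (simp_all add: pt.D3_eq algebra_simps)
  then have "linear_map_on (T p) UNIV (\<lambda>u. vol p [u, b, c])" "linear_map_on (T p) UNIV (\<lambda>u. vol p [a, u, c])"
    "linear_map_on (T p) UNIV (\<lambda>u. vol p [a, b, u])"
    using T by (auto simp: linear_map_on_def F_D3 add_divide_distrib distrib_left mult.left_commute)
  then show "\<forall>i<3. linear_map_on (T p) UNIV (\<lambda>u. vol p (vs[i := u]))"
    unfolding vs forall_less_3 by (simp add: eval_nat_numeral)
  show "\<not> distinct vs \<longrightarrow> vol p vs = 0"
    unfolding vs using F_D3[OF T] by (auto simp: pt.D3_eq algebra_simps)
qed

lemma orthonormal_D3:
  assumes "range b \<subseteq> T p" "\<And>i j. \<omega> p [b i, K p (b j)] = (if i = j then 1 else 0)"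
  shows "8 * (pt.D3 p (b 1) (b 2) (b (3 :: 3)))\<^sup>2 = 1"
proof (rule pt.D3_orthonormal[OF assms(1)])
  fix i j
  have "b j \<in> T p" using assms(1) by auto
  then show "\<omega> p [b i, pt.Kv p (b j)] = (if i = j then 1 else 0)" using assms(2)[of i j] by (simp add: K_Kv)
qed

lemma riemannian_volume_form_vol: "riemannian_volume_form T L (\<lambda>p u v. \<omega> p [u, K p v]) Or vol"
  unfolding riemannian_volume_form_def
proof (intro allI conjI ballI impI vol_alternating)
  fix p vs ws assume "vs \<in> vectors 3 (T p)" "ws \<in> vectors 3 (T p)" and d: "\<forall>i<3. vs ! i - ws ! i \<in> L p"
  then obtain a b c a' b' c' where vs: "vs = [a, b, c]" "ws = [a', b', c']"
    and T: "a \<in> T p" "b \<in> T p" "c \<in> T p" "a' \<in> T p" "b' \<in> T p" "c' \<in> T p" by (metis vectors_3E)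
  have "a - a' \<in> pt.ker p" "b - b' \<in> pt.ker p" "c - c' \<in> pt.ker p"
    using d unfolding vs forall_less_3 L_ker by (simp_all add: eval_nat_numeral del: minus_apply)
  from pt.D3_cong[OF T this] show "vol p vs = vol p ws" unfolding vs by (simp add: F_D3 T)
next
  fix p b assume b: "b \<in> Or p" and on: "\<forall>i j. \<omega> p [b i, K p (b j)] = (if i = j then 1 else 0)"
  have bT: "range b \<subseteq> T p" "b i \<in> T p" and pos: "pt.D3 p (b 1) (b 2) (b 3) > 0" for i
    using b by (auto simp: Or_iff)
  have "8 * (pt.D3 p (b 1) (b 2) (b 3))\<^sup>2 = 1" using orthonormal_D3[OF bT(1)] on by blast
  \<comment> \<open>The origin of the factor \<open>1 / sqrt 2\<close>: on an orthonormal frame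
    \<open>F\<close> is 4 times \<open>D3\<close>, and its square is 16/8 = 2.\<close>
  then have "(4 * pt.D3 p (b 1) (b 2) (b 3))\<^sup>2 = (sqrt 2)\<^sup>2" by (simp add: power_mult_distrib)
  then have "4 * pt.D3 p (b 1) (b 2) (b 3) = sqrt 2" 
    by (rule power2_eq_imp_eq) (use pos in auto)
  then show "vol p [b 1, b 2, b 3] = 1" unfolding F_D3[OF bT(2) bT(2) bT(2)] by simp
qed

text \<open>A volume form is 1 on positive orthonormal frames. An orthonormal frame on which
  \<open>vol\<close> is negative therefore lies outside \<open>Or' p\<close>. Since there are only
  two orientation classes at \<open>p\<close>, this forces \<open>Or' p\<close> to be the class with
  positive \<open>D3\<close>.\<close>

lemma orientation_unique:
  assumes or: "bundle_orientation A T L Or'"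
    and vol: "riemannian_volume_form T L (\<lambda>p u v. \<omega> p [u, K p v]) Or' vol"
  shows "Or' = Or"
proof
  fix p
  obtain b where b: "b \<in> quotient_frames (T p) (L p)"
    and eq: "Or' p = {b' \<in> quotient_frames (T p) (L p). same_orientation (L p) b b'}"
    using or unfolding bundle_orientation_def by blast
  \<comment> \<open>an orthonormal frame that is negative for \<open>F\<close>\<close>
  define o' where "o' i = (if i = 1 then - 1 / sqrt 2 else 1 / sqrt 2) *\<^sub>R pt.std p i" for i
  have sT: "pt.std p i \<in> T p" for i using pt.std_T[of p] by auto
  have oT: "o' i \<in> T p" for i unfolding o'_def by (intro pt.T_scale sT)
  have oD: "pt.D3 p (o' 1) (o' 2) (o' 3) < 0"
    unfolding o'_def using sT pt.D3_std[of p] by (simp add: pt.D3_eq pt.std_def)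
  have on: "\<omega> p [o' i, K p (o' j)] = (if i = j then 1 else 0)" for i j
    unfolding g_eq[OF oT oT] unfolding o'_def using sT exhaust_3[of i] exhaust_3[of j]
    by (auto simp: pt.std_def)
  have "o' \<notin> Or' p"
  proof
    assume "o' \<in> Or' p"
    then have "vol p [o' 1, o' 2, o' 3] = 1" using vol on unfolding riemannian_volume_form_def by blast
    then have "4 * pt.D3 p (o' 1) (o' 2) (o' 3) = sqrt 2" unfolding F_D3[OF oT oT oT] by simp
    moreover have "sqrt 2 > (0 :: real)" by simp
    ultimately show False using oD by linarith
  qed
  moreover have o: "o' \<in> quotient_frames (T p) (pt.ker p)" unfolding pt.frames_iff using oT oD by auto
  ultimately have "\<not> same_orientation (pt.ker p) b o'" unfolding eq L_ker by blast
  then have "\<not> pt.D3 p (b 1) (b 2) (b 3) < 0"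
    using pt.same_orientation_iff[OF b[unfolded L_ker] o] oD mult_neg_neg by blast
  moreover have "pt.D3 p (b 1) (b 2) (b 3) \<noteq> 0" using b unfolding L_ker pt.frames_iff by blast
  ultimately have pos: "pt.D3 p (b 1) (b 2) (b 3) > 0" by linarith
  show "Or' p = Or p" unfolding eq Or_def
  proof (rule Collect_cong, rule conj_cong[OF refl])
    fix d :: "3 \<Rightarrow> ('a, 6) tvec" assume "d \<in> quotient_frames (T p) (L p)"
    then show "same_orientation (L p) b d \<longleftrightarrow> pt.D3 p (d 1) (d 2) (d 3) > 0"
      using pt.same_orientation_iff[OF b[unfolded L_ker], of d] pos unfolding L_ker
      by (simp add: zero_less_mult_iff)
  qed
qed

text \<open>\<open>K p\<close> turns congruences modulo \<open>L p\<close> into equations in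
  \<open>L p\<close>. Hence frames and orientations of the quotient carry over to \<open>L\<close>,
  regarded as its quotient by 0.\<close>

lemma K_sum_3:
  assumes b: "range b \<subseteq> T p" and u: "u \<in> T p"
  shows "K p u - (\<Sum>i\<in>UNIV. r i *\<^sub>R K p (b (i :: 3))) \<in> {0} \<longleftrightarrow> u - (\<Sum>i\<in>UNIV. r i *\<^sub>R b i) \<in> L p"
proof -
  have bT: "b i \<in> T p" for i using b by auto
  have "(\<Sum>i\<in>UNIV. r i *\<^sub>R K p (b i)) = K p (\<Sum>i\<in>UNIV. r i *\<^sub>R b i)"
    unfolding sum_3 by (simp only: K_add K_scale pt.T_add pt.T_scale bT)
  then show ?thesis using K_eq_iff[OF u pt.sum_3_T[OF b, of r]] by (simp only: singleton_iff right_minus_eq)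
qed

lemma K_frames:
  assumes b: "range b \<subseteq> T p"
  shows "(\<lambda>i. K p (b (i :: 3))) \<in> quotient_frames (L p) {0} \<longleftrightarrow> b \<in> quotient_frames (T p) (L p)"
proof -
  have bL: "range (\<lambda>i. K p (b i)) \<subseteq> L p" using b by (auto simp: L_image)
  have "(\<forall>v\<in>L p. \<exists>!a :: real ^ 3. v - (\<Sum>i\<in>UNIV. a $ i *\<^sub>R K p (b i)) \<in> {0}) \<longleftrightarrow>
    (\<forall>u\<in>T p. \<exists>!a :: real ^ 3. K p u - (\<Sum>i\<in>UNIV. a $ i *\<^sub>R K p (b i)) \<in> {0})"
    unfolding L_image ball_simps ..
  also have "\<dots> \<longleftrightarrow> (\<forall>u\<in>T p. \<exists>!a :: real ^ 3. u - (\<Sum>i\<in>UNIV. a $ i *\<^sub>R b i) \<in> L p)"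
    by (rule ball_cong[OF refl]) (simp only: K_sum_3[OF b])
  finally show ?thesis unfolding quotient_frames_def mem_Collect_eq using b bL by (simp only:)
qed

lemma K_same_orientation:
  assumes b: "range b \<subseteq> T p" and b': "range b' \<subseteq> T p"
  shows "same_orientation {0} (\<lambda>i. K p (b (i :: 3))) (\<lambda>i. K p (b' i)) \<longleftrightarrow> same_orientation (L p) b b'"
  unfolding same_orientation_def by (simp only: K_sum_3[OF b range_subsetD[OF b']])

lemma bundle_orientation_L: "bundle_orientation A L (\<lambda>p. {0}) (\<lambda>p. (\<lambda>b i. K p (b i)) ` Or p)"
  unfolding bundle_orientation_def
proof (intro conjI allI)
  fix p
  let ?b = "\<lambda>i. K p (pt.std p i)"
  show "\<exists>b\<in>quotient_frames (L p) {0}. (\<lambda>b i. K p (b i)) ` Or p =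
      {b' \<in> quotient_frames (L p) {0}. same_orientation {0} b b'}"
  proof (intro rev_bexI set_eqI iffI)
    show "?b \<in> quotient_frames (L p) {0}" by (simp only: K_frames[OF pt.std_T] std_frame)
  next
    fix d assume "d \<in> (\<lambda>b i. K p (b i)) ` Or p"
    then obtain b where b: "b \<in> Or p" and d: "d = (\<lambda>i. K p (b i))" by blast
    have bT: "range b \<subseteq> T p" using b by (simp add: Or_iff)
    show "d \<in> {b' \<in> quotient_frames (L p) {0}. same_orientation {0} ?b b'}"
      using b unfolding d Or_std mem_Collect_eq K_frames[OF bT] K_same_orientation[OF pt.std_T bT] .
  next
    fix d assume d: "d \<in> {b' \<in> quotient_frames (L p) {0}. same_orientation {0} ?b b'}"
    then have "range d \<subseteq> K p ` T p" by (simp add: quotient_frames_def L_image)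
    then have "\<forall>i. \<exists>u. u \<in> T p \<and> d i = K p u" by blast
    then obtain u where u: "\<And>i. u i \<in> T p" "\<And>i. d i = K p (u i)" by metis
    have du: "d = (\<lambda>i. K p (u i))" using u(2) by (rule ext)
    have uT: "range u \<subseteq> T p" using u(1) by auto
    have "u \<in> Or p"
      using d unfolding du Or_std mem_Collect_eq K_frames[OF uT] K_same_orientation[OF pt.std_T uT] .
    then show "d \<in> (\<lambda>b i. K p (b i)) ` Or p" unfolding du by (rule imageI)
  qed
  obtain U X where U: "open U" "p \<in> U" and X: "\<And>i. vector_field_on A U (X i)" "\<And>q. q \<in> U \<Longrightarrow> (\<lambda>i. X i q) \<in> Or q"
    using local_Or_frame[of p] by metis
  have "vector_field_on A U (\<lambda>q. K q (X i q))" for i by (rule vector_field_K[OF X(1) U(1)])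
  then show "\<exists>U X. open U \<and> p \<in> U \<and> (\<forall>i. vector_field_on A U (X i)) \<and>
      (\<forall>q\<in>U. (\<lambda>i. X i q) \<in> (\<lambda>b i. K q (b i)) ` Or q)"
    using U X(2) by (intro exI[of _ U] exI[of _ "\<lambda>i q. K q (X i q)"] conjI allI ballI) (auto intro!: imageI)
qed

end

theorem proposition4p2:
  fixes A :: "('a::{t2_space, second_countable_topology}, 6) chart set"
    and \<omega> \<phi> :: "'a \<Rightarrow> ('a, 6) tvec list \<Rightarrow> real"
  defines "T \<equiv> tangent_space A"
    and "K \<equiv> K_endo A \<omega> \<phi>"
    and "L \<equiv> \<lambda>p. {v \<in> tangent_space A p. K_endo A \<omega> \<phi> p v = 0}"
    and "g \<equiv> \<lambda>p u v. \<omega> p [u, K_endo A \<omega> \<phi> p v]"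
  assumes "smooth_structure A"
    and "symplectic_form A \<omega>"
    and "differential_form A 3 \<phi>"
    and "primitive A \<omega> \<phi>"
    and "\<forall>p. in_orbit_0_plus A \<omega> \<phi> p"
    and "closed_form A 3 \<phi>"
    and "closed_form A 3 (F_form A \<omega> \<phi>)"
  shows
    "smooth_endomorphism A K \<and>
     (\<forall>p. \<forall>v\<in>T p. K p (K p v) = 0) \<and>
     (\<forall>p. L p = K p ` T p) \<and>
     lagrangian_distribution A \<omega> L \<and> foliation A 3 L \<and>
     (\<forall>U X Y. open U \<and> vector_field_on A U X \<and> vector_field_on A U Y \<longrightarrow>
        (\<forall>p\<in>U. nijenhuis A K X Y p =
             K p (lie_bracket A (\<lambda>q. K q (X q)) Y p) + K p (lie_bracket A X (\<lambda>q. K q (Y q)) p)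
             - lie_bracket A (\<lambda>q. K q (X q)) (\<lambda>q. K q (Y q)) p \<and>
           nijenhuis A K X Y p = 0)) \<and>
     bundle_metric A T L g \<and>
     induces_iso T L L K \<and>
     (\<exists>gL. bundle_metric A L (\<lambda>p. {0}) gL \<and>
        (\<forall>p. \<forall>u\<in>T p. \<forall>v\<in>T p. gL p (K p u) (K p v) = g p u v) \<and>
        (\<forall>p. \<forall>X\<in>L p. \<forall>Y\<in>L p. \<forall>u\<in>T p. K p u = X \<longrightarrow> gL p X Y = \<omega> p [u, Y])) \<and>
     (\<exists>Or. (bundle_orientation A T L Or \<and>
            riemannian_volume_form T L g Or (\<lambda>p vs. F_form A \<omega> \<phi> p vs / sqrt 2)) \<and>
        (\<forall>Or'. bundle_orientation A T L Or' \<and>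
            riemannian_volume_form T L g Or' (\<lambda>p vs. F_form A \<omega> \<phi> p vs / sqrt 2) \<longrightarrow> Or' = Or) \<and>
        bundle_orientation A L (\<lambda>p. {0}) (\<lambda>p. (\<lambda>b i. K p (b i)) ` Or p))"
proof -
  have "smooth_mfd A" using assms(5) by (simp add: smooth_mfd_def)
  have "\<forall>p. \<exists>e f. orbit_point (tangent_space A p) e f (\<omega> p) (\<phi> p)"
    using assms(5,9) orbit_point_exists by blast
  then obtain E B where "\<And>p. orbit_point (tangent_space A p) (E p) (B p) (\<omega> p) (\<phi> p)" by metis
  then interpret M: orbit_mfd A \<omega> \<phi> E B
    using assms(6,7,10,11) \<open>smooth_mfd A\<close>
    by (intro orbit_mfd.intro orbit_mfd_axioms.intro) (auto simp: symplectic_form_def)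
  have L: "L = M.L" unfolding assms(3) by (rule ext) (simp add: M.L_def)
  have gL: "\<exists>gL. bundle_metric A M.L (\<lambda>p. {0}) gL \<and>
      (\<forall>p. \<forall>u\<in>T p. \<forall>v\<in>T p. gL p (K p u) (K p v) = g p u v) \<and>
      (\<forall>p. \<forall>X\<in>M.L p. \<forall>Y\<in>M.L p. \<forall>u\<in>T p. K p u = X \<longrightarrow> gL p X Y = \<omega> p [u, Y])"
    unfolding assms(1,2,4)
  proof (intro exI[of _ M.gL] conjI allI ballI impI)
    fix p X Y u assume "Y \<in> M.L p" "u \<in> tangent_space A p" "M.K p u = X"
    then show "M.gL p X Y = \<omega> p [u, Y]" using M.gL_K by metis
  qed (rule M.bundle_metric_gL M.gL_K_K; assumption?)+
  have Or: "\<exists>Or. (bundle_orientation A T M.L Or \<and>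
        riemannian_volume_form T M.L g Or (\<lambda>p vs. F_form A \<omega> \<phi> p vs / sqrt 2)) \<and>
      (\<forall>Or'. bundle_orientation A T M.L Or' \<and>
        riemannian_volume_form T M.L g Or' (\<lambda>p vs. F_form A \<omega> \<phi> p vs / sqrt 2) \<longrightarrow> Or' = Or) \<and>
      bundle_orientation A M.L (\<lambda>p. {0}) (\<lambda>p. (\<lambda>b i. K p (b i)) ` Or p)"
    unfolding assms(1,2,4)
    by (intro exI[of _ M.Or] conjI allI impI M.bundle_orientation_Or M.riemannian_volume_form_vol
      M.bundle_orientation_L) (elim conjE, rule M.orientation_unique)
  have N: "\<forall>U X Y. open U \<and> vector_field_on A U X \<and> vector_field_on A U Y \<longrightarrow>
      (\<forall>p\<in>U. nijenhuis A K X Y p =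
           K p (lie_bracket A (\<lambda>q. K q (X q)) Y p) + K p (lie_bracket A X (\<lambda>q. K q (Y q)) p)
           - lie_bracket A (\<lambda>q. K q (X q)) (\<lambda>q. K q (Y q)) p \<and>
         nijenhuis A K X Y p = 0)"
    unfolding assms(2)
    by (intro allI impI ballI conjI; elim conjE) (rule M.nijenhuis_eq M.nijenhuis_0; assumption)+
  have "smooth_endomorphism A K" "\<forall>p. L p = K p ` T p" "lagrangian_distribution A \<omega> L" "foliation A 3 L"
    "bundle_metric A T L g" "induces_iso T L L K" "\<forall>p. \<forall>v\<in>T p. K p (K p v) = 0"
    unfolding L assms(1,2,4)
    by (rule M.smooth_endomorphism_K M.lagrangian_L M.foliation_L M.bundle_metric_g M.induces_iso_K
      | intro allI ballI M.L_image M.K_K_0)+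
  then show ?thesis using N gL Or unfolding L by (intro conjI)
qed

end
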